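(* Let $T\ge2$, $\delta_0>0$, $\delta\in(0,\delta_0)$, $M>0$, and let $(y_0,y_1)\in H^1_0(0,1)\times L^2(0,1)$ be given. The cost $J:\mathcal G_{\mathrm{ad}}\to\mathbb R$ is continuous over $\mathcal G_{\mathrm{ad}}$ for the norm of $L^\infty(0,T)$; that is, if $\gamma_n,\gamma\in\mathcal G_{\mathrm{ad}}$ and $\gamma_n\to\gamma$ in $L^\infty(0,T)$, then $J(\gamma_n)\to J(\gamma)$.
   Context: $\Omega=(0,1)$, $Q_T=\Omega\times(0,T)$, $\mathbf W=L^2(\Omega)\times H^{-1}(\Omega)$. For $(\varphi_0,\varphi_1)\in\mathbf W$, the corresponding $\varphi\in C([0,T];L^2(\Omega))\cap C^1([0,T];H^{-1}(\Omega))$ denotes the (transposition) solution of $\varphi_{tt}-\varphi_{xx}=0$ in $Q_T$, $\varphi=0$ on $\{0,1\}\times(0,T)$, $(\varphi,\varphi_t)(\cdot,0)=(\varphi_0,\varphi_1)$. Admissible curves: $\mathcal G_{\mathrm{ad}}=\{\gamma\in W^{1,\infty}(0,T):\ \|\gamma'\|_{L^\infty(0,T)}\le M,\ \delta_0\le\gamma\le1-\delta_0\}$. For such $\gamma$, $q_\gamma=\{(x,t)\in Q_T:\ |x-\gamma(t)|<\delta_0\}$. Cut-off: $\chi:\mathbb R\to[0,1]$ is a fixed even $C^1$ function with $\chi=1$ on $[-\delta_0+\delta,\delta_0-\delta]$, $\chi=0$ outside $(-\delta_0,\delta_0)$, and $\chi\in(0,1)$ elsewhere; $\chi_\gamma(x,t)=\chi(x-\gamma(t))$.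 Cost: for fixed $(y_0,y_1)$ and $\gamma$, let $$\mathcal J^\star_\gamma(\varphi_0,\varphi_1)=\frac12\iint_{q_\gamma}\varphi^2\chi_\gamma-\langle\varphi_1,y_0\rangle_{H^{-1}(\Omega),H^1_0(\Omega)}+\langle\varphi_0,y_1\rangle_{L^2(\Omega)},\qquad(\varphi_0,\varphi_1)\in\mathbf W.$$ For $T\ge2$ this functional has a unique minimizer over $\mathbf W$; with $\varphi$ the solution of the wave equation associated to that minimizer, $J(\gamma)=\iint_{q_\gamma}\varphi^2\chi_\gamma$. (Equivalently, $J(\gamma)=\|v\|^2_{L^2(q_\gamma;\chi_\gamma)}$ where $v=\varphi|_{q_\gamma}$ is the null control of minimal weighted $L^2$-norm for the initial datum $(y_0,y_1)$.) *)

theory Defs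
  imports "HOL-Analysis.Analysis" "HOL-Probability.Essential_Supremum"
begin

text \<open>
  Elements of Lebesgue and Sobolev spaces are represented by functions on the whole space; only
  their values almost everywhere on the underlying domain matter. Elements of \<open>H\<^sup>-\<^sup>1(0,1)\<close> are
  functionals, of which only the values on \<open>H\<^sup>1\<^sub>0(0,1)\<close> matter. The spaces, the
  admissible curves and the cost below do not depend on the choice of representatives.
\<close>

section \<open>Function spaces\<close>

definition L2 :: "'a::euclidean_space set \<Rightarrow> ('a \<Rightarrow> real) set" where
  "L2 S = {f. f \<in> borel_measurable (lebesgue_on S) \<and> integrable (lebesgue_on S) (\<lambda>x. (f x)\<^sup>2)}"

definition L2_norm :: "'a::euclidean_space set \<Rightarrow> ('a \<Rightarrow> real) \<Rightarrow> real" where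
  "L2_norm S f = sqrt (\<integral>x. (f x)\<^sup>2 \<partial>lebesgue_on S)"

definition Linf_norm :: "'a::euclidean_space set \<Rightarrow> ('a \<Rightarrow> real) \<Rightarrow> ereal" where
  "Linf_norm S f = esssup (lebesgue_on S) (\<lambda>x. ereal \<bar>f x\<bar>)"

definition Linf :: "'a::euclidean_space set \<Rightarrow> ('a \<Rightarrow> real) set" where
  "Linf S = {f. f \<in> borel_measurable (lebesgue_on S) \<and> Linf_norm S f < \<infinity>}"

definition Cc1 :: "real \<Rightarrow> real \<Rightarrow> (real \<Rightarrow> real) set" where
  "Cc1 a b = {\<eta>. \<eta> C1_differentiable_on UNIV \<and> closure {x. \<eta> x \<noteq> 0} \<subseteq> {a<..<b}}"

text \<open>
  Weak derivatives on a bounded interval, tested against \<open>C\<^sup>1\<close> functions of compact support (as in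
  Brezis' textbook). Integrability is required so that the integrals are meaningful; it is automatic
  for \<open>L\<^sup>2\<close> and \<open>L\<^sup>\<infinity>\<close> functions.
\<close>

definition has_weak_deriv :: "real \<Rightarrow> real \<Rightarrow> (real \<Rightarrow> real) \<Rightarrow> (real \<Rightarrow> real) \<Rightarrow> bool" where
  "has_weak_deriv a b u g \<longleftrightarrow>
     integrable (lebesgue_on {a<..<b}) u \<and> integrable (lebesgue_on {a<..<b}) g \<and>
     (\<forall>\<eta>\<in>Cc1 a b. (\<integral>x. u x * deriv \<eta> x \<partial>lebesgue_on {a<..<b})
                  = - (\<integral>x. g x * \<eta> x \<partial>lebesgue_on {a<..<b}))"

text \<open>The choice is immaterial: weak derivatives are unique almost everywhere on the interval.\<close>

definition weak_deriv :: "real \<Rightarrow> real \<Rightarrow> (real \<Rightarrow> real) \<Rightarrow> real \<Rightarrow> real" where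
  "weak_deriv a b u = (SOME g. has_weak_deriv a b u g)"

definition W1inf :: "real \<Rightarrow> real \<Rightarrow> (real \<Rightarrow> real) set" where
  "W1inf a b = {u. u \<in> Linf {a<..<b} \<and> (\<exists>g\<in>Linf {a<..<b}. has_weak_deriv a b u g)}"

abbreviation \<Omega> :: "real set" where
  "\<Omega> \<equiv> {0<..<1}"

definition H1 :: "(real \<Rightarrow> real) set" where
  "H1 = {u. u \<in> L2 \<Omega> \<and> (\<exists>g\<in>L2 \<Omega>. has_weak_deriv 0 1 u g)}"

definition H1_norm :: "(real \<Rightarrow> real) \<Rightarrow> real" where
  "H1_norm u = sqrt ((L2_norm \<Omega> u)\<^sup>2 + (L2_norm \<Omega> (weak_deriv 0 1 u))\<^sup>2)"

text \<open>The closure of the test functions in \<open>H\<^sup>1(0,1)\<close>.\<close>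

definition H10 :: "(real \<Rightarrow> real) set" where
  "H10 = {u. u \<in> H1 \<and>
     (\<exists>\<eta>::nat \<Rightarrow> real \<Rightarrow> real. (\<forall>n. \<eta> n \<in> Cc1 0 1) \<and> (\<lambda>n. H1_norm (\<lambda>x. u x - \<eta> n x)) \<longlonglongrightarrow> 0)}"

text \<open>
  The dual of \<open>H\<^sup>1\<^sub>0(0,1)\<close>; the duality bracket is application. Boundedness makes a functional
  insensitive to the choice of representative of its argument.
\<close>

definition Hm1 :: "((real \<Rightarrow> real) \<Rightarrow> real) set" where
  "Hm1 = {l. (\<forall>u\<in>H10. \<forall>v\<in>H10. l (\<lambda>x. u x + v x) = l u + l v) \<and>
             (\<forall>c. \<forall>u\<in>H10. l (\<lambda>x. c * u x) = c * l u) \<and>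
             (\<exists>C. \<forall>u\<in>H10. \<bar>l u\<bar> \<le> C * H1_norm u)}"

definition Hm1_norm :: "((real \<Rightarrow> real) \<Rightarrow> real) \<Rightarrow> real" where
  "Hm1_norm l = Sup {\<bar>l u\<bar> |u. u \<in> H10 \<and> H1_norm u \<le> 1}"

text \<open>The embedding of \<open>L\<^sup>2(0,1)\<close> into \<open>H\<^sup>-\<^sup>1(0,1)\<close>.\<close>

definition L2_to_Hm1 :: "(real \<Rightarrow> real) \<Rightarrow> (real \<Rightarrow> real) \<Rightarrow> real" where
  "L2_to_Hm1 f u = (\<integral>x. f x * u x \<partial>lebesgue_on \<Omega>)"

definition W :: "((real \<Rightarrow> real) \<times> ((real \<Rightarrow> real) \<Rightarrow> real)) set" where
  "W = L2 \<Omega> \<times> Hm1"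


section \<open>The wave equation\<close>

text \<open>Space-time functions are written \<open>\<phi> x t\<close>.\<close>

abbreviation Q :: "real \<Rightarrow> (real \<times> real) set" where
  "Q T \<equiv> \<Omega> \<times> {0<..<T}"

text \<open>
  \<open>\<phi> \<in> C([0,T]; L\<^sup>2(0,1)) \<inter> C\<^sup>1([0,T]; H\<^sup>-\<^sup>1(0,1))\<close>, where \<open>\<psi> t\<close> is the time derivative at \<open>t\<close>
  (one-sided at the end points). Joint measurability only fixes a representative for which double
  integrals over parts of \<open>Q T\<close> make sense.
\<close>

definition wave_path :: "real \<Rightarrow> (real \<Rightarrow> real \<Rightarrow> real) \<Rightarrow> (real \<Rightarrow> (real \<Rightarrow> real) \<Rightarrow> real) \<Rightarrow> bool"
  where
  "wave_path T \<phi> \<psi> \<longleftrightarrow>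
     (\<lambda>(x,t). \<phi> x t) \<in> borel_measurable (lebesgue_on (Q T)) \<and>
     (\<forall>t\<in>{0..T}. (\<lambda>x. \<phi> x t) \<in> L2 \<Omega> \<and> \<psi> t \<in> Hm1) \<and>
     (\<forall>t\<in>{0..T}.
        ((\<lambda>s. L2_norm \<Omega> (\<lambda>x. \<phi> x s - \<phi> x t)) \<longlongrightarrow> 0) (at t within {0..T}) \<and>
        ((\<lambda>s. Hm1_norm (\<lambda>u. (L2_to_Hm1 (\<lambda>x. \<phi> x s) u - L2_to_Hm1 (\<lambda>x. \<phi> x t) u) / (s - t)
                              - \<psi> t u)) \<longlongrightarrow> 0) (at t within {0..T}) \<and>
        ((\<lambda>s. Hm1_norm (\<lambda>u. \<psi> s u - \<psi> t u)) \<longlongrightarrow> 0) (at t within {0..T}))"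

definition C1_cyl ::
  "real \<Rightarrow> (real \<Rightarrow> real \<Rightarrow> real) \<Rightarrow> (real \<Rightarrow> real \<Rightarrow> real) \<Rightarrow> (real \<Rightarrow> real \<Rightarrow> real) \<Rightarrow> bool" where
  "C1_cyl T z zx zt \<longleftrightarrow>
     (\<forall>x\<in>{0..1}. \<forall>t\<in>{0..T}.
        ((\<lambda>(x,t). z x t) has_derivative (\<lambda>(h,k). zx x t * h + zt x t * k))
          (at (x,t) within {0..1} \<times> {0..T})) \<and>
     continuous_on ({0..1} \<times> {0..T}) (\<lambda>(x,t). zx x t) \<and>
     continuous_on ({0..1} \<times> {0..T}) (\<lambda>(x,t). zt x t)"

text \<open>
  \<open>z\<close> is a classical (\<open>C\<^sup>2\<close> up to the boundary) solution of the backward problem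
  \<open>z\<^sub>t\<^sub>t - z\<^sub>x\<^sub>x = f\<close>, \<open>z(0,t) = z(1,t) = 0\<close>, \<open>z(x,T) = z\<^sub>t(x,T) = 0\<close>, and \<open>zt\<close> is its time derivative.
\<close>

definition backward_solution ::
  "real \<Rightarrow> (real \<Rightarrow> real \<Rightarrow> real) \<Rightarrow> (real \<Rightarrow> real \<Rightarrow> real) \<Rightarrow> (real \<Rightarrow> real \<Rightarrow> real) \<Rightarrow> bool" where
  "backward_solution T f z zt \<longleftrightarrow>
     (\<exists>zx zxx zxt ztx ztt.
        C1_cyl T z zx zt \<and> C1_cyl T zx zxx zxt \<and> C1_cyl T zt ztx ztt \<and>
        (\<forall>x\<in>{0..1}. \<forall>t\<in>{0..T}. ztt x t - zxx x t = f x t)) \<and>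
     (\<forall>t\<in>{0..T}. z 0 t = 0 \<and> z 1 t = 0) \<and>
     (\<forall>x\<in>{0..1}. z x T = 0 \<and> zt x T = 0)"

text \<open>
  The transposition identity is what remains of
  \<open>\<integral>\<integral> \<phi> (z\<^sub>t\<^sub>t - z\<^sub>x\<^sub>x) = \<integral>\<integral> (\<phi>\<^sub>t\<^sub>t - \<phi>\<^sub>x\<^sub>x) z + \<dots>\<close> after integrating by parts for a smooth solution
  \<open>\<phi>\<close> of the homogeneous problem; it encodes the equation, the boundary condition and the initial
  data.
\<close>

definition transposition_solution ::
  "real \<Rightarrow> (real \<Rightarrow> real) \<times> ((real \<Rightarrow> real) \<Rightarrow> real) \<Rightarrow> (real \<Rightarrow> real \<Rightarrow> real) \<Rightarrow> bool" where
  "transposition_solution T = (\<lambda>(\<phi>0, \<phi>1) \<phi>.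
     (\<exists>\<psi>. wave_path T \<phi> \<psi> \<and> (AE x in lebesgue_on \<Omega>. \<phi> x 0 = \<phi>0 x) \<and> (\<forall>u\<in>H10. \<psi> 0 u = \<phi>1 u)) \<and>
     (\<forall>f z zt. backward_solution T f z zt \<longrightarrow>
        (\<integral>(x,t). \<phi> x t * f x t \<partial>lebesgue_on (Q T))
          = \<phi>1 (\<lambda>x. z x 0) - (\<integral>x. \<phi>0 x * zt x 0 \<partial>lebesgue_on \<Omega>)))"

text \<open>For data in \<open>W\<close> the solution is unique almost everywhere in \<open>Q T\<close>.\<close>

definition wave_sol ::
  "real \<Rightarrow> (real \<Rightarrow> real) \<times> ((real \<Rightarrow> real) \<Rightarrow> real) \<Rightarrow> real \<Rightarrow> real \<Rightarrow> real" where
  "wave_sol T p = (SOME \<phi>. transposition_solution T p \<phi>)"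


section \<open>Admissible curves and the cost\<close>

definition Gad :: "real \<Rightarrow> real \<Rightarrow> real \<Rightarrow> (real \<Rightarrow> real) set" where
  "Gad T \<delta>0 M = {\<gamma>. \<gamma> \<in> W1inf 0 T \<and> Linf_norm {0<..<T} (weak_deriv 0 T \<gamma>) \<le> ereal M \<and>
                     (AE t in lebesgue_on {0<..<T}. \<delta>0 \<le> \<gamma> t \<and> \<gamma> t \<le> 1 - \<delta>0)}"

definition tube :: "real \<Rightarrow> real \<Rightarrow> (real \<Rightarrow> real) \<Rightarrow> (real \<times> real) set" where
  "tube T \<delta>0 \<gamma> = {(x,t). (x,t) \<in> Q T \<and> \<bar>x - \<gamma> t\<bar> < \<delta>0}"

definition cutoff :: "real \<Rightarrow> real \<Rightarrow> (real \<Rightarrow> real) \<Rightarrow> bool" where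
  "cutoff \<delta>0 \<delta> chi \<longleftrightarrow>
     range chi \<subseteq> {0..1} \<and> (\<forall>x. chi (- x) = chi x) \<and> chi C1_differentiable_on UNIV \<and>
     (\<forall>x\<in>{- \<delta>0 + \<delta>..\<delta>0 - \<delta>}. chi x = 1) \<and>
     (\<forall>x. x \<notin> {- \<delta>0<..<\<delta>0} \<longrightarrow> chi x = 0) \<and>
     (\<forall>x\<in>{- \<delta>0<..<\<delta>0} - {- \<delta>0 + \<delta>..\<delta>0 - \<delta>}. 0 < chi x \<and> chi x < 1)"

definition weighted_energy ::
  "real \<Rightarrow> real \<Rightarrow> (real \<Rightarrow> real) \<Rightarrow> (real \<Rightarrow> real) \<Rightarrow> (real \<Rightarrow> real \<Rightarrow> real) \<Rightarrow> real" where
  "weighted_energy T \<delta>0 chi \<gamma> \<phi> =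
     (\<integral>(x,t). (\<phi> x t)\<^sup>2 * chi (x - \<gamma> t) \<partial>lebesgue_on (tube T \<delta>0 \<gamma>))"

definition Jstar ::
  "real \<Rightarrow> real \<Rightarrow> (real \<Rightarrow> real) \<Rightarrow> (real \<Rightarrow> real) \<Rightarrow> (real \<Rightarrow> real) \<Rightarrow> (real \<Rightarrow> real) \<Rightarrow>
   (real \<Rightarrow> real) \<times> ((real \<Rightarrow> real) \<Rightarrow> real) \<Rightarrow> real" where
  "Jstar T \<delta>0 chi y0 y1 \<gamma> = (\<lambda>(\<phi>0, \<phi>1).
     1/2 * weighted_energy T \<delta>0 chi \<gamma> (wave_sol T (\<phi>0, \<phi>1))
     - \<phi>1 y0 + (\<integral>x. \<phi>0 x * y1 x \<partial>lebesgue_on \<Omega>))"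

text \<open>
  The minimizer is unique as an element of \<open>L\<^sup>2(0,1) \<times> H\<^sup>-\<^sup>1(0,1)\<close>, so the choice made by
  \<^const>\<open>arg_min_on\<close> among its representatives is immaterial.
\<close>

definition J ::
  "real \<Rightarrow> real \<Rightarrow> (real \<Rightarrow> real) \<Rightarrow> (real \<Rightarrow> real) \<Rightarrow> (real \<Rightarrow> real) \<Rightarrow> (real \<Rightarrow> real) \<Rightarrow> real" where
  "J T \<delta>0 chi y0 y1 \<gamma> =
     weighted_energy T \<delta>0 chi \<gamma> (wave_sol T (arg_min_on (Jstar T \<delta>0 chi y0 y1 \<gamma>) W))"

end

theory Submission
  imports Defs
begin

text \<open>
  A transposition solution with data in \<open>W\<close> is \<open>\<phi>(x,t) = F(t + x) - F(t - x)\<close> almost everywhere, with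
  \<open>F\<close> square integrable and 2-periodic, unique up to a constant; data and solution depend linearly on
  \<open>F\<close>. In terms of \<open>F\<close> the functional to be minimised is \<open>a\<^sub>\<gamma>(F,F)/2 - l(F)\<close>, so a minimiser satisfies
  \<open>a\<^sub>\<gamma>(F,G) = l(G)\<close> for all \<open>G\<close>, whence \<open>J(\<gamma>) = l(F)\<close>. For two curves with minimisers \<open>F\<close>, \<open>F'\<close> this gives
  \<open>J(\<gamma>') - J(\<gamma>) = (a\<^sub>\<gamma> - a\<^sub>\<gamma>\<^sub>')(F,F')\<close>. The forms differ by \<open>O(\<parallel>\<gamma> - \<gamma>'\<parallel>\<^sub>\<infinity>)\<close> because the cut-off is
  Lipschitz, and the observability inequality for the limit curve bounds the nearby minimisers modulo
  constants.
\<close>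

section \<open>Square integrable functions\<close>

text \<open>Two Hilbert choices separate the definitions from the analysis. \<open>wave_sol\<close>
  is known almost everywhere only after existence (d'Alembert's formula) and uniqueness (testing
  with sources sin (k \<pi> x) c(t)) of transposition solutions. \<open>arg_min_on\<close> returns a
  minimiser only once one is known to exist; existence comes from a minimising sequence, and the
  Euler-Lagrange equation fixes the cost whichever minimiser is returned. Every estimate on F is
  modulo constants. The linear form l is compatible with this because weak derivatives of
  \<open>H10\<close> functions have mean zero. The observability constants of the approximating
  curves are not known to be uniform, so only the constant C of the limit curve enters the bound:
  exchanging the form of a nearby curve for that of the limit costs a multiple of e |F|^2, with e
  the distance of the curves, and this is absorbed on the left once e is small against 1/C. The
  value T = 2 is reached because a path that drifts across the tube while following the curve gains
  part of its width: one of t + x and t - x then sweeps an interval longer than 2.\<close>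

lemma L2_D:
  assumes "f \<in> L2 S"
  shows "f \<in> borel_measurable (lebesgue_on S)" "integrable (lebesgue_on S) (\<lambda>x. (f x)\<^sup>2)"
  using assms by (auto simp: L2_def)

lemma L2_mult_integrable:
  assumes "f \<in> L2 S" "g \<in> L2 S"
  shows "integrable (lebesgue_on S) (\<lambda>x. f x * g x)"
proof (rule Bochner_Integration.integrable_bound)
  show "integrable (lebesgue_on S) (\<lambda>x. (f x)\<^sup>2 + (g x)\<^sup>2)"
    using assms by (intro Bochner_Integration.integrable_add L2_D)
  show "(\<lambda>x. f x * g x) \<in> borel_measurable (lebesgue_on S)"
    using assms[THEN L2_D(1)] by simp
  have "\<bar>f x * g x\<bar> \<le> \<bar>(f x)\<^sup>2 + (g x)\<^sup>2\<bar>" for x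
  proof -
    have "2 * (\<bar>f x\<bar> * \<bar>g x\<bar>) \<le> (f x)\<^sup>2 + (g x)\<^sup>2"
      using sum_squares_bound[of "\<bar>f x\<bar>" "\<bar>g x\<bar>"] by simp
    moreover have "0 \<le> \<bar>f x\<bar> * \<bar>g x\<bar>" "0 \<le> (f x)\<^sup>2 + (g x)\<^sup>2" by simp_all
    ultimately show ?thesis unfolding abs_mult by linarith
  qed
  then show "AE x in lebesgue_on S. norm (f x * g x) \<le> norm ((f x)\<^sup>2 + (g x)\<^sup>2)"
    by simp
qed

lemma L2_lin:
  assumes "f \<in> L2 S" "g \<in> L2 S"
  shows "(\<lambda>x. s * f x + t * g x) \<in> L2 S"
proof -
  have "(\<lambda>x. (s * f x + t * g x)\<^sup>2) = (\<lambda>x. s\<^sup>2 * (f x)\<^sup>2 + t\<^sup>2 * (g x)\<^sup>2 + 2 * s * t * (f x * g x))"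
    by (auto simp: power2_eq_square algebra_simps)
  then show ?thesis
    using assms L2_mult_integrable[OF assms] by (auto simp: L2_def)
qed

lemma L2_add: "f \<in> L2 S \<Longrightarrow> g \<in> L2 S \<Longrightarrow> (\<lambda>x. f x + g x) \<in> L2 S"
  using L2_lin[of f S g 1 1] by simp

lemma L2_diff: "f \<in> L2 S \<Longrightarrow> g \<in> L2 S \<Longrightarrow> (\<lambda>x. f x - g x) \<in> L2 S"
  using L2_lin[of f S g 1 "-1"] by simp

lemma L2_cmult: "f \<in> L2 S \<Longrightarrow> (\<lambda>x. c * f x) \<in> L2 S"
  using L2_lin[of f S f c 0] by simp

lemma L2_uminus: "f \<in> L2 S \<Longrightarrow> (\<lambda>x. - f x) \<in> L2 S"
  using L2_cmult[of f S "-1"] by simp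

lemma L2_norm_ge0 [simp]: "0 \<le> L2_norm S f"
  by (simp add: L2_norm_def)

lemma L2_norm_square: "(L2_norm S f)\<^sup>2 = (\<integral>x. (f x)\<^sup>2 \<partial>lebesgue_on S)"
  by (simp add: L2_norm_def)

lemma L2_norm_cmult [simp]: "L2_norm S (\<lambda>x. c * f x) = \<bar>c\<bar> * L2_norm S f"
  by (simp add: L2_norm_def power_mult_distrib real_sqrt_mult)

lemma L2_norm_minus [simp]: "L2_norm S (\<lambda>x. - f x) = L2_norm S f"
  by (simp add: L2_norm_def)

lemma L2_norm_minus_commute: "L2_norm S (\<lambda>x. f x - g x) = L2_norm S (\<lambda>x. g x - f x)"
  by (simp add: L2_norm_def power2_commute)

lemma L2_norm_cong_AE:
  assumes "f \<in> borel_measurable (lebesgue_on S)" "g \<in> borel_measurable (lebesgue_on S)"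
    and "AE x in lebesgue_on S. f x = g x"
  shows "L2_norm S f = L2_norm S g"
proof -
  have "(\<integral>x. (f x)\<^sup>2 \<partial>lebesgue_on S) = (\<integral>x. (g x)\<^sup>2 \<partial>lebesgue_on S)"
    using assms by (intro integral_cong_AE) auto
  then show ?thesis by (simp add: L2_norm_def)
qed

lemma L2_cong_AE:
  assumes "f \<in> L2 S" "g \<in> borel_measurable (lebesgue_on S)" "AE x in lebesgue_on S. f x = g x"
  shows "g \<in> L2 S"
proof -
  have "integrable (lebesgue_on S) (\<lambda>x. (g x)\<^sup>2)"
  proof (subst integrable_cong_AE)
    show "AE x in lebesgue_on S. (g x)\<^sup>2 = (f x)\<^sup>2" using assms(3) by auto
  qed (use assms L2_D[OF assms(1)] in auto)
  then show ?thesis using assms by (simp add: L2_def)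
qed

text \<open>The integral of (s f + t g)^2 is a nonnegative quadratic form in (s, t). Both parameters
  are kept free so that the degenerate case, where \<open>g\<close> has norm zero, can be settled by
  a choice of its own.\<close>

lemma L2_Cauchy_Schwarz:
  assumes "f \<in> L2 S" "g \<in> L2 S"
  shows "\<bar>\<integral>x. f x * g x \<partial>lebesgue_on S\<bar> \<le> L2_norm S f * L2_norm S g"
proof -
  let ?A = "\<integral>x. (f x)\<^sup>2 \<partial>lebesgue_on S" and ?B = "\<integral>x. (g x)\<^sup>2 \<partial>lebesgue_on S"
  let ?C = "\<integral>x. f x * g x \<partial>lebesgue_on S"
  note int = L2_D(2)[OF assms(1)] L2_D(2)[OF assms(2)] L2_mult_integrable[OF assms]
  have quad: "0 \<le> s\<^sup>2 * ?A + t\<^sup>2 * ?B + 2 * s * t * ?C" for s t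
  proof -
    have "0 \<le> (\<integral>x. (s * f x + t * g x)\<^sup>2 \<partial>lebesgue_on S)" by simp
    also have "(\<lambda>x. (s * f x + t * g x)\<^sup>2) = (\<lambda>x. s\<^sup>2 * (f x)\<^sup>2 + t\<^sup>2 * (g x)\<^sup>2 + 2 * s * t * (f x * g x))"
      by (auto simp: power2_eq_square algebra_simps)
    also have "(\<integral>x. s\<^sup>2 * (f x)\<^sup>2 + t\<^sup>2 * (g x)\<^sup>2 + 2 * s * t * (f x * g x) \<partial>lebesgue_on S)
        = s\<^sup>2 * ?A + t\<^sup>2 * ?B + 2 * s * t * ?C"
      using int by simp
    finally show ?thesis .
  qed
  have A0: "0 \<le> ?A" and B0: "0 \<le> ?B" by simp_all
  have "?C\<^sup>2 \<le> ?A * ?B"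
  proof (cases "?B = 0")
    case True
    have "?C = 0"
    proof (rule ccontr)
      assume C: "?C \<noteq> 0"
      \<comment> \<open>This parameter turns the right-hand side into \<open>?A - (?A + 1)\<close>,
        which is negative.\<close>
      have "0 \<le> ?A + 2 * (- (?A + 1) / (2 * ?C)) * ?C"
        using quad[of 1 "- (?A + 1) / (2 * ?C)"] True by simp
      then show False using C by (simp add: field_simps)
    qed
    then show ?thesis using True by simp
  next
    case False
    then have B: "?B > 0" using B0 by linarith
    have "0 \<le> ?B\<^sup>2 * ?A + ?C\<^sup>2 * ?B - 2 * ?B * ?C\<^sup>2"
      using quad[of ?B "-?C"] by (simp add: power2_eq_square algebra_simps)
    then have "0 \<le> ?B * (?A * ?B - ?C\<^sup>2)" by (simp add: power2_eq_square algebra_simps)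
    then show ?thesis using B by (simp add: zero_le_mult_iff)
  qed
  then have "sqrt (?C\<^sup>2) \<le> sqrt (?A * ?B)" by (rule real_sqrt_le_mono)
  then show ?thesis by (simp add: L2_norm_def real_sqrt_mult)
qed

lemma L2_norm_triangle:
  assumes "f \<in> L2 S" "g \<in> L2 S"
  shows "L2_norm S (\<lambda>x. f x + g x) \<le> L2_norm S f + L2_norm S g"
proof (rule power2_le_imp_le)
  have "(\<lambda>x. (f x + g x)\<^sup>2) = (\<lambda>x. (f x)\<^sup>2 + (g x)\<^sup>2 + 2 * (f x * g x))"
    by (auto simp: power2_eq_square algebra_simps)
  then have "(L2_norm S (\<lambda>x. f x + g x))\<^sup>2
      = (L2_norm S f)\<^sup>2 + (L2_norm S g)\<^sup>2 + 2 * (\<integral>x. f x * g x \<partial>lebesgue_on S)"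
    unfolding L2_norm_square
    using L2_D(2)[OF assms(1)] L2_D(2)[OF assms(2)] L2_mult_integrable[OF assms] by simp
  also have "\<dots> \<le> (L2_norm S f + L2_norm S g)\<^sup>2"
    using L2_Cauchy_Schwarz[OF assms] by (simp add: power2_sum)
  finally show "(L2_norm S (\<lambda>x. f x + g x))\<^sup>2 \<le> (L2_norm S f + L2_norm S g)\<^sup>2" .
qed simp

lemma L2_norm_triangle_diff:
  assumes "f \<in> L2 S" "g \<in> L2 S"
  shows "L2_norm S (\<lambda>x. f x - g x) \<le> L2_norm S f + L2_norm S g"
  using L2_norm_triangle[OF assms(1) L2_uminus[OF assms(2)]] by simp

lemma L2_norm_triangle3:
  assumes "f \<in> L2 S" "g \<in> L2 S" "h \<in> L2 S"
  shows "L2_norm S (\<lambda>x. f x - h x) \<le> L2_norm S (\<lambda>x. f x - g x) + L2_norm S (\<lambda>x. g x - h x)"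
  using L2_norm_triangle[OF L2_diff[OF assms(1,2)] L2_diff[OF assms(2,3)]] by simp

lemma L2_norm_diff_abs:
  assumes "f \<in> L2 S" "g \<in> L2 S"
  shows "\<bar>L2_norm S f - L2_norm S g\<bar> \<le> L2_norm S (\<lambda>x. f x - g x)"
proof -
  have "L2_norm S f \<le> L2_norm S (\<lambda>x. f x - g x) + L2_norm S g"
    using L2_norm_triangle[OF L2_diff[OF assms] assms(2)] by simp
  moreover have "L2_norm S g \<le> L2_norm S (\<lambda>x. g x - f x) + L2_norm S f"
    using L2_norm_triangle[OF L2_diff[OF assms(2,1)] assms(1)] by simp
  ultimately show ?thesis using L2_norm_minus_commute[of S f g] by linarith
qed

lemma L2_norm_lin:
  assumes "f \<in> L2 S" "g \<in> L2 S"
  shows "L2_norm S (\<lambda>x. s * f x + t * g x) \<le> \<bar>s\<bar> * L2_norm S f + \<bar>t\<bar> * L2_norm S g"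
  using L2_norm_triangle[OF L2_cmult[OF assms(1)] L2_cmult[OF assms(2)]] by simp

lemma L2_norm_mono_AE:
  assumes "g \<in> L2 S" and "AE x in lebesgue_on S. \<bar>f x\<bar> \<le> \<bar>g x\<bar>"
  shows "L2_norm S f \<le> L2_norm S g"
  unfolding L2_norm_def
proof (rule real_sqrt_le_mono, rule integral_mono_AE')
  show "AE x in lebesgue_on S. (f x)\<^sup>2 \<le> (g x)\<^sup>2"
    using assms(2) by (auto simp: abs_le_square_iff)
qed (use L2_D[OF assms(1)] in auto)

lemma L2_const: "S \<in> lmeasurable \<Longrightarrow> (\<lambda>x. c) \<in> L2 S"
  by (simp add: L2_def finite_measure.integrable_const finite_measure_lebesgue_on)

lemma L2_norm_const:
  assumes "S \<in> lmeasurable" shows "L2_norm S (\<lambda>x. c) = \<bar>c\<bar> * sqrt (measure lebesgue S)"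
proof -
  have "measure (lebesgue_on S) S = measure lebesgue S"
    using assms by (simp add: measure_restrict_space fmeasurableD)
  then show ?thesis by (simp add: L2_norm_def real_sqrt_mult)
qed

lemma L2_bounded:
  assumes "S \<in> lmeasurable" "f \<in> borel_measurable (lebesgue_on S)"
    and "AE x in lebesgue_on S. \<bar>f x\<bar> \<le> B"
  shows "f \<in> L2 S" "L2_norm S f \<le> \<bar>B\<bar> * sqrt (measure lebesgue S)"
proof -
  interpret finite_measure "lebesgue_on S" using assms(1) by (rule finite_measure_lebesgue_on)
  have le: "AE x in lebesgue_on S. \<bar>f x\<bar> \<le> \<bar>B\<bar>" using assms(3) by auto
  then have "AE x in lebesgue_on S. norm ((f x)\<^sup>2) \<le> B\<^sup>2" by (auto simp: abs_le_square_iff)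
  then show "f \<in> L2 S"
    using integrable_const_bound[of "\<lambda>x. (f x)\<^sup>2" "B\<^sup>2"] assms(2) by (simp add: L2_def)
  show "L2_norm S f \<le> \<bar>B\<bar> * sqrt (measure lebesgue S)"
    using L2_norm_mono_AE[OF L2_const[OF assms(1)], of f B] le L2_norm_const[OF assms(1), of B] by simp
qed

lemma L2_imp_integrable:
  assumes "S \<in> lmeasurable" "f \<in> L2 S"
  shows "integrable (lebesgue_on S) f"
  using L2_mult_integrable[OF assms(2) L2_const[OF assms(1), of 1]] by simp

lemma L2_integral_bound:
  assumes "S \<in> lmeasurable" "f \<in> L2 S"
  shows "\<bar>\<integral>x. f x \<partial>lebesgue_on S\<bar> \<le> L2_norm S f * sqrt (measure lebesgue S)"
  using L2_Cauchy_Schwarz[OF assms(2) L2_const[OF assms(1), of 1]] L2_norm_const[OF assms(1), of 1]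
  by simp

lemma L2_abs: "f \<in> L2 S \<Longrightarrow> (\<lambda>x. \<bar>f x\<bar>) \<in> L2 S"
  by (auto simp: L2_def intro: borel_measurable_abs)

lemma L2_norm_abs [simp]: "L2_norm S (\<lambda>x. \<bar>f x\<bar>) = L2_norm S f"
  by (simp add: L2_norm_def)

lemma L2_mult_bounded:
  assumes "f \<in> L2 S" "g \<in> borel_measurable (lebesgue_on S)" "AE x in lebesgue_on S. \<bar>g x\<bar> \<le> B"
  shows "(\<lambda>x. g x * f x) \<in> L2 S" "L2_norm S (\<lambda>x. g x * f x) \<le> \<bar>B\<bar> * L2_norm S f"
proof -
  have le: "AE x in lebesgue_on S. \<bar>g x * f x\<bar> \<le> \<bar>B * f x\<bar>"
    using assms(3) by eventually_elim (auto simp: abs_mult intro!: mult_right_mono)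
  have "integrable (lebesgue_on S) (\<lambda>x. (g x * f x)\<^sup>2)"
  proof (rule Bochner_Integration.integrable_bound[OF L2_D(2)[OF L2_cmult[OF assms(1), of B]]])
    show "AE x in lebesgue_on S. norm ((g x * f x)\<^sup>2) \<le> norm ((B * f x)\<^sup>2)"
      using le by (auto simp: abs_le_square_iff)
  qed (use assms(2) L2_D(1)[OF assms(1)] in measurable)
  then show "(\<lambda>x. g x * f x) \<in> L2 S"
    using assms(2) L2_D(1)[OF assms(1)] by (simp add: L2_def)
  show "L2_norm S (\<lambda>x. g x * f x) \<le> \<bar>B\<bar> * L2_norm S f"
    using L2_norm_mono_AE[OF L2_cmult[OF assms(1)] le] by simp
qed

lemma L2_norm_eq_0:
  assumes "f \<in> L2 S" "L2_norm S f = 0"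
  shows "AE x in lebesgue_on S. f x = 0"
  using integral_nonneg_eq_0_iff_AE[OF L2_D(2)[OF assms(1)]] assms(2)
  by (simp add: L2_norm_def)

lemma L2_mono:
  assumes "f \<in> L2 T" "S \<subseteq> T" "S \<in> sets lebesgue" "T \<in> sets lebesgue"
  shows "f \<in> L2 S" "L2_norm S f \<le> L2_norm T f"
proof -
  have "f \<in> borel_measurable (lebesgue_on S)"
    using measurable_restrict_mono[OF L2_D(1)[OF assms(1)] assms(2)] .
  moreover have "integrable (lebesgue_on S) (\<lambda>x. (f x)\<^sup>2)"
  proof -
    have "integrable lebesgue (\<lambda>x. indicator T x *\<^sub>R (f x)\<^sup>2)"
      using L2_D(2)[OF assms(1)] assms(4) by (simp add: integrable_restrict_space)
    then have "integrable lebesgue (\<lambda>x. indicat_real S x *\<^sub>R indicat_real T x *\<^sub>R (f x)\<^sup>2)"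
      by (rule integrable_mult_indicator[OF assms(3)])
    moreover have "(\<lambda>x. indicat_real S x *\<^sub>R indicat_real T x *\<^sub>R (f x)\<^sup>2) = (\<lambda>x. indicat_real S x *\<^sub>R (f x)\<^sup>2)"
      using assms(2) by (auto simp: indicator_def fun_eq_iff)
    ultimately have "integrable lebesgue (\<lambda>x. indicator S x *\<^sub>R (f x)\<^sup>2)"
      by (simp only:)
    then show ?thesis using assms(3) by (simp add: integrable_restrict_space)
  qed
  ultimately show "f \<in> L2 S" by (simp add: L2_def)
  show "L2_norm S f \<le> L2_norm T f"
    unfolding L2_norm_def
    using integral_mono_lebesgue_on_AE[OF L2_D(2)[OF assms(1)], where S=S and g="\<lambda>x. (f x)\<^sup>2"] assms
    by auto
qed

text \<open>Riesz-Fischer. On a set of finite measure the sequence is also Cauchy in L1, hence has a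
  subsequence converging almost everywhere; Fatou's lemma along it turns the Cauchy estimates into
  estimates of the distance to the limit.\<close>

lemma L2_complete:
  fixes f :: "nat \<Rightarrow> 'a::euclidean_space \<Rightarrow> real"
  assumes S: "S \<in> lmeasurable" and f: "\<And>n. f n \<in> L2 S"
    and Cauchy: "\<And>e. e > 0 \<Longrightarrow> \<exists>N. \<forall>m\<ge>N. \<forall>n\<ge>N. L2_norm S (\<lambda>x. f m x - f n x) < e"
  obtains g where "g \<in> L2 S" "(\<lambda>n. L2_norm S (\<lambda>x. f n x - g x)) \<longlonglongrightarrow> 0"
proof -
  let ?M = "lebesgue_on S"
  \<comment> \<open>The summand 1 keeps \<open>c\<close> positive when \<open>S\<close> is a null
    set.\<close>
  define c where "c = sqrt (measure lebesgue S) + 1"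
  have c: "c > 0" "sqrt (measure lebesgue S) \<le> c" by (auto simp: c_def add_nonneg_pos)
  obtain r where r: "strict_mono r" "AE x in ?M. Cauchy (\<lambda>i. f (r i) x)"
  proof (rule cauchy_L1_AE_cauchy_subseq[of ?M f])
    show "integrable ?M (f n)" for n using L2_imp_integrable[OF S f] .
    fix e :: real assume e: "0 < e"
    obtain N where N: "\<And>m n. m \<ge> N \<Longrightarrow> n \<ge> N \<Longrightarrow> L2_norm S (\<lambda>x. f m x - f n x) < e / c"
      using Cauchy[of "e / c"] e c by auto
    have "(\<integral>x. norm (f m x - f n x) \<partial>?M) < e" if "m \<ge> N" "n \<ge> N" for m n
    proof -
      have "(\<integral>x. norm (f m x - f n x) \<partial>?M) \<le> L2_norm S (\<lambda>x. f m x - f n x) * sqrt (measure lebesgue S)"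
        using L2_integral_bound[OF S L2_abs[OF L2_diff[OF f[of m] f[of n]]]] by simp
      also have "\<dots> \<le> L2_norm S (\<lambda>x. f m x - f n x) * c"
        using c by (intro mult_left_mono) auto
      also have "\<dots> < e" using N[OF that] c by (simp add: field_simps)
      finally show ?thesis .
    qed
    then show "\<exists>N. \<forall>i\<ge>N. \<forall>j\<ge>N. (\<integral>x. norm (f i x - f j x) \<partial>?M) < e" by blast
  qed
  define g where "g x = lim (\<lambda>i. f (r i) x)" for x
  have lim: "AE x in ?M. (\<lambda>i. f (r i) x) \<longlonglongrightarrow> g x"
    using r(2) by eventually_elim (simp add: g_def Cauchy_convergent_iff convergent_LIMSEQ_iff)
  have [measurable]: "f n \<in> borel_measurable ?M" for n using L2_D(1)[OF f] .
  have g_meas [measurable]: "g \<in> borel_measurable ?M" unfolding g_def by measurable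
  \<comment> \<open>Integrability is part of the conclusion: \<open>g\<close> is so far only
    measurable, and its membership in \<open>L2 S\<close> is read off below from a single difference
    \<open>f N1 - g\<close>.\<close>
  have Fatou: "integrable ?M (\<lambda>x. (f n x - g x)\<^sup>2) \<and> L2_norm S (\<lambda>x. f n x - g x) \<le> e"
    if e: "e > 0" and N: "\<And>m. m \<ge> N \<Longrightarrow> L2_norm S (\<lambda>x. f n x - f m x) < e" for n N e
  proof -
    have "(\<integral>\<^sup>+x. ennreal ((f n x - g x)\<^sup>2) \<partial>?M)
        = (\<integral>\<^sup>+x. liminf (\<lambda>i. ennreal ((f n x - f (r i) x)\<^sup>2)) \<partial>?M)"
    proof (rule nn_integral_cong_AE)
      show "AE x in ?M. ennreal ((f n x - g x)\<^sup>2) = liminf (\<lambda>i. ennreal ((f n x - f (r i) x)\<^sup>2))"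
        using lim
      proof eventually_elim
        fix x assume "(\<lambda>i. f (r i) x) \<longlonglongrightarrow> g x"
        then have "(\<lambda>i. ennreal ((f n x - f (r i) x)\<^sup>2)) \<longlonglongrightarrow> ennreal ((f n x - g x)\<^sup>2)"
          by (intro tendsto_intros)
        then show "ennreal ((f n x - g x)\<^sup>2) = liminf (\<lambda>i. ennreal ((f n x - f (r i) x)\<^sup>2))"
          using lim_imp_Liminf[of sequentially] by force
      qed
    qed
    also have "\<dots> \<le> liminf (\<lambda>i. \<integral>\<^sup>+x. ennreal ((f n x - f (r i) x)\<^sup>2) \<partial>?M)"
      by (rule nn_integral_liminf) simp
    also have "\<dots> \<le> ennreal (e\<^sup>2)"
    proof (rule Liminf_le)
      show "\<forall>\<^sub>F i in sequentially. (\<integral>\<^sup>+x. ennreal ((f n x - f (r i) x)\<^sup>2) \<partial>?M) \<le> ennreal (e\<^sup>2)"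
      proof (rule eventually_sequentiallyI)
        fix i assume "i \<ge> N"
        then have "r i \<ge> N" using seq_suble[OF r(1), of i] by linarith
        then have "(L2_norm S (\<lambda>x. f n x - f (r i) x))\<^sup>2 \<le> e\<^sup>2"
          using N[of "r i"] by (intro power_mono) auto
        then show "(\<integral>\<^sup>+x. ennreal ((f n x - f (r i) x)\<^sup>2) \<partial>?M) \<le> ennreal (e\<^sup>2)"
          using nn_integral_eq_integral[OF L2_D(2)[OF L2_diff[OF f[of n] f[of "r i"]]]]
          by (simp add: L2_norm_square)
      qed
    qed simp
    finally have le: "(\<integral>\<^sup>+x. ennreal ((f n x - g x)\<^sup>2) \<partial>?M) \<le> ennreal (e\<^sup>2)" .
    then have int: "integrable ?M (\<lambda>x. (f n x - g x)\<^sup>2)"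
      by (intro integrableI_bounded) (auto simp: le_less_trans[OF _ ennreal_less_top])
    have "(L2_norm S (\<lambda>x. f n x - g x))\<^sup>2 \<le> e\<^sup>2"
      using le nn_integral_eq_integral[OF int] by (simp add: L2_norm_square)
    then show ?thesis using int e by (auto intro: power2_le_imp_le)
  qed
  obtain N1 where "\<And>m n. m \<ge> N1 \<Longrightarrow> n \<ge> N1 \<Longrightarrow> L2_norm S (\<lambda>x. f m x - f n x) < 1"
    using Cauchy[of 1] by auto
  then have "integrable ?M (\<lambda>x. (f N1 x - g x)\<^sup>2)" using Fatou[of 1 N1 N1] by auto
  then have "(\<lambda>x. f N1 x - g x) \<in> L2 S" by (simp add: L2_def)
  then have "g \<in> L2 S" using L2_diff[OF f[of N1]] by fastforce
  moreover have "(\<lambda>n. L2_norm S (\<lambda>x. f n x - g x)) \<longlonglongrightarrow> 0"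
  proof (rule LIMSEQ_I)
    fix e :: real assume "e > 0"
    then obtain N where "\<And>m n. m \<ge> N \<Longrightarrow> n \<ge> N \<Longrightarrow> L2_norm S (\<lambda>x. f m x - f n x) < e / 2"
      using Cauchy[of "e / 2"] by auto
    then have "L2_norm S (\<lambda>x. f n x - g x) \<le> e / 2" if "n \<ge> N" for n
      using Fatou[of "e/2" N n] \<open>e > 0\<close> that by auto
    then show "\<exists>no. \<forall>n\<ge>no. norm (L2_norm S (\<lambda>x. f n x - g x) - 0) < e"
      using \<open>e > 0\<close> by (intro exI[of _ N]) fastforce
  qed
  ultimately show ?thesis using that by blast
qed

text \<open>Dominated convergence for the squares. The domination is imposed on the differences, as
  these are the functions being integrated.\<close>

lemma L2_dominated_convergence:
  fixes f :: "nat \<Rightarrow> 'a::euclidean_space \<Rightarrow> real"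
  assumes "\<And>n. f n \<in> borel_measurable (lebesgue_on S)" "g \<in> borel_measurable (lebesgue_on S)" "w \<in> L2 S"
    and lim: "AE x in lebesgue_on S. (\<lambda>n. f n x) \<longlonglongrightarrow> g x"
    and bound: "\<And>n. AE x in lebesgue_on S. \<bar>f n x - g x\<bar> \<le> w x"
  shows "(\<lambda>n. L2_norm S (\<lambda>x. f n x - g x)) \<longlonglongrightarrow> 0"
proof -
  have "(\<lambda>n. \<integral>x. (f n x - g x)\<^sup>2 \<partial>lebesgue_on S) \<longlonglongrightarrow> (\<integral>x. 0 \<partial>lebesgue_on S)"
  proof (rule integral_dominated_convergence)
    show "integrable (lebesgue_on S) (\<lambda>x. (w x)\<^sup>2)" using L2_D[OF assms(3)] by simp
    show "AE x in lebesgue_on S. (\<lambda>n. (f n x - g x)\<^sup>2) \<longlonglongrightarrow> 0"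
      using lim
    proof eventually_elim
      fix x assume "(\<lambda>n. f n x) \<longlonglongrightarrow> g x"
      then have "(\<lambda>n. (f n x - g x)\<^sup>2) \<longlonglongrightarrow> (g x - g x)\<^sup>2" by (intro tendsto_intros)
      then show "(\<lambda>n. (f n x - g x)\<^sup>2) \<longlonglongrightarrow> 0" by simp
    qed
    show "AE x in lebesgue_on S. norm ((f n x - g x)\<^sup>2) \<le> (w x)\<^sup>2" for n
      using bound[of n] by eventually_elim (metis norm_power power_mono abs_ge_zero real_norm_def)
  qed (use assms in auto)
  then have "(\<lambda>n. sqrt (\<integral>x. (f n x - g x)\<^sup>2 \<partial>lebesgue_on S)) \<longlonglongrightarrow> sqrt 0"
    by (intro tendsto_real_sqrt) simp
  then show ?thesis by (simp add: L2_norm_def)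
qed

abbreviation clip :: "real \<Rightarrow> real \<Rightarrow> real" where
  "clip B x \<equiv> max (- B) (min B x)"

text \<open>\<open>measurable_on\<close> is defined through almost everywhere limits of continuous
  functions and coincides with Lebesgue measurability. All continuous approximations of merely
  measurable functions come from here.\<close>

lemma measurable_AE_limit_continuous:
  fixes f :: "'a::euclidean_space \<Rightarrow> real"
  assumes S: "S \<in> sets lebesgue" and f: "f \<in> borel_measurable (lebesgue_on S)"
  obtains g where "\<And>n. continuous_on UNIV (g n)" "AE x in lebesgue_on S. (\<lambda>n. g n x) \<longlonglongrightarrow> f x"
proof -
  have "f measurable_on S" using iffD2[OF measurable_on_iff_borel_measurable[OF S] f] .
  then obtain N g where N: "negligible N" and g: "\<And>n. continuous_on UNIV (g n)"
    and lim: "\<And>x. x \<notin> N \<Longrightarrow> (\<lambda>n. g n x) \<longlonglongrightarrow> (if x \<in> S then f x else 0)"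
    unfolding measurable_on_def by blast
  have "AE x in lebesgue. x \<notin> N" using N by (simp add: negligible_iff_null_sets AE_not_in)
  then have "AE x in lebesgue_on S. x \<notin> N"
    using S by (simp add: AE_restrict_space_iff) (auto elim: eventually_mono)
  then have "AE x in lebesgue_on S. (\<lambda>n. g n x) \<longlonglongrightarrow> f x"
    by (rule lebesgue_on_mono) (use lim in force)
  then show ?thesis using g that by blast
qed

lemma continuous_imp_lebesgue_on_measurable:
  fixes f :: "'a::euclidean_space \<Rightarrow> real"
  assumes "continuous_on UNIV f" shows "f \<in> borel_measurable (lebesgue_on S)"
  using borel_measurable_continuous_onI[OF assms]
  by (intro measurable_restrict_space1 measurable_completion) simp

text \<open>Truncate \<open>f\<close> at a level \<open>k\<close> and approximate the truncation
  almost everywhere by continuous functions clipped to the same level; the constant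
  \<open>2 * real k\<close> dominates because the measure is finite. The bound \<open>B\<close> is
  left over from the clipping and lets \<open>g\<close> be placed in L2.\<close>

lemma L2_continuous_dense:
  fixes f :: "'a::euclidean_space \<Rightarrow> real"
  assumes S: "S \<in> lmeasurable" and f: "f \<in> L2 S" and e: "e > 0"
  obtains g B where "continuous_on UNIV g" "\<And>x. \<bar>g x\<bar> \<le> B" "L2_norm S (\<lambda>x. f x - g x) < e"
proof -
  note fm [measurable] = L2_D(1)[OF f]
  have "(\<lambda>k. L2_norm S (\<lambda>x. clip (real k) (f x) - f x)) \<longlonglongrightarrow> 0"
  proof (rule L2_dominated_convergence[where w="\<lambda>x. \<bar>f x\<bar>"])
    show "AE x in lebesgue_on S. (\<lambda>n. clip (real n) (f x)) \<longlonglongrightarrow> f x"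
    proof (intro AE_I2 tendsto_eventually eventually_sequentiallyI)
      fix x n assume "nat \<lceil>\<bar>f x\<bar>\<rceil> \<le> n"
      then have "\<bar>f x\<bar> \<le> real n" by linarith
      then show "clip (real n) (f x) = f x" by auto
    qed
  qed (use L2_abs[OF f] in auto)
  then have "\<forall>\<^sub>F k in sequentially. L2_norm S (\<lambda>x. clip (real k) (f x) - f x) < e / 2"
    using e by (intro order_tendstoD(2)) auto
  then obtain k where k: "L2_norm S (\<lambda>x. clip (real k) (f x) - f x) < e / 2"
    by (auto simp: eventually_sequentially)
  define fk where "fk x = clip (real k) (f x)" for x
  have fkm [measurable]: "fk \<in> borel_measurable (lebesgue_on S)" unfolding fk_def by measurable
  have fk_bound: "\<bar>fk x\<bar> \<le> real k" for x by (auto simp: fk_def)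
  have fk: "fk \<in> L2 S" using L2_bounded(1)[OF S fkm, of "real k"] fk_bound by auto
  obtain g where g: "\<And>n. continuous_on UNIV (g n)" "AE x in lebesgue_on S. (\<lambda>n. g n x) \<longlonglongrightarrow> fk x"
    using measurable_AE_limit_continuous[OF fmeasurableD[OF S] fkm] by blast
  define h where "h n x = clip (real k) (g n x)" for n x
  have h: "continuous_on UNIV (h n)" for n
    unfolding h_def by (intro continuous_intros g)
  have h_bound: "\<bar>h n x\<bar> \<le> real k" for n x by (auto simp: h_def)
  have hm: "h n \<in> borel_measurable (lebesgue_on S)" for n
    using continuous_imp_lebesgue_on_measurable[OF h] .
  have "(\<lambda>n. L2_norm S (\<lambda>x. h n x - fk x)) \<longlonglongrightarrow> 0"
  proof (rule L2_dominated_convergence[where w="\<lambda>_. 2 * real k"])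
    show "AE x in lebesgue_on S. (\<lambda>n. h n x) \<longlonglongrightarrow> fk x"
      using g(2)
    proof eventually_elim
      fix x assume "(\<lambda>n. g n x) \<longlonglongrightarrow> fk x"
      then have "(\<lambda>n. h n x) \<longlonglongrightarrow> clip (real k) (fk x)"
        unfolding h_def by (intro tendsto_intros)
      then show "(\<lambda>n. h n x) \<longlonglongrightarrow> fk x" using fk_bound[of x] by (auto simp: max_def min_def split: if_splits)
    qed
    show "AE x in lebesgue_on S. \<bar>h n x - fk x\<bar> \<le> 2 * real k" for n
    proof (rule AE_I2)
      fix x show "\<bar>h n x - fk x\<bar> \<le> 2 * real k" using h_bound[of n x] fk_bound[of x] by linarith
    qed
  qed (use hm L2_const[OF S] in auto)
  then have "\<forall>\<^sub>F n in sequentially. L2_norm S (\<lambda>x. h n x - fk x) < e / 2"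
    using e by (intro order_tendstoD(2)) auto
  then obtain n where n: "L2_norm S (\<lambda>x. h n x - fk x) < e / 2"
    by (auto simp: eventually_sequentially)
  have "h n \<in> L2 S" using L2_bounded(1)[OF S hm] h_bound by blast
  then have "L2_norm S (\<lambda>x. f x - h n x) < e"
    using L2_norm_triangle3[OF f fk, of "h n"] n k L2_norm_minus_commute[of S f fk]
      L2_norm_minus_commute[of S fk "h n"] by (simp add: fk_def)
  then show ?thesis using that[OF h h_bound] by blast
qed

section \<open>Integrals over intervals\<close>

text \<open>Passes between Bochner integrals over open intervals, in which the function spaces are
  phrased, and the gauge integral over closed ones, for which the fundamental theorem of calculus is
  available.\<close>

lemma continuous_integral_interval:
  fixes f :: "real \<Rightarrow> real"
  assumes "continuous_on {a..b} f"
  shows "integrable (lebesgue_on {a..b}) f" "integrable (lebesgue_on {a<..<b}) f"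
    "(\<integral>x. f x \<partial>lebesgue_on {a..b}) = integral {a..b} f"
    "(\<integral>x. f x \<partial>lebesgue_on {a<..<b}) = integral {a..b} f"
proof -
  show 1: "integrable (lebesgue_on {a..b}) f" by (rule continuous_imp_integrable_real[OF assms])
  have "integrable lebesgue (\<lambda>x. indicator {a<..<b} x *\<^sub>R indicator {a..b} x *\<^sub>R f x)"
    using 1 by (intro integrable_mult_indicator[of "{a<..<b}"]) (simp_all add: integrable_restrict_space)
  moreover have "(\<lambda>x. indicat_real {a<..<b} x *\<^sub>R indicat_real {a..b} x *\<^sub>R f x) = (\<lambda>x. indicat_real {a<..<b} x *\<^sub>R f x)"
    by (auto simp: indicator_def fun_eq_iff)
  ultimately have "integrable lebesgue (\<lambda>x. indicat_real {a<..<b} x *\<^sub>R f x)" by (simp only:)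
  then show 2: "integrable (lebesgue_on {a<..<b}) f" by (simp add: integrable_restrict_space)
  show "(\<integral>x. f x \<partial>lebesgue_on {a..b}) = integral {a..b} f"
    using lebesgue_integral_eq_integral[OF 1] by simp
  have "(\<integral>x. f x \<partial>lebesgue_on {a<..<b}) = integral {a<..<b} f"
    using lebesgue_integral_eq_integral[OF 2] by simp
  then show "(\<integral>x. f x \<partial>lebesgue_on {a<..<b}) = integral {a..b} f"
    by (simp add: integral_open_interval_real)
qed

lemma continuous_Icc_bounded:
  fixes f :: "real \<Rightarrow> real"
  assumes "continuous_on {a..b} f"
  obtains B where "\<And>x. x \<in> {a..b} \<Longrightarrow> \<bar>f x\<bar> \<le> B"
proof -
  have "bounded (f ` {a..b})" by (intro compact_imp_bounded compact_continuous_image assms) simp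
  then obtain B where "\<forall>x\<in>{a..b}. \<bar>f x\<bar> \<le> B" by (auto simp: bounded_iff)
  then show ?thesis using that by blast
qed

section \<open>Test functions and weak derivatives\<close>

lemma Cc1_I:
  assumes "\<And>x. (\<eta> has_real_derivative \<eta>' x) (at x)" "continuous_on UNIV \<eta>'"
    and "\<And>x. x \<notin> {c..d} \<Longrightarrow> \<eta> x = 0" and "a < c" "d < b"
  shows "\<eta> \<in> Cc1 a b"
proof -
  have "\<eta> C1_differentiable_on UNIV"
    unfolding C1_differentiable_on_def using assms(1,2)
    by (auto simp: has_real_derivative_iff_has_vector_derivative)
  moreover have "closure {x. \<eta> x \<noteq> 0} \<subseteq> {c..d}"
    by (intro closure_minimal) (use assms(3) in force)+
  ultimately show ?thesis using assms(4,5) by (auto simp: Cc1_def)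
qed

lemma Cc1_D:
  assumes "\<eta> \<in> Cc1 a b"
  shows "(\<eta> has_real_derivative deriv \<eta> x) (at x)" "continuous_on UNIV (deriv \<eta>)" "continuous_on UNIV \<eta>"
proof -
  obtain D where D: "\<And>x. (\<eta> has_real_derivative D x) (at x)" "continuous_on UNIV D"
    using assms by (auto simp: Cc1_def C1_differentiable_on_def has_real_derivative_iff_has_vector_derivative)
  have "deriv \<eta> = D" using DERIV_imp_deriv[OF D(1)] by auto
  then show "(\<eta> has_real_derivative deriv \<eta> x) (at x)" "continuous_on UNIV (deriv \<eta>)"
    using D by auto
  show "continuous_on UNIV \<eta>" using D(1) DERIV_continuous_on by blast
qed

lemma Cc1_support:
  assumes "\<eta> \<in> Cc1 a b" "a < b"
  obtains c d where "a < c" "c \<le> d" "d < b" "\<And>x. x \<notin> {c..d} \<Longrightarrow> \<eta> x = 0"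
proof -
  let ?K = "closure {x. \<eta> x \<noteq> 0}"
  have K: "?K \<subseteq> {a<..<b}" using assms(1) by (simp add: Cc1_def)
  then have bdd: "bounded ?K" by (rule bounded_subset[rotated]) simp
  show ?thesis
  proof (cases "?K = {}")
    case True
    \<comment> \<open>For the zero function the infimum and supremum of the support carry no
      information, so a one-point interval is supplied.\<close>
    then show ?thesis using that[of "(a+b)/2" "(a+b)/2"] assms(2) by auto
  next
    case False
    have Inf: "Inf ?K \<in> ?K" and Sup: "Sup ?K \<in> ?K"
      using closed_contains_Inf[OF False bounded_imp_bdd_below[OF bdd]]
        closed_contains_Sup[OF False bounded_imp_bdd_above[OF bdd]] by simp_all
    show ?thesis
    proof (rule that)
      show "a < Inf ?K" "Sup ?K < b" using subsetD[OF K Inf] subsetD[OF K Sup] by simp_all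
      show "Inf ?K \<le> Sup ?K" using cSup_upper[OF Inf bounded_imp_bdd_above[OF bdd]] .
      fix x assume x: "x \<notin> {Inf ?K..Sup ?K}"
      show "\<eta> x = 0"
      proof (rule ccontr)
        assume "\<eta> x \<noteq> 0"
        then have "x \<in> ?K" by (intro subsetD[OF closure_subset]) simp
        then show False using x cInf_lower[OF _ bounded_imp_bdd_below[OF bdd], of x]
            cSup_upper[OF _ bounded_imp_bdd_above[OF bdd], of x] by simp
      qed
    qed
  qed
qed

lemma Cc1_outside: "\<eta> \<in> Cc1 a b \<Longrightarrow> x \<notin> {a<..<b} \<Longrightarrow> \<eta> x = 0"
  using closure_subset[of "{x. \<eta> x \<noteq> 0}"] by (auto simp: Cc1_def)

lemma Cc1_lin:
  assumes "\<eta> \<in> Cc1 a b" "\<theta> \<in> Cc1 a b"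
  shows "(\<lambda>x. s * \<eta> x + t * \<theta> x) \<in> Cc1 a b"
    "deriv (\<lambda>x. s * \<eta> x + t * \<theta> x) = (\<lambda>x. s * deriv \<eta> x + t * deriv \<theta> x)"
proof -
  note D = Cc1_D[OF assms(1)] Cc1_D[OF assms(2)]
  have d: "((\<lambda>x. s * \<eta> x + t * \<theta> x) has_real_derivative s * deriv \<eta> x + t * deriv \<theta> x) (at x)" for x
    by (auto intro!: derivative_eq_intros D)
  then show "deriv (\<lambda>x. s * \<eta> x + t * \<theta> x) = (\<lambda>x. s * deriv \<eta> x + t * deriv \<theta> x)"
    by (auto intro: DERIV_imp_deriv)
  have "(\<lambda>x. s * \<eta> x + t * \<theta> x) C1_differentiable_on UNIV"
    using assms by (intro derivative_intros) (auto simp: Cc1_def)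
  moreover have "closure {x. s * \<eta> x + t * \<theta> x \<noteq> 0} \<subseteq> closure ({x. \<eta> x \<noteq> 0} \<union> {x. \<theta> x \<noteq> 0})"
    by (intro closure_mono) auto
  ultimately show "(\<lambda>x. s * \<eta> x + t * \<theta> x) \<in> Cc1 a b"
    using assms by (auto simp: Cc1_def)
qed

text \<open>The squared positive part is a simple C1 function vanishing on a half line; products of
  two such factors are the explicit bumps used as test functions.\<close>

lemma max0_square_derivative:
  "((\<lambda>x::real. (max 0 x)\<^sup>2) has_real_derivative 2 * max 0 x) (at x)"
proof (cases "x = 0")
  case False
  then consider "x > 0" | "x < 0" by linarith
  then show ?thesis
  proof cases
    case 1
    have "((\<lambda>x. x\<^sup>2) has_real_derivative 2 * max 0 x) (at x)"
      using 1 by (auto intro!: derivative_eq_intros)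
    then show ?thesis
      by (rule has_field_derivative_transform_within_open[where S="{0<..}"]) (use 1 in auto)
  next
    case 2
    have "((\<lambda>x. 0) has_real_derivative 2 * max 0 x) (at x)"
      using 2 by (auto intro!: derivative_eq_intros)
    then show ?thesis
      by (rule has_field_derivative_transform_within_open[where S="{..<0}"]) (use 2 in auto)
  qed
next
  case True
  have "((\<lambda>h. (max 0 h)\<^sup>2 / h) \<longlongrightarrow> 0) (at (0::real))"
  proof (rule Lim_null_comparison[where g="\<lambda>h. \<bar>h\<bar>"])
    show "\<forall>\<^sub>F h in at (0::real). norm ((max 0 h)\<^sup>2 / h) \<le> \<bar>h\<bar>"
      by (intro always_eventually allI) (auto simp: max_def power2_eq_square)
    show "((\<lambda>h. \<bar>h\<bar>) \<longlongrightarrow> 0) (at (0::real))" by (rule tendsto_eq_intros refl | simp)+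
  qed
  then show ?thesis using True by (simp add: DERIV_def)
qed

text \<open>The test functions used are polynomials times truncations of the weight
  \<open>\<kappa>\<^sub>0(x) = (x - a)\<^sup>2 (b - x)\<^sup>2\<close>; they show that \<open>h \<kappa>\<^sub>0\<close> annihilates \<open>sgn h\<close>.\<close>

lemma fundamental_lemma:
  assumes h: "integrable (lebesgue_on {a<..<b}) h"
    and test: "\<And>\<eta>. \<eta> \<in> Cc1 a b \<Longrightarrow> (\<integral>x. h x * \<eta> x \<partial>lebesgue_on {a<..<b}) = 0"
  shows "AE x in lebesgue_on {a<..<b}. h x = 0"
proof (cases "a < b")
  case False
  then show ?thesis by (auto intro!: AE_I2)
next
  case ab: True
  let ?M = "lebesgue_on {a<..<b}"
  have hm [measurable]: "h \<in> borel_measurable ?M" using h by auto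
  have cm: "continuous_on UNIV f \<Longrightarrow> f \<in> borel_measurable ?M" for f :: "real \<Rightarrow> real"
    using continuous_imp_lebesgue_on_measurable .
  \<comment> \<open>\<open>\<kappa> n\<close> vanishes within distance 1/(n + 1) of the end points,
    so that its products with polynomials are test functions. It converges pointwise to \<kappa>0,
    which is positive on the open interval.\<close>
  define \<kappa> where "\<kappa> n x = (max 0 (x - (a + inverse (real (Suc n)))))\<^sup>2 * (max 0 ((b - inverse (real (Suc n))) - x))\<^sup>2" for n x
  define \<kappa>0 where "\<kappa>0 x = (max 0 (x - a))\<^sup>2 * (max 0 (b - x))\<^sup>2" for x
  have \<kappa>c: "continuous_on UNIV (\<kappa> n)" for n unfolding \<kappa>_def by (intro continuous_intros)
  have \<kappa>0c: "continuous_on UNIV \<kappa>0" unfolding \<kappa>0_def by (intro continuous_intros)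
  note [measurable] = cm[OF \<kappa>c] cm[OF \<kappa>0c]
  define L where "L = (b - a)\<^sup>2 * (b - a)\<^sup>2"
  have bnd: "\<bar>\<kappa>0 x\<bar> \<le> L" "\<bar>\<kappa> n x\<bar> \<le> L" if "x \<in> {a<..<b}" for n x
  proof -
    have i: "0 < inverse (real (Suc n))" by simp
    have "(max 0 (x - a))\<^sup>2 \<le> (b - a)\<^sup>2" "(max 0 (b - x))\<^sup>2 \<le> (b - a)\<^sup>2"
      using that by (auto intro!: power_mono)
    then have "(max 0 (x - a))\<^sup>2 * (max 0 (b - x))\<^sup>2 \<le> L" unfolding L_def by (intro mult_mono) auto
    then show "\<bar>\<kappa>0 x\<bar> \<le> L" by (simp add: \<kappa>0_def)
    have "(max 0 (x - (a + inverse (real (Suc n)))))\<^sup>2 \<le> (b - a)\<^sup>2" "(max 0 ((b - inverse (real (Suc n))) - x))\<^sup>2 \<le> (b - a)\<^sup>2"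
      proof -
      have "max 0 (x - (a + inverse (real (Suc n)))) \<le> b - a" "max 0 ((b - inverse (real (Suc n))) - x) \<le> b - a"
        using that i unfolding greaterThanLessThan_iff by linarith+
      then show "(max 0 (x - (a + inverse (real (Suc n)))))\<^sup>2 \<le> (b - a)\<^sup>2"
        "(max 0 ((b - inverse (real (Suc n))) - x))\<^sup>2 \<le> (b - a)\<^sup>2"
        by (simp_all only: power_mono max.cobounded1)
    qed
    then have "(max 0 (x - (a + inverse (real (Suc n)))))\<^sup>2 * (max 0 ((b - inverse (real (Suc n))) - x))\<^sup>2 \<le> L"
      unfolding L_def by (intro mult_mono) auto
    then show "\<bar>\<kappa> n x\<bar> \<le> L" unfolding \<kappa>_def by (simp only: abs_of_nonneg zero_le_power2 mult_nonneg_nonneg)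
  qed
  have poly: "(\<integral>x. h x * (\<kappa>0 x * p x) \<partial>?M) = 0" if pp: "polynomial_function p" for p :: "real \<Rightarrow> real"
  proof -
    have pc: "continuous_on UNIV p" using continuous_on_polymonial_function[OF pp] by simp
    note [measurable] = cm[OF pc]
    obtain p' where p': "polynomial_function p'" "\<And>x. (p has_vector_derivative p' x) (at x)"
      using has_vector_derivative_polynomial_function[OF pp] by blast
    have p'c: "continuous_on UNIV p'" using continuous_on_polymonial_function[OF p'(1)] by simp
    have pd: "(p has_real_derivative p' x) (at x)" for x
      using p'(2) by (simp add: has_real_derivative_iff_has_vector_derivative)
    obtain B where B: "\<And>x. x \<in> {a..b} \<Longrightarrow> \<bar>p x\<bar> \<le> B"
      using continuous_Icc_bounded[OF continuous_on_subset[OF pc]] by blast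
    have mem: "(\<lambda>x. \<kappa> n x * p x) \<in> Cc1 a b" for n
    proof (rule Cc1_I)
      let ?i = "inverse (real (Suc n))"
      show "((\<lambda>x. \<kappa> n x * p x) has_real_derivative
         ((2 * max 0 (x - (a + ?i)) * (max 0 ((b - ?i) - x))\<^sup>2 - 2 * max 0 ((b - ?i) - x) * (max 0 (x - (a + ?i)))\<^sup>2) * p x + \<kappa> n x * p' x)) (at x)" for x
        unfolding \<kappa>_def
        by (rule derivative_eq_intros DERIV_chain2[OF max0_square_derivative] pd refl | simp)+
      show "continuous_on UNIV (\<lambda>x. (2 * max 0 (x - (a + ?i)) * (max 0 ((b - ?i) - x))\<^sup>2 - 2 * max 0 ((b - ?i) - x) * (max 0 (x - (a + ?i)))\<^sup>2) * p x + \<kappa> n x * p' x)"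
        by (intro continuous_intros pc p'c \<kappa>c)
      show "\<kappa> n x * p x = 0" if "x \<notin> {a + ?i .. b - ?i}" for x
        using that by (auto simp: \<kappa>_def max_def)
    qed auto
    have "(\<lambda>n. \<integral>x. h x * (\<kappa> n x * p x) \<partial>?M) \<longlonglongrightarrow> (\<integral>x. h x * (\<kappa>0 x * p x) \<partial>?M)"
    proof (rule integral_dominated_convergence[where w="\<lambda>x. \<bar>h x\<bar> * (L * B)"])
      show "integrable ?M (\<lambda>x. \<bar>h x\<bar> * (L * B))" using h by auto
      show "AE x in ?M. (\<lambda>n. h x * (\<kappa> n x * p x)) \<longlonglongrightarrow> h x * (\<kappa>0 x * p x)"
      proof (rule AE_I2)
        fix x
        have "(\<lambda>n. \<kappa> n x) \<longlonglongrightarrow> (max 0 (x - (a + 0)))\<^sup>2 * (max 0 ((b - 0) - x))\<^sup>2"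
          unfolding \<kappa>_def by (intro tendsto_intros LIMSEQ_inverse_real_of_nat)
        then show "(\<lambda>n. h x * (\<kappa> n x * p x)) \<longlonglongrightarrow> h x * (\<kappa>0 x * p x)"
          unfolding \<kappa>0_def by (intro tendsto_intros) simp
      qed
      show "AE x in ?M. norm (h x * (\<kappa> n x * p x)) \<le> \<bar>h x\<bar> * (L * B)" for n
      proof (rule AE_I2)
        fix x assume "x \<in> space ?M"
        then have "\<bar>\<kappa> n x\<bar> * \<bar>p x\<bar> \<le> L * B"
          using bnd(2)[of x n] B[of x] by (intro mult_mono) auto
        then show "norm (h x * (\<kappa> n x * p x)) \<le> \<bar>h x\<bar> * (L * B)"
          by (simp add: abs_mult mult_left_mono)
      qed
    qed auto
    moreover have "(\<integral>x. h x * (\<kappa> n x * p x) \<partial>?M) = 0" for n using test[OF mem] .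
    ultimately show ?thesis by (simp add: LIMSEQ_const_iff)
  qed
  \<comment> \<open>Polynomial factors kept the test functions C1. With the weight \<kappa>0 in
    place, Weierstrass approximation passes from them to all continuous factors.\<close>
  have cont: "(\<integral>x. h x * (\<kappa>0 x * g x) \<partial>?M) = 0" if g: "continuous_on UNIV g" for g :: "real \<Rightarrow> real"
  proof -
    have "\<exists>p. real_polynomial_function p \<and> (\<forall>x\<in>{a..b}. \<bar>g x - p x\<bar> < inverse (real (Suc n)))" for n
    proof -
      obtain p where "real_polynomial_function p" "\<And>x. x \<in> {a..b} \<Longrightarrow> \<bar>g x - p x\<bar> < inverse (real (Suc n))"
        using Stone_Weierstrass_real_polynomial_function[of "{a..b}" g "inverse (real (Suc n))"]
          continuous_on_subset[OF g] by auto
      then show ?thesis by blast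
    qed
    then obtain p where p: "\<And>n. real_polynomial_function (p n)"
      "\<And>n x. x \<in> {a..b} \<Longrightarrow> \<bar>g x - p n x\<bar> < inverse (real (Suc n))" by metis
    have pc: "continuous_on UNIV (p n)" for n
      using p(1)[of n] by (simp add: continuous_on_polymonial_function real_polynomial_function_eq)
    note [measurable] = cm[OF pc] cm[OF g]
    obtain B where B: "\<And>x. x \<in> {a..b} \<Longrightarrow> \<bar>g x\<bar> \<le> B"
      using continuous_Icc_bounded[OF continuous_on_subset[OF g]] by blast
    have "(\<lambda>n. \<integral>x. h x * (\<kappa>0 x * p n x) \<partial>?M) \<longlonglongrightarrow> (\<integral>x. h x * (\<kappa>0 x * g x) \<partial>?M)"
    proof (rule integral_dominated_convergence[where w="\<lambda>x. \<bar>h x\<bar> * (L * (B + 1))"])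
      show "integrable ?M (\<lambda>x. \<bar>h x\<bar> * (L * (B + 1)))" using h by auto
      show "AE x in ?M. (\<lambda>n. h x * (\<kappa>0 x * p n x)) \<longlonglongrightarrow> h x * (\<kappa>0 x * g x)"
      proof (rule AE_I2)
        fix x assume x: "x \<in> space ?M"
        have "(\<lambda>n. g x - p n x) \<longlonglongrightarrow> 0"
        proof (rule Lim_null_comparison[OF _ LIMSEQ_inverse_real_of_nat])
          show "\<forall>\<^sub>F n in sequentially. norm (g x - p n x) \<le> inverse (real (Suc n))"
            using p(2)[of x] x by (intro always_eventually allI) (simp add: less_imp_le)
        qed
        then have "(\<lambda>n. g x - (g x - p n x)) \<longlonglongrightarrow> g x - 0" by (intro tendsto_intros)
        then have "(\<lambda>n. p n x) \<longlonglongrightarrow> g x" by simp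
        then show "(\<lambda>n. h x * (\<kappa>0 x * p n x)) \<longlonglongrightarrow> h x * (\<kappa>0 x * g x)" by (intro tendsto_intros)
      qed
      show "AE x in ?M. norm (h x * (\<kappa>0 x * p n x)) \<le> \<bar>h x\<bar> * (L * (B + 1))" for n
      proof (rule AE_I2)
        fix x assume x: "x \<in> space ?M"
        have "inverse (real (Suc n)) \<le> 1" by (simp add: field_simps)
        then have "\<bar>p n x\<bar> \<le> B + 1" using p(2)[of x n] B[of x] x by auto
        then have "\<bar>\<kappa>0 x\<bar> * \<bar>p n x\<bar> \<le> L * (B + 1)"
          using bnd(1)[of x] x by (intro mult_mono) auto
        then show "norm (h x * (\<kappa>0 x * p n x)) \<le> \<bar>h x\<bar> * (L * (B + 1))"
          by (simp add: abs_mult mult_left_mono)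
      qed
    qed auto
    moreover have "(\<integral>x. h x * (\<kappa>0 x * p n x) \<partial>?M) = 0" for n
      using poly[of "p n"] p(1)[of n] by (simp add: real_polynomial_function_eq)
    ultimately show ?thesis by (simp add: LIMSEQ_const_iff)
  qed
  \<comment> \<open>The sign of \<open>h\<close> is only measurable. It is reached through
    continuous functions clipped to [-1, 1], for which a multiple of |h| dominates.\<close>
  have sgm: "(\<lambda>x. sgn (h x)) \<in> borel_measurable ?M" by measurable
  obtain g where g: "\<And>n. continuous_on UNIV (g n)" "AE x in ?M. (\<lambda>n. g n x) \<longlonglongrightarrow> sgn (h x)"
    using measurable_AE_limit_continuous[OF _ sgm] by auto
  have gc: "continuous_on UNIV (\<lambda>x. clip 1 (g n x))" for n by (intro continuous_intros g)
  note [measurable] = cm[OF gc]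
  have "(\<lambda>n. \<integral>x. h x * (\<kappa>0 x * clip 1 (g n x)) \<partial>?M) \<longlonglongrightarrow> (\<integral>x. h x * (\<kappa>0 x * sgn (h x)) \<partial>?M)"
  proof (rule integral_dominated_convergence[where w="\<lambda>x. \<bar>h x\<bar> * (L * 1)"])
    show "integrable ?M (\<lambda>x. \<bar>h x\<bar> * (L * 1))" using h by auto
    show "AE x in ?M. (\<lambda>n. h x * (\<kappa>0 x * clip 1 (g n x))) \<longlonglongrightarrow> h x * (\<kappa>0 x * sgn (h x))"
      using g(2)
    proof eventually_elim
      fix x assume "(\<lambda>n. g n x) \<longlonglongrightarrow> sgn (h x)"
      then have "(\<lambda>n. h x * (\<kappa>0 x * clip 1 (g n x))) \<longlonglongrightarrow> h x * (\<kappa>0 x * clip 1 (sgn (h x)))"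
        by (intro tendsto_intros)
      moreover have "clip 1 (sgn (h x)) = sgn (h x)" by (auto simp: sgn_if)
      ultimately show "(\<lambda>n. h x * (\<kappa>0 x * clip 1 (g n x))) \<longlonglongrightarrow> h x * (\<kappa>0 x * sgn (h x))" by simp
    qed
    show "AE x in ?M. norm (h x * (\<kappa>0 x * clip 1 (g n x))) \<le> \<bar>h x\<bar> * (L * 1)" for n
    proof (rule AE_I2)
      fix x assume x: "x \<in> space ?M"
      have "\<bar>clip 1 (g n x)\<bar> \<le> 1" by auto
      then have "\<bar>\<kappa>0 x\<bar> * \<bar>clip 1 (g n x)\<bar> \<le> L * 1"
        using bnd(1)[of x] x by (intro mult_mono) auto
      then have "\<bar>h x\<bar> * (\<bar>\<kappa>0 x\<bar> * \<bar>clip 1 (g n x)\<bar>) \<le> \<bar>h x\<bar> * (L * 1)"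
        by (rule mult_left_mono) simp
      then show "norm (h x * (\<kappa>0 x * clip 1 (g n x))) \<le> \<bar>h x\<bar> * (L * 1)"
        by (simp only: real_norm_def abs_mult)
    qed
  qed auto
  then have "(\<integral>x. h x * (\<kappa>0 x * sgn (h x)) \<partial>?M) = 0"
    using cont[OF gc] by (simp add: LIMSEQ_const_iff)
  moreover have "h x * (\<kappa>0 x * sgn (h x)) = \<kappa>0 x * \<bar>h x\<bar>" for x by (simp add: sgn_if)
  ultimately have zero: "(\<integral>x. \<kappa>0 x * \<bar>h x\<bar> \<partial>?M) = 0" by simp
  have "integrable ?M (\<lambda>x. \<kappa>0 x * \<bar>h x\<bar>)"
  proof (rule Bochner_Integration.integrable_bound[where f="\<lambda>x. L * \<bar>h x\<bar>"])
    show "AE x in ?M. norm (\<kappa>0 x * \<bar>h x\<bar>) \<le> norm (L * \<bar>h x\<bar>)"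
    proof (rule AE_I2)
      fix x assume "x \<in> space ?M"
      then have "\<bar>\<kappa>0 x\<bar> \<le> \<bar>L\<bar>" using bnd(1)[of x] by auto
      then show "norm (\<kappa>0 x * \<bar>h x\<bar>) \<le> norm (L * \<bar>h x\<bar>)" by (simp add: abs_mult mult_right_mono)
    qed
  qed (use h in auto)
  then have "AE x in ?M. \<kappa>0 x * \<bar>h x\<bar> = 0"
    using integral_nonneg_eq_0_iff_AE[of ?M "\<lambda>x. \<kappa>0 x * \<bar>h x\<bar>"] zero by (auto simp: \<kappa>0_def)
  then show ?thesis
    by (rule lebesgue_on_mono) (auto simp: \<kappa>0_def max_def)
qed

lemma lmeasurable_open_interval [simp]: "{a<..<b::real} \<in> lmeasurable"
  by (simp flip: box_real)

lemma integrable_mult_continuous: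
  fixes g \<eta> :: "real \<Rightarrow> real"
  assumes g: "integrable (lebesgue_on {a<..<b}) g" and \<eta>: "continuous_on UNIV \<eta>"
  shows "integrable (lebesgue_on {a<..<b}) (\<lambda>x. g x * \<eta> x)"
proof -
  obtain B where B: "\<And>x. x \<in> {a..b} \<Longrightarrow> \<bar>\<eta> x\<bar> \<le> B"
    using continuous_Icc_bounded[OF continuous_on_subset[OF \<eta>]] by blast
  note [measurable] = continuous_imp_lebesgue_on_measurable[OF \<eta>] borel_measurable_integrable[OF g]
  show ?thesis
  proof (rule Bochner_Integration.integrable_bound[where f="\<lambda>x. B * g x"])
    show "AE x in lebesgue_on {a<..<b}. norm (g x * \<eta> x) \<le> norm (B * g x)"
    proof (rule AE_I2)
      fix x assume "x \<in> space (lebesgue_on {a<..<b})"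
      then have "\<bar>\<eta> x\<bar> \<le> \<bar>B\<bar>" using B[of x] by auto
      then show "norm (g x * \<eta> x) \<le> norm (B * g x)"
        unfolding real_norm_def abs_mult by (simp add: mult.commute mult_right_mono)
    qed
  qed (use g in auto)
qed

section \<open>Weak derivatives: uniqueness, linearity, agreement with classical derivatives\<close>

lemma has_weak_deriv_D:
  assumes "has_weak_deriv a b u g"
  shows "integrable (lebesgue_on {a<..<b}) u" "integrable (lebesgue_on {a<..<b}) g"
    "\<eta> \<in> Cc1 a b \<Longrightarrow> (\<integral>x. u x * deriv \<eta> x \<partial>lebesgue_on {a<..<b}) = - (\<integral>x. g x * \<eta> x \<partial>lebesgue_on {a<..<b})"
  using assms unfolding has_weak_deriv_def by blast+

lemma weak_deriv_unique:
  assumes "has_weak_deriv a b u g" "has_weak_deriv a b u h"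
  shows "AE x in lebesgue_on {a<..<b}. g x = h x"
proof -
  have int: "integrable (lebesgue_on {a<..<b}) g" "integrable (lebesgue_on {a<..<b}) h"
    using assms by (auto simp: has_weak_deriv_def)
  have "AE x in lebesgue_on {a<..<b}. g x - h x = 0"
  proof (rule fundamental_lemma)
    fix \<eta> assume \<eta>: "\<eta> \<in> Cc1 a b"
    have "(\<integral>x. (g x - h x) * \<eta> x \<partial>lebesgue_on {a<..<b})
        = (\<integral>x. g x * \<eta> x \<partial>lebesgue_on {a<..<b}) - (\<integral>x. h x * \<eta> x \<partial>lebesgue_on {a<..<b})"
      using integrable_mult_continuous[OF int(1) Cc1_D(3)[OF \<eta>]]
        integrable_mult_continuous[OF int(2) Cc1_D(3)[OF \<eta>]] by (simp add: left_diff_distrib)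
    moreover have "- (\<integral>x. g x * \<eta> x \<partial>lebesgue_on {a<..<b}) = - (\<integral>x. h x * \<eta> x \<partial>lebesgue_on {a<..<b})"
      using has_weak_deriv_D(3)[OF assms(1) \<eta>] has_weak_deriv_D(3)[OF assms(2) \<eta>] by simp
    ultimately show "(\<integral>x. (g x - h x) * \<eta> x \<partial>lebesgue_on {a<..<b}) = 0" by simp
  qed (rule Bochner_Integration.integrable_diff[OF int])
  then show ?thesis by (rule lebesgue_on_mono) simp
qed

lemma weak_deriv_has:
  "has_weak_deriv a b u g \<Longrightarrow> has_weak_deriv a b u (weak_deriv a b u)"
  unfolding weak_deriv_def by (rule someI[of "has_weak_deriv a b u"])

lemma weak_deriv_AE:
  "has_weak_deriv a b u g \<Longrightarrow> AE x in lebesgue_on {a<..<b}. weak_deriv a b u x = g x"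
  using weak_deriv_unique[OF weak_deriv_has] .

lemma weak_deriv_measurable:
  "has_weak_deriv a b u g \<Longrightarrow> weak_deriv a b u \<in> borel_measurable (lebesgue_on {a<..<b})"
  using weak_deriv_has[of a b u g] by (auto simp: has_weak_deriv_def)

lemma has_weak_deriv_lin:
  assumes "has_weak_deriv a b u g" "has_weak_deriv a b v h"
  shows "has_weak_deriv a b (\<lambda>x. s * u x + t * v x) (\<lambda>x. s * g x + t * h x)"
proof -
  let ?M = "lebesgue_on {a<..<b}"
  have int: "integrable ?M u" "integrable ?M v" "integrable ?M g" "integrable ?M h"
    using assms by (auto simp: has_weak_deriv_def)
  have "(\<integral>x. (s * u x + t * v x) * deriv \<eta> x \<partial>?M) = - (\<integral>x. (s * g x + t * h x) * \<eta> x \<partial>?M)"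
    if \<eta>: "\<eta> \<in> Cc1 a b" for \<eta>
  proof -
    note i = integrable_mult_continuous[OF int(1) Cc1_D(2)[OF \<eta>]] integrable_mult_continuous[OF int(2) Cc1_D(2)[OF \<eta>]]
      integrable_mult_continuous[OF int(3) Cc1_D(3)[OF \<eta>]] integrable_mult_continuous[OF int(4) Cc1_D(3)[OF \<eta>]]
    have "(\<integral>x. (s * u x + t * v x) * deriv \<eta> x \<partial>?M) = s * (\<integral>x. u x * deriv \<eta> x \<partial>?M) + t * (\<integral>x. v x * deriv \<eta> x \<partial>?M)"
      using i by (simp add: distrib_right mult.assoc)
    also have "\<dots> = - (s * (\<integral>x. g x * \<eta> x \<partial>?M) + t * (\<integral>x. h x * \<eta> x \<partial>?M))"
      using has_weak_deriv_D(3)[OF assms(1) \<eta>] has_weak_deriv_D(3)[OF assms(2) \<eta>] by simp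
    also have "s * (\<integral>x. g x * \<eta> x \<partial>?M) + t * (\<integral>x. h x * \<eta> x \<partial>?M) = (\<integral>x. (s * g x + t * h x) * \<eta> x \<partial>?M)"
      using i by (simp add: distrib_right mult.assoc)
    finally show ?thesis .
  qed
  then show ?thesis using int by (simp add: has_weak_deriv_def)
qed

lemma has_weak_deriv_C1:
  assumes w: "\<And>x. x \<in> {a..b} \<Longrightarrow> (w has_real_derivative w' x) (at x within {a..b})"
    and w': "continuous_on {a..b} w'"
  shows "has_weak_deriv a b w w'"
proof (cases "a < b")
  case False
  then show ?thesis by (simp add: has_weak_deriv_def)
next
  case True
  have wc: "continuous_on {a..b} w" by (rule DERIV_continuous_on[OF w])
  have "(\<integral>x. w x * deriv \<eta> x \<partial>lebesgue_on {a<..<b}) = - (\<integral>x. w' x * \<eta> x \<partial>lebesgue_on {a<..<b})"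
    if \<eta>: "\<eta> \<in> Cc1 a b" for \<eta>
  proof -
    note D = Cc1_D(1)[OF \<eta>]
    have c: "continuous_on {a..b} \<eta>" "continuous_on {a..b} (deriv \<eta>)"
      using Cc1_D(2,3)[OF \<eta>] by (auto intro: continuous_on_subset)
    have "((\<lambda>x. w' x * \<eta> x + w x * deriv \<eta> x) has_integral w b * \<eta> b - w a * \<eta> a) {a..b}"
      using True
      by (intro fundamental_theorem_of_calculus)
        (auto intro!: derivative_eq_intros w has_field_derivative_at_within[OF D]
          simp flip: has_real_derivative_iff_has_vector_derivative)
    moreover have "\<eta> a = 0" "\<eta> b = 0" using Cc1_outside[OF \<eta>] by auto
    ultimately have "integral {a..b} (\<lambda>x. w' x * \<eta> x + w x * deriv \<eta> x) = 0"
      by (simp add: integral_unique)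
    moreover have "integral {a..b} (\<lambda>x. w' x * \<eta> x + w x * deriv \<eta> x)
       = integral {a..b} (\<lambda>x. w' x * \<eta> x) + integral {a..b} (\<lambda>x. w x * deriv \<eta> x)"
      by (intro Henstock_Kurzweil_Integration.integral_add integrable_continuous_real continuous_intros w' wc c)
    moreover have "continuous_on {a..b} (\<lambda>x. w' x * \<eta> x)" "continuous_on {a..b} (\<lambda>x. w x * deriv \<eta> x)"
      by (intro continuous_intros w' wc c)+
    ultimately show ?thesis by (simp add: continuous_integral_interval)
  qed
  then show ?thesis using wc w' by (simp add: has_weak_deriv_def continuous_integral_interval)
qed

lemma has_weak_deriv_Cc1: "\<eta> \<in> Cc1 a b \<Longrightarrow> has_weak_deriv a b \<eta> (deriv \<eta>)"
  by (rule has_weak_deriv_C1)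
    (auto intro: has_field_derivative_at_within Cc1_D continuous_on_subset)

text \<open>Mean zero is exactly what makes the primitive vanish again to the right of the support;
  to the left it vanishes trivially. This is how test functions with a prescribed derivative are
  produced.\<close>

lemma Cc1_primitive:
  assumes \<theta>: "continuous_on UNIV \<theta>" and out: "\<And>x. x \<notin> {c..d} \<Longrightarrow> \<theta> x = 0"
    and ab: "a < c" "c \<le> d" "d < b" and zero: "integral {a..b} \<theta> = 0"
  shows "(\<lambda>x. integral {a..x} \<theta>) \<in> Cc1 a b" "deriv (\<lambda>x. integral {a..x} \<theta>) = \<theta>"
proof -
  let ?\<eta> = "\<lambda>x. integral {a..x} \<theta>"
  have cont: "continuous_on S \<theta>" for S using \<theta> continuous_on_subset by blast
  have low: "?\<eta> x = 0" if "x < c" for x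
  proof -
    have "?\<eta> x = integral {a..x} (\<lambda>_. 0)" using that by (intro integral_cong out) auto
    then show ?thesis by simp
  qed
  have high: "?\<eta> x = 0" if x: "x > d" for x
  proof (cases "x \<le> b")
    case True
    have "?\<eta> x + integral {x..b} \<theta> = integral {a..b} \<theta>"
      using True x ab by (intro Henstock_Kurzweil_Integration.integral_combine integrable_continuous_real cont) auto
    moreover have "integral {x..b} \<theta> = integral {x..b} (\<lambda>_. 0)" using x by (intro integral_cong out) auto
    ultimately show ?thesis using zero by simp
  next
    case False
    have "integral {a..b} \<theta> + integral {b..x} \<theta> = ?\<eta> x"
      using False x ab by (intro Henstock_Kurzweil_Integration.integral_combine integrable_continuous_real cont) auto
    moreover have "integral {b..x} \<theta> = integral {b..x} (\<lambda>_. 0)" using ab by (intro integral_cong out) auto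
    ultimately show ?thesis using zero by simp
  qed
  have D: "(?\<eta> has_real_derivative \<theta> x) (at x)" for x
  proof (cases "x > a")
    case True
    have "(?\<eta> has_real_derivative \<theta> x) (at x within {a..x+1})"
      by (rule integral_has_real_derivative) (use True cont in auto)
    moreover have "at x within {a..x+1} = at x"
      by (rule at_within_interior) (use True in \<open>simp add: interior_atLeastAtMost_real\<close>)
    ultimately show ?thesis by simp
  next
    case False
    \<comment> \<open>Here the primitive vanishes on the whole half line below \<open>c\<close>,
      which is a neighbourhood of \<open>x\<close> because \<open>a < c\<close>.\<close>
    have "((\<lambda>x. 0) has_real_derivative \<theta> x) (at x)"
      using False ab out[of x] by simp
    then show ?thesis
      by (rule has_field_derivative_transform_within_open[where S="{..<c}"]) (use False ab low in auto)
  qed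
  then show "deriv ?\<eta> = \<theta>" by (auto intro: DERIV_imp_deriv)
  show "?\<eta> \<in> Cc1 a b"
    by (rule Cc1_I[OF D \<theta>, of c d]) (use low high ab in \<open>auto simp: not_le\<close>)
qed

lemma Cc1_integral_deriv:
  assumes "\<eta> \<in> Cc1 a b" "a < b" "a \<le> x" "x \<le> b"
  shows "integral {a..x} (deriv \<eta>) = \<eta> x"
proof -
  have "(deriv \<eta> has_integral \<eta> x - \<eta> a) {a..x}"
    using assms by (intro fundamental_theorem_of_calculus)
      (auto intro!: has_field_derivative_at_within Cc1_D(1)[OF assms(1)]
          simp flip: has_real_derivative_iff_has_vector_derivative)
  moreover have "\<eta> a = 0" using Cc1_outside[OF assms(1)] by auto
  ultimately show ?thesis by (simp add: integral_unique)
qed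

lemma Cc1_unit_mass:
  assumes "a < b"
  obtains \<psi> where "\<psi> \<in> Cc1 a b" "integral {a..b} \<psi> = 1"
proof -
  define c d where "c = (2 * a + b) / 3" and "d = (a + 2 * b) / 3"
  have cd: "a < c" "c < d" "d < b" using assms by (auto simp: c_def d_def field_simps)
  define \<psi> where "\<psi> x = (max 0 (x - c))\<^sup>2 * (max 0 (d - x))\<^sup>2" for x
  have mem: "\<psi> \<in> Cc1 a b"
  proof (rule Cc1_I)
    show "(\<psi> has_real_derivative 2 * max 0 (x - c) * (max 0 (d - x))\<^sup>2 - 2 * max 0 (d - x) * (max 0 (x - c))\<^sup>2) (at x)" for x
      unfolding \<psi>_def by (rule derivative_eq_intros DERIV_chain2[OF max0_square_derivative] refl | simp)+
    show "continuous_on UNIV (\<lambda>x. 2 * max 0 (x - c) * (max 0 (d - x))\<^sup>2 - 2 * max 0 (d - x) * (max 0 (x - c))\<^sup>2)"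
      by (intro continuous_intros)
    show "\<psi> x = 0" if "x \<notin> {c..d}" for x using that by (auto simp: \<psi>_def max_def)
  qed (use cd in auto)
  have cont: "continuous_on {a..b} \<psi>" using Cc1_D(3)[OF mem] continuous_on_subset by blast
  have "integral {a..b} \<psi> \<noteq> 0"
  proof
    assume "integral {a..b} \<psi> = 0"
    then have "\<forall>x\<in>{a..b}. \<psi> x = 0"
      using integral_eq_0_iff[OF cont assms] by (auto simp: \<psi>_def)
    moreover have "(c + d) / 2 \<in> {a..b}" using cd by auto
    ultimately have "\<psi> ((c + d) / 2) = 0" by blast
    then show False using cd by (auto simp: \<psi>_def max_def field_simps split: if_splits)
  qed
  moreover have "(\<lambda>x. inverse (integral {a..b} \<psi>) * \<psi> x) \<in> Cc1 a b"
    using Cc1_lin(1)[OF mem mem, of "inverse (integral {a..b} \<psi>)" 0] by simp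
  ultimately show ?thesis by (intro that) auto
qed

text \<open>Subtracting from a test function \<open>k\<close> its integral times a fixed bump \<psi>
  of unit mass leaves a function of mean zero, hence the derivative of a test function. Testing
  \<open>u\<close> with it shows that (u - C) k integrates to zero for every
  \<open>k\<close>.\<close>

lemma du_Bois_Reymond:
  assumes u: "integrable (lebesgue_on {a<..<b}) u"
    and test: "\<And>\<eta>. \<eta> \<in> Cc1 a b \<Longrightarrow> (\<integral>x. u x * deriv \<eta> x \<partial>lebesgue_on {a<..<b}) = 0"
  obtains c where "AE x in lebesgue_on {a<..<b}. u x = c"
proof (cases "a < b")
  case False
  then show ?thesis by (intro that[of 0] AE_I2) auto
next
  case True
  let ?M = "lebesgue_on {a<..<b}"
  obtain \<psi> where \<psi>: "\<psi> \<in> Cc1 a b" and \<psi>1: "integral {a..b} \<psi> = 1"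
    using Cc1_unit_mass[OF True] by blast
  obtain c1 d1 where cd1: "a < c1" "c1 \<le> d1" "d1 < b" "\<And>x. x \<notin> {c1..d1} \<Longrightarrow> \<psi> x = 0"
    using Cc1_support[OF \<psi> True] by blast
  \<comment> \<open>A constant \<open>u\<close> has to equal its average against the unit mass
    \<psi>.\<close>
  define C where "C = (\<integral>x. u x * \<psi> x \<partial>?M)"
  have ucont: "integrable ?M (\<lambda>x. u x * g x)" if "continuous_on UNIV g" for g
    using integrable_mult_continuous[OF u that] .
  have "AE x in ?M. u x - C = 0"
  proof (rule fundamental_lemma)
    show "integrable ?M (\<lambda>x. u x - C)"
      using u L2_imp_integrable[OF lmeasurable_open_interval L2_const] by auto
    fix k assume k: "k \<in> Cc1 a b"
    have kc: "continuous_on S k" "continuous_on S \<psi>" for S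
      using Cc1_D(3)[OF k] Cc1_D(3)[OF \<psi>] continuous_on_subset by blast+
    obtain c2 d2 where cd2: "a < c2" "c2 \<le> d2" "d2 < b" "\<And>x. x \<notin> {c2..d2} \<Longrightarrow> k x = 0"
      using Cc1_support[OF k True] by blast
    define K where "K = integral {a..b} k"
    define \<theta> where "\<theta> x = k x - K * \<psi> x" for x
    have \<theta>: "continuous_on S \<theta>" for S unfolding \<theta>_def by (intro continuous_intros kc)
    have "(\<integral>x. u x * deriv (\<lambda>x. integral {a..x} \<theta>) x \<partial>?M) = 0"
    proof (rule test, rule Cc1_primitive[OF \<theta>, of "min c1 c2" "max d1 d2"])
      show "integral {a..b} \<theta> = 0"
        unfolding \<theta>_def using \<psi>1
        by (subst Henstock_Kurzweil_Integration.integral_diff)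
           (auto intro!: integrable_continuous_real continuous_intros kc simp: K_def)
      show "\<theta> x = 0" if "x \<notin> {min c1 c2..max d1 d2}" for x
        proof -
        have "x \<notin> {c1..d1}" "x \<notin> {c2..d2}" using that by auto
        then show ?thesis using cd1(4) cd2(4) by (simp add: \<theta>_def)
      qed
    qed (use cd1 cd2 in auto)
    also have "deriv (\<lambda>x. integral {a..x} \<theta>) = \<theta>"
    proof (rule Cc1_primitive[OF \<theta>, of "min c1 c2" "max d1 d2"])
      show "integral {a..b} \<theta> = 0"
        unfolding \<theta>_def using \<psi>1
        by (subst Henstock_Kurzweil_Integration.integral_diff)
           (auto intro!: integrable_continuous_real continuous_intros kc simp: K_def)
      show "\<theta> x = 0" if "x \<notin> {min c1 c2..max d1 d2}" for x
        proof -
        have "x \<notin> {c1..d1}" "x \<notin> {c2..d2}" using that by auto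
        then show ?thesis using cd1(4) cd2(4) by (simp add: \<theta>_def)
      qed
    qed (use cd1 cd2 in auto)
    also have "(\<integral>x. u x * \<theta> x \<partial>?M) = (\<integral>x. u x * k x \<partial>?M) - K * C"
      using ucont[OF kc(1)] ucont[OF kc(2)] unfolding \<theta>_def C_def by (simp add: right_diff_distrib mult.left_commute)
    finally have "(\<integral>x. u x * k x \<partial>?M) = K * C" by simp
    moreover have "(\<integral>x. k x \<partial>?M) = K" "integrable ?M k"
      using continuous_integral_interval[OF kc(1)] by (auto simp: K_def)
    moreover have "(\<integral>x. (u x - C) * k x \<partial>?M) = (\<integral>x. u x * k x \<partial>?M) - C * (\<integral>x. k x \<partial>?M)"
      using ucont[OF kc(1)] \<open>integrable ?M k\<close> by (simp add: left_diff_distrib)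
    ultimately show "(\<integral>x. (u x - C) * k x \<partial>?M) = 0" by simp
  qed
  then have "AE x in ?M. u x = C" by (rule lebesgue_on_mono) simp
  then show ?thesis using that by blast
qed

section \<open>Primitives of square integrable functions and continuous representatives\<close>

lemma L2_continuous_on_closed:
  fixes f :: "real \<Rightarrow> real"
  assumes "continuous_on {a..b} f" shows "f \<in> L2 {a<..<b}"
proof -
  obtain B where "\<And>x. x \<in> {a..b} \<Longrightarrow> \<bar>f x\<bar> \<le> B" using continuous_Icc_bounded[OF assms] by blast
  then show ?thesis
    using borel_measurable_integrable[OF continuous_integral_interval(2)[OF assms]]
    by (intro L2_bounded(1)[of _ _ B]) (auto intro!: AE_I2)
qed

text \<open>By Cauchy-Schwarz the primitives of continuous L2 approximations of \<open>g\<close>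
  converge uniformly to that of \<open>g\<close>. Continuity and integration by parts, both
  classical for the approximations, pass to the limit.\<close>

lemma L2_primitive:
  assumes g: "g \<in> L2 {a<..<b}"
  obtains v where "continuous_on {a..b} v" "has_weak_deriv a b v g"
proof (cases "a < b")
  case False
  then have "continuous_on {a..b} (\<lambda>_. 0::real)" "has_weak_deriv a b (\<lambda>_. 0) g"
    by (simp_all add: has_weak_deriv_def)
  then show ?thesis using that by blast
next
  case ab: True
  let ?M = "lebesgue_on {a<..<b}"
  have meas: "measure lebesgue {a<..<b} = b - a" using ab by simp
  have "\<exists>h. continuous_on UNIV h \<and> h \<in> L2 {a<..<b} \<and> L2_norm {a<..<b} (\<lambda>x. g x - h x) < inverse (real (Suc n))" for n
  proof -
    obtain h B where h: "continuous_on UNIV h" "\<And>x. \<bar>h x\<bar> \<le> B"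
      "L2_norm {a<..<b} (\<lambda>x. g x - h x) < inverse (real (Suc n))"
      using L2_continuous_dense[OF lmeasurable_open_interval g, of "inverse (real (Suc n))"] by auto
    have "h \<in> L2 {a<..<b}"
      by (rule L2_bounded(1)[OF _ continuous_imp_lebesgue_on_measurable[OF h(1)], of _ B]) (use h(2) in auto)
    then show ?thesis using h by blast
  qed
  then obtain h where h: "\<And>n. continuous_on UNIV (h n)" "\<And>n. h n \<in> L2 {a<..<b}"
    "\<And>n. L2_norm {a<..<b} (\<lambda>x. g x - h n x) < inverse (real (Suc n))" by metis
  have hc: "continuous_on S (h n)" for S n using h(1) continuous_on_subset by blast
  have h_lim: "(\<lambda>n. L2_norm {a<..<b} (\<lambda>x. g x - h n x)) \<longlonglongrightarrow> 0"
    by (rule Lim_null_comparison[OF _ LIMSEQ_inverse_real_of_nat])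
      (use h(3) in \<open>simp add: less_imp_le\<close>)
  define v where "v x = (\<integral>y. g y \<partial>lebesgue_on {a<..<x})" for x
  define w where "w n x = integral {a..x} (h n)" for n x
  have sub: "f \<in> L2 {a<..<x}" "L2_norm {a<..<x} f \<le> L2_norm {a<..<b} f"
    if "f \<in> L2 {a<..<b}" "x \<in> {a..b}" for f :: "real \<Rightarrow> real" and x
    using that(2) by (intro L2_mono[OF that(1)]; force)+
  have close: "\<bar>v x - w n x\<bar> \<le> L2_norm {a<..<b} (\<lambda>x. g x - h n x) * sqrt (b - a)" if x: "x \<in> {a..b}" for n x
  proof -
    have "w n x = (\<integral>y. h n y \<partial>lebesgue_on {a<..<x})"
      using continuous_integral_interval(4)[OF hc] by (simp add: w_def)
    then have "v x - w n x = (\<integral>y. g y - h n y \<partial>lebesgue_on {a<..<x})"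
      using L2_imp_integrable[OF _ sub(1)[OF g x]] L2_imp_integrable[OF _ sub(1)[OF h(2) x]]
      by (simp add: v_def)
    also have "\<bar>\<dots>\<bar> \<le> L2_norm {a<..<x} (\<lambda>x. g x - h n x) * sqrt (measure lebesgue {a<..<x})"
      using L2_integral_bound[OF _ sub(1)[OF L2_diff[OF g h(2)] x]] by simp
    also have "\<dots> \<le> L2_norm {a<..<b} (\<lambda>x. g x - h n x) * sqrt (b - a)"
      using sub(2)[OF L2_diff[OF g h(2)] x] x by (intro mult_mono real_sqrt_le_mono) auto
    finally show ?thesis .
  qed
  have close0: "(\<lambda>n. L2_norm {a<..<b} (\<lambda>x. g x - h n x) * sqrt (b - a)) \<longlonglongrightarrow> 0"
    using tendsto_mult_right[OF h_lim, of "sqrt (b - a)"] by simp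
  have w: "(w n has_real_derivative h n x) (at x within {a..b})" if "x \<in> {a..b}" for n x
    unfolding w_def by (rule integral_has_real_derivative[OF hc that])
  have wc: "continuous_on {a..b} (w n)" for n by (rule DERIV_continuous_on[OF w])
  have "uniform_limit {a..b} w v sequentially"
  proof (rule uniform_limitI)
    fix e :: real assume "e > 0"
    then have "\<forall>\<^sub>F n in sequentially. L2_norm {a<..<b} (\<lambda>x. g x - h n x) * sqrt (b - a) < e"
      by (rule order_tendstoD(2)[OF close0])
    then show "\<forall>\<^sub>F n in sequentially. \<forall>x\<in>{a..b}. dist (w n x) (v x) < e"
    proof eventually_elim
      case (elim n)
      then show ?case using close[of _ n] by (force simp: dist_real_def abs_minus_commute)
    qed
  qed
  then have vc: "continuous_on {a..b} v"
    by (rule uniform_limit_theorem[rotated]) (use wc in auto)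
  have vL2: "v \<in> L2 {a<..<b}" by (rule L2_continuous_on_closed[OF vc])
  have "(\<integral>x. v x * deriv \<eta> x \<partial>?M) = - (\<integral>x. g x * \<eta> x \<partial>?M)" if \<eta>: "\<eta> \<in> Cc1 a b" for \<eta>
  proof -
    have L2\<eta>: "\<eta> \<in> L2 {a<..<b}" "deriv \<eta> \<in> L2 {a<..<b}"
      using Cc1_D(2,3)[OF \<eta>] by (auto intro!: L2_continuous_on_closed intro: continuous_on_subset)
    have wL2: "w n \<in> L2 {a<..<b}" for n by (rule L2_continuous_on_closed[OF wc])
    define c where "c n = L2_norm {a<..<b} (\<lambda>x. g x - h n x) * sqrt (b - a)" for n
    have c: "c \<longlonglongrightarrow> 0" using close0 by (simp add: c_def[abs_def])
    have "\<bar>(\<integral>x. v x * deriv \<eta> x \<partial>?M) + (\<integral>x. g x * \<eta> x \<partial>?M)\<bar>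
        \<le> (c n * sqrt (b - a)) * L2_norm {a<..<b} (deriv \<eta>) + L2_norm {a<..<b} (\<lambda>x. g x - h n x) * L2_norm {a<..<b} \<eta>" for n
    proof -
      have "has_weak_deriv a b (w n) (h n)" by (rule has_weak_deriv_C1[OF w hc])
      then have eq: "(\<integral>x. w n x * deriv \<eta> x \<partial>?M) = - (\<integral>x. h n x * \<eta> x \<partial>?M)"
        using \<eta> by (auto simp: has_weak_deriv_def)
      have "(\<integral>x. (v x - w n x) * deriv \<eta> x \<partial>?M) = (\<integral>x. v x * deriv \<eta> x \<partial>?M) - (\<integral>x. w n x * deriv \<eta> x \<partial>?M)"
        using L2_mult_integrable[OF vL2 L2\<eta>(2)] L2_mult_integrable[OF wL2[of n] L2\<eta>(2)]
        by (simp add: left_diff_distrib)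
      moreover have "(\<integral>x. (g x - h n x) * \<eta> x \<partial>?M) = (\<integral>x. g x * \<eta> x \<partial>?M) - (\<integral>x. h n x * \<eta> x \<partial>?M)"
        using L2_mult_integrable[OF g L2\<eta>(1)] L2_mult_integrable[OF h(2)[of n] L2\<eta>(1)]
        by (simp add: left_diff_distrib)
      moreover have "AE x in ?M. \<bar>v x - w n x\<bar> \<le> c n" using close by (intro AE_I2) (auto simp: c_def)
      then have "L2_norm {a<..<b} (\<lambda>x. v x - w n x) \<le> \<bar>c n\<bar> * sqrt (b - a)"
        using L2_bounded(2)[OF _ L2_D(1)[OF L2_diff[OF vL2 wL2[of n]]], of "c n"] meas by simp
      then have "L2_norm {a<..<b} (\<lambda>x. v x - w n x) \<le> c n * sqrt (b - a)"
        using ab by (simp add: c_def)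
      then have "\<bar>\<integral>x. (v x - w n x) * deriv \<eta> x \<partial>?M\<bar> \<le> (c n * sqrt (b - a)) * L2_norm {a<..<b} (deriv \<eta>)"
        using L2_Cauchy_Schwarz[OF L2_diff[OF vL2 wL2[of n]] L2\<eta>(2)]
        by (meson L2_norm_ge0 mult_right_mono order_trans)
      moreover have "\<bar>\<integral>x. (g x - h n x) * \<eta> x \<partial>?M\<bar> \<le> L2_norm {a<..<b} (\<lambda>x. g x - h n x) * L2_norm {a<..<b} \<eta>"
        using L2_Cauchy_Schwarz[OF L2_diff[OF g h(2)[of n]] L2\<eta>(1)] .
      ultimately show ?thesis using eq by linarith
    qed
    moreover have "(\<lambda>n. (c n * sqrt (b - a)) * L2_norm {a<..<b} (deriv \<eta>) + L2_norm {a<..<b} (\<lambda>x. g x - h n x) * L2_norm {a<..<b} \<eta>)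
       \<longlonglongrightarrow> (0 * sqrt (b - a)) * L2_norm {a<..<b} (deriv \<eta>) + 0 * L2_norm {a<..<b} \<eta>"
      by (intro tendsto_intros c h_lim)
    ultimately have "\<bar>(\<integral>x. v x * deriv \<eta> x \<partial>?M) + (\<integral>x. g x * \<eta> x \<partial>?M)\<bar> \<le> 0"
      by (intro LIMSEQ_le_const) auto
    then show ?thesis by simp
  qed
  then have "has_weak_deriv a b v g"
    using L2_imp_integrable[OF _ vL2] L2_imp_integrable[OF _ g] by (simp add: has_weak_deriv_def)
  then show ?thesis using that vc by blast
qed

lemma Linf_imp_L2:
  fixes g :: "real \<Rightarrow> real"
  assumes "g \<in> Linf {a<..<b}" shows "g \<in> L2 {a<..<b}"
proof -
  have gm: "g \<in> borel_measurable (lebesgue_on {a<..<b})" and fin: "Linf_norm {a<..<b} g < \<infinity>"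
    using assms by (auto simp: Linf_def)
  obtain B where B: "Linf_norm {a<..<b} g \<le> ereal B"
    using fin by (cases "Linf_norm {a<..<b} g") (auto intro: order_refl)
  have "AE x in lebesgue_on {a<..<b}. ereal \<bar>g x\<bar> \<le> Linf_norm {a<..<b} g"
    unfolding Linf_norm_def by (rule esssup_AE)
  then have "AE x in lebesgue_on {a<..<b}. \<bar>g x\<bar> \<le> B"
  proof eventually_elim
    case (elim x)
    then have "ereal \<bar>g x\<bar> \<le> ereal B" using B by (rule order_trans)
    then show ?case by simp
  qed
  then show ?thesis by (rule L2_bounded(1)[OF lmeasurable_open_interval gm])
qed

text \<open>The weak derivative is essentially bounded and so has a continuous primitive. The
  difference of \<open>u\<close> and this primitive has weak derivative zero and is constant by du
  Bois-Reymond.\<close>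

lemma W1inf_continuous_representative:
  assumes "u \<in> W1inf a b"
  obtains v where "continuous_on {a..b} v" "AE x in lebesgue_on {a<..<b}. u x = v x"
proof -
  obtain g where g: "g \<in> Linf {a<..<b}" "has_weak_deriv a b u g" using assms by (auto simp: W1inf_def)
  obtain v where v: "continuous_on {a..b} v" "has_weak_deriv a b v g"
    using L2_primitive[OF Linf_imp_L2[OF g(1)]] by blast
  have wd: "has_weak_deriv a b (\<lambda>x. 1 * u x + (-1) * v x) (\<lambda>x. 1 * g x + (-1) * g x)"
    by (rule has_weak_deriv_lin[OF g(2) v(2)])
  obtain c where c: "AE x in lebesgue_on {a<..<b}. 1 * u x + (-1) * v x = c"
    using du_Bois_Reymond[OF has_weak_deriv_D(1)[OF wd]] has_weak_deriv_D(3)[OF wd] by auto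
  show ?thesis
  proof
    show "continuous_on {a..b} (\<lambda>x. v x + c)" by (intro continuous_intros v)
    show "AE x in lebesgue_on {a<..<b}. u x = v x + c" using c by eventually_elim auto
  qed
qed

section \<open>The space of functions vanishing at the end points\<close>

lemma lmeasurable_\<Omega> [simp]: "\<Omega> \<in> lmeasurable"
  by simp

lemma Cc1_L2:
  assumes "\<eta> \<in> Cc1 a b" shows "\<eta> \<in> L2 {a<..<b}" "deriv \<eta> \<in> L2 {a<..<b}"
  using Cc1_D(2,3)[OF assms] by (auto intro!: L2_continuous_on_closed intro: continuous_on_subset)

lemma H1_weak_deriv:
  assumes "u \<in> H1"
  shows "u \<in> L2 \<Omega>" "weak_deriv 0 1 u \<in> L2 \<Omega>" "has_weak_deriv 0 1 u (weak_deriv 0 1 u)"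
proof -
  obtain g where g: "u \<in> L2 \<Omega>" "g \<in> L2 \<Omega>" "has_weak_deriv 0 1 u g"
    using assms by (auto simp: H1_def)
  show "u \<in> L2 \<Omega>" by fact
  show "has_weak_deriv 0 1 u (weak_deriv 0 1 u)" by (rule weak_deriv_has[OF g(3)])
  have "AE x in lebesgue_on \<Omega>. g x = weak_deriv 0 1 u x"
    using weak_deriv_AE[OF g(3)] by eventually_elim simp
  then show "weak_deriv 0 1 u \<in> L2 \<Omega>"
    using L2_cong_AE[OF g(2) weak_deriv_measurable[OF g(3)]] by blast
qed

text \<open>\<open>weak_deriv\<close> is a Hilbert choice and therefore linear only almost
  everywhere; norms and integrals containing it are rewritten under an almost everywhere
  equality.\<close>

lemma H1_lin:
  assumes "u \<in> H1" "v \<in> H1"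
  shows "(\<lambda>x. s * u x + t * v x) \<in> H1"
    "AE x in lebesgue_on \<Omega>. weak_deriv 0 1 (\<lambda>x. s * u x + t * v x) x = s * weak_deriv 0 1 u x + t * weak_deriv 0 1 v x"
proof -
  note wd = has_weak_deriv_lin[OF H1_weak_deriv(3)[OF assms(1)] H1_weak_deriv(3)[OF assms(2)], of s t]
  show "AE x in lebesgue_on \<Omega>. weak_deriv 0 1 (\<lambda>x. s * u x + t * v x) x = s * weak_deriv 0 1 u x + t * weak_deriv 0 1 v x"
    by (rule weak_deriv_AE[OF wd])
  show "(\<lambda>x. s * u x + t * v x) \<in> H1"
    using wd L2_lin H1_weak_deriv assms unfolding H1_def by blast
qed

lemma L2_norm_weak_deriv_lin:
  assumes "u \<in> H1" "v \<in> H1"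
  shows "L2_norm \<Omega> (weak_deriv 0 1 (\<lambda>x. s * u x + t * v x))
    = L2_norm \<Omega> (\<lambda>x. s * weak_deriv 0 1 u x + t * weak_deriv 0 1 v x)"
  by (rule L2_norm_cong_AE[OF L2_D(1)[OF H1_weak_deriv(2)[OF H1_lin(1)[OF assms]]] L2_D(1) H1_lin(2)[OF assms]])
    (intro L2_lin H1_weak_deriv(2) assms)

lemma H1_norm_bounds:
  "L2_norm \<Omega> u \<le> H1_norm u" "L2_norm \<Omega> (weak_deriv 0 1 u) \<le> H1_norm u"
  "H1_norm u \<le> L2_norm \<Omega> u + L2_norm \<Omega> (weak_deriv 0 1 u)" "0 \<le> H1_norm u"
  unfolding H1_norm_def by (auto simp: real_le_rsqrt sqrt_sum_squares_le_sum)

lemma H1_Cc1: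
  assumes "\<eta> \<in> Cc1 0 1"
  shows "\<eta> \<in> H1" "AE x in lebesgue_on \<Omega>. weak_deriv 0 1 \<eta> x = deriv \<eta> x"
    "L2_norm \<Omega> (weak_deriv 0 1 \<eta>) = L2_norm \<Omega> (deriv \<eta>)"
proof -
  note wd = has_weak_deriv_Cc1[OF assms] and L2 = Cc1_L2[OF assms]
  show "\<eta> \<in> H1" using wd L2 unfolding H1_def by blast
  show ae: "AE x in lebesgue_on \<Omega>. weak_deriv 0 1 \<eta> x = deriv \<eta> x" by (rule weak_deriv_AE[OF wd])
  show "L2_norm \<Omega> (weak_deriv 0 1 \<eta>) = L2_norm \<Omega> (deriv \<eta>)"
    by (rule L2_norm_cong_AE[OF weak_deriv_measurable[OF wd] L2_D(1)[OF L2(2)] ae])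
qed

lemma L2_norm_weak_deriv_diff_Cc1:
  assumes u: "u \<in> H1" and \<eta>: "\<eta> \<in> Cc1 0 1"
  shows "L2_norm \<Omega> (weak_deriv 0 1 (\<lambda>x. u x - \<eta> x)) = L2_norm \<Omega> (\<lambda>x. weak_deriv 0 1 u x - deriv \<eta> x)"
proof -
  have "L2_norm \<Omega> (weak_deriv 0 1 (\<lambda>x. u x - \<eta> x)) = L2_norm \<Omega> (\<lambda>x. 1 * weak_deriv 0 1 u x + (-1) * weak_deriv 0 1 \<eta> x)"
    using L2_norm_weak_deriv_lin[OF u H1_Cc1(1)[OF \<eta>], of 1 "-1"] by simp
  also have "\<dots> = L2_norm \<Omega> (\<lambda>x. weak_deriv 0 1 u x - deriv \<eta> x)"
  proof (rule L2_norm_cong_AE)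
    show "AE x in lebesgue_on \<Omega>. 1 * weak_deriv 0 1 u x + - 1 * weak_deriv 0 1 \<eta> x = weak_deriv 0 1 u x - deriv \<eta> x"
      using H1_Cc1(2)[OF \<eta>] by eventually_elim simp
    show "(\<lambda>x. 1 * weak_deriv 0 1 u x + - 1 * weak_deriv 0 1 \<eta> x) \<in> borel_measurable (lebesgue_on \<Omega>)"
      by (intro L2_D(1) L2_lin H1_weak_deriv(2) u H1_Cc1(1) \<eta>)
    show "(\<lambda>x. weak_deriv 0 1 u x - deriv \<eta> x) \<in> borel_measurable (lebesgue_on \<Omega>)"
      by (intro L2_D(1) L2_diff H1_weak_deriv(2) u Cc1_L2(2) \<eta>)
  qed
  finally show ?thesis .
qed

text \<open>The H1 norm contains the chosen weak derivative of a difference. Here it is split into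
  two L2 limits in which the test functions enter with their classical derivatives, the form in
  which approximation is used later.\<close>

lemma H10_iff:
  "u \<in> H10 \<longleftrightarrow> u \<in> H1 \<and> (\<exists>\<eta>. (\<forall>n::nat. \<eta> n \<in> Cc1 0 1) \<and> (\<lambda>n. L2_norm \<Omega> (\<lambda>x. u x - \<eta> n x)) \<longlonglongrightarrow> 0 \<and>
      (\<lambda>n. L2_norm \<Omega> (\<lambda>x. weak_deriv 0 1 u x - deriv (\<eta> n) x)) \<longlonglongrightarrow> 0)"
proof -
  have "(\<lambda>n. H1_norm (\<lambda>x. u x - \<eta> n x)) \<longlonglongrightarrow> 0 \<longleftrightarrow>
      (\<lambda>n. L2_norm \<Omega> (\<lambda>x. u x - \<eta> n x)) \<longlonglongrightarrow> 0 \<and>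
      (\<lambda>n. L2_norm \<Omega> (\<lambda>x. weak_deriv 0 1 u x - deriv (\<eta> n) x)) \<longlonglongrightarrow> 0" (is "?A \<longleftrightarrow> ?B \<and> ?C")
    if u: "u \<in> H1" and \<eta>: "\<And>n. \<eta> n \<in> Cc1 0 1" for \<eta> :: "nat \<Rightarrow> real \<Rightarrow> real"
  proof -
    note b = H1_norm_bounds[of "\<lambda>x. u x - \<eta> _ x", unfolded L2_norm_weak_deriv_diff_Cc1[OF u \<eta>]]
    have B: ?B if ?A by (rule Lim_null_comparison[OF _ that]) (use b in auto)
    have C: ?C if ?A by (rule Lim_null_comparison[OF _ that]) (use b in auto)
    have A: ?A if ?B ?C
      by (rule Lim_null_comparison[OF _ tendsto_add_zero[OF that]]) (use b in auto)
    show ?thesis using A B C by blast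
  qed
  then show ?thesis unfolding H10_def by blast
qed

lemma H10_D:
  assumes "u \<in> H10"
  shows "u \<in> H1" "u \<in> L2 \<Omega>" "weak_deriv 0 1 u \<in> L2 \<Omega>" "has_weak_deriv 0 1 u (weak_deriv 0 1 u)"
  using assms H10_iff H1_weak_deriv by blast+

lemma H10_approx:
  assumes "u \<in> H10"
  obtains \<eta> :: "nat \<Rightarrow> real \<Rightarrow> real" where "\<And>n. \<eta> n \<in> Cc1 0 1" "(\<lambda>n. L2_norm \<Omega> (\<lambda>x. u x - \<eta> n x)) \<longlonglongrightarrow> 0"
     "(\<lambda>n. L2_norm \<Omega> (\<lambda>x. weak_deriv 0 1 u x - deriv (\<eta> n) x)) \<longlonglongrightarrow> 0"
  using assms H10_iff by blast

lemma H10_lin: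
  assumes u: "u \<in> H10" and v: "v \<in> H10"
  shows "(\<lambda>x. s * u x + t * v x) \<in> H10"
proof -
  obtain \<eta> where \<eta>: "\<And>n::nat. \<eta> n \<in> Cc1 0 1" "(\<lambda>n. L2_norm \<Omega> (\<lambda>x. u x - \<eta> n x)) \<longlonglongrightarrow> 0"
     "(\<lambda>n. L2_norm \<Omega> (\<lambda>x. weak_deriv 0 1 u x - deriv (\<eta> n) x)) \<longlonglongrightarrow> 0"
    using H10_approx[OF u] by blast
  obtain \<theta> where \<theta>: "\<And>n::nat. \<theta> n \<in> Cc1 0 1" "(\<lambda>n. L2_norm \<Omega> (\<lambda>x. v x - \<theta> n x)) \<longlonglongrightarrow> 0"
     "(\<lambda>n. L2_norm \<Omega> (\<lambda>x. weak_deriv 0 1 v x - deriv (\<theta> n) x)) \<longlonglongrightarrow> 0"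
    using H10_approx[OF v] by blast
  define \<zeta> where "\<zeta> n x = s * \<eta> n x + t * \<theta> n x" for n x
  have \<zeta>: "\<zeta> n \<in> Cc1 0 1" "deriv (\<zeta> n) = (\<lambda>x. s * deriv (\<eta> n) x + t * deriv (\<theta> n) x)" for n
    unfolding \<zeta>_def using Cc1_lin[OF \<eta>(1) \<theta>(1)] by auto
  have lim0: "(\<lambda>n. \<bar>s\<bar> * a n + \<bar>t\<bar> * b n) \<longlonglongrightarrow> 0" if "a \<longlonglongrightarrow> 0" "b \<longlonglongrightarrow> 0" for a b :: "nat \<Rightarrow> real"
  proof -
    have "(\<lambda>n. \<bar>s\<bar> * a n + \<bar>t\<bar> * b n) \<longlonglongrightarrow> \<bar>s\<bar> * 0 + \<bar>t\<bar> * 0" by (intro tendsto_intros that)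
    then show ?thesis by simp
  qed
  have 1: "(\<lambda>n. L2_norm \<Omega> (\<lambda>x. (s * u x + t * v x) - \<zeta> n x)) \<longlonglongrightarrow> 0"
  proof (rule Lim_null_comparison[OF _ lim0[OF \<eta>(2) \<theta>(2)]], intro always_eventually allI)
    fix n
    have "(\<lambda>x. (s * u x + t * v x) - \<zeta> n x) = (\<lambda>x. s * (u x - \<eta> n x) + t * (v x - \<theta> n x))"
      by (auto simp: \<zeta>_def algebra_simps)
    then show "norm (L2_norm \<Omega> (\<lambda>x. (s * u x + t * v x) - \<zeta> n x))
      \<le> \<bar>s\<bar> * L2_norm \<Omega> (\<lambda>x. u x - \<eta> n x) + \<bar>t\<bar> * L2_norm \<Omega> (\<lambda>x. v x - \<theta> n x)"
      using L2_norm_lin[OF L2_diff[OF H10_D(2)[OF u] Cc1_L2(1)[OF \<eta>(1)[of n]]]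
          L2_diff[OF H10_D(2)[OF v] Cc1_L2(1)[OF \<theta>(1)[of n]]], of s t] by simp
  qed
  have 2: "(\<lambda>n. L2_norm \<Omega> (\<lambda>x. weak_deriv 0 1 (\<lambda>x. s * u x + t * v x) x - deriv (\<zeta> n) x)) \<longlonglongrightarrow> 0"
  proof (rule Lim_null_comparison[OF _ lim0[OF \<eta>(3) \<theta>(3)]], intro always_eventually allI)
    fix n
    let ?w = "weak_deriv 0 1"
    have "L2_norm \<Omega> (\<lambda>x. ?w (\<lambda>x. s * u x + t * v x) x - deriv (\<zeta> n) x)
      = L2_norm \<Omega> (\<lambda>x. s * (?w u x - deriv (\<eta> n) x) + t * (?w v x - deriv (\<theta> n) x))"
    proof (rule L2_norm_cong_AE)
      show "(\<lambda>x. ?w (\<lambda>x. s * u x + t * v x) x - deriv (\<zeta> n) x) \<in> borel_measurable (lebesgue_on \<Omega>)"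
        by (intro L2_D(1) L2_diff H1_weak_deriv(2) H1_lin(1) H10_D(1) u v Cc1_L2(2) \<zeta>(1))
      show "(\<lambda>x. s * (?w u x - deriv (\<eta> n) x) + t * (?w v x - deriv (\<theta> n) x)) \<in> borel_measurable (lebesgue_on \<Omega>)"
        by (intro L2_D(1) L2_lin L2_diff H10_D(3) u v Cc1_L2(2) \<eta>(1) \<theta>(1))
      show "AE x in lebesgue_on \<Omega>. ?w (\<lambda>x. s * u x + t * v x) x - deriv (\<zeta> n) x
          = s * (?w u x - deriv (\<eta> n) x) + t * (?w v x - deriv (\<theta> n) x)"
        using H1_lin(2)[OF H10_D(1)[OF u] H10_D(1)[OF v], of s t]
        by eventually_elim (simp add: \<zeta>(2) algebra_simps)
    qed
    then show "norm (L2_norm \<Omega> (\<lambda>x. ?w (\<lambda>x. s * u x + t * v x) x - deriv (\<zeta> n) x))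
      \<le> \<bar>s\<bar> * L2_norm \<Omega> (\<lambda>x. ?w u x - deriv (\<eta> n) x) + \<bar>t\<bar> * L2_norm \<Omega> (\<lambda>x. ?w v x - deriv (\<theta> n) x)"
      using L2_norm_lin[OF L2_diff[OF H10_D(3)[OF u] Cc1_L2(2)[OF \<eta>(1)[of n]]]
          L2_diff[OF H10_D(3)[OF v] Cc1_L2(2)[OF \<theta>(1)[of n]]], of s t] by simp
  qed
  show ?thesis
    unfolding H10_iff using H1_lin(1)[OF H10_D(1)[OF u] H10_D(1)[OF v]] \<zeta>(1) 1 2 by blast
qed

lemma H10_Cc1: "\<eta> \<in> Cc1 0 1 \<Longrightarrow> \<eta> \<in> H10"
proof -
  assume \<eta>: "\<eta> \<in> Cc1 0 1"
  have "L2_norm \<Omega> (\<lambda>x. weak_deriv 0 1 \<eta> x - deriv \<eta> x) = L2_norm \<Omega> (\<lambda>x. 0)"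
    using H1_Cc1(2)[OF \<eta>]
    by (intro L2_norm_cong_AE L2_D(1) L2_diff H1_weak_deriv(2) H1_Cc1(1) Cc1_L2(2) \<eta> L2_const lmeasurable_\<Omega>) auto
  then show ?thesis
    unfolding H10_iff using H1_Cc1(1)[OF \<eta>] \<eta>
    by (intro conjI exI[of _ "\<lambda>_. \<eta>"]) (auto simp: L2_norm_def)
qed

text \<open>The derivative of a test function integrates to zero, and the mean is continuous in L2.
  This makes the linear part of the cost functional blind to additive constants in the profile
  F.\<close>

lemma H10_mean_weak_deriv:
  assumes "u \<in> H10" shows "(\<integral>x. weak_deriv 0 1 u x \<partial>lebesgue_on \<Omega>) = 0"
proof -
  obtain \<eta> where \<eta>: "\<And>n::nat. \<eta> n \<in> Cc1 0 1"
     "(\<lambda>n. L2_norm \<Omega> (\<lambda>x. weak_deriv 0 1 u x - deriv (\<eta> n) x)) \<longlonglongrightarrow> 0"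
    using H10_approx[OF assms] by blast
  have "\<bar>\<integral>x. weak_deriv 0 1 u x \<partial>lebesgue_on \<Omega>\<bar> \<le> L2_norm \<Omega> (\<lambda>x. weak_deriv 0 1 u x - deriv (\<eta> n) x)" for n
  proof -
    have "(\<integral>x. deriv (\<eta> n) x \<partial>lebesgue_on \<Omega>) = \<eta> n 1"
      using continuous_integral_interval(4)[of 0 1 "deriv (\<eta> n)"] Cc1_integral_deriv[OF \<eta>(1)[of n], of 1]
        continuous_on_subset[OF Cc1_D(2)[OF \<eta>(1)[of n]]] by auto
    also have "\<dots> = 0" using Cc1_outside[OF \<eta>(1)] by auto
    finally have "(\<integral>x. weak_deriv 0 1 u x \<partial>lebesgue_on \<Omega>) = (\<integral>x. weak_deriv 0 1 u x - deriv (\<eta> n) x \<partial>lebesgue_on \<Omega>)"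
      using L2_imp_integrable[OF _ H10_D(3)[OF assms]] L2_imp_integrable[OF _ Cc1_L2(2)[OF \<eta>(1)[of n]]]
      by simp
    then show ?thesis
      using L2_integral_bound[OF _ L2_diff[OF H10_D(3)[OF assms] Cc1_L2(2)[OF \<eta>(1)[of n]]]] by simp
  qed
  then have "\<bar>\<integral>x. weak_deriv 0 1 u x \<partial>lebesgue_on \<Omega>\<bar> \<le> 0"
    by (intro LIMSEQ_le_const[OF \<eta>(2)]) auto
  then show ?thesis by simp
qed

lemma L2_tendsto_integral:
  assumes "\<And>n. f n \<in> L2 S" "h \<in> L2 S" "g \<in> L2 S" and lim: "(\<lambda>n. L2_norm S (\<lambda>x. f n x - h x)) \<longlonglongrightarrow> 0"
  shows "(\<lambda>n. \<integral>x. f n x * g x \<partial>lebesgue_on S) \<longlonglongrightarrow> (\<integral>x. h x * g x \<partial>lebesgue_on S)"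
proof -
  have "(\<lambda>n. (\<integral>x. f n x * g x \<partial>lebesgue_on S) - (\<integral>x. h x * g x \<partial>lebesgue_on S)) \<longlonglongrightarrow> 0"
  proof (rule Lim_null_comparison)
    show "(\<lambda>n. L2_norm S (\<lambda>x. f n x - h x) * L2_norm S g) \<longlonglongrightarrow> 0"
      using tendsto_mult_right[OF lim, of "L2_norm S g"] by simp
    show "\<forall>\<^sub>F n in sequentially. norm ((\<integral>x. f n x * g x \<partial>lebesgue_on S) - (\<integral>x. h x * g x \<partial>lebesgue_on S))
        \<le> L2_norm S (\<lambda>x. f n x - h x) * L2_norm S g"
    proof (intro always_eventually allI)
      fix n
      have "(\<integral>x. f n x * g x \<partial>lebesgue_on S) - (\<integral>x. h x * g x \<partial>lebesgue_on S) = (\<integral>x. (f n x - h x) * g x \<partial>lebesgue_on S)"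
        using L2_mult_integrable[OF assms(1)[of n] assms(3)] L2_mult_integrable[OF assms(2,3)]
        by (simp add: left_diff_distrib)
      then show "norm ((\<integral>x. f n x * g x \<partial>lebesgue_on S) - (\<integral>x. h x * g x \<partial>lebesgue_on S))
        \<le> L2_norm S (\<lambda>x. f n x - h x) * L2_norm S g"
        using L2_Cauchy_Schwarz[OF L2_diff[OF assms(1)[of n] assms(2)] assms(3)] by simp
    qed
  qed
  then show ?thesis by (simp add: LIM_zero_iff)
qed

text \<open>Cauchy-Schwarz on (0, x), whose length is at most one; hence the constant 1.\<close>

lemma primitive_bound:
  assumes f: "continuous_on {0..1} f" and x: "x \<in> {0..1}"
  shows "\<bar>integral {0..x} f\<bar> \<le> L2_norm \<Omega> f"
proof -
  have f': "continuous_on {0..x} f" using f x by (auto intro: continuous_on_subset)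
  have "integral {0..x} f = (\<integral>y. f y \<partial>lebesgue_on {0<..<x})"
    using continuous_integral_interval(4)[OF f'] by simp
  also have "\<bar>\<dots>\<bar> \<le> L2_norm {0<..<x} f * sqrt (measure lebesgue {0<..<x})"
    by (intro L2_integral_bound L2_continuous_on_closed f') simp
  also have "{0<..<x} \<subseteq> \<Omega>" using x by auto
  then have "L2_norm {0<..<x} f * sqrt (measure lebesgue {0<..<x}) \<le> L2_norm \<Omega> f * 1"
    using x L2_mono(2)[OF L2_continuous_on_closed[OF f], of "{0<..<x}"]
    by (intro mult_mono) auto
  finally show ?thesis by simp
qed

lemma primitive_L2_bound:
  assumes f: "continuous_on {0..1} f" and v: "\<And>x. x \<in> \<Omega> \<Longrightarrow> v x = integral {0..x} f"
    and vm: "v \<in> borel_measurable (lebesgue_on \<Omega>)"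
  shows "L2_norm \<Omega> v \<le> L2_norm \<Omega> f"
proof -
  have "AE x in lebesgue_on \<Omega>. \<bar>v x\<bar> \<le> L2_norm \<Omega> f"
    using primitive_bound[OF f] v by (intro AE_I2) auto
  from L2_bounded(2)[OF lmeasurable_\<Omega> vm this] show ?thesis by simp
qed

text \<open>The derivative is cut off near the end points and a multiple of a bump restores mean zero, so
  that the primitive has compact support.\<close>

lemma H10_C1:
  assumes w: "\<And>x. x \<in> {0..1} \<Longrightarrow> (w has_real_derivative w' x) (at x within {0..1})"
    and w'c: "continuous_on {0..1} w'" and w0: "w 0 = 0" "w 1 = 0"
  shows "w \<in> H10" "AE x in lebesgue_on \<Omega>. weak_deriv 0 1 w x = w' x"
proof -
  have wd: "has_weak_deriv 0 1 w w'" by (rule has_weak_deriv_C1[OF w w'c])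
  show ae: "AE x in lebesgue_on \<Omega>. weak_deriv 0 1 w x = w' x" by (rule weak_deriv_AE[OF wd])
  have wc: "continuous_on {0..1} w" by (rule DERIV_continuous_on[OF w])
  have wL2: "w \<in> L2 \<Omega>" "w' \<in> L2 \<Omega>" by (intro L2_continuous_on_closed wc w'c)+
  have wH1: "w \<in> H1" using wL2 wd unfolding H1_def by blast
  have w_int: "(w' has_integral w x) {0..x}" if "x \<in> {0..1}" for x
  proof -
    have "(w has_vector_derivative w' y) (at y within {0..x})" if "y \<in> {0..x}" for y
      using has_field_derivative_subset[OF w[of y], of "{0..x}"] that \<open>x \<in> {0..1}\<close>
      by (auto simp: has_real_derivative_iff_has_vector_derivative)
    then show ?thesis
      using fundamental_theorem_of_calculus[of 0 x w w'] that w0 by auto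
  qed
  \<comment> \<open>The derivative is continued by its end point values, because test functions
    arise as primitives of functions continuous on the whole line.\<close>
  define V where "V x = w' (max 0 (min 1 x))" for x
  have Vc: "continuous_on S V" for S
    unfolding V_def by (rule continuous_on_compose2[OF w'c]) (auto intro!: continuous_intros)
  have V: "V x = w' x" if "x \<in> {0..1}" for x using that by (auto simp: V_def)
  obtain \<psi> where \<psi>: "\<psi> \<in> Cc1 0 1" "integral {0..1} \<psi> = 1" using Cc1_unit_mass[of 0 1] by auto
  obtain c d where cd: "0 < c" "c \<le> d" "d < 1" "\<And>x. x \<notin> {c..d} \<Longrightarrow> \<psi> x = 0"
    using Cc1_support[OF \<psi>(1)] by auto
  have \<psi>c: "continuous_on S \<psi>" for S using Cc1_D(3)[OF \<psi>(1)] continuous_on_subset by blast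
  \<comment> \<open>Piecewise linear cut-off: zero within distance 1/(n + 3) of the end points, one
    from distance 2/(n + 3) on.\<close>
  define \<rho> where "\<rho> n x = min 1 (max 0 (real (n + 3) * min x (1 - x) - 1))" for n x
  have \<rho>c: "continuous_on S (\<rho> n)" for S n unfolding \<rho>_def by (intro continuous_intros)
  have \<rho>V: "(\<lambda>x. \<rho> n x * V x) \<in> L2 \<Omega>" "V \<in> L2 \<Omega>" for n
    by (intro L2_continuous_on_closed continuous_intros Vc \<rho>c)+
  define L where "L n = L2_norm \<Omega> (\<lambda>x. \<rho> n x * V x - V x)" for n
  have "(\<lambda>n. L2_norm \<Omega> (\<lambda>x. \<rho> n x * V x - V x)) \<longlonglongrightarrow> 0"
  proof (rule L2_dominated_convergence[where w="\<lambda>x. \<bar>V x\<bar>"])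
    show "AE x in lebesgue_on \<Omega>. (\<lambda>n. \<rho> n x * V x) \<longlonglongrightarrow> V x"
    proof (intro AE_I2 tendsto_eventually)
      fix x assume "x \<in> space (lebesgue_on \<Omega>)"
      then have m: "0 < min x (1 - x)" by auto
      show "\<forall>\<^sub>F n in sequentially. \<rho> n x * V x = V x"
      proof (rule eventually_sequentiallyI)
        fix n assume "n \<ge> nat \<lceil>2 / min x (1 - x)\<rceil>"
        then have "2 / min x (1 - x) \<le> real (n + 3)" by linarith
        then have "2 \<le> real (n + 3) * min x (1 - x)" using m by (simp only: pos_divide_le_eq)
        then have "\<rho> n x = 1" unfolding \<rho>_def by linarith
        then show "\<rho> n x * V x = V x" by simp
      qed
    qed
    show "AE x in lebesgue_on \<Omega>. \<bar>\<rho> n x * V x - V x\<bar> \<le> \<bar>V x\<bar>" for n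
    proof (rule AE_I2)
      fix x
      have "\<bar>\<rho> n x - 1\<bar> \<le> 1" by (auto simp: \<rho>_def)
      then have "\<bar>\<rho> n x - 1\<bar> * \<bar>V x\<bar> \<le> 1 * \<bar>V x\<bar>" by (rule mult_right_mono) simp
      then show "\<bar>\<rho> n x * V x - V x\<bar> \<le> \<bar>V x\<bar>" by (simp add: left_diff_distrib flip: abs_mult)
    qed
  qed (intro L2_abs L2_D(1) \<rho>V)+
  then have L0: "L \<longlonglongrightarrow> 0" by (simp add: L_def[abs_def])
  define cn where "cn n = integral {0..1} (\<lambda>x. \<rho> n x * V x)" for n
  define \<theta> where "\<theta> n x = \<rho> n x * V x - cn n * \<psi> x" for n x
  have \<theta>c: "continuous_on S (\<theta> n)" for S n
    unfolding \<theta>_def by (intro continuous_intros \<rho>c Vc \<psi>c)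
  \<comment> \<open>The correction is small because \<open>w'\<close> has mean
    \<open>w 1 - w 0 = 0\<close>, so that \<open>cn n\<close> is also the mean of the error made by
    cutting off.\<close>
  have cn: "\<bar>cn n\<bar> \<le> L n" for n
  proof -
    have "integral {0..1} V = integral {0..1} w'" by (intro integral_cong V)
    also have "\<dots> = 0" using w_int[of 1] w0 by (simp add: integral_unique)
    finally have "cn n = integral {0..1} (\<lambda>x. \<rho> n x * V x - V x)"
      unfolding cn_def by (subst Henstock_Kurzweil_Integration.integral_diff)
        (auto intro!: integrable_continuous_real continuous_intros Vc \<rho>c)
    moreover have "continuous_on {0..1} (\<lambda>x. \<rho> n x * V x - V x)"
      by (intro continuous_intros \<rho>c Vc)
    ultimately show ?thesis using primitive_bound[of "\<lambda>x. \<rho> n x * V x - V x" 1] by (simp add: L_def)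
  qed
  define \<eta> where "\<eta> n = (\<lambda>x. integral {0..x} (\<theta> n))" for n
  have "\<eta> n \<in> Cc1 0 1 \<and> deriv (\<eta> n) = \<theta> n" for n
  proof -
    let ?i = "1 / real (n + 3)"
    have z: "integral {0..1} (\<theta> n) = 0"
      unfolding \<theta>_def using \<psi>(2)
      by (subst Henstock_Kurzweil_Integration.integral_diff)
        (auto intro!: integrable_continuous_real continuous_intros Vc \<rho>c \<psi>c simp: cn_def)
    have o: "\<theta> n x = 0" if "x \<notin> {min c ?i..max d (1 - ?i)}" for x
    proof -
      have "min x (1 - x) \<le> ?i" "x \<notin> {c..d}" using that by auto
      then have "real (n + 3) * min x (1 - x) \<le> real (n + 3) * ?i" by (intro mult_left_mono) auto
      then have "real (n + 3) * min x (1 - x) \<le> 1" by simp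
      then have "\<rho> n x = 0" unfolding \<rho>_def by linarith
      then show ?thesis using cd(4)[OF \<open>x \<notin> {c..d}\<close>] by (simp add: \<theta>_def)
    qed
    have lt: "0 < min c ?i" "min c ?i \<le> max d (1 - ?i)" "max d (1 - ?i) < 1" using cd by auto
    show ?thesis unfolding \<eta>_def using Cc1_primitive[OF \<theta>c o lt z] by simp
  qed
  then have \<eta>: "\<eta> n \<in> Cc1 0 1" "deriv (\<eta> n) = \<theta> n" for n by auto
  have d: "L2_norm \<Omega> (\<lambda>x. w' x - \<theta> n x) \<le> L n * (1 + L2_norm \<Omega> \<psi>)" for n
  proof -
    have "L2_norm \<Omega> (\<lambda>x. w' x - \<theta> n x) = L2_norm \<Omega> (\<lambda>x. (V x - \<rho> n x * V x) + cn n * \<psi> x)"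
      using V by (intro L2_norm_cong_AE L2_D(1) L2_diff L2_add L2_cmult wL2 \<rho>V Cc1_L2(1)[OF \<psi>(1)] L2_continuous_on_closed \<theta>c)
        (auto simp: \<theta>_def intro!: AE_I2)
    also have "\<dots> \<le> L2_norm \<Omega> (\<lambda>x. V x - \<rho> n x * V x) + L2_norm \<Omega> (\<lambda>x. cn n * \<psi> x)"
      by (intro L2_norm_triangle L2_diff L2_cmult \<rho>V Cc1_L2(1)[OF \<psi>(1)])
    also have "\<dots> \<le> L n + L n * L2_norm \<Omega> \<psi>"
      using cn[of n] by (simp add: L_def L2_norm_minus_commute[of \<Omega> V] mult_right_mono)
    finally show ?thesis by (simp add: algebra_simps)
  qed
  have lim: "(\<lambda>n. L n * (1 + L2_norm \<Omega> \<psi>)) \<longlonglongrightarrow> 0"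
    using tendsto_mult_right[OF L0, of "1 + L2_norm \<Omega> \<psi>"] by simp
  have lim1: "(\<lambda>n. L2_norm \<Omega> (\<lambda>x. w' x - \<theta> n x)) \<longlonglongrightarrow> 0"
    by (rule Lim_null_comparison[OF _ lim]) (use d in simp)
  have "L2_norm \<Omega> (\<lambda>x. w x - \<eta> n x) \<le> L2_norm \<Omega> (\<lambda>x. w' x - \<theta> n x)" for n
  proof (rule primitive_L2_bound)
    show "continuous_on {0..1} (\<lambda>x. w' x - \<theta> n x)" by (intro continuous_intros w'c \<theta>c)
    show "w x - \<eta> n x = integral {0..x} (\<lambda>x. w' x - \<theta> n x)" if "x \<in> \<Omega>" for x
      unfolding \<eta>_def
      using w_int[of x] that
      by (subst Henstock_Kurzweil_Integration.integral_diff)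
        (auto intro!: integrable_continuous_real \<theta>c continuous_on_subset[OF w'c] simp: integral_unique)
    show "(\<lambda>x. w x - \<eta> n x) \<in> borel_measurable (lebesgue_on \<Omega>)"
      by (intro L2_D(1) L2_diff wL2 Cc1_L2(1)[OF \<eta>(1)])
  qed
  then have lim2: "(\<lambda>n. L2_norm \<Omega> (\<lambda>x. w x - \<eta> n x)) \<longlonglongrightarrow> 0"
    by (intro Lim_null_comparison[OF _ lim1]) simp
  have "L2_norm \<Omega> (\<lambda>x. weak_deriv 0 1 w x - deriv (\<eta> n) x) = L2_norm \<Omega> (\<lambda>x. w' x - \<theta> n x)" for n
    using ae by (intro L2_norm_cong_AE L2_D(1) L2_diff H1_weak_deriv(2)[OF wH1] Cc1_L2(2)[OF \<eta>(1)] wL2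
        L2_continuous_on_closed[OF \<theta>c]) (auto simp: \<eta>(2) elim: eventually_mono)
  then show "w \<in> H10" unfolding H10_iff using wH1 \<eta>(1) lim1 lim2
    by (intro conjI exI[of _ \<eta>]) simp_all
qed

section \<open>Minimisation of quadratic functionals\<close>

text \<open>Riesz representation in a space that may be incomplete, with a form that may be
  degenerate. The outcome is therefore a sequence, Cauchy for \<open>B\<close> and solving the
  equation in the limit, which each application completes in its own norm: once for functionals on
  \<open>H10\<close>, once for the minimiser of the cost functional.\<close>

lemma quadratic_minimizing_sequence:
  fixes S :: "('a \<Rightarrow> real) set" and B :: "('a \<Rightarrow> real) \<Rightarrow> ('a \<Rightarrow> real) \<Rightarrow> real" and l :: "('a \<Rightarrow> real) \<Rightarrow> real"
  assumes ne: "S \<noteq> {}" and lin: "\<And>u v s t. u \<in> S \<Longrightarrow> v \<in> S \<Longrightarrow> (\<lambda>x. s * u x + t * v x) \<in> S"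
    and Blin: "\<And>u v w s t. u \<in> S \<Longrightarrow> v \<in> S \<Longrightarrow> w \<in> S \<Longrightarrow> B (\<lambda>x. s * u x + t * v x) w = s * B u w + t * B v w"
    and Bsym: "\<And>u v. u \<in> S \<Longrightarrow> v \<in> S \<Longrightarrow> B u v = B v u" and Bpos: "\<And>u. u \<in> S \<Longrightarrow> 0 \<le> B u u"
    and llin: "\<And>u v s t. u \<in> S \<Longrightarrow> v \<in> S \<Longrightarrow> l (\<lambda>x. s * u x + t * v x) = s * l u + t * l v"
    and lbound: "\<And>u. u \<in> S \<Longrightarrow> (l u)\<^sup>2 \<le> K * B u u"
  obtains v :: "nat \<Rightarrow> 'a \<Rightarrow> real" where "\<And>n. v n \<in> S"
    "\<And>e. e > 0 \<Longrightarrow> \<exists>N. \<forall>m\<ge>N. \<forall>n\<ge>N. B (\<lambda>x. v m x - v n x) (\<lambda>x. v m x - v n x) < e"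
    "\<And>w. w \<in> S \<Longrightarrow> (\<lambda>n. B (v n) w) \<longlonglongrightarrow> l w"
proof -
  define q where "q u = B u u / 2 - l u" for u
  have BB: "B (\<lambda>x. s * u x + t * v x) (\<lambda>x. s * u x + t * v x) = s\<^sup>2 * B u u + 2 * s * t * B u v + t\<^sup>2 * B v v"
    if u: "u \<in> S" and v: "v \<in> S" for u v s t
  proof -
    have "B (\<lambda>x. s * u x + t * v x) (\<lambda>x. s * u x + t * v x)
        = s * B (\<lambda>x. s * u x + t * v x) u + t * B (\<lambda>x. s * u x + t * v x) v"
      using Blin[OF u v lin[OF u v], of s t s t] Bsym[OF u lin[OF u v]] Bsym[OF v lin[OF u v]] by simp
    also have "\<dots> = s * (s * B u u + t * B u v) + t * (s * B u v + t * B v v)"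
      using Blin[OF u v u] Blin[OF u v v] Bsym[OF u v] by simp
    finally show ?thesis by (simp add: power2_eq_square algebra_simps)
  qed
  define K' where "K' = \<bar>K\<bar> + 1"
  have K': "K' > 0" "K \<le> K'" by (auto simp: K'_def)
  \<comment> \<open>Young's inequality 2 l <= l^2/K' + K'; passing from \<open>K\<close> to the
    positive \<open>K'\<close> permits the division.\<close>
  have low: "- K' / 2 \<le> q u" if u: "u \<in> S" for u
  proof -
    have "(l u)\<^sup>2 \<le> K' * B u u" using lbound[OF u] mult_right_mono[OF K'(2) Bpos[OF u]] by linarith
    then have "(l u)\<^sup>2 / K' \<le> B u u" using K' by (simp add: field_simps)
    moreover have "0 \<le> (l u - K')\<^sup>2 / K'" using K' by simp
    then have "2 * l u \<le> (l u)\<^sup>2 / K' + K'" using K' by (simp add: power2_diff field_simps power2_eq_square)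
    ultimately show ?thesis by (simp add: q_def)
  qed
  have bdd: "bdd_below (q ` S)" using low by (intro bdd_belowI2) auto
  define m where "m = Inf (q ` S)"
  have m_le: "m \<le> q u" if "u \<in> S" for u unfolding m_def using bdd that by (intro cInf_lower) auto
  have "\<exists>v\<in>S. q v < m + inverse (real (Suc n))" for n
  proof -
    have "Inf (q ` S) < m + inverse (real (Suc n))" by (simp add: m_def)
    then show ?thesis using cInf_less_iff[of "q ` S"] ne bdd by auto
  qed
  then obtain v where v: "\<And>n. v n \<in> S" "\<And>n. q (v n) < m + inverse (real (Suc n))" by metis
  have i0: "(\<lambda>n. inverse (real (Suc n))) \<longlonglongrightarrow> 0" by (rule LIMSEQ_inverse_real_of_nat)
  \<comment> \<open>Parallelogram identity: the value at the midpoint lies below the average of the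
    two values by an eighth of \<open>B\<close> of the difference, and it cannot lie below the
    infimum.\<close>
  have Bdiff: "B (\<lambda>x. v i x - v j x) (\<lambda>x. v i x - v j x) \<le> 4 * (inverse (real (Suc i)) + inverse (real (Suc j)))" for i j
  proof -
    have "m \<le> q (\<lambda>x. 1/2 * v i x + 1/2 * v j x)" by (intro m_le lin v)
    also have "\<dots> = (q (v i) + q (v j)) / 2 - B (\<lambda>x. 1 * v i x + (-1) * v j x) (\<lambda>x. 1 * v i x + (-1) * v j x) / 8"
      unfolding q_def BB[OF v(1) v(1)] llin[OF v(1) v(1)] by (simp add: power2_eq_square field_simps)
    finally have "m \<le> (q (v i) + q (v j)) / 2 - B (\<lambda>x. v i x - v j x) (\<lambda>x. v i x - v j x) / 8" by simp
    moreover have "X \<le> 4 * (r + s)" if "m \<le> (a + b) / 2 - X / 8" "a < m + r" "b < m + s" for X a b r s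
      using that by (simp add: field_simps)
    ultimately show ?thesis using v(2) by blast
  qed
  show ?thesis
  proof
    show "v n \<in> S" for n by (rule v)
    show "\<exists>N. \<forall>m\<ge>N. \<forall>n\<ge>N. B (\<lambda>x. v m x - v n x) (\<lambda>x. v m x - v n x) < e" if e: "e > 0" for e
    proof -
      have "\<forall>\<^sub>F n in sequentially. inverse (real (Suc n)) < e / 8"
        by (rule order_tendstoD(2)[OF i0]) (use e in simp)
      then obtain N where N: "\<And>n. n \<ge> N \<Longrightarrow> inverse (real (Suc n)) < e / 8"
        by (auto simp: eventually_sequentially)
      have "B (\<lambda>x. v m x - v n x) (\<lambda>x. v m x - v n x) < e" if "m \<ge> N" "n \<ge> N" for m n
      proof -
        have "X < e" if "X \<le> 4 * (r + s)" "r < e / 8" "s < e / 8" for X r s using that by simp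
        then show ?thesis using Bdiff[of m n] N[OF that(1)] N[OF that(2)] by blast
      qed
      then show ?thesis by blast
    qed
    show "(\<lambda>n. B (v n) w) \<longlonglongrightarrow> l w" if w: "w \<in> S" for w
    proof -
      define b where "b = B w w + 1"
      have b: "b > 0" "B w w \<le> b" using Bpos[OF w] by (auto simp: b_def)
      have sq: "(B (v n) w - l w)\<^sup>2 \<le> 2 * b * inverse (real (Suc n))" for n
      proof -
        define d where "d = B (v n) w - l w"
        \<comment> \<open>This \<open>s\<close> minimises \<open>s * d + s\<^sup>2 * b / 2\<close>.
          The summand 1 in \<open>b\<close> permits the division also when \<open>B w w\<close> is
          zero.\<close>
        define s where "s = - d / b"
        have "m \<le> q (\<lambda>x. 1 * v n x + s * w x)" by (intro m_le lin v w)
        also have "\<dots> = q (v n) + (s * d + s\<^sup>2 * B w w / 2)"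
          unfolding q_def BB[OF v(1) w] llin[OF v(1) w] d_def by (simp add: field_simps)
        also have "\<dots> \<le> q (v n) + (s * d + s\<^sup>2 * b / 2)"
          using mult_left_mono[OF b(2), of "s\<^sup>2"] by simp
        also have "s * d + s\<^sup>2 * b / 2 = - d\<^sup>2 / (2 * b)"
          using b(1) by (simp add: s_def power2_eq_square field_simps)
        finally have "d\<^sup>2 / (2 * b) \<le> inverse (real (Suc n))" using v(2)[of n] by simp
        then show ?thesis using b(1) unfolding d_def by (simp add: pos_divide_le_eq mult.commute)
      qed
      have "(\<lambda>n. (B (v n) w - l w)\<^sup>2) \<longlonglongrightarrow> 0"
      proof (rule Lim_null_comparison)
        show "(\<lambda>n. 2 * b * inverse (real (Suc n))) \<longlonglongrightarrow> 0"
          using tendsto_mult_left[OF i0, of "2 * b"] by simp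
      qed (use sq in simp)
      then have "(\<lambda>n. sqrt ((B (v n) w - l w)\<^sup>2)) \<longlonglongrightarrow> sqrt 0" by (rule tendsto_real_sqrt)
      then have "(\<lambda>n. \<bar>B (v n) w - l w\<bar>) \<longlonglongrightarrow> 0" by simp
      then have "(\<lambda>n. B (v n) w - l w) \<longlonglongrightarrow> 0" by (rule tendsto_rabs_zero_cancel)
      then show ?thesis by (simp add: LIM_zero_iff)
    qed
  qed
qed

section \<open>The dual space\<close>

lemma Hm1_lin:
  assumes l: "l \<in> Hm1" and u: "u \<in> H10" and v: "v \<in> H10"
  shows "l (\<lambda>x. s * u x + t * v x) = s * l u + t * l v"
proof -
  have h: "\<And>u v. u \<in> H10 \<Longrightarrow> v \<in> H10 \<Longrightarrow> l (\<lambda>x. u x + v x) = l u + l v" "\<And>c u. u \<in> H10 \<Longrightarrow> l (\<lambda>x. c * u x) = c * l u"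
    using l by (auto simp: Hm1_def)
  have "(\<lambda>x. s * u x) \<in> H10" "(\<lambda>x. t * v x) \<in> H10"
    using H10_lin[OF u u, of s 0] H10_lin[OF v v, of t 0] by simp_all
  then show ?thesis using h(1)[of "\<lambda>x. s * u x" "\<lambda>x. t * v x"] h(2) u v by simp
qed

lemma Hm1_bound:
  assumes "l \<in> Hm1" obtains C where "C \<ge> 0" "\<And>u. u \<in> H10 \<Longrightarrow> \<bar>l u\<bar> \<le> C * H1_norm u"
proof -
  obtain C where C: "\<And>u. u \<in> H10 \<Longrightarrow> \<bar>l u\<bar> \<le> C * H1_norm u" using assms unfolding Hm1_def by blast
  have "\<bar>l u\<bar> \<le> \<bar>C\<bar> * H1_norm u" if "u \<in> H10" for u
    using C[OF that] mult_right_mono[OF abs_ge_self[of C] H1_norm_bounds(4)[of u]] by linarith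
  then show ?thesis using that[of "\<bar>C\<bar>"] by simp
qed

text \<open>A test function is the primitive from 0 of its derivative, and the interval has length
  one; hence the constant 1.\<close>

lemma Poincare:
  assumes "\<eta> \<in> Cc1 0 1" shows "L2_norm \<Omega> \<eta> \<le> L2_norm \<Omega> (deriv \<eta>)"
  using assms by (intro primitive_L2_bound L2_D(1) Cc1_L2)
    (auto simp: Cc1_integral_deriv intro: continuous_on_subset Cc1_D)

text \<open>By density it suffices to represent the functional on test functions, where the energy
  \<open>\<integral> \<eta>'\<^sup>2\<close> controls it; the derivatives of a minimising sequence converge to the representative.\<close>

lemma Hm1_representation:
  assumes l: "l \<in> Hm1"
  obtains G where "G \<in> L2 \<Omega>" "\<And>u. u \<in> H10 \<Longrightarrow> l u = (\<integral>x. G x * weak_deriv 0 1 u x \<partial>lebesgue_on \<Omega>)"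
proof -
  let ?M = "lebesgue_on \<Omega>"
  define B where "B u v = (\<integral>x. deriv u x * deriv v x \<partial>?M)" for u v :: "real \<Rightarrow> real"
  obtain C where C: "C \<ge> 0" "\<And>u. u \<in> H10 \<Longrightarrow> \<bar>l u\<bar> \<le> C * H1_norm u" using Hm1_bound[OF l] by blast
  have BB: "B u u = (L2_norm \<Omega> (deriv u))\<^sup>2" for u
    unfolding B_def L2_norm_square by (simp add: power2_eq_square)
  obtain v :: "nat \<Rightarrow> real \<Rightarrow> real" where v: "\<And>n. v n \<in> Cc1 0 1"
    "\<And>e. e > 0 \<Longrightarrow> \<exists>N. \<forall>m\<ge>N. \<forall>n\<ge>N. B (\<lambda>x. v m x - v n x) (\<lambda>x. v m x - v n x) < e"
    "\<And>w. w \<in> Cc1 0 1 \<Longrightarrow> (\<lambda>n. B (v n) w) \<longlonglongrightarrow> l w"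
  proof (rule quadratic_minimizing_sequence[of "Cc1 0 1" B l "(2 * C)\<^sup>2"])
    show "Cc1 0 1 \<noteq> {}" using Cc1_unit_mass[of 0 1] by auto
    show "(\<lambda>x. s * u x + t * w x) \<in> Cc1 0 1" if "u \<in> Cc1 0 1" "w \<in> Cc1 0 1" for u w s t
      using Cc1_lin[OF that] by simp
    show "B (\<lambda>x. s * u x + t * v x) w = s * B u w + t * B v w"
      if "u \<in> Cc1 0 1" "v \<in> Cc1 0 1" "w \<in> Cc1 0 1" for u v w s t
      using L2_mult_integrable[OF Cc1_L2(2)[OF that(1)] Cc1_L2(2)[OF that(3)]]
        L2_mult_integrable[OF Cc1_L2(2)[OF that(2)] Cc1_L2(2)[OF that(3)]]
      by (simp add: B_def Cc1_lin(2)[OF that(1,2)] distrib_right mult.assoc)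
    show "B u v = B v u" for u v by (simp add: B_def mult.commute)
    show "0 \<le> B u u" for u by (simp add: BB)
    show "l (\<lambda>x. s * u x + t * v x) = s * l u + t * l v" if "u \<in> Cc1 0 1" "v \<in> Cc1 0 1" for u v s t
      by (intro Hm1_lin[OF l] H10_Cc1 that)
    show "(l u)\<^sup>2 \<le> (2 * C)\<^sup>2 * B u u" if u: "u \<in> Cc1 0 1" for u
    proof -
      have "\<bar>l u\<bar> \<le> C * H1_norm u" by (rule C(2)[OF H10_Cc1[OF u]])
      \<comment> \<open>The factor 2: the H1 norm is at most the sum of the two L2 norms, and
        Poincare bounds the norm of \<open>u\<close> by that of its derivative.\<close>
      also have "\<dots> \<le> C * (2 * L2_norm \<Omega> (deriv u))"
        using H1_norm_bounds(3)[of u] Poincare[OF u] H1_Cc1(3)[OF u] C(1) by (intro mult_left_mono) auto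
      finally have "\<bar>l u\<bar> \<le> \<bar>2 * C * L2_norm \<Omega> (deriv u)\<bar>" by (simp add: algebra_simps)
      then show ?thesis unfolding BB by (simp add: abs_le_square_iff power_mult_distrib)
    qed
  qed blast
  obtain G where G: "G \<in> L2 \<Omega>" "(\<lambda>n. L2_norm \<Omega> (\<lambda>x. deriv (v n) x - G x)) \<longlonglongrightarrow> 0"
  proof (rule L2_complete[of \<Omega> "\<lambda>n. deriv (v n)"])
    fix e :: real assume e: "e > 0"
    obtain N where N: "\<And>m n. m \<ge> N \<Longrightarrow> n \<ge> N \<Longrightarrow> B (\<lambda>x. v m x - v n x) (\<lambda>x. v m x - v n x) < e\<^sup>2"
      using v(2)[of "e\<^sup>2"] e by auto
    have "L2_norm \<Omega> (\<lambda>x. deriv (v m) x - deriv (v n) x) < e" if "m \<ge> N" "n \<ge> N" for m n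
    proof -
      have "deriv (\<lambda>x. v m x - v n x) = (\<lambda>x. deriv (v m) x - deriv (v n) x)"
        using Cc1_lin(2)[OF v(1)[of m] v(1)[of n], of 1 "-1"] by simp
      then have "(L2_norm \<Omega> (\<lambda>x. deriv (v m) x - deriv (v n) x))\<^sup>2 < e\<^sup>2" using N[OF that] by (simp add: BB)
      then show ?thesis using e by (simp add: power2_less_imp_less)
    qed
    then show "\<exists>N. \<forall>m\<ge>N. \<forall>n\<ge>N. L2_norm \<Omega> (\<lambda>x. deriv (v m) x - deriv (v n) x) < e" by blast
  qed (use Cc1_L2 v(1) in auto)
  have test: "l \<eta> = (\<integral>x. G x * deriv \<eta> x \<partial>?M)" if \<eta>: "\<eta> \<in> Cc1 0 1" for \<eta>
    using LIMSEQ_unique[OF v(3)[OF \<eta>, unfolded B_def]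
        L2_tendsto_integral[OF Cc1_L2(2)[OF v(1)] G(1) Cc1_L2(2)[OF \<eta>] G(2)]] .
  have "l u = (\<integral>x. G x * weak_deriv 0 1 u x \<partial>?M)" if u: "u \<in> H10" for u
  proof -
    obtain \<eta> where \<eta>: "\<And>n::nat. \<eta> n \<in> Cc1 0 1" "(\<lambda>n. L2_norm \<Omega> (\<lambda>x. u x - \<eta> n x)) \<longlonglongrightarrow> 0"
     "(\<lambda>n. L2_norm \<Omega> (\<lambda>x. weak_deriv 0 1 u x - deriv (\<eta> n) x)) \<longlonglongrightarrow> 0"
      using H10_approx[OF u] by blast
    have "(\<lambda>n. l u - l (\<eta> n)) \<longlonglongrightarrow> 0"
    proof (rule Lim_null_comparison)
      show "(\<lambda>n. C * (L2_norm \<Omega> (\<lambda>x. u x - \<eta> n x) + L2_norm \<Omega> (\<lambda>x. weak_deriv 0 1 u x - deriv (\<eta> n) x))) \<longlonglongrightarrow> 0"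
        using tendsto_mult_left[OF tendsto_add[OF \<eta>(2,3)], of C] by simp
      show "\<forall>\<^sub>F n in sequentially. norm (l u - l (\<eta> n))
          \<le> C * (L2_norm \<Omega> (\<lambda>x. u x - \<eta> n x) + L2_norm \<Omega> (\<lambda>x. weak_deriv 0 1 u x - deriv (\<eta> n) x))"
      proof (intro always_eventually allI)
        fix n
        have m: "(\<lambda>x. u x - \<eta> n x) \<in> H10" using H10_lin[OF u H10_Cc1[OF \<eta>(1)[of n]], of 1 "-1"] by simp
        have "l u - l (\<eta> n) = l (\<lambda>x. u x - \<eta> n x)"
          using Hm1_lin[OF l u H10_Cc1[OF \<eta>(1)[of n]], of 1 "-1"] by simp
        also have "\<bar>\<dots>\<bar> \<le> C * H1_norm (\<lambda>x. u x - \<eta> n x)" by (rule C(2)[OF m])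
        also have "\<dots> \<le> C * (L2_norm \<Omega> (\<lambda>x. u x - \<eta> n x) + L2_norm \<Omega> (\<lambda>x. weak_deriv 0 1 u x - deriv (\<eta> n) x))"
          using H1_norm_bounds(3)[of "\<lambda>x. u x - \<eta> n x"] C(1)
            L2_norm_weak_deriv_diff_Cc1[OF H10_D(1)[OF u] \<eta>(1)[of n]] by (intro mult_left_mono) auto
        finally show "norm (l u - l (\<eta> n))
          \<le> C * (L2_norm \<Omega> (\<lambda>x. u x - \<eta> n x) + L2_norm \<Omega> (\<lambda>x. weak_deriv 0 1 u x - deriv (\<eta> n) x))"
          by simp
      qed
    qed
    then have "(\<lambda>n. l u - (l u - l (\<eta> n))) \<longlonglongrightarrow> l u - 0" by (intro tendsto_intros)
    then have a: "(\<lambda>n. l (\<eta> n)) \<longlonglongrightarrow> l u" by simp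
    have "(\<lambda>n. L2_norm \<Omega> (\<lambda>x. deriv (\<eta> n) x - weak_deriv 0 1 u x)) \<longlonglongrightarrow> 0"
      using \<eta>(3) by (simp add: L2_norm_minus_commute[of _ "weak_deriv 0 1 u"])
    from L2_tendsto_integral[OF Cc1_L2(2)[OF \<eta>(1)] H10_D(3)[OF u] G(1) this]
    have "(\<lambda>n. l (\<eta> n)) \<longlonglongrightarrow> (\<integral>x. weak_deriv 0 1 u x * G x \<partial>?M)"
      by (simp add: test[OF \<eta>(1)] mult.commute)
    then show ?thesis using LIMSEQ_unique[OF a] by (simp add: mult.commute)
  qed
  then show ?thesis using that G(1) by blast
qed

lemma Hm1_of_L2:
  assumes G: "G \<in> L2 \<Omega>"
  shows "(\<lambda>u. \<integral>x. G x * weak_deriv 0 1 u x \<partial>lebesgue_on \<Omega>) \<in> Hm1"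
    "u \<in> H10 \<Longrightarrow> \<bar>\<integral>x. G x * weak_deriv 0 1 u x \<partial>lebesgue_on \<Omega>\<bar> \<le> L2_norm \<Omega> G * H1_norm u"
proof -
  let ?l = "\<lambda>u. \<integral>x. G x * weak_deriv 0 1 u x \<partial>lebesgue_on \<Omega>"
  have lin: "?l (\<lambda>x. s * u x + t * v x) = s * ?l u + t * ?l v" if u: "u \<in> H10" and v: "v \<in> H10" for u v s t
  proof -
    have "?l (\<lambda>x. s * u x + t * v x) = (\<integral>x. G x * (s * weak_deriv 0 1 u x + t * weak_deriv 0 1 v x) \<partial>lebesgue_on \<Omega>)"
    proof (rule integral_cong_AE)
      show "(\<lambda>x. G x * weak_deriv 0 1 (\<lambda>x. s * u x + t * v x) x) \<in> borel_measurable (lebesgue_on \<Omega>)"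
        by (intro borel_measurable_integrable L2_mult_integrable G H10_D(3) H10_lin u v)
      show "(\<lambda>x. G x * (s * weak_deriv 0 1 u x + t * weak_deriv 0 1 v x)) \<in> borel_measurable (lebesgue_on \<Omega>)"
        by (intro borel_measurable_integrable L2_mult_integrable G H10_D(3) L2_lin u v)
      show "AE x in lebesgue_on \<Omega>. G x * weak_deriv 0 1 (\<lambda>x. s * u x + t * v x) x = G x * (s * weak_deriv 0 1 u x + t * weak_deriv 0 1 v x)"
        using H1_lin(2)[OF H10_D(1)[OF u] H10_D(1)[OF v], of s t] by eventually_elim simp
    qed
    also have "\<dots> = s * ?l u + t * ?l v"
      using L2_mult_integrable[OF G H10_D(3)[OF u]] L2_mult_integrable[OF G H10_D(3)[OF v]]
      by (simp add: distrib_left mult.left_commute)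
    finally show ?thesis .
  qed
  show bound: "\<bar>?l u\<bar> \<le> L2_norm \<Omega> G * H1_norm u" if "u \<in> H10" for u
  proof -
    have "\<bar>?l u\<bar> \<le> L2_norm \<Omega> G * L2_norm \<Omega> (weak_deriv 0 1 u)"
      by (rule L2_Cauchy_Schwarz[OF G H10_D(3)[OF that]])
    also have "\<dots> \<le> L2_norm \<Omega> G * H1_norm u"
      by (intro mult_left_mono H1_norm_bounds) simp
    finally show ?thesis .
  qed
  have "?l (\<lambda>x. u x + v x) = ?l u + ?l v" if "u \<in> H10" "v \<in> H10" for u v
    using lin[OF that, of 1 1] by simp
  moreover have "?l (\<lambda>x. c * u x) = c * ?l u" if "u \<in> H10" for u c
    using lin[OF that that, of c 0] by simp
  ultimately show "?l \<in> Hm1" unfolding Hm1_def using bound by blast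
qed

text \<open>A real \<open>Sup\<close> is informative only for nonempty bounded sets; the zero
  function supplies an element, which also shows that the supremum is nonnegative. The absolute
  value suits comparison with null sequences.\<close>

lemma Hm1_norm_le:
  assumes "\<And>u. u \<in> H10 \<Longrightarrow> \<bar>l u\<bar> \<le> C * H1_norm u" "C \<ge> 0"
  shows "\<bar>Hm1_norm l\<bar> \<le> C"
proof -
  let ?A = "{\<bar>l u\<bar> |u. u \<in> H10 \<and> H1_norm u \<le> 1}"
  obtain \<psi> where "\<psi> \<in> Cc1 0 1" using Cc1_unit_mass[of 0 1] by auto
  then have "(\<lambda>x. 0 * \<psi> x + 0 * \<psi> x) \<in> Cc1 0 1" by (intro Cc1_lin)
  then have z: "(\<lambda>x. 0) \<in> Cc1 0 1" by simp
  have "H1_norm (\<lambda>x. 0) \<le> 0"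
    using H1_norm_bounds(3)[of "\<lambda>x. 0"] H1_Cc1(3)[OF z] by (simp add: L2_norm_def)
  then have mem: "\<bar>l (\<lambda>x. 0)\<bar> \<in> ?A" using H10_Cc1[OF z] by force
  have le: "a \<le> C" if a: "a \<in> ?A" for a
  proof -
    obtain u where u: "a = \<bar>l u\<bar>" "u \<in> H10" "H1_norm u \<le> 1" using a by blast
    have "a \<le> C * H1_norm u" using assms(1)[OF u(2)] u(1) by simp
    also have "\<dots> \<le> C * 1" using u(3) assms(2) by (rule mult_left_mono)
    finally show ?thesis by simp
  qed
  have "Sup ?A \<le> C" using mem le by (intro cSup_least) auto
  moreover have "0 \<le> Sup ?A"
    by (rule order_trans[OF abs_ge_zero cSup_upper[OF mem]]) (rule bdd_aboveI[of _ C], rule le)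
  ultimately show ?thesis by (simp add: Hm1_norm_def)
qed

section \<open>Periodic functions\<close>

text \<open>Substitutions and Tonelli's theorem are carried out with nonnegative integrals over
  \<open>lborel\<close>. This passes to them from Lebesgue measure, at the price of Borel measurable
  integrands.\<close>

lemma nn_integral_lebesgue_on:
  fixes f :: "'a::euclidean_space \<Rightarrow> ennreal"
  assumes [measurable]: "f \<in> borel_measurable borel" "S \<in> sets borel"
  shows "(\<integral>\<^sup>+x. f x \<partial>lebesgue_on S) = (\<integral>\<^sup>+x. f x * indicator S x \<partial>lborel)"
proof -
  have "(\<integral>\<^sup>+x. f x \<partial>lebesgue_on S) = (\<integral>\<^sup>+x. f x * indicator S x \<partial>lebesgue)"
    by (subst nn_integral_restrict_space) auto
  also have "\<dots> = (\<integral>\<^sup>+x. f x * indicator S x \<partial>lborel)"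
    by (rule nn_integral_completion)
  finally show ?thesis .
qed

lemma borel_measurable_lebesgue_on:
  fixes f :: "'a::euclidean_space \<Rightarrow> real"
  assumes "f \<in> borel_measurable borel" shows "f \<in> borel_measurable (lebesgue_on S)"
  using assms by (intro measurable_restrict_space1 measurable_completion) simp

lemma L2_nn_integral:
  fixes f :: "'a::euclidean_space \<Rightarrow> real"
  assumes f: "f \<in> borel_measurable borel" and S: "S \<in> sets borel"
  shows "f \<in> L2 S \<longleftrightarrow> (\<integral>\<^sup>+x. ennreal ((f x)\<^sup>2) * indicator S x \<partial>lborel) < \<infinity>"
    "f \<in> L2 S \<Longrightarrow> (\<integral>\<^sup>+x. ennreal ((f x)\<^sup>2) * indicator S x \<partial>lborel) = ennreal ((L2_norm S f)\<^sup>2)"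
proof -
  note m = borel_measurable_lebesgue_on[OF f, of S]
  have eq: "(\<integral>\<^sup>+x. ennreal ((f x)\<^sup>2) * indicator S x \<partial>lborel) = (\<integral>\<^sup>+x. ennreal ((f x)\<^sup>2) \<partial>lebesgue_on S)"
    using f S by (subst nn_integral_lebesgue_on) auto
  show "f \<in> L2 S \<longleftrightarrow> (\<integral>\<^sup>+x. ennreal ((f x)\<^sup>2) * indicator S x \<partial>lborel) < \<infinity>"
    using m by (simp add: L2_def integrable_iff_bounded eq)
  show "(\<integral>\<^sup>+x. ennreal ((f x)\<^sup>2) * indicator S x \<partial>lborel) = ennreal ((L2_norm S f)\<^sup>2)" if "f \<in> L2 S"
    unfolding eq L2_norm_square by (rule nn_integral_eq_integral[OF L2_D(2)[OF that]]) simp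
qed

lemma nn_integral_interval_open:
  fixes h :: "real \<Rightarrow> ennreal"
  assumes [measurable]: "h \<in> borel_measurable borel"
  shows "(\<integral>\<^sup>+x. h x * indicator {a<..<b} x \<partial>lborel) = (\<integral>\<^sup>+x. h x * indicator {a..<b} x \<partial>lborel)"
    "(\<integral>\<^sup>+x. h x * indicator {a<..<b} x \<partial>lborel) = (\<integral>\<^sup>+x. h x * indicator {a..b} x \<partial>lborel)"
proof -
  have "AE x in lborel. x \<noteq> a \<and> x \<noteq> b" using AE_lborel_singleton[of a] AE_lborel_singleton[of b] by auto
  then show "(\<integral>\<^sup>+x. h x * indicator {a<..<b} x \<partial>lborel) = (\<integral>\<^sup>+x. h x * indicator {a..<b} x \<partial>lborel)"
    "(\<integral>\<^sup>+x. h x * indicator {a<..<b} x \<partial>lborel) = (\<integral>\<^sup>+x. h x * indicator {a..b} x \<partial>lborel)"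
    by (intro nn_integral_cong_AE; eventually_elim; auto simp: indicator_def)+
qed

lemma nn_integral_shift:
  fixes h :: "real \<Rightarrow> ennreal"
  assumes "h \<in> borel_measurable borel"
  shows "(\<integral>\<^sup>+x. h (t + x) * indicator {a..<b} x \<partial>lborel) = (\<integral>\<^sup>+x. h x * indicator {t + a..<t + b} x \<partial>lborel)"
proof -
  have "(\<integral>\<^sup>+x. h x * indicator {t + a..<t + b} x \<partial>lborel) = ennreal \<bar>1\<bar> * (\<integral>\<^sup>+x. h (t + 1 * x) * indicator {t + a..<t + b} (t + 1 * x) \<partial>lborel)"
    using assms by (intro nn_integral_real_affine) auto
  also have "\<dots> = (\<integral>\<^sup>+x. h (t + x) * indicator {a..<b} x \<partial>lborel)"
    by (auto intro!: nn_integral_cong simp: indicator_def)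
  finally show ?thesis by simp
qed

text \<open>Shifting \<open>a\<close> by 2 changes nothing, so \<open>a\<close> may be taken in [0,
  2); the piece of the window beyond 2 is then moved back by one period.\<close>

lemma nn_integral_periodic:
  fixes h :: "real \<Rightarrow> ennreal"
  assumes h [measurable]: "h \<in> borel_measurable borel" and per: "\<And>x. h (x + 2) = h x"
  shows "(\<integral>\<^sup>+x. h x * indicator {a..<a + 2} x \<partial>lborel) = (\<integral>\<^sup>+x. h x * indicator {0..<2} x \<partial>lborel)"
proof -
  define I where "I a = (\<integral>\<^sup>+x. h x * indicator {a..<a + 2} x \<partial>lborel)" for a
  have I2: "I (2 + a) = I a" for a
    unfolding I_def using nn_integral_shift[OF h, of 2 a "a + 2"] per by (simp add: add.commute add.left_commute)
  have In: "I (a + 2 * real n) = I a" for a n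
  proof (induction n)
    case (Suc n)
    have "a + 2 * real (Suc n) = 2 + (a + 2 * real n)" by simp
    then show ?case using I2[of "a + 2 * real n"] Suc by (simp only:)
  qed simp
  have base: "I a = I 0" if a: "0 \<le> a" "a < 2" for a
  proof -
    have "I a = (\<integral>\<^sup>+x. (h x * indicator {a..<2} x + h x * indicator {2 + 0..<2 + a} x) \<partial>lborel)"
      unfolding I_def using a by (intro nn_integral_cong) (auto simp: indicator_def)
    also have "\<dots> = (\<integral>\<^sup>+x. h x * indicator {a..<2} x \<partial>lborel) + (\<integral>\<^sup>+x. h x * indicator {2 + 0..<2 + a} x \<partial>lborel)"
      by (rule nn_integral_add) auto
    also have "(\<integral>\<^sup>+x. h x * indicator {2 + 0..<2 + a} x \<partial>lborel) = (\<integral>\<^sup>+x. h x * indicator {0..<a} x \<partial>lborel)"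
      using nn_integral_shift[OF h, of 2 0 a] per by (simp add: add.commute)
    also have "(\<integral>\<^sup>+x. h x * indicator {a..<2} x \<partial>lborel) + \<dots> = (\<integral>\<^sup>+x. (h x * indicator {a..<2} x + h x * indicator {0..<a} x) \<partial>lborel)"
      by (rule nn_integral_add[symmetric]) auto
    also have "\<dots> = I 0"
      unfolding I_def using a by (intro nn_integral_cong) (auto simp: indicator_def)
    finally show ?thesis .
  qed
  define k where "k = \<lfloor>a / 2\<rfloor>"
  have k: "0 \<le> a - 2 * of_int k" "a - 2 * of_int k < 2" unfolding k_def by linarith+
  have "I a = I (a - 2 * of_int k)"
  proof (cases "k \<ge> 0")
    case True
    then have "a = (a - 2 * of_int k) + 2 * real (nat k)" by simp
    then have "I a = I ((a - 2 * of_int k) + 2 * real (nat k))" by (rule arg_cong)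
    then show ?thesis unfolding In .
  next
    case False
    then have "a - 2 * of_int k = a + 2 * real (nat (- k))" by simp
    then have "I (a - 2 * of_int k) = I (a + 2 * real (nat (- k)))" by (rule arg_cong)
    then show ?thesis unfolding In by (rule sym)
  qed
  also have "\<dots> = I 0" by (rule base[OF k])
  finally show ?thesis by (simp add: I_def)
qed

text \<open>Borel measurability on the whole line lets \<open>F\<close> be composed with t + x and t
  - x on the plane. Periodicity at every point keeps null sets out of the translations.\<close>

definition periodic_L2 :: "(real \<Rightarrow> real) set" where
  "periodic_L2 = {F. F \<in> borel_measurable borel \<and> (\<forall>x. F (x + 2) = F x) \<and> F \<in> L2 {0<..<2}}"

abbreviation circle_norm :: "(real \<Rightarrow> real) \<Rightarrow> real" where
  "circle_norm F \<equiv> L2_norm {0<..<2} F"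

lemma periodic_L2_D:
  assumes "F \<in> periodic_L2"
  shows "F \<in> borel_measurable borel" "F (x + 2) = F x" "F \<in> L2 {0<..<2}"
  using assms by (auto simp: periodic_L2_def)

lemma periodic_L2_lin:
  assumes "F \<in> periodic_L2" "G \<in> periodic_L2" shows "(\<lambda>x. s * F x + t * G x) \<in> periodic_L2"
  using assms L2_lin[of F _ G s t] by (auto simp: periodic_L2_def)

lemma periodic_L2_diff:
  assumes "F \<in> periodic_L2" "G \<in> periodic_L2" shows "(\<lambda>x. F x - G x) \<in> periodic_L2"
  using periodic_L2_lin[OF assms, of 1 "-1"] by simp

lemma periodic_L2_const: "(\<lambda>x. c) \<in> periodic_L2"
  by (simp add: periodic_L2_def L2_const)

lemma periodic_nn_integral:
  assumes "F \<in> periodic_L2"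
  shows "(\<integral>\<^sup>+x. ennreal ((F x)\<^sup>2) * indicator {a..<a + 2} x \<partial>lborel) = ennreal ((circle_norm F)\<^sup>2)"
proof -
  note F = periodic_L2_D[OF assms]
  have m: "(\<lambda>x. ennreal ((F x)\<^sup>2)) \<in> borel_measurable borel" using F(1) by measurable
  have "(\<integral>\<^sup>+x. ennreal ((F x)\<^sup>2) * indicator {a..<a + 2} x \<partial>lborel) = (\<integral>\<^sup>+x. ennreal ((F x)\<^sup>2) * indicator {0..<2} x \<partial>lborel)"
    using nn_integral_periodic[OF m] F(2) by simp
  also have "\<dots> = ennreal ((circle_norm F)\<^sup>2)"
    using L2_nn_integral(2)[OF F(1) _ F(3)] nn_integral_interval_open(1)[OF m, of 0 2] by simp
  finally show ?thesis .
qed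

lemma circle_norm_eqI:
  assumes "G \<in> borel_measurable borel" "\<And>x. G (x + 2) = G x"
    and "(\<integral>\<^sup>+x. ennreal ((G x)\<^sup>2) * indicator {0..<2} x \<partial>lborel) = ennreal (c\<^sup>2)" "c \<ge> 0"
  shows "G \<in> periodic_L2" "circle_norm G = c"
proof -
  have m: "(\<lambda>x. ennreal ((G x)\<^sup>2)) \<in> borel_measurable borel" using assms(1) by measurable
  have eq: "(\<integral>\<^sup>+x. ennreal ((G x)\<^sup>2) * indicator {0<..<2} x \<partial>lborel) = ennreal (c\<^sup>2)"
    using nn_integral_interval_open(1)[OF m, of 0 2] assms(3) by simp
  then have L2: "G \<in> L2 {0<..<2}" using L2_nn_integral(1)[OF assms(1), of "{0<..<2}"] by simp
  then show "G \<in> periodic_L2" using assms by (simp add: periodic_L2_def)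
  have "(circle_norm G)\<^sup>2 = c\<^sup>2" using L2_nn_integral(2)[OF assms(1) _ L2] eq by simp
  then show "circle_norm G = c" using assms(4) by (simp add: power2_eq_iff_nonneg)
qed

lemma periodic_L2_shift:
  assumes "F \<in> periodic_L2"
  shows "(\<lambda>x. F (t + x)) \<in> periodic_L2" "circle_norm (\<lambda>x. F (t + x)) = circle_norm F"
proof -
  note F = periodic_L2_D[OF assms]
  have m: "(\<lambda>x. ennreal ((F x)\<^sup>2)) \<in> borel_measurable borel" using F(1) by measurable
  have "(\<integral>\<^sup>+x. ennreal ((F (t + x))\<^sup>2) * indicator {0..<2} x \<partial>lborel) = ennreal ((circle_norm F)\<^sup>2)"
    using nn_integral_shift[OF m, of t 0 2] periodic_nn_integral[OF assms, of t] by simp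
  moreover have "(\<lambda>x. F (t + x)) \<in> borel_measurable borel" using F(1) by measurable
  moreover have "F (t + (x + 2)) = F (t + x)" for x using F(2)[of "t + x"] by (simp add: add.assoc)
  ultimately show "(\<lambda>x. F (t + x)) \<in> periodic_L2" "circle_norm (\<lambda>x. F (t + x)) = circle_norm F"
    using circle_norm_eqI[of "\<lambda>x. F (t + x)" "circle_norm F"] by auto
qed

lemma nn_integral_reflect:
  fixes h :: "real \<Rightarrow> ennreal"
  assumes [measurable]: "h \<in> borel_measurable borel"
  shows "(\<integral>\<^sup>+x. h (- x) * indicator {a..<b} x \<partial>lborel) = (\<integral>\<^sup>+x. h x * indicator {-b..<-a} x \<partial>lborel)"
proof -
  have "(\<integral>\<^sup>+x. h x * indicator {-b..<-a} x \<partial>lborel) = (\<integral>\<^sup>+x. h x * indicator {-b..-a} x \<partial>lborel)"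
    using nn_integral_interval_open[OF assms, of "-b" "-a"] by simp
  also have "\<dots> = ennreal \<bar>-1\<bar> * (\<integral>\<^sup>+x. h (0 + (-1) * x) * indicator {-b..-a} (0 + (-1) * x) \<partial>lborel)"
    using assms by (intro nn_integral_real_affine) auto
  also have "\<dots> = (\<integral>\<^sup>+x. h (- x) * indicator {a..b} x \<partial>lborel)"
    by (auto intro!: nn_integral_cong simp: indicator_def)
  also have "\<dots> = (\<integral>\<^sup>+x. h (- x) * indicator {a..<b} x \<partial>lborel)"
    using nn_integral_interval_open[of "\<lambda>x. h (- x)" a b] by simp
  finally show ?thesis by simp
qed

lemma periodic_L2_reflect:
  assumes "F \<in> periodic_L2"
  shows "(\<lambda>x. F (- x)) \<in> periodic_L2" "circle_norm (\<lambda>x. F (- x)) = circle_norm F"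
proof -
  note F = periodic_L2_D[OF assms]
  have m: "(\<lambda>x. ennreal ((F x)\<^sup>2)) \<in> borel_measurable borel" using F(1) by measurable
  have "(\<integral>\<^sup>+x. ennreal ((F (- x))\<^sup>2) * indicator {0..<2} x \<partial>lborel) = ennreal ((circle_norm F)\<^sup>2)"
    using nn_integral_reflect[OF m, of 0 2] periodic_nn_integral[OF assms, of "-2"] by simp
  moreover have "(\<lambda>x. F (- x)) \<in> borel_measurable borel" using F(1) by measurable
  moreover have "F (- (x + 2)) = F (- x)" for x using F(2)[of "- x - 2"] by (simp add: algebra_simps)
  ultimately show "(\<lambda>x. F (- x)) \<in> periodic_L2" "circle_norm (\<lambda>x. F (- x)) = circle_norm F"
    using circle_norm_eqI[of "\<lambda>x. F (- x)" "circle_norm F"] by auto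
qed

lemma periodic_L2_shift_reflect:
  assumes "F \<in> periodic_L2"
  shows "(\<lambda>x. F (t - x)) \<in> periodic_L2" "circle_norm (\<lambda>x. F (t - x)) = circle_norm F"
  using periodic_L2_reflect[OF periodic_L2_shift(1)[OF assms, of t]] periodic_L2_shift(2)[OF assms, of t]
  by simp_all

lemma periodic_L2_\<Omega>:
  assumes "F \<in> periodic_L2" shows "F \<in> L2 \<Omega>" "L2_norm \<Omega> F \<le> circle_norm F"
proof -
  have "\<Omega> \<subseteq> {0<..<2}" by auto
  then show "F \<in> L2 \<Omega>" "L2_norm \<Omega> F \<le> circle_norm F"
    using L2_mono[OF periodic_L2_D(3)[OF assms], of \<Omega>] by simp_all
qed

text \<open>One period is taken as (-1, 1) and folded at 0. The difference of the two halves is the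
  displacement at time 0, their sum up to sign the density of the velocity.\<close>

lemma circle_norm_halves:
  assumes "F \<in> periodic_L2"
  shows "(circle_norm F)\<^sup>2 = (L2_norm \<Omega> F)\<^sup>2 + (L2_norm \<Omega> (\<lambda>x. F (- x)))\<^sup>2"
proof -
  note F = periodic_L2_D[OF assms]
  have m: "(\<lambda>x. ennreal ((F x)\<^sup>2)) \<in> borel_measurable borel" "(\<lambda>x. ennreal ((F (- x))\<^sup>2)) \<in> borel_measurable borel"
    using F(1) by measurable
  note [measurable] = m
  have "ennreal ((circle_norm F)\<^sup>2) = (\<integral>\<^sup>+x. ennreal ((F x)\<^sup>2) * indicator {-1..<1} x \<partial>lborel)"
    using periodic_nn_integral[OF assms, of "-1"] by simp
  also have "\<dots> = (\<integral>\<^sup>+x. (ennreal ((F x)\<^sup>2) * indicator {0..<1} x + ennreal ((F x)\<^sup>2) * indicator {-1..<-0} x) \<partial>lborel)"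
    by (intro nn_integral_cong) (auto simp: indicator_def)
  also have "\<dots> = (\<integral>\<^sup>+x. ennreal ((F x)\<^sup>2) * indicator {0..<1} x \<partial>lborel) + (\<integral>\<^sup>+x. ennreal ((F x)\<^sup>2) * indicator {-1..<-0} x \<partial>lborel)"
    by (rule nn_integral_add) auto
  also have "(\<integral>\<^sup>+x. ennreal ((F x)\<^sup>2) * indicator {-1..<-0} x \<partial>lborel) = (\<integral>\<^sup>+x. ennreal ((F (- x))\<^sup>2) * indicator {0..<1} x \<partial>lborel)"
    by (rule nn_integral_reflect[OF m(1), symmetric])
  also have "\<dots> = ennreal ((L2_norm \<Omega> (\<lambda>x. F (- x)))\<^sup>2)"
    using L2_nn_integral(2)[OF _ _ periodic_L2_\<Omega>(1)[OF periodic_L2_reflect(1)[OF assms]]] F(1)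
      nn_integral_interval_open(1)[OF m(2), of 0 1] by simp
  also have "(\<integral>\<^sup>+x. ennreal ((F x)\<^sup>2) * indicator {0..<1} x \<partial>lborel) = ennreal ((L2_norm \<Omega> F)\<^sup>2)"
    using L2_nn_integral(2)[OF F(1) _ periodic_L2_\<Omega>(1)[OF assms]]
      nn_integral_interval_open(1)[OF m(1), of 0 1] by simp
  finally show ?thesis by (simp flip: ennreal_plus)
qed

section \<open>Borel representatives, density of trigonometric polynomials, completeness of the
  sines\<close>

lemma AE_lebesgue_on_iff:
  assumes S: "S \<in> sets borel"
  shows "(AE x in lebesgue_on S. R x) \<longleftrightarrow> (AE x in lborel. x \<in> S \<longrightarrow> R x)"
  using S by (simp add: AE_restrict_space_iff AE_completion_iff)

lemma measurable_borel_representative: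
  fixes f :: "'a::euclidean_space \<Rightarrow> real"
  assumes f: "f \<in> borel_measurable (lebesgue_on S)" and S: "S \<in> sets borel"
  obtains g where "g \<in> borel_measurable borel" "AE x in lebesgue_on S. f x = g x"
proof -
  have Sl: "S \<in> sets lebesgue" using S by simp
  have "(\<lambda>x. if x \<in> S then f x else 0) \<in> borel_measurable lebesgue"
    using f borel_measurable_if[OF Sl, of f] by simp
  then obtain g where g: "g \<in> borel_measurable lborel" "AE x in lborel. (if x \<in> S then f x else 0) = g x"
    using completion_ex_borel_measurable_real by blast
  have "AE x in lebesgue_on S. f x = g x"
    unfolding AE_lebesgue_on_iff[OF S] using g(2) by eventually_elim auto
  then show ?thesis using that[of g] g(1) by simp
qed

lemma L2_borel_representative:
  assumes f: "f \<in> L2 S" and S: "S \<in> sets borel"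
  obtains g where "g \<in> borel_measurable borel" "g \<in> L2 S" "AE x in lebesgue_on S. f x = g x"
proof -
  obtain g where g: "g \<in> borel_measurable borel" "AE x in lebesgue_on S. f x = g x"
    using measurable_borel_representative[OF L2_D(1)[OF f] S] by blast
  then show ?thesis using that L2_cong_AE[OF f borel_measurable_lebesgue_on[OF g(1)] g(2)] by blast
qed

lemma periodic_L2_halves:
  assumes f: "f \<in> L2 \<Omega>" and g: "g \<in> L2 \<Omega>"
  obtains F where "F \<in> periodic_L2" "AE x in lebesgue_on \<Omega>. F x = f x" "AE x in lebesgue_on \<Omega>. F (- x) = g x"
proof -
  obtain f' where f': "f' \<in> borel_measurable borel" "f' \<in> L2 \<Omega>" "AE x in lebesgue_on \<Omega>. f x = f' x"
    using L2_borel_representative[OF f] by auto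
  obtain g' where g': "g' \<in> borel_measurable borel" "g' \<in> L2 \<Omega>" "AE x in lebesgue_on \<Omega>. g x = g' x"
    using L2_borel_representative[OF g] by auto
  \<comment> \<open>The argument is reduced to its representative \<open>x\<close> in [-1, 1); there
    \<open>f'\<close> fills the right half and the reflection of \<open>g'\<close> the left
    half.\<close>
  define F where "F y = (let x = y - 2 * of_int \<lfloor>(y + 1) / 2\<rfloor> in if x \<ge> 0 then f' x else g' (- x))" for y :: real
  note [measurable] = f'(1) g'(1)
  have Fm [measurable]: "F \<in> borel_measurable borel" unfolding F_def Let_def by measurable
  have per: "F (x + 2) = F x" for x
  proof -
    have "(x + 2 + 1) / 2 = (x + 1) / 2 + of_int 1" by (simp add: field_simps)
    then have "\<lfloor>(x + 2 + 1) / 2\<rfloor> = \<lfloor>(x + 1) / 2\<rfloor> + 1" by (simp only: floor_add_int)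
    then show ?thesis by (simp add: F_def)
  qed
  have F1: "F x = f' x" if "x \<in> {0..<1}" for x
  proof -
    have "\<lfloor>(x + 1) / 2\<rfloor> = 0" using that by (simp add: floor_eq_iff)
    then show ?thesis using that by (simp add: F_def)
  qed
  have F2: "F (- x) = g' x" if "x \<in> {0<..<1}" for x
  proof -
    have "\<lfloor>(- x + 1) / 2\<rfloor> = 0" using that by (simp add: floor_eq_iff)
    then show ?thesis using that by (simp add: F_def)
  qed
  have m: "(\<lambda>x. ennreal ((F x)\<^sup>2)) \<in> borel_measurable borel" "(\<lambda>x. ennreal ((F (- x))\<^sup>2)) \<in> borel_measurable borel"
    by measurable
  have "(\<integral>\<^sup>+x. ennreal ((F x)\<^sup>2) * indicator {0..<2} x \<partial>lborel) = (\<integral>\<^sup>+x. ennreal ((F x)\<^sup>2) * indicator {-1..<-1+2} x \<partial>lborel)"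
    by (rule nn_integral_periodic[OF m(1), symmetric]) (simp add: per)
  also have "\<dots> = (\<integral>\<^sup>+x. (ennreal ((F x)\<^sup>2) * indicator {0..<1} x + ennreal ((F x)\<^sup>2) * indicator {-1..<-0} x) \<partial>lborel)"
    by (intro nn_integral_cong) (auto simp: indicator_def)
  also have "\<dots> = (\<integral>\<^sup>+x. ennreal ((F x)\<^sup>2) * indicator {0..<1} x \<partial>lborel) + (\<integral>\<^sup>+x. ennreal ((F x)\<^sup>2) * indicator {-1..<-0} x \<partial>lborel)"
    by (rule nn_integral_add) auto
  also have "(\<integral>\<^sup>+x. ennreal ((F x)\<^sup>2) * indicator {-1..<-0} x \<partial>lborel) = (\<integral>\<^sup>+x. ennreal ((F (- x))\<^sup>2) * indicator {0..<1} x \<partial>lborel)"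
    by (rule nn_integral_reflect[OF m(1), symmetric])
  also have "\<dots> = (\<integral>\<^sup>+x. ennreal ((g' x)\<^sup>2) * indicator {0<..<1} x \<partial>lborel)"
    unfolding nn_integral_interval_open(1)[OF m(2), symmetric]
    by (intro nn_integral_cong) (auto simp: indicator_def F2)
  also have "\<dots> = ennreal ((L2_norm \<Omega> g')\<^sup>2)" by (rule L2_nn_integral(2)[OF g'(1) _ g'(2)]) simp
  also have "(\<integral>\<^sup>+x. ennreal ((F x)\<^sup>2) * indicator {0..<1} x \<partial>lborel) = (\<integral>\<^sup>+x. ennreal ((f' x)\<^sup>2) * indicator {0<..<1} x \<partial>lborel)"
    unfolding nn_integral_interval_open(1)[OF m(1), symmetric]
    by (intro nn_integral_cong) (auto simp: indicator_def F1)
  also have "\<dots> = ennreal ((L2_norm \<Omega> f')\<^sup>2)" by (rule L2_nn_integral(2)[OF f'(1) _ f'(2)]) simp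
  also have "\<dots> + ennreal ((L2_norm \<Omega> g')\<^sup>2) = ennreal ((sqrt ((L2_norm \<Omega> f')\<^sup>2 + (L2_norm \<Omega> g')\<^sup>2))\<^sup>2)"
    by simp
  finally have "F \<in> periodic_L2" by (rule circle_norm_eqI(1)[OF Fm per]) simp
  moreover have "AE x in lebesgue_on \<Omega>. F x = f x"
    using lebesgue_on_mono[OF f'(3), of "\<lambda>x. F x = f x"] F1 by simp
  moreover have "AE x in lebesgue_on \<Omega>. F (- x) = g x"
    using lebesgue_on_mono[OF g'(3), of "\<lambda>x. F (- x) = g x"] F2 by simp
  ultimately show ?thesis using that by blast
qed

text \<open>The substitution c = cos (\<pi> x) maps [0, 1] homeomorphically onto [-1, 1], where
  Weierstrass approximation by polynomials in c applies.\<close>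

lemma cos_polynomial_dense:
  assumes f: "f \<in> L2 \<Omega>" and e: "e > 0"
  obtains a n where "L2_norm \<Omega> (\<lambda>x. f x - (\<Sum>i\<le>n::nat. a i * cos (pi * x) ^ i)) < e"
proof -
  obtain g B where g: "continuous_on UNIV g" "\<And>x. \<bar>g x\<bar> \<le> B" "L2_norm \<Omega> (\<lambda>x. f x - g x) < e / 2"
    using L2_continuous_dense[OF lmeasurable_\<Omega> f, of "e / 2"] e by auto
  have "continuous_on {-1..1} (\<lambda>c. g (arccos c / pi))"
    by (rule continuous_on_compose2[OF g(1)]) (auto intro!: continuous_intros)
  then obtain p where p: "real_polynomial_function p" "\<And>c. c \<in> {-1..1} \<Longrightarrow> \<bar>g (arccos c / pi) - p c\<bar> < e / 2"
    using Stone_Weierstrass_real_polynomial_function[of "{-1..1::real}" "\<lambda>c. g (arccos c / pi)" "e / 2"] e by auto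
  obtain a n where a: "p = (\<lambda>x. \<Sum>i\<le>n. a i * x ^ i)" using p(1) real_polynomial_function_iff_sum by blast
  let ?q = "\<lambda>x. \<Sum>i\<le>n::nat. a i * cos (pi * x) ^ i"
  have gL: "g \<in> L2 \<Omega>" by (rule L2_continuous_on_closed[OF continuous_on_subset[OF g(1)]]) simp
  have qL: "?q \<in> L2 \<Omega>" by (rule L2_continuous_on_closed) (intro continuous_intros)
  have "AE x in lebesgue_on \<Omega>. \<bar>g x - ?q x\<bar> \<le> e / 2"
  proof (rule AE_I2)
    fix x assume "x \<in> space (lebesgue_on \<Omega>)"
    then have x: "0 < x" "x < 1" by auto
    have "arccos (cos (pi * x)) = pi * x" using x by (intro arccos_cos) auto
    then show "\<bar>g x - ?q x\<bar> \<le> e / 2" using p(2)[of "cos (pi * x)"] by (simp add: a)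
  qed
  then have "L2_norm \<Omega> (\<lambda>x. g x - ?q x) \<le> \<bar>e / 2\<bar> * sqrt (measure lebesgue \<Omega>)"
    by (rule L2_bounded(2)[OF lmeasurable_\<Omega> L2_D(1)[OF L2_diff[OF gL qL]]])
  then have "L2_norm \<Omega> (\<lambda>x. f x - ?q x) < e"
    using L2_norm_triangle3[OF f gL qL] g(3) e by simp
  then show ?thesis using that by blast
qed

text \<open>Dividing \<open>f\<close> by sin (\<pi> x) may leave L2 near the end points. The
  regularised quotient \<open>m n\<close> times \<open>f\<close> stays in L2 and is approximated by
  polynomials in the cosine; multiplication by the sine does not increase norms and leads back close
  to \<open>f\<close>.\<close>

lemma sin_cos_polynomial_dense:
  assumes f: "f \<in> L2 \<Omega>" and e: "e > 0"
  obtains a n where "L2_norm \<Omega> (\<lambda>x. f x - sin (pi * x) * (\<Sum>i\<le>n::nat. a i * cos (pi * x) ^ i)) < e"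
proof -
  define i where "i n = inverse (real (Suc n))" for n
  have i: "i n > 0" for n by (simp add: i_def)
  define m where "m n x = sin (pi * x) / ((sin (pi * x))\<^sup>2 + i n)" for n x
  have den: "0 < (sin (pi * x))\<^sup>2 + i n" for n x using i[of n] by (simp add: add_nonneg_pos)
  have mc: "continuous_on UNIV (m n)" for n
    unfolding m_def using den by (intro continuous_intros) (auto simp: less_le)
  have mb: "\<bar>m n x\<bar> \<le> inverse (i n)" for n x
  proof -
    have "\<bar>m n x\<bar> = \<bar>sin (pi * x)\<bar> / ((sin (pi * x))\<^sup>2 + i n)" using den[of x n] by (simp add: m_def abs_of_pos)
    also have "\<dots> \<le> 1 / i n" using i[of n] by (intro frac_le) auto
    finally show ?thesis by (simp add: inverse_eq_divide)
  qed
  have mm: "m n \<in> borel_measurable (lebesgue_on \<Omega>)" for n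
    by (rule continuous_imp_lebesgue_on_measurable[OF mc])
  have kL: "(\<lambda>x. m n x * f x) \<in> L2 \<Omega>" for n
    by (rule L2_mult_bounded(1)[OF f mm AE_I2]) (rule mb)
  have sm: "(\<lambda>x. sin (pi * x)) \<in> borel_measurable (lebesgue_on \<Omega>)"
    by (intro continuous_imp_lebesgue_on_measurable continuous_intros)
  have skL: "(\<lambda>x. sin (pi * x) * (m n x * f x)) \<in> L2 \<Omega>" for n
    by (rule L2_mult_bounded(1)[OF kL sm AE_I2[where P="\<lambda>x. \<bar>sin (pi * x)\<bar> \<le> 1"]]) simp
  have "(\<lambda>n. L2_norm \<Omega> (\<lambda>x. sin (pi * x) * (m n x * f x) - f x)) \<longlonglongrightarrow> 0"
  proof (rule L2_dominated_convergence[OF L2_D(1)[OF skL] L2_D(1)[OF f] L2_abs[OF f]])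
    have eq: "sin (pi * x) * (m n x * f x) = (sin (pi * x))\<^sup>2 / ((sin (pi * x))\<^sup>2 + i n) * f x" for n x
      by (simp add: m_def power2_eq_square)
    show "AE x in lebesgue_on \<Omega>. (\<lambda>n. sin (pi * x) * (m n x * f x)) \<longlonglongrightarrow> f x"
    proof (rule AE_I2)
      fix x assume "x \<in> space (lebesgue_on \<Omega>)"
      then have s: "sin (pi * x) > 0" by (intro sin_gt_zero) auto
      have "(\<lambda>n. (sin (pi * x))\<^sup>2 / ((sin (pi * x))\<^sup>2 + i n) * f x) \<longlonglongrightarrow> (sin (pi * x))\<^sup>2 / ((sin (pi * x))\<^sup>2 + 0) * f x"
        unfolding i_def using s by (intro tendsto_intros LIMSEQ_inverse_real_of_nat) auto
      then show "(\<lambda>n. sin (pi * x) * (m n x * f x)) \<longlonglongrightarrow> f x" using s by (simp add: eq)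
    qed
    show "AE x in lebesgue_on \<Omega>. \<bar>sin (pi * x) * (m n x * f x) - f x\<bar> \<le> \<bar>f x\<bar>" for n
    proof (rule AE_I2)
      fix x
      have "sin (pi * x) * (m n x * f x) - f x = ((sin (pi * x))\<^sup>2 / ((sin (pi * x))\<^sup>2 + i n) - 1) * f x"
        by (simp add: eq left_diff_distrib)
      moreover have "0 \<le> (sin (pi * x))\<^sup>2 / ((sin (pi * x))\<^sup>2 + i n)" "(sin (pi * x))\<^sup>2 / ((sin (pi * x))\<^sup>2 + i n) \<le> 1"
        using den[of x n] i[of n] by (simp_all add: pos_divide_le_eq less_imp_le)
      then have "\<bar>(sin (pi * x))\<^sup>2 / ((sin (pi * x))\<^sup>2 + i n) - 1\<bar> \<le> 1" by linarith
      then have "\<bar>(sin (pi * x))\<^sup>2 / ((sin (pi * x))\<^sup>2 + i n) - 1\<bar> * \<bar>f x\<bar> \<le> 1 * \<bar>f x\<bar>" by (rule mult_right_mono) simp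
      ultimately show "\<bar>sin (pi * x) * (m n x * f x) - f x\<bar> \<le> \<bar>f x\<bar>" by (simp add: abs_mult)
    qed
  qed
  then have "\<forall>\<^sub>F n in sequentially. L2_norm \<Omega> (\<lambda>x. sin (pi * x) * (m n x * f x) - f x) < e / 2"
    by (rule order_tendstoD(2)) (use e in simp)
  then obtain N where N: "L2_norm \<Omega> (\<lambda>x. sin (pi * x) * (m N x * f x) - f x) < e / 2"
    by (auto simp: eventually_sequentially)
  obtain a n where a: "L2_norm \<Omega> (\<lambda>x. m N x * f x - (\<Sum>i\<le>n::nat. a i * cos (pi * x) ^ i)) < e / 2"
    using cos_polynomial_dense[OF kL, of "e/2"] e by auto
  let ?q = "\<lambda>x. \<Sum>i\<le>n::nat. a i * cos (pi * x) ^ i"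
  have qL: "?q \<in> L2 \<Omega>" "(\<lambda>x. sin (pi * x) * ?q x) \<in> L2 \<Omega>"
    by (rule L2_continuous_on_closed, intro continuous_intros)+
  have "L2_norm \<Omega> (\<lambda>x. sin (pi * x) * (m N x * f x - ?q x)) \<le> \<bar>1\<bar> * L2_norm \<Omega> (\<lambda>x. m N x * f x - ?q x)"
    by (rule L2_mult_bounded(2)[OF L2_diff[OF kL qL(1)] sm AE_I2]) simp
  then have "L2_norm \<Omega> (\<lambda>x. sin (pi * x) * (m N x * f x) - sin (pi * x) * ?q x) < e / 2"
    using a by (simp add: right_diff_distrib)
  then have "L2_norm \<Omega> (\<lambda>x. f x - sin (pi * x) * ?q x) < e"
    using L2_norm_triangle3[OF f skL[of N] qL(2)] N L2_norm_minus_commute[of \<Omega> f] by simp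
  then show ?thesis using that by blast
qed

lemma trig_periodic_L2:
  "(\<lambda>x. cos (of_int k * pi * x)) \<in> periodic_L2" "(\<lambda>x. sin (of_int k * pi * x)) \<in> periodic_L2"
proof -
  have eq: "of_int k * pi * (x + 2) = of_int k * pi * x + 2 * pi * of_int k" for x :: real by (simp add: algebra_simps)
  have c: "cos (2 * pi * of_int k) = 1" "sin (2 * pi * of_int k) = 0" by (simp_all add: cos_int_2pin sin_int_2pin)
  have "cos (of_int k * pi * (x + 2)) = cos (of_int k * pi * x)" "sin (of_int k * pi * (x + 2)) = sin (of_int k * pi * x)" for x :: real
    unfolding eq cos_add sin_add c by simp_all
  moreover have "(\<lambda>x. cos (of_int k * pi * x)) \<in> L2 {0<..<2}" "(\<lambda>x. sin (of_int k * pi * x)) \<in> L2 {0<..<2}"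
    by (rule L2_continuous_on_closed, intro continuous_intros)+
  ultimately show "(\<lambda>x. cos (of_int k * pi * x)) \<in> periodic_L2" "(\<lambda>x. sin (of_int k * pi * x)) \<in> periodic_L2"
    unfolding periodic_L2_def by auto
qed

text \<open>Density of trigonometric polynomials as an induction principle: the even part of \<open>F\<close> is
  approximated by polynomials in \<open>cos (\<pi>x)\<close>, the odd part by \<open>sin (\<pi>x)\<close> times such polynomials.\<close>

lemma periodic_L2_induct [consumes 1, case_names cos sin lin closed]:
  assumes F: "F \<in> periodic_L2"
    and cos: "\<And>k::int. R (\<lambda>x. cos (of_int k * pi * x))"
    and sin: "\<And>k::int. R (\<lambda>x. sin (of_int k * pi * x))"
    and lin: "\<And>F G s t. F \<in> periodic_L2 \<Longrightarrow> G \<in> periodic_L2 \<Longrightarrow> R F \<Longrightarrow> R G \<Longrightarrow> R (\<lambda>x. s * F x + t * G x)"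
    and closed: "\<And>F Fs. F \<in> periodic_L2 \<Longrightarrow> (\<And>n. Fs n \<in> periodic_L2) \<Longrightarrow> (\<And>n::nat. R (Fs n)) \<Longrightarrow>
      (\<lambda>n. circle_norm (\<lambda>x. Fs n x - F x)) \<longlonglongrightarrow> 0 \<Longrightarrow> R F"
  shows "R F"
proof -
  \<comment> \<open>Membership is carried along because the rules \<open>lin\<close> and
    \<open>closed\<close> ask for it.\<close>
  define R' where "R' F \<longleftrightarrow> F \<in> periodic_L2 \<and> R F" for F
  have R'lin: "R' (\<lambda>x. s * F x + t * G x)" if "R' F" "R' G" for F G s t
    using that lin periodic_L2_lin unfolding R'_def by blast
  \<comment> \<open>Powers of cos (\<pi> x) are built up one factor at a time by the product-to-sum
    formulas; each factor shifts the frequency by one in both directions.\<close>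
  have base: "R' (\<lambda>x. cos (pi * x) ^ i * cos (of_int k * pi * x)) \<and> R' (\<lambda>x. cos (pi * x) ^ i * sin (of_int k * pi * x))" for i k
  proof (induction i arbitrary: k)
    case 0
    show ?case using cos sin trig_periodic_L2 by (simp add: R'_def)
  next
    case (Suc i)
    have e: "of_int (k + 1) * pi * x = of_int k * pi * x + pi * x" "of_int (k - 1) * pi * x = of_int k * pi * x - pi * x" for x :: real
      by (simp_all add: algebra_simps)
    have "(\<lambda>x. cos (pi * x) ^ Suc i * cos (of_int k * pi * x)) = (\<lambda>x. 1/2 * (cos (pi * x) ^ i * cos (of_int (k + 1) * pi * x))
        + 1/2 * (cos (pi * x) ^ i * cos (of_int (k - 1) * pi * x)))"
      unfolding e cos_add cos_diff by (auto simp: algebra_simps)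
    moreover have "(\<lambda>x. cos (pi * x) ^ Suc i * sin (of_int k * pi * x)) = (\<lambda>x. 1/2 * (cos (pi * x) ^ i * sin (of_int (k + 1) * pi * x))
        + 1/2 * (cos (pi * x) ^ i * sin (of_int (k - 1) * pi * x)))"
      unfolding e sin_add sin_diff by (auto simp: algebra_simps)
    ultimately show ?case using Suc.IH[of "k + 1"] Suc.IH[of "k - 1"] R'lin by (simp only:)
  qed
  have R0: "R' (\<lambda>x. 0)" using R'lin[of _ _ 0 0] base[of 0 0] by simp
  have cosp: "R' (\<lambda>x. \<Sum>i\<le>n::nat. a i * cos (pi * x) ^ i)" for a n
  proof (induction n)
    case 0
    show ?case using R'lin[OF base[THEN conjunct1, of 0 0] R0, of "a 0" 0] by simp
  next
    case (Suc n)
    show ?case using R'lin[OF Suc base[THEN conjunct1, of "Suc n" 0], of 1 "a (Suc n)"] by simp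
  qed
  have sinp: "R' (\<lambda>x. sin (pi * x) * (\<Sum>i\<le>n::nat. a i * cos (pi * x) ^ i))" for a n
  proof (induction n)
    case 0
    show ?case using R'lin[OF base[THEN conjunct2, of 0 1] R0, of "a 0" 0] by (simp add: mult.commute)
  next
    case (Suc n)
    show ?case using R'lin[OF Suc base[THEN conjunct2, of "Suc n" 1], of 1 "a (Suc n)"]
      by (simp add: distrib_left mult.commute mult.left_commute)
  qed
  note Fr = periodic_L2_reflect(1)[OF F]
  define c where "c x = (F x + F (- x)) / 2" for x
  define s where "s x = (F x - F (- x)) / 2" for x
  have cL: "c \<in> L2 \<Omega>" "s \<in> L2 \<Omega>"
    using periodic_L2_\<Omega>(1)[OF periodic_L2_lin[OF F Fr, of "1/2" "1/2"]] periodic_L2_\<Omega>(1)[OF periodic_L2_lin[OF F Fr, of "1/2" "-1/2"]]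
    by (simp_all add: c_def[abs_def] s_def[abs_def] diff_divide_distrib add_divide_distrib)
  have "\<exists>G. R' G \<and> circle_norm (\<lambda>x. G x - F x) \<le> 2 * inverse (real (Suc n))" for n
  proof -
    let ?e = "inverse (real (Suc n))"
    obtain a k where a: "L2_norm \<Omega> (\<lambda>x. c x - (\<Sum>i\<le>k::nat. a i * cos (pi * x) ^ i)) < ?e"
      using cos_polynomial_dense[OF cL(1), of ?e] by auto
    obtain b l where b: "L2_norm \<Omega> (\<lambda>x. s x - sin (pi * x) * (\<Sum>i\<le>l::nat. b i * cos (pi * x) ^ i)) < ?e"
      using sin_cos_polynomial_dense[OF cL(2), of ?e] by auto
    define C where "C x = (\<Sum>i\<le>k::nat. a i * cos (pi * x) ^ i)" for x
    define S where "S x = sin (pi * x) * (\<Sum>i\<le>l::nat. b i * cos (pi * x) ^ i)" for x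
    have CS: "C (- x) = C x" "S (- x) = - S x" for x by (simp_all add: C_def S_def)
    have RG: "R' (\<lambda>x. 1 * C x + 1 * S x)" unfolding C_def S_def by (rule R'lin[OF cosp sinp])
    define G where "G x = C x + S x" for x
    have G: "R' G" using RG by (simp add: G_def[abs_def])
    have GF: "(\<lambda>x. G x - F x) \<in> periodic_L2" using G F periodic_L2_diff by (simp add: R'_def)
    define p where "p x = C x - c x" for x
    define q where "q x = S x - s x" for x
    have pq: "p \<in> L2 \<Omega>" "q \<in> L2 \<Omega>" using cosp[of a k] sinp[of b l] periodic_L2_\<Omega>(1) cL
      by (auto simp: R'_def p_def[abs_def] q_def[abs_def] C_def[abs_def] S_def[abs_def] intro!: L2_diff)
    have n: "L2_norm \<Omega> p \<le> ?e" "L2_norm \<Omega> q \<le> ?e"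
      using a b L2_norm_minus_commute[of \<Omega> c C] L2_norm_minus_commute[of \<Omega> s S]
      by (simp_all add: p_def[abs_def] q_def[abs_def] C_def[abs_def] S_def[abs_def])
    have e1: "(\<lambda>x. G x - F x) = (\<lambda>x. p x + q x)"
      by (auto simp: p_def q_def G_def c_def s_def field_simps)
    have e2: "(\<lambda>x. G (- x) - F (- x)) = (\<lambda>x. p x - q x)"
      by (auto simp: p_def q_def G_def c_def s_def CS field_simps)
    have "L2_norm \<Omega> (\<lambda>x. p x + q x) \<le> 2 * ?e" "L2_norm \<Omega> (\<lambda>x. p x - q x) \<le> 2 * ?e"
      using L2_norm_triangle[OF pq] L2_norm_triangle_diff[OF pq] n by linarith+
    \<comment> \<open>The errors \<open>p\<close> of the even part and \<open>q\<close> of the odd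
      part are orthogonal on the circle: after folding, the cross terms cancel.\<close>
    have "(circle_norm (\<lambda>x. G x - F x))\<^sup>2 = (L2_norm \<Omega> (\<lambda>x. p x + q x))\<^sup>2 + (L2_norm \<Omega> (\<lambda>x. p x - q x))\<^sup>2"
      using circle_norm_halves[OF GF] unfolding e1 e2 .
    also have "\<dots> = 2 * (L2_norm \<Omega> p)\<^sup>2 + 2 * (L2_norm \<Omega> q)\<^sup>2"
    proof -
      have i: "(\<lambda>x. (p x + q x)\<^sup>2) = (\<lambda>x. (p x)\<^sup>2 + (q x)\<^sup>2 + 2 * (p x * q x))"
        "(\<lambda>x. (p x - q x)\<^sup>2) = (\<lambda>x. (p x)\<^sup>2 + (q x)\<^sup>2 - 2 * (p x * q x))"
        by (auto simp: power2_eq_square algebra_simps)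
      show ?thesis unfolding L2_norm_square i
        using L2_D(2)[OF pq(1)] L2_D(2)[OF pq(2)] L2_mult_integrable[OF pq] by simp
    qed
    also have "\<dots> \<le> 2 * ?e\<^sup>2 + 2 * ?e\<^sup>2" using n by (intro add_mono mult_left_mono power_mono) auto
    also have "\<dots> = (2 * ?e)\<^sup>2" by (simp add: power_mult_distrib)
    finally have "circle_norm (\<lambda>x. G x - F x) \<le> 2 * ?e" by (rule power2_le_imp_le) simp
    then show ?thesis using G by blast
  qed
  then obtain G where G: "\<And>n. R' (G n)" "\<And>n. circle_norm (\<lambda>x. G n x - F x) \<le> 2 * inverse (real (Suc n))" by metis
  have "(\<lambda>n. circle_norm (\<lambda>x. G n x - F x)) \<longlonglongrightarrow> 0"
  proof (rule Lim_null_comparison)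
    show "(\<lambda>n. 2 * inverse (real (Suc n))) \<longlonglongrightarrow> 0"
      using tendsto_mult_left[OF LIMSEQ_inverse_real_of_nat, of 2] by simp
  qed (use G(2) in simp)
  then show ?thesis using closed[OF F, of G] G(1) by (simp add: R'_def)
qed

text \<open>Extend \<open>h\<close> to an odd periodic function. Pairing \<open>h\<close> with twice
  the odd part of a periodic function is continuous, vanishes on sines by hypothesis and on cosines
  by parity, hence everywhere; on the extension itself it equals twice the squared norm of
  \<open>h\<close>.\<close>

lemma sine_complete:
  assumes h: "h \<in> L2 \<Omega>" and orth: "\<And>k::int. (\<integral>x. h x * sin (of_int k * pi * x) \<partial>lebesgue_on \<Omega>) = 0"
  shows "AE x in lebesgue_on \<Omega>. h x = 0"
proof -
  obtain F where F: "F \<in> periodic_L2" "AE x in lebesgue_on \<Omega>. F x = h x" "AE x in lebesgue_on \<Omega>. F (- x) = - h x"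
    using periodic_L2_halves[OF h L2_uminus[OF h]] by blast
  have oL: "(\<lambda>x. E x - E (- x)) \<in> L2 \<Omega>" if "E \<in> periodic_L2" for E
    by (intro L2_diff periodic_L2_\<Omega>(1) periodic_L2_reflect(1) that)
  have "(\<integral>x. h x * (F x - F (- x)) \<partial>lebesgue_on \<Omega>) = 0"
    using F(1)
  proof (induction rule: periodic_L2_induct)
    case (sin k)
    have "h x * (sin (of_int k * pi * x) - sin (of_int k * pi * - x)) = 2 * (h x * sin (of_int k * pi * x))" for x by simp
    then have "(\<integral>x. h x * (sin (of_int k * pi * x) - sin (of_int k * pi * - x)) \<partial>lebesgue_on \<Omega>)
      = 2 * (\<integral>x. h x * sin (of_int k * pi * x) \<partial>lebesgue_on \<Omega>)"
      by (simp only: integral_mult_right_zero)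
    then show ?case unfolding orth by simp
  next
    case (lin F G s t)
    have "h x * (s * F x + t * G x - (s * F (- x) + t * G (- x))) = s * (h x * (F x - F (- x))) + t * (h x * (G x - G (- x)))" for x
      by (simp add: algebra_simps)
    then show ?case
      using L2_mult_integrable[OF h oL[OF lin(1)]] L2_mult_integrable[OF h oL[OF lin(2)]] lin(3,4) by simp
  next
    case (closed F Fs)
    have "(\<lambda>n. L2_norm \<Omega> (\<lambda>x. (Fs n x - Fs n (- x)) - (F x - F (- x)))) \<longlonglongrightarrow> 0"
    proof (rule Lim_null_comparison)
      show "(\<lambda>n. 2 * circle_norm (\<lambda>x. Fs n x - F x)) \<longlonglongrightarrow> 0"
        using tendsto_mult_left[OF closed(3), of 2] by simp
      show "\<forall>\<^sub>F n in sequentially. norm (L2_norm \<Omega> (\<lambda>x. (Fs n x - Fs n (- x)) - (F x - F (- x)))) \<le> 2 * circle_norm (\<lambda>x. Fs n x - F x)"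
      proof (intro always_eventually allI)
        fix n
        note d = periodic_L2_diff[OF closed(2)[of n] closed(1)]
        have "L2_norm \<Omega> (\<lambda>x. (Fs n x - F x) - (Fs n (- x) - F (- x))) \<le> circle_norm (\<lambda>x. Fs n x - F x) + circle_norm (\<lambda>x. Fs n x - F x)"
          using L2_norm_triangle_diff[OF periodic_L2_\<Omega>(1)[OF d] periodic_L2_\<Omega>(1)[OF periodic_L2_reflect(1)[OF d]]]
            periodic_L2_\<Omega>(2)[OF d] periodic_L2_\<Omega>(2)[OF periodic_L2_reflect(1)[OF d]] periodic_L2_reflect(2)[OF d]
          by simp
        then show "norm (L2_norm \<Omega> (\<lambda>x. (Fs n x - Fs n (- x)) - (F x - F (- x)))) \<le> 2 * circle_norm (\<lambda>x. Fs n x - F x)"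
          by (simp add: algebra_simps)
      qed
    qed
    from L2_tendsto_integral[OF oL[OF closed(2)] oL[OF closed(1)] h this]
    have "(\<lambda>n. 0) \<longlonglongrightarrow> (\<integral>x. (F x - F (- x)) * h x \<partial>lebesgue_on \<Omega>)"
      using closed(4) by (simp add: mult.commute)
    then show ?case by (simp add: LIMSEQ_const_iff mult.commute)
  qed simp
  also have "(\<integral>x. h x * (F x - F (- x)) \<partial>lebesgue_on \<Omega>) = (\<integral>x. 2 * (h x)\<^sup>2 \<partial>lebesgue_on \<Omega>)"
  proof (rule integral_cong_AE)
    show "(\<lambda>x. h x * (F x - F (- x))) \<in> borel_measurable (lebesgue_on \<Omega>)"
      by (intro borel_measurable_integrable L2_mult_integrable h oL F)
    show "(\<lambda>x. 2 * (h x)\<^sup>2) \<in> borel_measurable (lebesgue_on \<Omega>)" using L2_D(1)[OF h] by measurable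
    show "AE x in lebesgue_on \<Omega>. h x * (F x - F (- x)) = 2 * (h x)\<^sup>2"
      using F(2,3) by eventually_elim (simp add: power2_eq_square)
  qed
  finally have "L2_norm \<Omega> h = 0" by (simp add: L2_norm_def)
  then show ?thesis by (rule L2_norm_eq_0[OF h])
qed

section \<open>Continuity of translations in L2 of the circle\<close>

lemma abs_cos_sin_diff_le:
  "\<bar>cos a - cos b\<bar> \<le> \<bar>a - b :: real\<bar>" "\<bar>sin a - sin b\<bar> \<le> \<bar>a - b\<bar>"
proof -
  have "\<bar>2 * (x * y)\<bar> \<le> \<bar>a - b\<bar>" if "\<bar>x\<bar> \<le> 1" "\<bar>y\<bar> \<le> \<bar>(a - b) / 2\<bar>" for x y
    using mult_mono[OF that] by (simp add: abs_mult)
  note bound = this[of _ "sin ((a - b) / 2)", OF _ abs_sin_x_le_abs_x]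
  have "(b - a) / 2 = - ((a - b) / 2)" by (simp add: field_simps)
  then have "cos a - cos b = 2 * (- sin ((a + b) / 2) * sin ((a - b) / 2))"
    unfolding cos_diff_cos by (simp only: sin_minus mult_minus_left mult_minus_right)
  then show "\<bar>cos a - cos b\<bar> \<le> \<bar>a - b\<bar>" using bound[of "- sin ((a + b) / 2)"] by simp
  have "sin a - sin b = 2 * (cos ((a + b) / 2) * sin ((a - b) / 2))"
    unfolding sin_diff_sin by simp
  then show "\<bar>sin a - sin b\<bar> \<le> \<bar>a - b\<bar>" using bound[of "cos ((a + b) / 2)"] by simp
qed

text \<open>Sines and cosines are Lipschitz, and translations are isometries of the circle norm, so
  the property survives linear combinations and limits.\<close>

lemma translation_continuous:
  assumes "F \<in> periodic_L2"
  shows "((\<lambda>s. circle_norm (\<lambda>x. F (s + x) - F (t + x))) \<longlongrightarrow> 0) (at t)"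
  using assms
proof (induction rule: periodic_L2_induct)
  have *: "((\<lambda>s. circle_norm (\<lambda>x. F (s + x) - F (t + x))) \<longlongrightarrow> 0) (at t)"
    if F: "F \<in> periodic_L2" and L: "\<And>x y. \<bar>F x - F y\<bar> \<le> L * \<bar>x - y\<bar>" for F L
  proof (rule Lim_null_comparison)
    have "((\<lambda>s. \<bar>L * \<bar>s - t\<bar>\<bar> * sqrt 2) \<longlongrightarrow> \<bar>L * \<bar>t - t\<bar>\<bar> * sqrt 2) (at t)" by (intro tendsto_intros)
    then show "((\<lambda>s. \<bar>L * \<bar>s - t\<bar>\<bar> * sqrt 2) \<longlongrightarrow> 0) (at t)" by simp
    show "\<forall>\<^sub>F s in at t. norm (circle_norm (\<lambda>x. F (s + x) - F (t + x))) \<le> \<bar>L * \<bar>s - t\<bar>\<bar> * sqrt 2"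
    proof (intro always_eventually allI)
      fix s
      have "AE x in lebesgue_on {0<..<2}. \<bar>F (s + x) - F (t + x)\<bar> \<le> L * \<bar>s - t\<bar>"
      proof (rule AE_I2)
        fix x show "\<bar>F (s + x) - F (t + x)\<bar> \<le> L * \<bar>s - t\<bar>" using L[of "s + x" "t + x"] by simp
      qed
      from L2_bounded(2)[OF _ L2_D(1)[OF periodic_L2_D(3)[OF periodic_L2_diff[OF periodic_L2_shift(1)[OF F] periodic_L2_shift(1)[OF F]]]] this]
      show "norm (circle_norm (\<lambda>x. F (s + x) - F (t + x))) \<le> \<bar>L * \<bar>s - t\<bar>\<bar> * sqrt 2" by simp
    qed
  qed
  {
    case (cos k)
    show ?case
    proof (rule *[OF trig_periodic_L2(1)])
      show "\<bar>cos (of_int k * pi * x) - cos (of_int k * pi * y)\<bar> \<le> \<bar>of_int k * pi\<bar> * \<bar>x - y\<bar>" for x y :: real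
        using abs_cos_sin_diff_le(1)[of "of_int k * pi * x" "of_int k * pi * y"] by (simp flip: abs_mult right_diff_distrib)
    qed
  next
    case (sin k)
    show ?case
    proof (rule *[OF trig_periodic_L2(2)])
      show "\<bar>sin (of_int k * pi * x) - sin (of_int k * pi * y)\<bar> \<le> \<bar>of_int k * pi\<bar> * \<bar>x - y\<bar>" for x y :: real
        using abs_cos_sin_diff_le(2)[of "of_int k * pi * x" "of_int k * pi * y"] by (simp flip: abs_mult right_diff_distrib)
    qed
  }
next
  case (lin F G a b)
  show ?case
  proof (rule Lim_null_comparison)
    have "((\<lambda>s. \<bar>a\<bar> * circle_norm (\<lambda>x. F (s + x) - F (t + x)) + \<bar>b\<bar> * circle_norm (\<lambda>x. G (s + x) - G (t + x))) \<longlongrightarrow> \<bar>a\<bar> * 0 + \<bar>b\<bar> * 0) (at t)"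
      by (intro tendsto_intros lin)
    then show "((\<lambda>s. \<bar>a\<bar> * circle_norm (\<lambda>x. F (s + x) - F (t + x)) + \<bar>b\<bar> * circle_norm (\<lambda>x. G (s + x) - G (t + x))) \<longlongrightarrow> 0) (at t)"
      by simp
    show "\<forall>\<^sub>F s in at t. norm (circle_norm (\<lambda>x. a * F (s + x) + b * G (s + x) - (a * F (t + x) + b * G (t + x))))
        \<le> \<bar>a\<bar> * circle_norm (\<lambda>x. F (s + x) - F (t + x)) + \<bar>b\<bar> * circle_norm (\<lambda>x. G (s + x) - G (t + x))"
    proof (intro always_eventually allI)
      fix s
      have "(\<lambda>x. a * F (s + x) + b * G (s + x) - (a * F (t + x) + b * G (t + x)))
        = (\<lambda>x. a * (F (s + x) - F (t + x)) + b * (G (s + x) - G (t + x)))" by (auto simp: algebra_simps)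
      then show "norm (circle_norm (\<lambda>x. a * F (s + x) + b * G (s + x) - (a * F (t + x) + b * G (t + x))))
        \<le> \<bar>a\<bar> * circle_norm (\<lambda>x. F (s + x) - F (t + x)) + \<bar>b\<bar> * circle_norm (\<lambda>x. G (s + x) - G (t + x))"
        using L2_norm_lin[OF periodic_L2_D(3)[OF periodic_L2_diff[OF periodic_L2_shift(1)[OF lin(1)] periodic_L2_shift(1)[OF lin(1)]]]
            periodic_L2_D(3)[OF periodic_L2_diff[OF periodic_L2_shift(1)[OF lin(2)] periodic_L2_shift(1)[OF lin(2)]]], of a s t b s t]
        by simp
    qed
  qed
next
  case (closed F Fs)
  show ?case
  proof (rule tendstoI)
    fix e :: real assume e: "e > 0"
    obtain n where n: "circle_norm (\<lambda>x. Fs n x - F x) < e / 4"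
      using order_tendstoD(2)[OF closed(3), of "e / 4"] e by (auto simp: eventually_sequentially)
    have "\<forall>\<^sub>F s in at t. circle_norm (\<lambda>x. Fs n (s + x) - Fs n (t + x)) < e / 4"
      by (rule order_tendstoD(2)[OF closed(4)]) (use e in simp)
    then show "\<forall>\<^sub>F s in at t. dist (circle_norm (\<lambda>x. F (s + x) - F (t + x))) 0 < e"
    proof eventually_elim
      case (elim s)
      have sh: "circle_norm (\<lambda>x. F (r + x) - Fs n (r + x)) < e / 4" for r
        using n periodic_L2_shift(2)[OF periodic_L2_diff[OF closed(1) closed(2)[of n]], of r]
          L2_norm_minus_commute[of _ "Fs n" F] by simp
      note m = periodic_L2_D(3)[OF periodic_L2_shift(1)[OF closed(1)]] periodic_L2_D(3)[OF periodic_L2_shift(1)[OF closed(2)]]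
      have "circle_norm (\<lambda>x. F (s + x) - F (t + x)) \<le> circle_norm (\<lambda>x. F (s + x) - Fs n (s + x)) + circle_norm (\<lambda>x. Fs n (s + x) - F (t + x))"
        by (rule L2_norm_triangle3[OF m(1) m(2) m(1)])
      also have "circle_norm (\<lambda>x. Fs n (s + x) - F (t + x)) \<le> circle_norm (\<lambda>x. Fs n (s + x) - Fs n (t + x)) + circle_norm (\<lambda>x. Fs n (t + x) - F (t + x))"
        by (rule L2_norm_triangle3[OF m(2) m(2) m(1)])
      finally have le: "circle_norm (\<lambda>x. F (s + x) - F (t + x)) \<le> circle_norm (\<lambda>x. F (s + x) - Fs n (s + x))
          + (circle_norm (\<lambda>x. Fs n (s + x) - Fs n (t + x)) + circle_norm (\<lambda>x. F (t + x) - Fs n (t + x)))"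
        by (simp add: L2_norm_minus_commute[of _ "\<lambda>x. Fs n (t + x)" "\<lambda>x. F (t + x)"])
      have "X < e" if "X \<le> a + (b + c)" "a < e / 4" "b < e / 4" "c < e / 4" for X a b c
        using that e by linarith
      from this[OF le sh elim sh] show ?case by (simp add: dist_real_def)
    qed
  qed
qed

section \<open>Solutions of d'Alembert type\<close>

definition dAlembert :: "(real \<Rightarrow> real) \<Rightarrow> real \<Rightarrow> real \<Rightarrow> real" where
  "dAlembert F x t = F (t + x) - F (t - x)"

text \<open>The time derivative F'(t + x) - F'(t - x) is the x-derivative of F(t + x) + F(t - x).
  Moving that derivative onto \<open>u\<close> gives a functional that makes sense for square
  integrable \<open>F\<close>.\<close>

definition velocity :: "(real \<Rightarrow> real) \<Rightarrow> real \<Rightarrow> (real \<Rightarrow> real) \<Rightarrow> real" where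
  "velocity F t u = (\<integral>x. - (F (t + x) + F (t - x)) * weak_deriv 0 1 u x \<partial>lebesgue_on \<Omega>)"

abbreviation modulus :: "(real \<Rightarrow> real) \<Rightarrow> real \<Rightarrow> real \<Rightarrow> real" where
  "modulus F s t \<equiv> circle_norm (\<lambda>x. F (s + x) - F (t + x))"

lemma shift_sum_\<Omega>:
  assumes F: "F \<in> periodic_L2"
  shows "(\<lambda>x. a * F (t + x) + b * F (t - x)) \<in> L2 \<Omega>"
    "L2_norm \<Omega> (\<lambda>x. a * F (t + x) + b * F (t - x)) \<le> (\<bar>a\<bar> + \<bar>b\<bar>) * circle_norm F"
proof -
  note s = periodic_L2_shift[OF F, of t] and r = periodic_L2_shift_reflect[OF F, of t]
  note m = periodic_L2_\<Omega>[OF s(1)] periodic_L2_\<Omega>[OF r(1)]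
  show "(\<lambda>x. a * F (t + x) + b * F (t - x)) \<in> L2 \<Omega>" by (rule L2_lin[OF m(1) m(3)])
  have "L2_norm \<Omega> (\<lambda>x. a * F (t + x) + b * F (t - x)) \<le> \<bar>a\<bar> * L2_norm \<Omega> (\<lambda>x. F (t + x)) + \<bar>b\<bar> * L2_norm \<Omega> (\<lambda>x. F (t - x))"
    by (rule L2_norm_lin[OF m(1) m(3)])
  also have "\<dots> \<le> \<bar>a\<bar> * circle_norm F + \<bar>b\<bar> * circle_norm F"
    using m(2,4) s(2) r(2) by (intro add_mono mult_left_mono) auto
  finally show "L2_norm \<Omega> (\<lambda>x. a * F (t + x) + b * F (t - x)) \<le> (\<bar>a\<bar> + \<bar>b\<bar>) * circle_norm F"
    by (simp add: distrib_right)
qed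

lemma shift_sum_\<Omega>_diff:
  assumes F: "F \<in> periodic_L2"
  shows "L2_norm \<Omega> (\<lambda>x. (a * F (s + x) + b * F (s - x)) - (a * F (t + x) + b * F (t - x))) \<le> (\<bar>a\<bar> + \<bar>b\<bar>) * modulus F s t"
proof -
  define G where "G y = F (s + y) - F (t + y)" for y
  have G: "G \<in> periodic_L2" unfolding G_def[abs_def] by (intro periodic_L2_diff periodic_L2_shift F)
  have "(\<lambda>x. (a * F (s + x) + b * F (s - x)) - (a * F (t + x) + b * F (t - x))) = (\<lambda>x. a * G (0 + x) + b * G (0 - x))"
    by (auto simp: G_def algebra_simps)
  then show ?thesis using shift_sum_\<Omega>(2)[OF G, of a 0 b] by (simp add: G_def[abs_def])
qed

lemma dAlembert_L2:
  assumes "F \<in> periodic_L2"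
  shows "(\<lambda>x. dAlembert F x t) \<in> L2 \<Omega>" "L2_norm \<Omega> (\<lambda>x. dAlembert F x t) \<le> 2 * circle_norm F"
    "L2_norm \<Omega> (\<lambda>x. dAlembert F x s - dAlembert F x t) \<le> 2 * modulus F s t"
  using shift_sum_\<Omega>[OF assms, of 1 t "-1"] shift_sum_\<Omega>_diff[OF assms, of 1 s "-1" t]
  by (simp_all add: dAlembert_def)

lemma velocity_density:
  assumes "F \<in> periodic_L2"
  shows "(\<lambda>x. - (F (t + x) + F (t - x))) \<in> L2 \<Omega>" "L2_norm \<Omega> (\<lambda>x. - (F (t + x) + F (t - x))) \<le> 2 * circle_norm F"
    "L2_norm \<Omega> (\<lambda>x. - (F (s + x) + F (s - x)) - - (F (t + x) + F (t - x))) \<le> 2 * modulus F s t"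
proof -
  have e: "- (a + b) = - 1 * a + - 1 * b" for a b :: real by simp
  show "(\<lambda>x. - (F (t + x) + F (t - x))) \<in> L2 \<Omega>" "L2_norm \<Omega> (\<lambda>x. - (F (t + x) + F (t - x))) \<le> 2 * circle_norm F"
    "L2_norm \<Omega> (\<lambda>x. - (F (s + x) + F (s - x)) - - (F (t + x) + F (t - x))) \<le> 2 * modulus F s t"
    unfolding e using shift_sum_\<Omega>[OF assms, of "-1" t "-1"] shift_sum_\<Omega>_diff[OF assms, of "-1" s "-1" t]
    by simp_all
qed

lemma velocity_lin:
  assumes F: "F \<in> periodic_L2" and G: "G \<in> periodic_L2" and u: "u \<in> H10"
  shows "velocity (\<lambda>x. a * F x + b * G x) t u = a * velocity F t u + b * velocity G t u"
proof -
  have "velocity (\<lambda>x. a * F x + b * G x) t u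
      = (\<integral>x. a * (- (F (t + x) + F (t - x)) * weak_deriv 0 1 u x) + b * (- (G (t + x) + G (t - x)) * weak_deriv 0 1 u x) \<partial>lebesgue_on \<Omega>)"
    unfolding velocity_def by (intro Bochner_Integration.integral_cong) (auto simp: algebra_simps)
  also have "\<dots> = a * velocity F t u + b * velocity G t u"
    unfolding velocity_def
    using L2_mult_integrable[OF velocity_density(1)[OF F] H10_D(3)[OF u]] L2_mult_integrable[OF velocity_density(1)[OF G] H10_D(3)[OF u]]
    by (subst Bochner_Integration.integral_add) auto
  finally show ?thesis .
qed

lemma velocity_Hm1: "F \<in> periodic_L2 \<Longrightarrow> velocity F t \<in> Hm1"
  unfolding velocity_def[abs_def] by (rule Hm1_of_L2(1)[OF velocity_density(1)])

lemma velocity_bound: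
  assumes "F \<in> periodic_L2" "u \<in> H10"
  shows "\<bar>velocity F t u\<bar> \<le> 2 * circle_norm F * L2_norm \<Omega> (weak_deriv 0 1 u)"
  unfolding velocity_def
  using L2_Cauchy_Schwarz[OF velocity_density(1)[OF assms(1)] H10_D(3)[OF assms(2)]]
    mult_right_mono[OF velocity_density(2)[OF assms(1)] L2_norm_ge0] by (rule order_trans)

lemma velocity_diff_bound:
  assumes "F \<in> periodic_L2" "u \<in> H10"
  shows "\<bar>velocity F s u - velocity F t u\<bar> \<le> 2 * modulus F s t * L2_norm \<Omega> (weak_deriv 0 1 u)"
proof -
  note L = velocity_density(1)[OF assms(1)] and w = H10_D(3)[OF assms(2)]
  have "velocity F s u - velocity F t u = (\<integral>x. (- (F (s + x) + F (s - x)) - - (F (t + x) + F (t - x))) * weak_deriv 0 1 u x \<partial>lebesgue_on \<Omega>)"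
    unfolding velocity_def left_diff_distrib
    by (rule Bochner_Integration.integral_diff[OF L2_mult_integrable[OF L w] L2_mult_integrable[OF L w], symmetric])
  then have "\<bar>velocity F s u - velocity F t u\<bar>
      \<le> L2_norm \<Omega> (\<lambda>x. - (F (s + x) + F (s - x)) - - (F (t + x) + F (t - x))) * L2_norm \<Omega> (weak_deriv 0 1 u)"
    using L2_Cauchy_Schwarz[OF L2_diff[OF L L] w] by (simp only:)
  then show ?thesis
    by (rule order_trans[OF _ mult_right_mono[OF velocity_density(3)[OF assms(1)] L2_norm_ge0]])
qed

lemma velocity_Cc1:
  assumes F: "F \<in> periodic_L2" and \<eta>: "\<eta> \<in> Cc1 0 1"
  shows "velocity F t \<eta> = (\<integral>x. - (F (t + x) + F (t - x)) * deriv \<eta> x \<partial>lebesgue_on \<Omega>)"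
  unfolding velocity_def
proof (rule integral_cong_AE)
  show "(\<lambda>x. - (F (t + x) + F (t - x)) * weak_deriv 0 1 \<eta> x) \<in> borel_measurable (lebesgue_on \<Omega>)"
    by (intro borel_measurable_integrable L2_mult_integrable velocity_density(1) F H10_D(3) H10_Cc1 \<eta>)
  show "(\<lambda>x. - (F (t + x) + F (t - x)) * deriv \<eta> x) \<in> borel_measurable (lebesgue_on \<Omega>)"
    by (intro borel_measurable_integrable L2_mult_integrable velocity_density(1) F Cc1_L2(2) \<eta>)
  show "AE x in lebesgue_on \<Omega>. - (F (t + x) + F (t - x)) * weak_deriv 0 1 \<eta> x = - (F (t + x) + F (t - x)) * deriv \<eta> x"
    using H1_Cc1(2)[OF \<eta>] by eventually_elim simp
qed

lemma modulus_tendsto: "F \<in> periodic_L2 \<Longrightarrow> ((\<lambda>s. modulus F s t) \<longlongrightarrow> 0) (at t within S)"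
  using tendsto_mono[OF at_le[OF subset_UNIV] translation_continuous] by blast

lemma velocity_continuous:
  assumes "F \<in> periodic_L2" "u \<in> H10" shows "continuous_on S (\<lambda>t. velocity F t u)"
  unfolding continuous_on_def
proof
  fix t
  have "((\<lambda>s. velocity F s u - velocity F t u) \<longlongrightarrow> 0) (at t within S)"
  proof (rule Lim_null_comparison)
    show "\<forall>\<^sub>F s in at t within S. norm (velocity F s u - velocity F t u) \<le> 2 * modulus F s t * L2_norm \<Omega> (weak_deriv 0 1 u)"
      using velocity_diff_bound[OF assms] by simp
    have "((\<lambda>s. 2 * modulus F s t * L2_norm \<Omega> (weak_deriv 0 1 u)) \<longlongrightarrow> 2 * 0 * L2_norm \<Omega> (weak_deriv 0 1 u)) (at t within S)"
      by (intro tendsto_intros modulus_tendsto assms)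
    then show "((\<lambda>s. 2 * modulus F s t * L2_norm \<Omega> (weak_deriv 0 1 u)) \<longlongrightarrow> 0) (at t within S)" by simp
  qed
  then show "((\<lambda>s. velocity F s u) \<longlongrightarrow> velocity F t u) (at t within S)" by (simp add: LIM_zero_iff)
qed

lemma dAlembert_trig:
  "dAlembert (\<lambda>x. cos (k * x)) x t = - 2 * sin (k * t) * sin (k * x)"
  "dAlembert (\<lambda>x. sin (k * x)) x t = 2 * cos (k * t) * sin (k * x)"
  "cos (k * (t + x)) + cos (k * (t - x)) = 2 * cos (k * t) * cos (k * x)"
  "sin (k * (t + x)) + sin (k * (t - x)) = 2 * sin (k * t) * cos (k * x)"
  by (simp_all add: dAlembert_def distrib_left right_diff_distrib cos_add cos_diff sin_add sin_diff)

lemma dAlembert_lin: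
  "dAlembert (\<lambda>x. a * F x + b * G x) x t = a * dAlembert F x t + b * dAlembert G x t"
  by (simp add: dAlembert_def algebra_simps)

text \<open>That \<open>velocity\<close> is the time derivative is stated in integrated form because
  this form passes to limits of profiles. For a single frequency it is the fundamental theorem in
  time and one integration by parts in space.\<close>

lemma dAlembert_integral_velocity:
  assumes F: "F \<in> periodic_L2" and \<eta>: "\<eta> \<in> Cc1 0 1" and ts: "t \<le> s"
  shows "(\<integral>x. dAlembert F x s * \<eta> x \<partial>lebesgue_on \<Omega>) - (\<integral>x. dAlembert F x t * \<eta> x \<partial>lebesgue_on \<Omega>)
    = integral {t..s} (\<lambda>\<tau>. velocity F \<tau> \<eta>)"
  using F
proof (induction rule: periodic_L2_induct)
  let ?A = "\<lambda>k. \<integral>x. sin (k * x) * \<eta> x \<partial>lebesgue_on \<Omega>"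
  have ibp: "(\<integral>x. cos (k * x) * deriv \<eta> x \<partial>lebesgue_on \<Omega>) = k * ?A k" for k
  proof -
    have "has_weak_deriv 0 1 (\<lambda>x. cos (k * x)) (\<lambda>x. - sin (k * x) * k)"
      by (rule has_weak_deriv_C1) (auto intro!: derivative_eq_intros continuous_intros)
    from has_weak_deriv_D(3)[OF this \<eta>] show ?thesis by (simp add: mult.commute mult.left_commute)
  qed
  have fin: "c s * A - c t * A = integral {t..s} (\<lambda>\<tau>. c' \<tau> * A)"
    if c: "\<And>\<tau>. (c has_real_derivative c' \<tau>) (at \<tau>)" for c c' :: "real \<Rightarrow> real" and A
  proof -
    have "((\<lambda>\<tau>. c' \<tau> * A) has_integral c s * A - c t * A) {t..s}"
      using ts by (intro fundamental_theorem_of_calculus)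
        (auto intro!: derivative_eq_intros has_field_derivative_at_within[OF c] simp flip: has_real_derivative_iff_has_vector_derivative)
    then show ?thesis by (rule integral_unique[symmetric])
  qed
  {
    case (cos k)
    let ?k = "of_int k * pi :: real"
    have v: "velocity (\<lambda>x. cos (?k * x)) \<tau> \<eta> = (- 2 * (cos (?k * \<tau>) * ?k)) * ?A ?k" for \<tau>
      unfolding velocity_Cc1[OF trig_periodic_L2(1) \<eta>] dAlembert_trig(3)
      using ibp[of ?k] by (simp add: mult.assoc)
    have d: "(\<integral>x. dAlembert (\<lambda>x. cos (?k * x)) x \<tau> * \<eta> x \<partial>lebesgue_on \<Omega>) = (- 2 * sin (?k * \<tau>)) * ?A ?k" for \<tau>
      unfolding dAlembert_trig(1) by (simp add: mult.assoc)
    show ?case unfolding v d by (rule fin) (auto intro!: derivative_eq_intros)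
  next
    case (sin k)
    let ?k = "of_int k * pi :: real"
    have v: "velocity (\<lambda>x. sin (?k * x)) \<tau> \<eta> = (2 * (- sin (?k * \<tau>) * ?k)) * ?A ?k" for \<tau>
      unfolding velocity_Cc1[OF trig_periodic_L2(2) \<eta>] dAlembert_trig(4)
      using ibp[of ?k] by (simp add: mult.assoc)
    have d: "(\<integral>x. dAlembert (\<lambda>x. sin (?k * x)) x \<tau> * \<eta> x \<partial>lebesgue_on \<Omega>) = (2 * cos (?k * \<tau>)) * ?A ?k" for \<tau>
      unfolding dAlembert_trig(2) by (simp add: mult.assoc)
    show ?case unfolding v d by (rule fin) (auto intro!: derivative_eq_intros)
  }
next
  case (lin F G a b)
  note \<eta>L = Cc1_L2(1)[OF \<eta>]
  have "(\<integral>x. dAlembert (\<lambda>x. a * F x + b * G x) x \<tau> * \<eta> x \<partial>lebesgue_on \<Omega>)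
     = a * (\<integral>x. dAlembert F x \<tau> * \<eta> x \<partial>lebesgue_on \<Omega>) + b * (\<integral>x. dAlembert G x \<tau> * \<eta> x \<partial>lebesgue_on \<Omega>)" for \<tau>
    using L2_mult_integrable[OF dAlembert_L2(1)[OF lin(1)] \<eta>L] L2_mult_integrable[OF dAlembert_L2(1)[OF lin(2)] \<eta>L]
    by (simp add: dAlembert_lin distrib_right mult.assoc)
  moreover have "integral {t..s} (\<lambda>\<tau>. velocity (\<lambda>x. a * F x + b * G x) \<tau> \<eta>)
      = a * integral {t..s} (\<lambda>\<tau>. velocity F \<tau> \<eta>) + b * integral {t..s} (\<lambda>\<tau>. velocity G \<tau> \<eta>)"
    unfolding velocity_lin[OF lin(1,2) H10_Cc1[OF \<eta>]]
    by (subst Henstock_Kurzweil_Integration.integral_add)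
      (auto intro!: integrable_continuous_real continuous_intros velocity_continuous lin H10_Cc1 \<eta>)
  ultimately show ?case using lin(3,4) by (simp add: algebra_simps)
next
  case (closed F Fs)
  note \<eta>L = Cc1_L2(1)[OF \<eta>] and \<eta>H = H10_Cc1[OF \<eta>]
  let ?D = "\<lambda>F \<tau>. \<integral>x. dAlembert F x \<tau> * \<eta> x \<partial>lebesgue_on \<Omega>"
  let ?V = "\<lambda>F. integral {t..s} (\<lambda>\<tau>. velocity F \<tau> \<eta>)"
  have n2: "(\<lambda>n. 2 * circle_norm (\<lambda>x. Fs n x - F x)) \<longlonglongrightarrow> 0"
    using tendsto_mult_left[OF closed(3), of 2] by simp
  have D: "(\<lambda>n. ?D (Fs n) \<tau>) \<longlonglongrightarrow> ?D F \<tau>" for \<tau>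
  proof (rule L2_tendsto_integral[OF dAlembert_L2(1)[OF closed(2)] dAlembert_L2(1)[OF closed(1)] \<eta>L])
    show "(\<lambda>n. L2_norm \<Omega> (\<lambda>x. dAlembert (Fs n) x \<tau> - dAlembert F x \<tau>)) \<longlonglongrightarrow> 0"
    proof (rule Lim_null_comparison[OF always_eventually n2], rule allI)
      fix n
      show "norm (L2_norm \<Omega> (\<lambda>x. dAlembert (Fs n) x \<tau> - dAlembert F x \<tau>)) \<le> 2 * circle_norm (\<lambda>x. Fs n x - F x)"
        using dAlembert_L2(2)[OF periodic_L2_diff[OF closed(2)[of n] closed(1)], of \<tau>]
          dAlembert_lin[of 1 "Fs n" "-1" F _ \<tau>] by simp
    qed
  qed
  have V: "(\<lambda>n. ?V (Fs n)) \<longlonglongrightarrow> ?V F"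
  proof -
    have "(\<lambda>n. ?V (Fs n) - ?V F) \<longlonglongrightarrow> 0"
    proof (rule Lim_null_comparison)
      show "(\<lambda>n. 2 * circle_norm (\<lambda>x. Fs n x - F x) * L2_norm \<Omega> (weak_deriv 0 1 \<eta>) * (s - t)) \<longlonglongrightarrow> 0"
        using tendsto_mult_right[OF n2, of "L2_norm \<Omega> (weak_deriv 0 1 \<eta>) * (s - t)"] by (simp add: mult.assoc)
      show "\<forall>\<^sub>F n in sequentially. norm (?V (Fs n) - ?V F) \<le> 2 * circle_norm (\<lambda>x. Fs n x - F x) * L2_norm \<Omega> (weak_deriv 0 1 \<eta>) * (s - t)"
      proof (intro always_eventually allI)
        fix n
        note d = periodic_L2_diff[OF closed(2)[of n] closed(1)]
        have "?V (Fs n) - ?V F = integral {t..s} (\<lambda>\<tau>. velocity (Fs n) \<tau> \<eta> - velocity F \<tau> \<eta>)"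
          by (rule Henstock_Kurzweil_Integration.integral_diff[symmetric,
                OF integrable_continuous_real[OF velocity_continuous[OF closed(2) \<eta>H]]
                  integrable_continuous_real[OF velocity_continuous[OF closed(1) \<eta>H]]])
        also have "\<dots> = integral {t..s} (\<lambda>\<tau>. velocity (\<lambda>x. Fs n x - F x) \<tau> \<eta>)"
          using velocity_lin[OF closed(2)[of n] closed(1) \<eta>H, of 1 "-1"] by simp
        also have "norm \<dots> \<le> 2 * circle_norm (\<lambda>x. Fs n x - F x) * L2_norm \<Omega> (weak_deriv 0 1 \<eta>) * (s - t)"
          using velocity_bound[OF d \<eta>H] ts
          by (intro integral_bound velocity_continuous d \<eta>H) auto
        finally show "norm (?V (Fs n) - ?V F) \<le> 2 * circle_norm (\<lambda>x. Fs n x - F x) * L2_norm \<Omega> (weak_deriv 0 1 \<eta>) * (s - t)" .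
      qed
    qed
    then show ?thesis by (simp add: LIM_zero_iff)
  qed
  show ?case using LIMSEQ_unique[OF tendsto_diff[OF D[of s] D[of t]]] V closed(4) by simp
qed

lemma dAlembert_pairing_derivative:
  assumes F: "F \<in> periodic_L2" and \<eta>: "\<eta> \<in> Cc1 0 1"
  shows "((\<lambda>s. \<integral>x. dAlembert F x s * \<eta> x \<partial>lebesgue_on \<Omega>) has_real_derivative velocity F t \<eta>) (at t)"
proof -
  let ?D = "\<lambda>s. \<integral>x. dAlembert F x s * \<eta> x \<partial>lebesgue_on \<Omega>"
  have eq: "?D (t - 1) + integral {t - 1..s} (\<lambda>\<tau>. velocity F \<tau> \<eta>) = ?D s" if "s \<in> {t - 1..t + 1}" for s
    using dAlembert_integral_velocity[OF F \<eta>, of "t - 1" s, symmetric] that by simp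
  have "((\<lambda>s. ?D (t - 1) + integral {t - 1..s} (\<lambda>\<tau>. velocity F \<tau> \<eta>)) has_real_derivative 0 + velocity F t \<eta>) (at t within {t - 1..t + 1})"
    by (intro derivative_intros integral_has_real_derivative velocity_continuous F H10_Cc1 \<eta>) auto
  then have "(?D has_real_derivative 0 + velocity F t \<eta>) (at t within {t - 1..t + 1})"
    by (rule has_field_derivative_transform_within[OF _ zero_less_one _ eq]) simp_all
  moreover have "at t within {t - 1..t + 1} = at t"
    by (rule at_within_interior) (simp add: interior_atLeastAtMost_real)
  ultimately show ?thesis by simp
qed

text \<open>On test functions the mean value theorem turns the quotient into the velocity at an
  intermediate time, which differs from that at \<open>t\<close> by the modulus of translation;
  density extends the bound to \<open>H10\<close>. The intermediate time depends on the test
  function, hence the hypothesis on all \<open>r\<close> no farther from \<open>t\<close> than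
  \<open>s\<close>.\<close>

lemma difference_quotient_bound:
  assumes F: "F \<in> periodic_L2" and u: "u \<in> H10" and st: "s \<noteq> t"
    and e: "\<And>r. \<bar>r - t\<bar> \<le> \<bar>s - t\<bar> \<Longrightarrow> 2 * modulus F r t \<le> e"
  shows "\<bar>(L2_to_Hm1 (\<lambda>x. dAlembert F x s) u - L2_to_Hm1 (\<lambda>x. dAlembert F x t) u) / (s - t) - velocity F t u\<bar>
    \<le> e * L2_norm \<Omega> (weak_deriv 0 1 u)"
proof -
  define l where "l u = (L2_to_Hm1 (\<lambda>x. dAlembert F x s) u - L2_to_Hm1 (\<lambda>x. dAlembert F x t) u) / (s - t) - velocity F t u" for u
  have test: "\<bar>l \<eta>\<bar> \<le> e * L2_norm \<Omega> (deriv \<eta>)" if \<eta>: "\<eta> \<in> Cc1 0 1" for \<eta>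
  proof -
    let ?D = "\<lambda>s. \<integral>x. dAlembert F x s * \<eta> x \<partial>lebesgue_on \<Omega>"
    note D = dAlembert_pairing_derivative[OF F \<eta>]
    obtain r where r: "\<bar>r - t\<bar> \<le> \<bar>s - t\<bar>" "?D s - ?D t = (s - t) * velocity F r \<eta>"
    proof (cases "s < t")
      case True
      then obtain r where "s < r" "r < t" "?D t - ?D s = (t - s) * velocity F r \<eta>" using MVT2[OF True D] by blast
      then show ?thesis using that[of r] by (simp add: algebra_simps)
    next
      case False
      then have "t < s" using st by simp
      then obtain r where "t < r" "r < s" "?D s - ?D t = (s - t) * velocity F r \<eta>" using MVT2[OF \<open>t < s\<close> D] by blast
      then show ?thesis using that[of r] by simp
    qed
    have "l \<eta> = velocity F r \<eta> - velocity F t \<eta>" using st r(2) by (simp add: l_def L2_to_Hm1_def)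
    then have "\<bar>l \<eta>\<bar> \<le> 2 * modulus F r t * L2_norm \<Omega> (weak_deriv 0 1 \<eta>)"
      using velocity_diff_bound[OF F H10_Cc1[OF \<eta>]] by simp
    also have "\<dots> \<le> e * L2_norm \<Omega> (deriv \<eta>)"
      unfolding H1_Cc1(3)[OF \<eta>] using e[OF r(1)] by (rule mult_right_mono) simp
    finally show ?thesis .
  qed
  obtain \<eta> where \<eta>: "\<And>n::nat. \<eta> n \<in> Cc1 0 1" "(\<lambda>n. L2_norm \<Omega> (\<lambda>x. u x - \<eta> n x)) \<longlonglongrightarrow> 0"
     "(\<lambda>n. L2_norm \<Omega> (\<lambda>x. weak_deriv 0 1 u x - deriv (\<eta> n) x)) \<longlonglongrightarrow> 0"
    using H10_approx[OF u] by blast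
  note \<eta>' = \<eta>(2,3)[unfolded L2_norm_minus_commute[of _ u] L2_norm_minus_commute[of _ "weak_deriv 0 1 u"]]
  have p: "(\<lambda>n. L2_to_Hm1 (\<lambda>x. dAlembert F x \<tau>) (\<eta> n)) \<longlonglongrightarrow> L2_to_Hm1 (\<lambda>x. dAlembert F x \<tau>) u" for \<tau>
    using L2_tendsto_integral[OF Cc1_L2(1)[OF \<eta>(1)] H10_D(2)[OF u] dAlembert_L2(1)[OF F] \<eta>'(1)]
    by (simp add: L2_to_Hm1_def mult.commute)
  have v: "(\<lambda>n. velocity F t (\<eta> n)) \<longlonglongrightarrow> velocity F t u"
    unfolding velocity_Cc1[OF F \<eta>(1)] unfolding velocity_def mult.commute[of "- _"]
    by (rule L2_tendsto_integral[OF Cc1_L2(2)[OF \<eta>(1)] H10_D(3)[OF u] velocity_density(1)[OF F] \<eta>'(2)])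
  have lim: "(\<lambda>n. \<bar>l (\<eta> n)\<bar>) \<longlonglongrightarrow> \<bar>l u\<bar>"
    unfolding l_def by (intro tendsto_intros p v) (use st in simp)
  have "(\<lambda>n. L2_norm \<Omega> (deriv (\<eta> n)) - L2_norm \<Omega> (weak_deriv 0 1 u)) \<longlonglongrightarrow> 0"
    by (rule Lim_null_comparison[OF _ \<eta>'(2)])
      (use L2_norm_diff_abs[OF Cc1_L2(2)[OF \<eta>(1)] H10_D(3)[OF u]] in simp)
  then have "(\<lambda>n. L2_norm \<Omega> (deriv (\<eta> n))) \<longlonglongrightarrow> L2_norm \<Omega> (weak_deriv 0 1 u)" by (simp add: LIM_zero_iff)
  then have "(\<lambda>n. e * L2_norm \<Omega> (deriv (\<eta> n))) \<longlonglongrightarrow> e * L2_norm \<Omega> (weak_deriv 0 1 u)" by (intro tendsto_intros)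
  from LIMSEQ_le[OF lim this] show ?thesis using test[OF \<eta>(1)] by (auto simp: l_def)
qed

lemma dAlembert_measurable:
  assumes "F \<in> borel_measurable borel"
  shows "(\<lambda>(x,t). dAlembert F x t) \<in> borel_measurable borel"
proof -
  note [measurable] = assms
  have "(\<lambda>z. F (snd z + fst z) - F (snd z - fst z)) \<in> borel_measurable borel"
    unfolding borel_prod[symmetric] by measurable
  then show ?thesis by (simp add: dAlembert_def case_prod_beta')
qed

text \<open>All three limits reduce to continuity of translations, because the bounds on the
  functionals are uniform over the unit ball of \<open>H10\<close>.\<close>

lemma dAlembert_wave_path:
  assumes F: "F \<in> periodic_L2"
  shows "wave_path T (dAlembert F) (velocity F)"
  unfolding wave_path_def
proof (intro conjI ballI)
  show "(\<lambda>(x,t). dAlembert F x t) \<in> borel_measurable (lebesgue_on (Q T))"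
    by (intro borel_measurable_lebesgue_on dAlembert_measurable periodic_L2_D(1)[OF F])
  fix t
  show "(\<lambda>x. dAlembert F x t) \<in> L2 \<Omega>" by (rule dAlembert_L2(1)[OF F])
  show "velocity F t \<in> Hm1" by (rule velocity_Hm1[OF F])
  have m2: "((\<lambda>s. 2 * modulus F s t) \<longlongrightarrow> 0) (at t within S)" for S
    using tendsto_mult_left[OF modulus_tendsto[OF F], of 2] by simp
  show "((\<lambda>s. L2_norm \<Omega> (\<lambda>x. dAlembert F x s - dAlembert F x t)) \<longlongrightarrow> 0) (at t within {0..T})"
    by (rule Lim_null_comparison[OF _ m2]) (use dAlembert_L2(3)[OF F] in simp)
  show "((\<lambda>s. Hm1_norm (\<lambda>u. velocity F s u - velocity F t u)) \<longlongrightarrow> 0) (at t within {0..T})"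
  proof (rule Lim_null_comparison[OF always_eventually m2], rule allI)
    fix s
    have "\<bar>Hm1_norm (\<lambda>u. velocity F s u - velocity F t u)\<bar> \<le> 2 * modulus F s t"
    proof (rule Hm1_norm_le)
      fix u assume u: "u \<in> H10"
      have "2 * modulus F s t * L2_norm \<Omega> (weak_deriv 0 1 u) \<le> 2 * modulus F s t * H1_norm u"
        by (intro mult_left_mono H1_norm_bounds) simp
      then show "\<bar>velocity F s u - velocity F t u\<bar> \<le> 2 * modulus F s t * H1_norm u"
        using velocity_diff_bound[OF F u, of s t] by linarith
    qed simp
    then show "norm (Hm1_norm (\<lambda>u. velocity F s u - velocity F t u)) \<le> 2 * modulus F s t" by simp
  qed
  show "((\<lambda>s. Hm1_norm (\<lambda>u. (L2_to_Hm1 (\<lambda>x. dAlembert F x s) u - L2_to_Hm1 (\<lambda>x. dAlembert F x t) u) / (s - t)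
           - velocity F t u)) \<longlongrightarrow> 0) (at t within {0..T})" (is "(?h \<longlongrightarrow> 0) _")
  proof (rule tendstoI)
    fix e :: real assume e: "e > 0"
    have "\<forall>\<^sub>F s in at t. 2 * modulus F s t < e / 2"
      by (rule order_tendstoD(2)[OF m2]) (use e in simp)
    then obtain d where d: "d > 0" "\<And>r. r \<noteq> t \<Longrightarrow> \<bar>r - t\<bar> < d \<Longrightarrow> 2 * modulus F r t < e / 2"
      by (auto simp: eventually_at dist_real_def)
    \<comment> \<open>The limit at \<open>t\<close> is silent about \<open>r = t\<close>, where the
      modulus is zero.\<close>
    have small: "2 * modulus F r t \<le> e / 2" if "\<bar>r - t\<bar> < d" for r
    proof (cases "r = t")
      case True
      then show ?thesis using e by (simp add: L2_norm_def)
    qed (use d(2)[of r] that in simp)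
    have "dist (?h s) 0 < e" if s: "s \<noteq> t" "\<bar>s - t\<bar> < d" for s
    proof -
      have "\<bar>?h s\<bar> \<le> e / 2"
      proof (rule Hm1_norm_le)
        fix u assume u: "u \<in> H10"
        have "\<bar>(L2_to_Hm1 (\<lambda>x. dAlembert F x s) u - L2_to_Hm1 (\<lambda>x. dAlembert F x t) u) / (s - t) - velocity F t u\<bar>
          \<le> e / 2 * L2_norm \<Omega> (weak_deriv 0 1 u)"
          by (rule difference_quotient_bound[OF F u s(1)]) (use small s(2) in fastforce)
        also have "\<dots> \<le> e / 2 * H1_norm u" using e by (intro mult_left_mono H1_norm_bounds) simp
        finally show "\<bar>(L2_to_Hm1 (\<lambda>x. dAlembert F x s) u - L2_to_Hm1 (\<lambda>x. dAlembert F x t) u) / (s - t) - velocity F t u\<bar>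
          \<le> e / 2 * H1_norm u" .
      qed (use e in simp)
      then show ?thesis using e by simp
    qed
    then show "\<forall>\<^sub>F s in at t within {0..T}. dist (?h s) 0 < e"
      using d(1) by (auto simp: eventually_at dist_real_def intro!: exI[of _ d])
  qed
qed

section \<open>Integration over the space-time cylinder\<close>

lemma box_Times: "box (a::real, c::real) (b, d) = {a<..<b} \<times> {c<..<d}"
  by (auto simp: box_def Basis_prod_def)

lemma Q_lmeasurable [simp]: "Q T \<in> lmeasurable"
  using lmeasurable_box[of "(0::real, 0::real)" "(1, T)"] by (simp add: box_Times)

lemma Q_borel [simp]: "Q T \<in> sets borel"
  using borel_open[OF open_box, of "(0::real, 0::real)" "(1, T)"] by (simp add: box_Times)

lemma continuous_on_Q:
  fixes f :: "real \<times> real \<Rightarrow> real"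
  assumes f: "continuous_on ({0..1} \<times> {0..T}) f"
  shows "f \<in> L2 (Q T)" "integrable (lebesgue_on (Q T)) f"
    "(\<integral>z. f z \<partial>lebesgue_on (Q T)) = integral {0..1} (\<lambda>x. integral {0..T} (\<lambda>t. f (x, t)))"
proof -
  have sub: "Q T \<subseteq> {0..1} \<times> {0..T}" by auto
  have m: "f \<in> borel_measurable (lebesgue_on (Q T))"
    by (rule continuous_imp_measurable_on_sets_lebesgue[OF continuous_on_subset[OF f sub]]) (simp add: fmeasurableD)
  have "bounded (f ` ({0..1} \<times> {0..T}))"
    by (intro compact_imp_bounded compact_continuous_image f compact_Times) auto
  then obtain B where B: "\<forall>z\<in>{0..1} \<times> {0..T}. \<bar>f z\<bar> \<le> B" by (auto simp: bounded_iff)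
  have "AE z in lebesgue_on (Q T). \<bar>f z\<bar> \<le> B"
    by (rule AE_I2) (use B sub in auto)
  then show L2: "f \<in> L2 (Q T)" by (rule L2_bounded(1)[OF Q_lmeasurable m])
  show i: "integrable (lebesgue_on (Q T)) f" by (rule L2_imp_integrable[OF Q_lmeasurable L2])
  have "(\<integral>z. f z \<partial>lebesgue_on (Q T)) = integral (Q T) f"
    using lebesgue_integral_eq_integral[OF i] by (simp add: fmeasurableD)
  also have "\<dots> = integral (cbox (0, 0) (1, T)) f"
    using integral_open_interval[of "(0, 0)" "(1, T)" f] by (simp add: box_Times)
  also have "\<dots> = integral (cbox 0 1) (\<lambda>x. integral (cbox 0 T) (\<lambda>t. f (x, t)))"
    by (rule integral_prod_continuous) (use f in \<open>simp add: cbox_Pair_eq\<close>)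
  finally show "(\<integral>z. f z \<partial>lebesgue_on (Q T)) = integral {0..1} (\<lambda>x. integral {0..T} (\<lambda>t. f (x, t)))" by simp
qed

lemma nn_integral_Q:
  fixes g :: "real \<times> real \<Rightarrow> ennreal"
  assumes g: "g \<in> borel_measurable borel"
  shows "(\<integral>\<^sup>+z. g z * indicator (Q T) z \<partial>lborel)
    = (\<integral>\<^sup>+t. (\<integral>\<^sup>+x. g (x, t) * indicator \<Omega> x \<partial>lborel) * indicator {0<..<T} t \<partial>lborel)"
proof -
  have m: "(\<lambda>z. g z * indicator (Q T) z) \<in> borel_measurable (lborel \<Otimes>\<^sub>M lborel)"
    unfolding lborel_prod 
    using borel_measurable_times_ennreal[OF g borel_measurable_indicator[OF Q_borel]] by simp
  have m2 [measurable]: "(\<lambda>x. g (x, t)) \<in> borel_measurable borel" for t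
    using g by (intro measurable_compose[OF _ g]) (simp add: borel_prod[symmetric])
  have "(\<integral>\<^sup>+z. g z * indicator (Q T) z \<partial>lborel) = (\<integral>\<^sup>+z. g z * indicator (Q T) z \<partial>(lborel \<Otimes>\<^sub>M lborel))"
    by (simp add: lborel_prod)
  also have "\<dots> = (\<integral>\<^sup>+t. (\<integral>\<^sup>+x. g (x, t) * indicator (Q T) (x, t) \<partial>lborel) \<partial>lborel)"
    by (rule lborel_pair.nn_integral_snd[OF m, symmetric])
  also have "\<dots> = (\<integral>\<^sup>+t. (\<integral>\<^sup>+x. (g (x, t) * indicator \<Omega> x) * indicator {0<..<T} t \<partial>lborel) \<partial>lborel)"
    by (intro nn_integral_cong) (auto simp: indicator_def)
  also have "\<dots> = (\<integral>\<^sup>+t. (\<integral>\<^sup>+x. g (x, t) * indicator \<Omega> x \<partial>lborel) * indicator {0<..<T} t \<partial>lborel)"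
    by (intro nn_integral_cong nn_integral_multc) measurable
  finally show ?thesis .
qed

text \<open>At each time the spatial norm is at most twice the circle norm; integrating its square
  over a time interval of length \<open>T\<close> with Tonelli gives the factor sqrt T.\<close>

lemma dAlembert_Q:
  assumes F: "F \<in> periodic_L2" and T: "T \<ge> 0"
  shows "(\<lambda>(x,t). dAlembert F x t) \<in> L2 (Q T)"
    "L2_norm (Q T) (\<lambda>(x,t). dAlembert F x t) \<le> 2 * sqrt T * circle_norm F"
proof -
  let ?d = "\<lambda>(x,t). dAlembert F x t"
  note m = dAlembert_measurable[OF periodic_L2_D(1)[OF F]]
  have m1: "(\<lambda>x. dAlembert F x t) \<in> borel_measurable borel" for t
    unfolding dAlembert_def using periodic_L2_D(1)[OF F] by measurable
  have "(\<integral>\<^sup>+z. ennreal ((?d z)\<^sup>2) * indicator (Q T) z \<partial>lborel)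
    = (\<integral>\<^sup>+t. (\<integral>\<^sup>+x. ennreal ((?d (x, t))\<^sup>2) * indicator \<Omega> x \<partial>lborel) * indicator {0<..<T} t \<partial>lborel)"
    by (rule nn_integral_Q, rule measurable_compose[OF m]) measurable
  also have "\<dots> \<le> (\<integral>\<^sup>+t. ennreal ((2 * circle_norm F)\<^sup>2) * indicator {0<..<T} t \<partial>lborel)"
  proof (rule nn_integral_mono, rule mult_right_mono)
    fix t
    have "(\<integral>\<^sup>+x. ennreal ((?d (x, t))\<^sup>2) * indicator \<Omega> x \<partial>lborel) = ennreal ((L2_norm \<Omega> (\<lambda>x. dAlembert F x t))\<^sup>2)"
      using L2_nn_integral(2)[OF m1 _ dAlembert_L2(1)[OF F]] by simp
    also have "\<dots> \<le> ennreal ((2 * circle_norm F)\<^sup>2)"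
      by (intro ennreal_leI power_mono dAlembert_L2 F) simp
    finally show "(\<integral>\<^sup>+x. ennreal ((?d (x, t))\<^sup>2) * indicator \<Omega> x \<partial>lborel) \<le> ennreal ((2 * circle_norm F)\<^sup>2)" .
  qed simp
  also have "\<dots> = ennreal ((2 * circle_norm F)\<^sup>2) * ennreal T"
    using T by (simp add: nn_integral_cmult_indicator)
  also have "\<dots> = ennreal ((2 * sqrt T * circle_norm F)\<^sup>2)"
    using T by (simp add: ennreal_mult[symmetric] power_mult_distrib algebra_simps)
  finally have le: "(\<integral>\<^sup>+z. ennreal ((?d z)\<^sup>2) * indicator (Q T) z \<partial>lborel) \<le> ennreal ((2 * sqrt T * circle_norm F)\<^sup>2)" .
  then show L: "?d \<in> L2 (Q T)"
    using L2_nn_integral(1)[OF m Q_borel] by (simp add: le_less_trans[OF _ ennreal_less_top])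
  have "(L2_norm (Q T) ?d)\<^sup>2 \<le> (2 * sqrt T * circle_norm F)\<^sup>2"
    using le L2_nn_integral(2)[OF m Q_borel L] by simp
  then show "L2_norm (Q T) ?d \<le> 2 * sqrt T * circle_norm F"
    by (rule power2_le_imp_le) (use T in simp)
qed

section \<open>The transposition identity\<close>

lemma C1_cyl_D:
  assumes z: "C1_cyl T z zx zt"
  shows "continuous_on ({0..1} \<times> {0..T}) (\<lambda>(x,t). z x t)"
    "continuous_on ({0..1} \<times> {0..T}) (\<lambda>(x,t). zx x t)"
    "continuous_on ({0..1} \<times> {0..T}) (\<lambda>(x,t). zt x t)"
    "x \<in> {0..1} \<Longrightarrow> t \<in> {0..T} \<Longrightarrow> ((\<lambda>t. z x t) has_real_derivative zt x t) (at t within {0..T})"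
    "x \<in> {0..1} \<Longrightarrow> t \<in> {0..T} \<Longrightarrow> ((\<lambda>x. z x t) has_real_derivative zx x t) (at x within {0..1})"
proof -
  have d: "((\<lambda>(x,t). z x t) has_derivative (\<lambda>(h,k). zx x t * h + zt x t * k)) (at (x,t) within {0..1} \<times> {0..T})"
    if "x \<in> {0..1}" "t \<in> {0..T}" for x t
    using z that by (simp add: C1_cyl_def)
  show "continuous_on ({0..1} \<times> {0..T}) (\<lambda>(x,t). zx x t)" "continuous_on ({0..1} \<times> {0..T}) (\<lambda>(x,t). zt x t)"
    using z by (simp_all add: C1_cyl_def)
  show "continuous_on ({0..1} \<times> {0..T}) (\<lambda>(x,t). z x t)"
    unfolding continuous_on_eq_continuous_within
    by (auto intro!: has_derivative_continuous[OF d])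
  {
    assume x: "x \<in> {0..1}" and t: "t \<in> {0..T}"
    have "((\<lambda>(x,t). z x t) \<circ> (\<lambda>t. (x, t)) has_derivative (\<lambda>(h,k). zx x t * h + zt x t * k) \<circ> (\<lambda>k. (0, k))) (at t within {0..T})"
      by (rule diff_chain_within, (auto intro!: derivative_eq_intros)[1],
          rule has_derivative_subset[OF d[OF x t]]) (use x in auto)
    then show "((\<lambda>t. z x t) has_real_derivative zt x t) (at t within {0..T})"
      by (simp add: has_field_derivative_def o_def)
    have "((\<lambda>(x,t). z x t) \<circ> (\<lambda>x. (x, t)) has_derivative (\<lambda>(h,k). zx x t * h + zt x t * k) \<circ> (\<lambda>h. (h, 0))) (at x within {0..1})"
      by (rule diff_chain_within, (auto intro!: derivative_eq_intros)[1],
          rule has_derivative_subset[OF d[OF x t]]) (use t in auto)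
    then show "((\<lambda>x. z x t) has_real_derivative zx x t) (at x within {0..1})"
      by (simp add: has_field_derivative_def o_def)
  }
qed

lemma continuous_on_slice:
  assumes "continuous_on (A \<times> B) (\<lambda>(x,t). g x t)"
  shows "x \<in> A \<Longrightarrow> continuous_on B (\<lambda>t. g x t)" "t \<in> B \<Longrightarrow> continuous_on A (\<lambda>x. g x t)"
proof -
  show "continuous_on B (\<lambda>t. g x t)" if "x \<in> A"
  proof -
    have "continuous_on B (\<lambda>t. (x, t))" "(\<lambda>t. (x, t)) ` B \<subseteq> A \<times> B"
      using that by (auto intro: continuous_on_Pair)
    from continuous_on_compose2[OF assms this] show ?thesis by simp
  qed
  show "continuous_on A (\<lambda>x. g x t)" if "t \<in> B"
  proof -
    have "continuous_on A (\<lambda>x. (x, t))" "(\<lambda>x. (x, t)) ` A \<subseteq> A \<times> B"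
      using that by (auto intro: continuous_on_Pair)
    from continuous_on_compose2[OF assms this] show ?thesis by simp
  qed
qed

lemma integral_by_parts_twice:
  fixes c c' c'' z z' z'' :: "real \<Rightarrow> real"
  assumes ab: "a \<le> b"
    and c: "\<And>t. t \<in> {a..b} \<Longrightarrow> (c has_real_derivative c' t) (at t within {a..b})"
      "\<And>t. t \<in> {a..b} \<Longrightarrow> (c' has_real_derivative c'' t) (at t within {a..b})" "continuous_on {a..b} c''"
    and z: "\<And>t. t \<in> {a..b} \<Longrightarrow> (z has_real_derivative z' t) (at t within {a..b})"
      "\<And>t. t \<in> {a..b} \<Longrightarrow> (z' has_real_derivative z'' t) (at t within {a..b})" "continuous_on {a..b} z''"
  shows "integral {a..b} (\<lambda>t. c t * z'' t)
    = (c b * z' b - c' b * z b) - (c a * z' a - c' a * z a) + integral {a..b} (\<lambda>t. c'' t * z t)"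
proof -
  have cont: "continuous_on {a..b} c" "continuous_on {a..b} z"
    using c z by (blast intro: DERIV_continuous_on)+
  have "((\<lambda>t. c t * z'' t - c'' t * z t) has_integral (c b * z' b - c' b * z b) - (c a * z' a - c' a * z a)) {a..b}"
    using ab by (intro fundamental_theorem_of_calculus)
      (auto intro!: derivative_eq_intros c z simp: algebra_simps simp flip: has_real_derivative_iff_has_vector_derivative)
  moreover have "integral {a..b} (\<lambda>t. c t * z'' t - c'' t * z t) = integral {a..b} (\<lambda>t. c t * z'' t) - integral {a..b} (\<lambda>t. c'' t * z t)"
    by (intro Henstock_Kurzweil_Integration.integral_diff integrable_continuous_real continuous_intros cont c z)
  ultimately show ?thesis by (simp add: integral_unique)
qed

text \<open>Two integrations by parts in time and two in space leave the same interior term,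
  -\<alpha>^2 times the integral of c(t) sin (\<alpha> x) z, and these cancel. At time
  \<open>T\<close> both \<open>z\<close> and \<open>zt\<close> vanish, at the lateral boundary both
  \<open>z\<close> and the sine vanish, so that only terms at time 0 remain.\<close>

lemma separated_transposition:
  fixes c c' :: "real \<Rightarrow> real"
  assumes T: "T \<ge> 0"
    and z: "C1_cyl T z zx zt" "C1_cyl T zx zxx zxt" "C1_cyl T zt ztx ztt"
    and bc: "\<And>t. t \<in> {0..T} \<Longrightarrow> z 0 t = 0 \<and> z 1 t = 0" and fin: "\<And>x. x \<in> {0..1} \<Longrightarrow> z x T = 0 \<and> zt x T = 0"
    and c: "\<And>t. (c has_real_derivative c' t) (at t)" "\<And>t. (c' has_real_derivative - (\<alpha>\<^sup>2) * c t) (at t)"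
    and \<alpha>: "sin \<alpha> = 0"
  shows "(\<integral>(x,t). c t * sin (\<alpha> * x) * (ztt x t - zxx x t) \<partial>lebesgue_on (Q T))
    = (\<integral>x. sin (\<alpha> * x) * (c' 0 * z x 0 - c 0 * zt x 0) \<partial>lebesgue_on \<Omega>)"
proof -
  have cc: "continuous_on S c" for S using c(1) by (meson DERIV_continuous_on has_field_derivative_at_within)
  have cfst: "continuous_on ({0..1} \<times> {0..T}) (\<lambda>(x,t). h x)" if "continuous_on UNIV h" for h :: "real \<Rightarrow> real"
    unfolding case_prod_beta by (rule continuous_on_compose2[OF that]) (auto intro!: continuous_intros)
  have csnd: "continuous_on ({0..1} \<times> {0..T}) (\<lambda>(x,t). h t)" if "continuous_on UNIV h" for h :: "real \<Rightarrow> real"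
    unfolding case_prod_beta by (rule continuous_on_compose2[OF that]) (auto intro!: continuous_intros)
  note cont = C1_cyl_D(1)[OF z(1)] C1_cyl_D(3)[OF z(3)] C1_cyl_D(2)[OF z(2)] C1_cyl_D(3)[OF z(1)]
  have sc: "continuous_on S (\<lambda>x. sin (\<alpha> * x))" for S by (intro continuous_intros)
  have cs: "continuous_on ({0..1} \<times> {0..T}) (\<lambda>(x,t). c t * sin (\<alpha> * x) * g x t)"
    if "continuous_on ({0..1} \<times> {0..T}) (\<lambda>(x,t). g x t)" for g
    using continuous_on_mult[OF continuous_on_mult[OF csnd[OF cc] cfst[OF sc]] that]
    by (simp add: case_prod_beta)
  let ?I = "\<lambda>g. integral {0..1} (\<lambda>x. integral {0..T} (\<lambda>t. c t * sin (\<alpha> * x) * g x t))"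
  have swap: "?I g = integral {0..T} (\<lambda>t. integral {0..1} (\<lambda>x. c t * sin (\<alpha> * x) * g x t))"
    if "continuous_on ({0..1} \<times> {0..T}) (\<lambda>(x,t). g x t)" for g
    using integral_swap_continuous[of 0 0 1 T "\<lambda>x t. c t * sin (\<alpha> * x) * g x t"] cs[OF that]
    by (simp add: cbox_Pair_eq)
  have QI: "(\<integral>(x,t). c t * sin (\<alpha> * x) * g x t \<partial>lebesgue_on (Q T)) = ?I g" "integrable (lebesgue_on (Q T)) (\<lambda>(x,t). c t * sin (\<alpha> * x) * g x t)"
    if "continuous_on ({0..1} \<times> {0..T}) (\<lambda>(x,t). g x t)" for g
    using continuous_on_Q(2,3)[OF cs[OF that]] by simp_all
  have "(\<integral>(x,t). c t * sin (\<alpha> * x) * (ztt x t - zxx x t) \<partial>lebesgue_on (Q T)) = ?I ztt - ?I zxx"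
  proof -
    have "(\<lambda>(x,t). c t * sin (\<alpha> * x) * (ztt x t - zxx x t))
      = (\<lambda>p. (case p of (x,t) \<Rightarrow> c t * sin (\<alpha> * x) * ztt x t) - (case p of (x,t) \<Rightarrow> c t * sin (\<alpha> * x) * zxx x t))"
      by (auto simp: right_diff_distrib)
    then show ?thesis
      using Bochner_Integration.integral_diff[OF QI(2)[OF cont(2)] QI(2)[OF cont(3)]]
      by (simp only: QI(1)[OF cont(2)] QI(1)[OF cont(3)])
  qed
  moreover have "?I ztt = integral {0..1} (\<lambda>x. sin (\<alpha> * x) * (c' 0 * z x 0 - c 0 * zt x 0)) - \<alpha>\<^sup>2 * ?I z"
  proof -
    have "integral {0..T} (\<lambda>t. c t * sin (\<alpha> * x) * ztt x t)
        = sin (\<alpha> * x) * (c' 0 * z x 0 - c 0 * zt x 0) - \<alpha>\<^sup>2 * integral {0..T} (\<lambda>t. c t * sin (\<alpha> * x) * z x t)"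
      if x: "x \<in> {0..1}" for x
    proof -
      have "integral {0..T} (\<lambda>t. c t * ztt x t)
         = (c T * zt x T - c' T * z x T) - (c 0 * zt x 0 - c' 0 * z x 0) + integral {0..T} (\<lambda>t. - (\<alpha>\<^sup>2) * c t * z x t)"
        by (rule integral_by_parts_twice[OF T has_field_derivative_at_within[OF c(1)] has_field_derivative_at_within[OF c(2)]
              continuous_on_mult[OF continuous_on_const cc]
              C1_cyl_D(4)[OF z(1) x] C1_cyl_D(4)[OF z(3) x] continuous_on_slice(1)[OF cont(2) x]])
      also have "\<dots> = c' 0 * z x 0 - c 0 * zt x 0 - \<alpha>\<^sup>2 * integral {0..T} (\<lambda>t. c t * z x t)"
        using fin[OF x] by (simp add: mult.assoc)
      finally have eq: "integral {0..T} (\<lambda>t. c t * ztt x t) = c' 0 * z x 0 - c 0 * zt x 0 - \<alpha>\<^sup>2 * integral {0..T} (\<lambda>t. c t * z x t)" .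
      have f: "integral {0..T} (\<lambda>t. c t * sin (\<alpha> * x) * g t) = sin (\<alpha> * x) * integral {0..T} (\<lambda>t. c t * g t)" for g
        by (simp only: mult.commute[of _ "sin (\<alpha> * x)"] mult.assoc Henstock_Kurzweil_Integration.integral_mult_right)
      show ?thesis unfolding f eq by (simp add: right_diff_distrib)
    qed
    then have "?I ztt = integral {0..1} (\<lambda>x. sin (\<alpha> * x) * (c' 0 * z x 0 - c 0 * zt x 0)
        - \<alpha>\<^sup>2 * integral {0..T} (\<lambda>t. c t * sin (\<alpha> * x) * z x t))"
      by (intro integral_cong) auto
    also have "\<dots> = integral {0..1} (\<lambda>x. sin (\<alpha> * x) * (c' 0 * z x 0 - c 0 * zt x 0)) - integral {0..1} (\<lambda>x. \<alpha>\<^sup>2 * integral {0..T} (\<lambda>t. c t * sin (\<alpha> * x) * z x t))"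
    proof (rule Henstock_Kurzweil_Integration.integral_diff)
      have "0 \<in> {0..T}" using T by simp
      then show "(\<lambda>x. sin (\<alpha> * x) * (c' 0 * z x 0 - c 0 * zt x 0)) integrable_on {0..1}"
        by (intro integrable_continuous_real continuous_intros sc continuous_on_slice(2)[OF cont(1)] continuous_on_slice(2)[OF cont(4)])
      have "continuous_on (cbox 0 1) (\<lambda>x. integral (cbox 0 T) (\<lambda>t. c t * sin (\<alpha> * x) * z x t))"
        using cs[OF cont(1)] by (intro integral_continuous_on_param) simp
      then show "(\<lambda>x. \<alpha>\<^sup>2 * integral {0..T} (\<lambda>t. c t * sin (\<alpha> * x) * z x t)) integrable_on {0..1}"
        by (intro integrable_continuous_real continuous_intros) simp
    qed
    finally show ?thesis by simp
  qed
  moreover have "?I zxx = - (\<alpha>\<^sup>2) * ?I z"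
  proof -
    have "integral {0..1} (\<lambda>x. c t * sin (\<alpha> * x) * zxx x t) = - (\<alpha>\<^sup>2) * integral {0..1} (\<lambda>x. c t * sin (\<alpha> * x) * z x t)"
      if t: "t \<in> {0..T}" for t
    proof -
      have "integral {0..1} (\<lambda>x. sin (\<alpha> * x) * zxx x t)
         = (sin (\<alpha> * 1) * zx 1 t - (cos (\<alpha> * 1) * \<alpha>) * z 1 t) - (sin (\<alpha> * 0) * zx 0 t - (cos (\<alpha> * 0) * \<alpha>) * z 0 t)
          + integral {0..1} (\<lambda>x. (- sin (\<alpha> * x) * \<alpha> * \<alpha>) * z x t)"
      proof (rule integral_by_parts_twice[OF _ _ _ _ C1_cyl_D(5)[OF z(1) _ t] C1_cyl_D(5)[OF z(2) _ t] continuous_on_slice(2)[OF cont(3) t]])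
        show "((\<lambda>x. sin (\<alpha> * x)) has_real_derivative cos (\<alpha> * x) * \<alpha>) (at x within {0..1})" for x
          by (auto intro!: derivative_eq_intros)
        show "((\<lambda>x. cos (\<alpha> * x) * \<alpha>) has_real_derivative - sin (\<alpha> * x) * \<alpha> * \<alpha>) (at x within {0..1})" for x
          by (auto intro!: derivative_eq_intros)
      qed (simp_all add: continuous_intros)
      also have "\<dots> = - (\<alpha>\<^sup>2) * integral {0..1} (\<lambda>x. sin (\<alpha> * x) * z x t)"
      proof -
        have "(\<lambda>x. (- sin (\<alpha> * x) * \<alpha> * \<alpha>) * z x t) = (\<lambda>x. - (\<alpha>\<^sup>2) * (sin (\<alpha> * x) * z x t))"
          by (auto simp: power2_eq_square)
        then show ?thesis using bc[OF t] \<alpha> by (simp only: Henstock_Kurzweil_Integration.integral_mult_right) simp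
      qed
      finally have eq: "integral {0..1} (\<lambda>x. sin (\<alpha> * x) * zxx x t) = - (\<alpha>\<^sup>2) * integral {0..1} (\<lambda>x. sin (\<alpha> * x) * z x t)" .
      have f: "integral {0..1} (\<lambda>x. c t * sin (\<alpha> * x) * g x) = c t * integral {0..1} (\<lambda>x. sin (\<alpha> * x) * g x)" for g
        by (simp only: mult.assoc Henstock_Kurzweil_Integration.integral_mult_right)
      show ?thesis unfolding f eq by simp
    qed
    then have "integral {0..T} (\<lambda>t. integral {0..1} (\<lambda>x. c t * sin (\<alpha> * x) * zxx x t))
      = integral {0..T} (\<lambda>t. - (\<alpha>\<^sup>2) * integral {0..1} (\<lambda>x. c t * sin (\<alpha> * x) * z x t))"
      by (intro integral_cong) auto
    then show ?thesis unfolding swap[OF cont(3)] swap[OF cont(1)]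
      by (simp only: Henstock_Kurzweil_Integration.integral_mult_right)
  qed
  ultimately have "(\<integral>(x,t). c t * sin (\<alpha> * x) * (ztt x t - zxx x t) \<partial>lebesgue_on (Q T))
      = integral {0..1} (\<lambda>x. sin (\<alpha> * x) * (c' 0 * z x 0 - c 0 * zt x 0))" by simp
  also have "\<dots> = (\<integral>x. sin (\<alpha> * x) * (c' 0 * z x 0 - c 0 * zt x 0) \<partial>lebesgue_on \<Omega>)"
  proof -
    have "0 \<in> {0..T}" using T by simp
    then show ?thesis
      by (intro continuous_integral_interval(4)[symmetric] continuous_intros sc
          continuous_on_slice(2)[OF cont(1)] continuous_on_slice(2)[OF cont(4)])
  qed
  finally show ?thesis .
qed

text \<open>Both sides are linear and continuous in \<open>F\<close>, so single frequencies suffice;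
  there the solution separates into c(t) sin (\<alpha> x).\<close>

lemma dAlembert_transposition:
  assumes F: "F \<in> periodic_L2" and T: "T \<ge> 0" and sol: "backward_solution T f z zt"
  shows "(\<integral>(x,t). dAlembert F x t * f x t \<partial>lebesgue_on (Q T))
    = velocity F 0 (\<lambda>x. z x 0) - (\<integral>x. dAlembert F x 0 * zt x 0 \<partial>lebesgue_on \<Omega>)"
proof -
  obtain zx zxx zxt ztx ztt where z: "C1_cyl T z zx zt" "C1_cyl T zx zxx zxt" "C1_cyl T zt ztx ztt"
    and f: "\<And>x t. x \<in> {0..1} \<Longrightarrow> t \<in> {0..T} \<Longrightarrow> ztt x t - zxx x t = f x t"
    and bc: "\<And>t. t \<in> {0..T} \<Longrightarrow> z 0 t = 0 \<and> z 1 t = 0" and fin: "\<And>x. x \<in> {0..1} \<Longrightarrow> z x T = 0 \<and> zt x T = 0"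
    using sol unfolding backward_solution_def by blast
  have T0: "0 \<in> {0..T}" using T by simp
  let ?g = "\<lambda>(x,t). ztt x t - zxx x t"
  have gL: "?g \<in> L2 (Q T)"
  proof (rule continuous_on_Q(1))
    show "continuous_on ({0..1} \<times> {0..T}) ?g"
      using continuous_on_diff[OF C1_cyl_D(3)[OF z(3)] C1_cyl_D(2)[OF z(2)]] by (simp add: case_prod_beta)
  qed
  \<comment> \<open>\<open>f\<close> is prescribed only on the closed cylinder; there it equals
    \<open>ztt - zxx\<close>, which is continuous and hence square integrable.\<close>
  have fg: "(\<integral>(x,t). h x t * f x t \<partial>lebesgue_on (Q T)) = (\<integral>p. (case p of (x,t) \<Rightarrow> h x t) * ?g p \<partial>lebesgue_on (Q T))" for h
    by (rule Bochner_Integration.integral_cong) (auto simp: f)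
  let ?z0 = "\<lambda>x. z x 0"
  have z0d: "\<And>x. x \<in> {0..1} \<Longrightarrow> (?z0 has_real_derivative zx x 0) (at x within {0..1})"
    by (rule C1_cyl_D(5)[OF z(1) _ T0])
  have zxc: "continuous_on {0..1} (\<lambda>x. zx x 0)" by (rule continuous_on_slice(2)[OF C1_cyl_D(2)[OF z(1)] T0])
  have z0c: "continuous_on {0..1} ?z0" by (rule DERIV_continuous_on[OF z0d])
  have zt0L: "(\<lambda>x. zt x 0) \<in> L2 \<Omega>"
    by (rule L2_continuous_on_closed[OF continuous_on_slice(2)[OF C1_cyl_D(3)[OF z(1)] T0]])
  have z0H: "?z0 \<in> H10" "AE x in lebesgue_on \<Omega>. weak_deriv 0 1 ?z0 x = zx x 0"
    by (rule H10_C1[of ?z0 "\<lambda>x. zx x 0", OF z0d zxc]; use bc[OF T0] in simp)+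
  have zxL: "(\<lambda>x. zx x 0) \<in> L2 \<Omega>" by (rule L2_continuous_on_closed[OF zxc])
  have vel: "velocity F 0 ?z0 = (\<integral>x. - (F (0 + x) + F (0 - x)) * zx x 0 \<partial>lebesgue_on \<Omega>)" if F: "F \<in> periodic_L2" for F
    unfolding velocity_def
  proof (rule integral_cong_AE)
    show "(\<lambda>x. - (F (0 + x) + F (0 - x)) * weak_deriv 0 1 ?z0 x) \<in> borel_measurable (lebesgue_on \<Omega>)"
      by (rule borel_measurable_integrable[OF L2_mult_integrable[OF velocity_density(1)[OF F] H10_D(3)[OF z0H(1)]]])
    show "(\<lambda>x. - (F (0 + x) + F (0 - x)) * zx x 0) \<in> borel_measurable (lebesgue_on \<Omega>)"
      by (rule borel_measurable_integrable[OF L2_mult_integrable[OF velocity_density(1)[OF F] zxL]])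
    show "AE x in lebesgue_on \<Omega>. - (F (0 + x) + F (0 - x)) * weak_deriv 0 1 ?z0 x = - (F (0 + x) + F (0 - x)) * zx x 0"
      using z0H(2) by eventually_elim simp
  qed
  show ?thesis
    unfolding fg using F
  proof (induction rule: periodic_L2_induct)
    case (cos k)
    let ?a = "of_int k * pi :: real"
    have sa: "sin ?a = 0" by (simp add: mult.commute sin_zero_iff_int2)
    have "(\<integral>p. (case p of (x,t) \<Rightarrow> dAlembert (\<lambda>x. cos (?a * x)) x t) * ?g p \<partial>lebesgue_on (Q T))
      = (\<integral>(x,t). (- 2 * sin (?a * t)) * sin (?a * x) * (ztt x t - zxx x t) \<partial>lebesgue_on (Q T))"
      unfolding dAlembert_trig(1) by (rule Bochner_Integration.integral_cong) auto
    also have "\<dots> = (\<integral>x. sin (?a * x) * ((- 2 * (cos (?a * 0) * ?a)) * z x 0 - (- 2 * sin (?a * 0)) * zt x 0) \<partial>lebesgue_on \<Omega>)"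
      by (rule separated_transposition[OF T z bc fin _ _ sa])
        (auto intro!: derivative_eq_intros simp: power2_eq_square)
    also have "\<dots> = (\<integral>x. - 2 * ?a * (sin (?a * x) * z x 0) \<partial>lebesgue_on \<Omega>)"
      by (rule Bochner_Integration.integral_cong) auto
    also have "\<dots> = - 2 * ?a * integral {0..1} (\<lambda>x. sin (?a * x) * z x 0)"
      unfolding integral_mult_right_zero
      by (subst continuous_integral_interval(4)) (intro continuous_intros z0c, simp)
    finally have lhs: "(\<integral>p. (case p of (x,t) \<Rightarrow> dAlembert (\<lambda>x. cos (?a * x)) x t) * ?g p \<partial>lebesgue_on (Q T))
      = - 2 * ?a * integral {0..1} (\<lambda>x. sin (?a * x) * z x 0)" .
    \<comment> \<open>A cosine profile has zero displacement at time 0, and \<open>velocity\<close>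
      involves the x-derivative of \<open>z\<close>. One integration by parts in x, with
      \<open>z\<close> vanishing at both ends, matches it with the separated identity.\<close>
    have "((\<lambda>x. (- sin (?a * x) * ?a) * z x 0 + cos (?a * x) * zx x 0) has_integral cos (?a * 1) * z 1 0 - cos (?a * 0) * z 0 0) {0..1}"
      by (intro fundamental_theorem_of_calculus)
        (auto intro!: derivative_eq_intros z0d simp flip: has_real_derivative_iff_has_vector_derivative)
    then have "integral {0..1} (\<lambda>x. (- sin (?a * x) * ?a) * z x 0 + cos (?a * x) * zx x 0) = 0"
      using bc[OF T0] by (simp add: integral_unique)
    moreover have "integral {0..1} (\<lambda>x. (- sin (?a * x) * ?a) * z x 0 + cos (?a * x) * zx x 0)
      = integral {0..1} (\<lambda>x. (- sin (?a * x) * ?a) * z x 0) + integral {0..1} (\<lambda>x. cos (?a * x) * zx x 0)"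
      by (intro Henstock_Kurzweil_Integration.integral_add integrable_continuous_real continuous_intros z0c zxc)
    moreover have "integral {0..1} (\<lambda>x. (- sin (?a * x) * ?a) * z x 0) = - ?a * integral {0..1} (\<lambda>x. sin (?a * x) * z x 0)"
      unfolding Henstock_Kurzweil_Integration.integral_mult_right[symmetric]
      by (rule integral_cong) simp
    ultimately have ibp: "integral {0..1} (\<lambda>x. cos (?a * x) * zx x 0) = ?a * integral {0..1} (\<lambda>x. sin (?a * x) * z x 0)" by simp
    have "velocity (\<lambda>x. cos (?a * x)) 0 ?z0 = (\<integral>x. - 2 * (cos (?a * x) * zx x 0) \<partial>lebesgue_on \<Omega>)"
      unfolding vel[OF trig_periodic_L2(1)] dAlembert_trig(3) by (rule Bochner_Integration.integral_cong) auto
    also have "\<dots> = - 2 * integral {0..1} (\<lambda>x. cos (?a * x) * zx x 0)"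
      unfolding integral_mult_right_zero
      by (subst continuous_integral_interval(4)) (intro continuous_intros zxc, simp)
    finally have "velocity (\<lambda>x. cos (?a * x)) 0 ?z0 = - 2 * ?a * integral {0..1} (\<lambda>x. sin (?a * x) * z x 0)"
      unfolding ibp by simp
    then show ?case unfolding lhs by (simp add: dAlembert_trig(1))
  next
    case (sin k)
    let ?a = "of_int k * pi :: real"
    have sa: "sin ?a = 0" by (simp add: mult.commute sin_zero_iff_int2)
    have "(\<integral>p. (case p of (x,t) \<Rightarrow> dAlembert (\<lambda>x. sin (?a * x)) x t) * ?g p \<partial>lebesgue_on (Q T))
      = (\<integral>(x,t). (2 * cos (?a * t)) * sin (?a * x) * (ztt x t - zxx x t) \<partial>lebesgue_on (Q T))"
      unfolding dAlembert_trig(2) by (rule Bochner_Integration.integral_cong) auto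
    also have "\<dots> = (\<integral>x. sin (?a * x) * ((2 * (- sin (?a * 0) * ?a)) * z x 0 - (2 * cos (?a * 0)) * zt x 0) \<partial>lebesgue_on \<Omega>)"
      by (rule separated_transposition[OF T z bc fin _ _ sa])
        (auto intro!: derivative_eq_intros simp: power2_eq_square)
    also have "\<dots> = (\<integral>x. - (dAlembert (\<lambda>x. sin (?a * x)) x 0 * zt x 0) \<partial>lebesgue_on \<Omega>)"
      unfolding dAlembert_trig(2) by (rule Bochner_Integration.integral_cong) auto
    finally show ?case
      unfolding vel[OF trig_periodic_L2(2)] dAlembert_trig(4) by simp
  next
    case (lin F G a b)
    have "(\<integral>p. (case p of (x,t) \<Rightarrow> dAlembert (\<lambda>x. a * F x + b * G x) x t) * ?g p \<partial>lebesgue_on (Q T))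
      = (\<integral>p. a * ((case p of (x,t) \<Rightarrow> dAlembert F x t) * ?g p) + b * ((case p of (x,t) \<Rightarrow> dAlembert G x t) * ?g p) \<partial>lebesgue_on (Q T))"
      unfolding dAlembert_lin by (rule Bochner_Integration.integral_cong) (auto simp: algebra_simps)
    also have "\<dots> = a * (\<integral>p. (case p of (x,t) \<Rightarrow> dAlembert F x t) * ?g p \<partial>lebesgue_on (Q T))
        + b * (\<integral>p. (case p of (x,t) \<Rightarrow> dAlembert G x t) * ?g p \<partial>lebesgue_on (Q T))"
      using L2_mult_integrable[OF dAlembert_Q(1)[OF lin(1) T] gL] L2_mult_integrable[OF dAlembert_Q(1)[OF lin(2) T] gL]
      by (subst Bochner_Integration.integral_add) simp_all
    finally have 1: "(\<integral>p. (case p of (x,t) \<Rightarrow> dAlembert (\<lambda>x. a * F x + b * G x) x t) * ?g p \<partial>lebesgue_on (Q T))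
      = a * (\<integral>p. (case p of (x,t) \<Rightarrow> dAlembert F x t) * ?g p \<partial>lebesgue_on (Q T))
        + b * (\<integral>p. (case p of (x,t) \<Rightarrow> dAlembert G x t) * ?g p \<partial>lebesgue_on (Q T))" .
    have 2: "(\<integral>x. dAlembert (\<lambda>x. a * F x + b * G x) x 0 * zt x 0 \<partial>lebesgue_on \<Omega>)
      = a * (\<integral>x. dAlembert F x 0 * zt x 0 \<partial>lebesgue_on \<Omega>) + b * (\<integral>x. dAlembert G x 0 * zt x 0 \<partial>lebesgue_on \<Omega>)"
      using L2_mult_integrable[OF dAlembert_L2(1)[OF lin(1)] zt0L] L2_mult_integrable[OF dAlembert_L2(1)[OF lin(2)] zt0L]
      by (simp add: dAlembert_lin distrib_right mult.assoc)
    show ?case unfolding 1 2 velocity_lin[OF lin(1,2) z0H(1)] lin(3,4) by (simp add: algebra_simps)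
  next
    case (closed F Fs)
    let ?d = "\<lambda>F (x,t). dAlembert F x t"
    have null: "(\<lambda>n. C * circle_norm (\<lambda>x. Fs n x - F x)) \<longlonglongrightarrow> 0" for C
      using tendsto_mult_left[OF closed(3), of C] by simp
    have dd: "dAlembert (Fs n) x t - dAlembert F x t = dAlembert (\<lambda>x. Fs n x - F x) x t" for n x t
      by (simp add: dAlembert_def)
    have 1: "(\<lambda>n. \<integral>p. ?d (Fs n) p * ?g p \<partial>lebesgue_on (Q T)) \<longlonglongrightarrow> (\<integral>p. ?d F p * ?g p \<partial>lebesgue_on (Q T))"
    proof (rule L2_tendsto_integral[OF dAlembert_Q(1)[OF closed(2) T] dAlembert_Q(1)[OF closed(1) T] gL])
      show "(\<lambda>n. L2_norm (Q T) (\<lambda>p. ?d (Fs n) p - ?d F p)) \<longlonglongrightarrow> 0"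
      proof (rule Lim_null_comparison[OF always_eventually null[of "2 * sqrt T"]], rule allI)
        fix n
        have "(\<lambda>p. ?d (Fs n) p - ?d F p) = ?d (\<lambda>x. Fs n x - F x)" by (auto simp: dd)
        then show "norm (L2_norm (Q T) (\<lambda>p. ?d (Fs n) p - ?d F p)) \<le> 2 * sqrt T * circle_norm (\<lambda>x. Fs n x - F x)"
          using dAlembert_Q(2)[OF periodic_L2_diff[OF closed(2)[of n] closed(1)] T] by simp
      qed
    qed
    have 2: "(\<lambda>n. \<integral>x. dAlembert (Fs n) x 0 * zt x 0 \<partial>lebesgue_on \<Omega>) \<longlonglongrightarrow> (\<integral>x. dAlembert F x 0 * zt x 0 \<partial>lebesgue_on \<Omega>)"
    proof (rule L2_tendsto_integral[OF dAlembert_L2(1)[OF closed(2)] dAlembert_L2(1)[OF closed(1)] zt0L])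
      show "(\<lambda>n. L2_norm \<Omega> (\<lambda>x. dAlembert (Fs n) x 0 - dAlembert F x 0)) \<longlonglongrightarrow> 0"
        unfolding dd by (rule Lim_null_comparison[OF always_eventually null[of 2]])
          (use dAlembert_L2(2)[OF periodic_L2_diff[OF closed(2) closed(1)]] in simp)
    qed
    have "(\<lambda>n. velocity (Fs n) 0 ?z0 - velocity F 0 ?z0) \<longlonglongrightarrow> 0"
    proof (rule Lim_null_comparison[OF always_eventually null[of "2 * L2_norm \<Omega> (weak_deriv 0 1 ?z0)"]], rule allI)
      fix n
      have "velocity (Fs n) 0 ?z0 - velocity F 0 ?z0 = velocity (\<lambda>x. Fs n x - F x) 0 ?z0"
        using velocity_lin[OF closed(2)[of n] closed(1) z0H(1), of 1 "-1" 0] by simp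
      then show "norm (velocity (Fs n) 0 ?z0 - velocity F 0 ?z0) \<le> 2 * L2_norm \<Omega> (weak_deriv 0 1 ?z0) * circle_norm (\<lambda>x. Fs n x - F x)"
        using velocity_bound[OF periodic_L2_diff[OF closed(2)[of n] closed(1)] z0H(1), of 0]
        by (simp add: mult.assoc mult.commute[of "circle_norm _"])
    qed
    then have 3: "(\<lambda>n. velocity (Fs n) 0 ?z0) \<longlonglongrightarrow> velocity F 0 ?z0" by (simp add: LIM_zero_iff)
    show ?case using LIMSEQ_unique[OF 1] tendsto_diff[OF 3 2] unfolding closed(4) by blast
  qed
qed

section \<open>Initial data and the profiles generating them\<close>

lemma backward_solution_initial:
  assumes T: "T \<ge> 0" and sol: "backward_solution T f z zt"
  shows "(\<lambda>x. z x 0) \<in> H10" "(\<lambda>x. zt x 0) \<in> L2 \<Omega>"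
proof -
  obtain zx where z: "C1_cyl T z zx zt" and bc: "z 0 0 = 0" "z 1 0 = 0"
    using sol T unfolding backward_solution_def by auto
  have T0: "0 \<in> {0..T}" using T by simp
  show "(\<lambda>x. z x 0) \<in> H10"
    by (rule H10_C1(1)[of _ "\<lambda>x. zx x 0"]) (use C1_cyl_D(5)[OF z _ T0] continuous_on_slice(2)[OF C1_cyl_D(2)[OF z] T0] bc in auto)
  show "(\<lambda>x. zt x 0) \<in> L2 \<Omega>"
    by (rule L2_continuous_on_closed[OF continuous_on_slice(2)[OF C1_cyl_D(3)[OF z] T0]])
qed

text \<open>Equality is that of elements of L2 and \<open>Hm1\<close>: representatives in
  \<open>W\<close> are arbitrary on null sets and off \<open>H10\<close>.\<close>

definition generates :: "(real \<Rightarrow> real) \<Rightarrow> (real \<Rightarrow> real) \<times> ((real \<Rightarrow> real) \<Rightarrow> real) \<Rightarrow> bool" where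
  "generates F p \<longleftrightarrow> (AE x in lebesgue_on \<Omega>. dAlembert F x 0 = fst p x) \<and> (\<forall>u\<in>H10. velocity F 0 u = snd p u)"

text \<open>With \<open>G\<close> representing p1, the data prescribe F(x) - F(-x) = p0 and -(F(x) +
  F(-x)) = G on (0, 1). This linear system determines both halves of one period.\<close>

lemma W_generated:
  assumes "p \<in> W" obtains F where "F \<in> periodic_L2" "generates F p"
proof -
  obtain p0 p1 where p: "p = (p0, p1)" "p0 \<in> L2 \<Omega>" "p1 \<in> Hm1" using assms by (auto simp: W_def)
  obtain G where G: "G \<in> L2 \<Omega>" "\<And>u. u \<in> H10 \<Longrightarrow> p1 u = (\<integral>x. G x * weak_deriv 0 1 u x \<partial>lebesgue_on \<Omega>)"
    using Hm1_representation[OF p(3)] by blast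
  obtain F where F: "F \<in> periodic_L2" "AE x in lebesgue_on \<Omega>. F x = 1/2 * p0 x + (-1/2) * G x"
    "AE x in lebesgue_on \<Omega>. F (- x) = (-1/2) * p0 x + (-1/2) * G x"
    using periodic_L2_halves[OF L2_lin[OF p(2) G(1)] L2_lin[OF p(2) G(1)]] by blast
  have "AE x in lebesgue_on \<Omega>. dAlembert F x 0 = p0 x"
    using F(2,3) by eventually_elim (simp add: dAlembert_def field_simps)
  moreover have "velocity F 0 u = p1 u" if u: "u \<in> H10" for u
    unfolding velocity_def G(2)[OF u]
  proof (rule integral_cong_AE)
    show "(\<lambda>x. - (F (0 + x) + F (0 - x)) * weak_deriv 0 1 u x) \<in> borel_measurable (lebesgue_on \<Omega>)"
      by (rule borel_measurable_integrable[OF L2_mult_integrable[OF velocity_density(1)[OF F(1)] H10_D(3)[OF u]]])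
    show "(\<lambda>x. G x * weak_deriv 0 1 u x) \<in> borel_measurable (lebesgue_on \<Omega>)"
      by (rule borel_measurable_integrable[OF L2_mult_integrable[OF G(1) H10_D(3)[OF u]]])
    show "AE x in lebesgue_on \<Omega>. - (F (0 + x) + F (0 - x)) * weak_deriv 0 1 u x = G x * weak_deriv 0 1 u x"
      using F(2,3)
    proof eventually_elim
      case (elim x)
      have "- (F x + F (- x)) = G x" unfolding elim by simp
      then show ?case by simp
    qed
  qed
  ultimately have "generates F p" by (simp add: generates_def p(1))
  then show ?thesis using that F(1) by blast
qed

lemma generates_W:
  assumes F: "F \<in> periodic_L2"
  shows "((\<lambda>x. dAlembert F x 0), velocity F 0) \<in> W" "generates F ((\<lambda>x. dAlembert F x 0), velocity F 0)"
  using dAlembert_L2(1)[OF F] velocity_Hm1[OF F] by (auto simp: W_def generates_def)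

lemma dAlembert_transposition_solution:
  assumes F: "F \<in> periodic_L2" and p: "p \<in> W" and g: "generates F p" and T: "T \<ge> 0"
  shows "transposition_solution T p (dAlembert F)"
proof -
  obtain p0 p1 where pp: "p = (p0, p1)" by (cases p)
  have p0: "p0 \<in> L2 \<Omega>" using p by (simp add: pp W_def)
  have ae: "AE x in lebesgue_on \<Omega>. dAlembert F x 0 = p0 x" and v: "\<And>u. u \<in> H10 \<Longrightarrow> velocity F 0 u = p1 u"
    using g by (auto simp: generates_def pp)
  have "(\<integral>(x,t). dAlembert F x t * f x t \<partial>lebesgue_on (Q T)) = p1 (\<lambda>x. z x 0) - (\<integral>x. p0 x * zt x 0 \<partial>lebesgue_on \<Omega>)"
    if sol: "backward_solution T f z zt" for f z zt
  proof -
    have "(\<integral>x. dAlembert F x 0 * zt x 0 \<partial>lebesgue_on \<Omega>) = (\<integral>x. p0 x * zt x 0 \<partial>lebesgue_on \<Omega>)"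
    proof (rule integral_cong_AE)
      show "(\<lambda>x. dAlembert F x 0 * zt x 0) \<in> borel_measurable (lebesgue_on \<Omega>)"
        by (rule borel_measurable_integrable[OF L2_mult_integrable[OF dAlembert_L2(1)[OF F] backward_solution_initial(2)[OF T sol]]])
      show "(\<lambda>x. p0 x * zt x 0) \<in> borel_measurable (lebesgue_on \<Omega>)"
        by (rule borel_measurable_integrable[OF L2_mult_integrable[OF p0 backward_solution_initial(2)[OF T sol]]])
      show "AE x in lebesgue_on \<Omega>. dAlembert F x 0 * zt x 0 = p0 x * zt x 0"
        using ae by eventually_elim simp
    qed
    then show ?thesis
      using dAlembert_transposition[OF F T sol] v[OF backward_solution_initial(1)[OF T sol]] by simp
  qed
  then show ?thesis
    using dAlembert_wave_path[OF F, of T] ae v unfolding transposition_solution_def pp by auto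
qed

section \<open>Uniqueness of transposition solutions\<close>

lemma C1_cyl_product:
  assumes A: "\<And>x. (A has_real_derivative A' x) (at x)" "continuous_on UNIV A'"
    and B: "\<And>t. t \<in> {0..T} \<Longrightarrow> (B has_real_derivative B' t) (at t within {0..T})" "continuous_on {0..T} B'"
  shows "C1_cyl T (\<lambda>x t. A x * B t) (\<lambda>x t. A' x * B t) (\<lambda>x t. A x * B' t)"
proof -
  have Ac: "continuous_on UNIV A" using A(1) by (meson DERIV_continuous_on has_field_derivative_at_within)
  have Bc: "continuous_on {0..T} B" by (rule DERIV_continuous_on[OF B(1)])
  have fst: "continuous_on ({0..1} \<times> {0..T}) (\<lambda>p. g (fst p))" if "continuous_on UNIV g" for g :: "real \<Rightarrow> real"
    by (rule continuous_on_compose2[OF that]) (auto intro!: continuous_intros)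
  have snd: "continuous_on ({0..1} \<times> {0..T}) (\<lambda>p. g (snd p))" if "continuous_on {0..T} g" for g :: "real \<Rightarrow> real"
    by (rule continuous_on_compose2[OF that]) (auto intro!: continuous_intros)
  have "((\<lambda>(x,t). A x * B t) has_derivative (\<lambda>(h,k). A' x * B t * h + A x * B' t * k)) (at (x,t) within {0..1} \<times> {0..T})"
    if x: "x \<in> {0..1}" and t: "t \<in> {0..T}" for x t
  proof -
    have a: "((\<lambda>p. A (fst p)) has_derivative (\<lambda>q. A' x * fst q)) (at (x,t) within {0..1} \<times> {0..T})"
    proof -
      have "(A has_derivative (\<lambda>h. A' x * h)) (at (fst (x,t)))" using A(1)[of x] by (simp add: has_field_derivative_def)
      from has_derivative_compose[OF has_derivative_fst[OF has_derivative_ident] this] show ?thesis by simp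
    qed
    have b: "((\<lambda>p. B (snd p)) has_derivative (\<lambda>q. B' t * snd q)) (at (x,t) within {0..1} \<times> {0..T})"
    proof -
      have "snd ` ({0..1::real} \<times> {0..T}) = {0..T}" by force
      then have "(B has_derivative (\<lambda>h. B' t * h)) (at (snd (x,t)) within snd ` ({0..1::real} \<times> {0..T}))"
        using B(1)[OF t] by (simp only: has_field_derivative_def snd_conv)
      from diff_chain_within[OF has_derivative_snd[OF has_derivative_ident] this] show ?thesis by (simp add: o_def)
    qed
    show ?thesis
      using has_derivative_mult[OF a b] by (simp add: case_prod_unfold algebra_simps)
  qed
  moreover have "continuous_on ({0..1} \<times> {0..T}) (\<lambda>p. A' (fst p) * B (snd p))"
    "continuous_on ({0..1} \<times> {0..T}) (\<lambda>p. A (fst p) * B' (snd p))"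
    by (intro continuous_on_mult fst snd A Ac B Bc)+
  ultimately show ?thesis by (simp add: C1_cyl_def case_prod_beta)
qed

text \<open>Duhamel's formula \<open>h(t) = 1/\<alpha> \<integral>\<^sub>t\<^sup>T sin (\<alpha>(s - t)) c(s) ds\<close>, with the sine expanded, solves
  \<open>h'' + \<alpha>\<^sup>2 h = c\<close> backwards from zero data.\<close>

lemma separated_backward_solution:
  assumes \<alpha>: "sin \<alpha> = 0" "\<alpha> \<noteq> 0" and c: "continuous_on UNIV c" and T: "T \<ge> 0"
  obtains z zt where "backward_solution T (\<lambda>x t. sin (\<alpha> * x) * c t) z zt"
proof -
  have cc: "continuous_on X c" for X using c continuous_on_subset by blast
  \<comment> \<open>Integrals over [t, T] are written as differences of integrals from 0, to which
    the derivative rule for a variable upper limit applies.\<close>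
  define S where "S t = integral {0..T} (\<lambda>s. sin (\<alpha> * s) * c s) - integral {0..t} (\<lambda>s. sin (\<alpha> * s) * c s)" for t
  define C where "C t = integral {0..T} (\<lambda>s. cos (\<alpha> * s) * c s) - integral {0..t} (\<lambda>s. cos (\<alpha> * s) * c s)" for t
  have S: "(S has_real_derivative - (sin (\<alpha> * t) * c t)) (at t within {0..T})" if "t \<in> {0..T}" for t
  proof -
    have "continuous_on {0..T} (\<lambda>s. sin (\<alpha> * s) * c s)" by (intro continuous_intros cc)
    from DERIV_diff[OF DERIV_const integral_has_real_derivative[OF this that]]
    show ?thesis unfolding S_def[abs_def] by simp
  qed
  have C: "(C has_real_derivative - (cos (\<alpha> * t) * c t)) (at t within {0..T})" if "t \<in> {0..T}" for t
  proof -
    have "continuous_on {0..T} (\<lambda>s. cos (\<alpha> * s) * c s)" by (intro continuous_intros cc)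
    from DERIV_diff[OF DERIV_const integral_has_real_derivative[OF this that]]
    show ?thesis unfolding C_def[abs_def] by simp
  qed
  have SCc: "continuous_on {0..T} S" "continuous_on {0..T} C"
    by (rule DERIV_continuous_on[OF S], assumption, rule DERIV_continuous_on[OF C], assumption)
  define h where "h t = (cos (\<alpha> * t) * S t - sin (\<alpha> * t) * C t) / \<alpha>" for t
  define h1 where "h1 t = - (sin (\<alpha> * t) * S t) - cos (\<alpha> * t) * C t" for t
  define h2 where "h2 t = c t - \<alpha>\<^sup>2 * h t" for t
  have h: "(h has_real_derivative h1 t) (at t within {0..T})" if t: "t \<in> {0..T}" for t
    unfolding h_def[abs_def] h1_def using \<alpha>(2)
    by (auto intro!: derivative_eq_intros S[OF t] C[OF t] simp: field_simps)
  have sc1: "sin y * sin y * v + cos y * cos y * v = v" for y v :: real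
    using sin_cos_squared_add3[of y] by (simp flip: distrib_right add: add.commute)
  have h1: "(h1 has_real_derivative h2 t) (at t within {0..T})" if t: "t \<in> {0..T}" for t
  proof -
    have "(h1 has_real_derivative (- ((cos (\<alpha> * t) * \<alpha>) * S t + sin (\<alpha> * t) * (- (sin (\<alpha> * t) * c t)))
       - ((- sin (\<alpha> * t) * \<alpha>) * C t + cos (\<alpha> * t) * (- (cos (\<alpha> * t) * c t))))) (at t within {0..T})"
      unfolding h1_def[abs_def]
      by (rule derivative_eq_intros S[OF t] C[OF t] refl | simp)+
    also have "- ((cos (\<alpha> * t) * \<alpha>) * S t + sin (\<alpha> * t) * (- (sin (\<alpha> * t) * c t)))
       - ((- sin (\<alpha> * t) * \<alpha>) * C t + cos (\<alpha> * t) * (- (cos (\<alpha> * t) * c t)))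
       = (sin (\<alpha> * t) * sin (\<alpha> * t) * c t + cos (\<alpha> * t) * cos (\<alpha> * t) * c t) - \<alpha> * (cos (\<alpha> * t) * S t - sin (\<alpha> * t) * C t)"
      by (simp add: algebra_simps)
    also have "\<dots> = h2 t" unfolding sc1 h2_def h_def using \<alpha>(2) by (simp add: power2_eq_square)
    finally show ?thesis .
  qed
  have hc: "continuous_on {0..T} h" "continuous_on {0..T} h1" "continuous_on {0..T} h2"
    unfolding h_def[abs_def] h1_def[abs_def] h2_def[abs_def] using \<alpha>(2) by (auto intro!: continuous_intros SCc cc)
  have hT: "h T = 0" "h1 T = 0" by (simp_all add: h_def h1_def S_def C_def)
  have s: "((\<lambda>x. sin (\<alpha> * x)) has_real_derivative \<alpha> * cos (\<alpha> * x)) (at x)"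
    "((\<lambda>x. \<alpha> * cos (\<alpha> * x)) has_real_derivative - \<alpha>\<^sup>2 * sin (\<alpha> * x)) (at x)" for x
    by (auto intro!: derivative_eq_intros simp: power2_eq_square)
  have cont: "continuous_on UNIV (\<lambda>x. \<alpha> * cos (\<alpha> * x))" "continuous_on UNIV (\<lambda>x. - \<alpha>\<^sup>2 * sin (\<alpha> * x))"
    by (intro continuous_intros)+
  have "backward_solution T (\<lambda>x t. sin (\<alpha> * x) * c t) (\<lambda>x t. sin (\<alpha> * x) * h t) (\<lambda>x t. sin (\<alpha> * x) * h1 t)"
    unfolding backward_solution_def
  proof (intro conjI exI)
    show "C1_cyl T (\<lambda>x t. sin (\<alpha> * x) * h t) (\<lambda>x t. (\<alpha> * cos (\<alpha> * x)) * h t) (\<lambda>x t. sin (\<alpha> * x) * h1 t)"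
      by (rule C1_cyl_product[OF s(1) cont(1) h hc(2)])
    show "C1_cyl T (\<lambda>x t. (\<alpha> * cos (\<alpha> * x)) * h t) (\<lambda>x t. (- \<alpha>\<^sup>2 * sin (\<alpha> * x)) * h t) (\<lambda>x t. (\<alpha> * cos (\<alpha> * x)) * h1 t)"
      by (rule C1_cyl_product[OF s(2) cont(2) h hc(2)])
    show "C1_cyl T (\<lambda>x t. sin (\<alpha> * x) * h1 t) (\<lambda>x t. (\<alpha> * cos (\<alpha> * x)) * h1 t) (\<lambda>x t. sin (\<alpha> * x) * h2 t)"
      by (rule C1_cyl_product[OF s(1) cont(1) h1 hc(3)])
    show "\<forall>x\<in>{0..1}. \<forall>t\<in>{0..T}. sin (\<alpha> * x) * h2 t - (- \<alpha>\<^sup>2 * sin (\<alpha> * x)) * h t = sin (\<alpha> * x) * c t"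
      by (simp add: h2_def algebra_simps)
  qed (use hT \<alpha> in auto)
  then show ?thesis using that by blast
qed

section \<open>Time slices of null sets and of square integrable functions\<close>

lemma borel_measurable_nn_integral_section:
  assumes f: "f \<in> borel_measurable (lborel \<Otimes>\<^sub>M lborel)"
  shows "(\<lambda>t. \<integral>\<^sup>+x. f (x :: real, t :: real) \<partial>lborel) \<in> borel_measurable lborel"
proof (rule lborel.borel_measurable_nn_integral)
  show "(\<lambda>(t, x). f (x, t)) \<in> borel_measurable (lborel \<Otimes>\<^sub>M lborel)"
    using measurable_compose[OF measurable_pair_swap' f] by (simp add: case_prod_unfold)
qed

text \<open>The predicate need not be measurable, so the exceptional set is covered by a Borel null
  set, to which Tonelli applies.\<close>

lemma AE_section:
  assumes "AE z in lborel. R (z :: real \<times> real)"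
  shows "AE t in lborel. AE x in lborel. R (x, t)"
proof -
  obtain N where N: "N \<in> null_sets lborel" "{z. \<not> R z} \<subseteq> N"
    using assms by (auto simp: eventually_ae_filter)
  have Nb: "N \<in> sets (lborel \<Otimes>\<^sub>M lborel)" unfolding lborel_prod using N(1) by (simp add: null_sets_def)
  have m: "(\<lambda>z. indicator N z :: ennreal) \<in> borel_measurable (lborel \<Otimes>\<^sub>M lborel)" using Nb by simp
  have "(\<integral>\<^sup>+t. (\<integral>\<^sup>+x. indicator N (x, t) \<partial>lborel) \<partial>lborel) = (\<integral>\<^sup>+z. indicator N z \<partial>(lborel \<Otimes>\<^sub>M lborel))"
    by (rule lborel_pair.nn_integral_snd[OF m])
  also have "\<dots> = 0" using N(1) Nb by (simp add: lborel_prod null_sets_def)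
  finally have "AE t in lborel. (\<integral>\<^sup>+x. indicator N (x, t) \<partial>lborel) = 0"
    using borel_measurable_nn_integral_section[OF m] by (subst (asm) nn_integral_0_iff_AE) auto
  then show ?thesis
  proof eventually_elim
    case (elim t)
    have "(\<lambda>x. indicator N (x, t) :: ennreal) \<in> borel_measurable lborel"
      by (rule measurable_compose[OF _ m]) simp
    then have "AE x in lborel. (indicator N (x, t) :: ennreal) = 0"
      using elim by (subst (asm) nn_integral_0_iff_AE) auto
    then show ?case by eventually_elim (use N(2) in \<open>auto simp: indicator_def split: if_splits\<close>)
  qed
qed

text \<open>On the way from slices back to the plane, Tonelli is applied to the exceptional set
  itself, which is where measurability of the predicate enters.\<close>

lemma AE_Q_iff:
  assumes m: "{z. R z} \<in> sets borel"
  shows "(AE z in lebesgue_on (Q T). R z) \<longleftrightarrow> (AE t in lebesgue_on {0<..<T}. AE x in lebesgue_on \<Omega>. R (x, t))"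
proof
  assume "AE z in lebesgue_on (Q T). R z"
  then have "AE z in lborel. z \<in> Q T \<longrightarrow> R z" by (simp add: AE_lebesgue_on_iff)
  from AE_section[OF this] show "AE t in lebesgue_on {0<..<T}. AE x in lebesgue_on \<Omega>. R (x, t)"
    by (simp add: AE_lebesgue_on_iff) (auto elim!: eventually_mono)
next
  assume "AE t in lebesgue_on {0<..<T}. AE x in lebesgue_on \<Omega>. R (x, t)"
  then have ae: "AE t in lborel. t \<in> {0<..<T} \<longrightarrow> (AE x in lborel. x \<in> \<Omega> \<longrightarrow> R (x, t))"
    by (simp add: AE_lebesgue_on_iff)
  define g :: "real \<times> real \<Rightarrow> ennreal" where "g z = indicator (- {z. R z}) z" for z
  have gm: "g \<in> borel_measurable borel" unfolding g_def[abs_def] using m by simp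
  have "(\<integral>\<^sup>+z. g z * indicator (Q T) z \<partial>lborel)
    = (\<integral>\<^sup>+t. (\<integral>\<^sup>+x. g (x, t) * indicator \<Omega> x \<partial>lborel) * indicator {0<..<T} t \<partial>lborel)"
    by (rule nn_integral_Q[OF gm])
  also have "\<dots> = (\<integral>\<^sup>+t. 0 \<partial>(lborel :: real measure))"
  proof (rule nn_integral_cong_AE)
    show "AE t in lborel. (\<integral>\<^sup>+x. g (x, t) * indicator \<Omega> x \<partial>lborel) * indicator {0<..<T} t = 0"
      using ae
    proof eventually_elim
      case (elim t)
      show ?case
      proof (cases "t \<in> {0<..<T}")
        case True
        then have "AE x in lborel. x \<in> \<Omega> \<longrightarrow> R (x, t)" using elim by simp
        then have "AE x in lborel. g (x, t) * indicator \<Omega> x = 0"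
          by eventually_elim (auto simp: g_def indicator_def)
        then have "(\<integral>\<^sup>+x. g (x, t) * indicator \<Omega> x \<partial>lborel) = (\<integral>\<^sup>+x. 0 \<partial>(lborel :: real measure))"
          by (rule nn_integral_cong_AE)
        then show ?thesis by simp
      qed simp
    qed
  qed
  finally have "(\<integral>\<^sup>+z. g z * indicator (Q T) z \<partial>lborel) = 0" by simp
  moreover have "(\<lambda>z. g z * indicator (Q T) z) \<in> borel_measurable lborel"
    using borel_measurable_times_ennreal[OF gm borel_measurable_indicator[OF Q_borel]] by simp
  ultimately have "AE z in lborel. g z * indicator (Q T) z = 0"
    by (simp add: nn_integral_0_iff_AE)
  then have "AE z in lborel. z \<in> Q T \<longrightarrow> R z"
    by eventually_elim (auto simp: g_def indicator_def split: if_splits)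
  then show "AE z in lebesgue_on (Q T). R z" by (simp add: AE_lebesgue_on_iff)
qed

text \<open>Continuity in time on a compact interval bounds the spatial norms uniformly. Their
  squares are integrated through a Borel representative, which agrees with the path on almost every
  time slice.\<close>

lemma wave_path_L2:
  assumes w: "wave_path T \<phi> \<psi>" and T: "T \<ge> 0"
  shows "(\<lambda>(x,t). \<phi> x t) \<in> L2 (Q T)"
proof -
  have slice: "(\<lambda>x. \<phi> x t) \<in> L2 \<Omega>" if "t \<in> {0..T}" for t using w that by (simp add: wave_path_def)
  have cont: "continuous_on {0..T} (\<lambda>t. L2_norm \<Omega> (\<lambda>x. \<phi> x t))"
    unfolding continuous_on_def
  proof
    fix t assume t: "t \<in> {0..T}"
    have l: "((\<lambda>s. L2_norm \<Omega> (\<lambda>x. \<phi> x s - \<phi> x t)) \<longlongrightarrow> 0) (at t within {0..T})"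
      using w t by (simp add: wave_path_def)
    have "((\<lambda>s. L2_norm \<Omega> (\<lambda>x. \<phi> x s) - L2_norm \<Omega> (\<lambda>x. \<phi> x t)) \<longlongrightarrow> 0) (at t within {0..T})"
    proof (rule Lim_null_comparison[OF _ l])
      show "\<forall>\<^sub>F s in at t within {0..T}. norm (L2_norm \<Omega> (\<lambda>x. \<phi> x s) - L2_norm \<Omega> (\<lambda>x. \<phi> x t)) \<le> L2_norm \<Omega> (\<lambda>x. \<phi> x s - \<phi> x t)"
        unfolding eventually_at using L2_norm_diff_abs[OF slice slice[OF t]] by (intro exI[of _ 1]) simp
    qed
    then show "((\<lambda>s. L2_norm \<Omega> (\<lambda>x. \<phi> x s)) \<longlongrightarrow> L2_norm \<Omega> (\<lambda>x. \<phi> x t)) (at t within {0..T})"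
      by (simp add: LIM_zero_iff)
  qed
  obtain B where B: "\<And>t. t \<in> {0..T} \<Longrightarrow> \<bar>L2_norm \<Omega> (\<lambda>x. \<phi> x t)\<bar> \<le> B" using continuous_Icc_bounded[OF cont] by blast
  have m: "(\<lambda>(x,t). \<phi> x t) \<in> borel_measurable (lebesgue_on (Q T))" using w by (simp add: wave_path_def)
  obtain g where g: "g \<in> borel_measurable borel" "AE z in lebesgue_on (Q T). (case z of (x,t) \<Rightarrow> \<phi> x t) = g z"
    using measurable_borel_representative[OF m Q_borel] by blast
  have "AE z in lborel. z \<in> Q T \<longrightarrow> (case z of (x,t) \<Rightarrow> \<phi> x t) = g z" using g(2) by (simp add: AE_lebesgue_on_iff)
  from AE_section[OF this] have ae: "AE t in lborel. AE x in lborel. x \<in> \<Omega> \<and> t \<in> {0<..<T} \<longrightarrow> \<phi> x t = g (x, t)" by simp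
  have gt: "(\<lambda>x. g (x, t)) \<in> borel_measurable borel" for t
    by (intro measurable_compose[OF _ g(1)]) (simp add: borel_prod[symmetric])
  have "(\<integral>\<^sup>+z. ennreal ((g z)\<^sup>2) * indicator (Q T) z \<partial>lborel)
    = (\<integral>\<^sup>+t. (\<integral>\<^sup>+x. ennreal ((g (x, t))\<^sup>2) * indicator \<Omega> x \<partial>lborel) * indicator {0<..<T} t \<partial>lborel)"
    by (rule nn_integral_Q, rule measurable_compose[OF g(1)]) measurable
  also have "\<dots> \<le> (\<integral>\<^sup>+t. ennreal (B\<^sup>2) * indicator {0<..<T} t \<partial>lborel)"
  proof (rule nn_integral_mono_AE)
    show "AE t in lborel. (\<integral>\<^sup>+x. ennreal ((g (x, t))\<^sup>2) * indicator \<Omega> x \<partial>lborel) * indicator {0<..<T} t \<le> ennreal (B\<^sup>2) * indicator {0<..<T} t"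
      using ae
    proof eventually_elim
      case (elim t)
      show ?case
      proof (cases "t \<in> {0<..<T}")
        case True
        then have t: "t \<in> {0..T}" by simp
        have a: "AE x in lebesgue_on \<Omega>. \<phi> x t = g (x, t)"
          using elim True by (simp add: AE_lebesgue_on_iff)
        have gL: "(\<lambda>x. g (x, t)) \<in> L2 \<Omega>"
          by (rule L2_cong_AE[OF slice[OF t] borel_measurable_lebesgue_on[OF gt] a])
        have "L2_norm \<Omega> (\<lambda>x. g (x, t)) = L2_norm \<Omega> (\<lambda>x. \<phi> x t)"
          by (rule L2_norm_cong_AE[OF L2_D(1)[OF slice[OF t]] L2_D(1)[OF gL] a, symmetric])
        then have "(L2_norm \<Omega> (\<lambda>x. g (x, t)))\<^sup>2 \<le> B\<^sup>2" using B[OF t] by (simp add: power_mono)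
        then show ?thesis
          using L2_nn_integral(2)[OF gt _ gL] by (simp add: ennreal_leI mult_right_mono)
      qed simp
    qed
  qed
  also have "\<dots> < \<infinity>" using T by (simp add: nn_integral_cmult_indicator ennreal_mult_less_top)
  finally have "g \<in> L2 (Q T)" using L2_nn_integral(1)[OF g(1) Q_borel] by simp
  then show ?thesis
    by (rule L2_cong_AE[OF _ m]) (use g(2) in \<open>auto elim: eventually_mono\<close>)
qed

text \<open>For fixed \<open>k\<close> the sine coefficient \<open>a k t\<close> of the slice at
  time \<open>t\<close> is orthogonal to all test functions of time, hence zero for almost every
  \<open>t\<close>. As there are countably many \<open>k\<close>, almost every slice has all its
  sine coefficients zero and vanishes by completeness of the sines.\<close>

lemma separated_orthogonality:
  assumes w: "w \<in> L2 (Q T)"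
    and orth: "\<And>k::int. \<And>c. c \<in> Cc1 0 T \<Longrightarrow> (\<integral>z. w z * (sin (of_int k * pi * fst z) * c (snd z)) \<partial>lebesgue_on (Q T)) = 0"
  shows "AE z in lebesgue_on (Q T). w z = 0"
proof -
  obtain g where g: "g \<in> borel_measurable borel" "g \<in> L2 (Q T)" "AE z in lebesgue_on (Q T). w z = g z"
    using L2_borel_representative[OF w Q_borel] by blast
  have gt: "(\<lambda>x. g (x, t)) \<in> borel_measurable borel" for t
    by (intro measurable_compose[OF _ g(1)]) (simp add: borel_prod[symmetric])
  define a where "a k t = (\<integral>x. g (x, t) * sin (of_int k * pi * x) \<partial>lebesgue_on \<Omega>)" for k :: int and t
  have sm: "(\<lambda>z::real \<times> real. sin (r * fst z)) \<in> borel_measurable borel" for r :: real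
    unfolding borel_prod[symmetric] by measurable
  have cm: "(\<lambda>z::real \<times> real. c (snd z)) \<in> borel_measurable borel" if "continuous_on UNIV c" for c :: "real \<Rightarrow> real"
    using borel_measurable_continuous_onI[OF that] unfolding borel_prod[symmetric] by measurable
  have key: "AE t in lebesgue_on {0<..<T}. a k t = 0" for k
  proof -
    \<comment> \<open>Extension by zero turns the integral over the cylinder into one over the
      plane, where Fubini is available.\<close>
    define G where "G z = indicat_real (Q T) z * (g z * sin (of_int k * pi * fst z))" for z
    have gs: "(\<lambda>z. sin (of_int k * pi * fst z) * g z) \<in> L2 (Q T)"
      by (rule L2_mult_bounded(1)[OF g(2) borel_measurable_lebesgue_on[OF sm] AE_I2[where P="\<lambda>z. \<bar>sin (of_int k * pi * fst z)\<bar> \<le> 1"]]) simp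
    have Gm: "G \<in> borel_measurable borel"
      unfolding G_def[abs_def] by (intro borel_measurable_times borel_measurable_indicator g(1) sm Q_borel)
    have "integrable (lebesgue_on (Q T)) (\<lambda>z. sin (of_int k * pi * fst z) * g z)"
      by (rule L2_imp_integrable[OF Q_lmeasurable gs])
    then have "integrable lebesgue G"
      by (simp add: integrable_restrict_space fmeasurableD G_def[abs_def] mult.commute mult.left_commute)
    then have Gi: "integrable (lborel \<Otimes>\<^sub>M lborel) G" using integrable_completion[of G lborel] Gm by (simp add: lborel_prod)
    have ai: "integrable lborel (\<lambda>t. \<integral>x. G (x, t) \<partial>lborel)"
      using lborel_pair.integrable_snd[of "\<lambda>x t. G (x, t)"] Gi by simp
    have aG: "(\<integral>x. G (x, t) \<partial>lborel) = indicat_real {0<..<T} t * a k t" for t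
    proof -
      have m: "(\<lambda>x. indicat_real \<Omega> x *\<^sub>R (g (x, t) * sin (of_int k * pi * x))) \<in> borel_measurable lborel"
        using gt[of t] by measurable
      have "a k t = (\<integral>x. indicat_real \<Omega> x *\<^sub>R (g (x, t) * sin (of_int k * pi * x)) \<partial>lebesgue)"
        unfolding a_def by (rule integral_restrict_space) simp
      also have "\<dots> = (\<integral>x. indicat_real \<Omega> x *\<^sub>R (g (x, t) * sin (of_int k * pi * x)) \<partial>lborel)"
        by (rule integral_completion[OF m])
      finally have "indicat_real {0<..<T} t * a k t = (\<integral>x. indicat_real {0<..<T} t * (indicat_real \<Omega> x *\<^sub>R (g (x, t) * sin (of_int k * pi * x))) \<partial>lborel)"
        by simp
      also have "\<dots> = (\<integral>x. G (x, t) \<partial>lborel)"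
        by (rule Bochner_Integration.integral_cong) (auto simp: G_def indicator_def)
      finally show ?thesis by simp
    qed
    show ?thesis
    proof (rule fundamental_lemma)
      have "integrable lebesgue (\<lambda>t. \<integral>x. G (x, t) \<partial>lborel)"
        using ai by (rule integrable_completion[THEN iffD2, rotated]) (use ai in auto)
      then show "integrable (lebesgue_on {0<..<T}) (a k)"
        unfolding aG by (simp add: integrable_restrict_space)
      fix c assume c: "c \<in> Cc1 0 T"
      have cm': "c \<in> borel_measurable borel" using borel_measurable_continuous_onI[OF Cc1_D(3)[OF c]] .
      obtain B where B: "\<And>x. x \<in> {0..T} \<Longrightarrow> \<bar>c x\<bar> \<le> B"
        using continuous_Icc_bounded[OF continuous_on_subset[OF Cc1_D(3)[OF c]]] by blast
      have i1: "integrable (lborel \<Otimes>\<^sub>M lborel) (\<lambda>z. G z * c (snd z))"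
      proof (rule Bochner_Integration.integrable_bound[of _ "\<lambda>z. B * G z"])
        show "integrable (lborel \<Otimes>\<^sub>M lborel) (\<lambda>z. B * G z)" using Gi by simp
        show "(\<lambda>z. G z * c (snd z)) \<in> borel_measurable (lborel \<Otimes>\<^sub>M lborel)"
          unfolding lborel_prod using Gm cm[OF Cc1_D(3)[OF c]] by simp
        show "AE z in lborel \<Otimes>\<^sub>M lborel. norm (G z * c (snd z)) \<le> norm (B * G z)"
        proof (rule AE_I2)
          fix z
          show "norm (G z * c (snd z)) \<le> norm (B * G z)"
          proof (cases "z \<in> Q T")
            case True
            then have "snd z \<in> {0..T}" by auto
            then have "\<bar>c (snd z)\<bar> \<le> \<bar>B\<bar>" using B[of "snd z"] by linarith
            from mult_left_mono[OF this abs_ge_zero[of "G z"]] show ?thesis by (simp add: abs_mult mult.commute)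
          qed (simp add: G_def)
        qed
      qed
      have "(\<integral>t. (\<integral>x. G (x, t) * c t \<partial>lborel) \<partial>lborel) = (\<integral>z. G z * c (snd z) \<partial>(lborel \<Otimes>\<^sub>M lborel))"
        using lborel_pair.integral_snd[of "\<lambda>x t. G (x, t) * c t"] i1 by (simp add: case_prod_unfold)
      also have "\<dots> = (\<integral>z. G z * c (snd z) \<partial>lebesgue)"
        unfolding lborel_prod by (rule integral_completion[symmetric]) (use Gm cm[OF Cc1_D(3)[OF c]] in simp)
      also have "\<dots> = (\<integral>z. indicat_real (Q T) z *\<^sub>R (g z * (sin (of_int k * pi * fst z) * c (snd z))) \<partial>lebesgue)"
        by (rule Bochner_Integration.integral_cong) (auto simp: G_def)
      also have "\<dots> = (\<integral>z. g z * (sin (of_int k * pi * fst z) * c (snd z)) \<partial>lebesgue_on (Q T))"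
        by (rule integral_restrict_space[symmetric]) (simp add: fmeasurableD)
      also have "\<dots> = (\<integral>z. w z * (sin (of_int k * pi * fst z) * c (snd z)) \<partial>lebesgue_on (Q T))"
      proof (rule integral_cong_AE)
        have sc: "(\<lambda>z. sin (of_int k * pi * fst z) * c (snd z)) \<in> borel_measurable (lebesgue_on (Q T))"
          by (intro borel_measurable_lebesgue_on borel_measurable_times sm cm Cc1_D(3)[OF c])
        show "(\<lambda>z. g z * (sin (of_int k * pi * fst z) * c (snd z))) \<in> borel_measurable (lebesgue_on (Q T))"
          by (rule borel_measurable_times[OF L2_D(1)[OF g(2)] sc])
        show "(\<lambda>z. w z * (sin (of_int k * pi * fst z) * c (snd z))) \<in> borel_measurable (lebesgue_on (Q T))"
          by (rule borel_measurable_times[OF L2_D(1)[OF w] sc])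
        show "AE z in lebesgue_on (Q T). g z * (sin (of_int k * pi * fst z) * c (snd z)) = w z * (sin (of_int k * pi * fst z) * c (snd z))"
          using g(3) by eventually_elim simp
      qed
      also have "\<dots> = 0" by (rule orth[OF c])
      finally have z: "(\<integral>t. (\<integral>x. G (x, t) * c t \<partial>lborel) \<partial>lborel) = 0" .
      have "(\<integral>t. a k t * c t \<partial>lebesgue_on {0<..<T}) = (\<integral>t. indicat_real {0<..<T} t *\<^sub>R (a k t * c t) \<partial>lebesgue)"
        by (rule integral_restrict_space) simp
      also have "\<dots> = (\<integral>t. (\<integral>x. G (x, t) \<partial>lborel) * c t \<partial>lebesgue)"
        unfolding aG by (rule Bochner_Integration.integral_cong) auto
      also have "\<dots> = (\<integral>t. (\<integral>x. G (x, t) \<partial>lborel) * c t \<partial>lborel)"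
        using borel_measurable_integrable[OF ai] cm' by (intro integral_completion) simp
      also have "\<dots> = 0" using z by simp
      finally show "(\<integral>t. a k t * c t \<partial>lebesgue_on {0<..<T}) = 0" .
    qed
  qed
  \<comment> \<open>Completeness of the sines asks for square integrable slices; Tonelli provides
    them for almost every time.\<close>
  have fin: "AE t in lebesgue_on {0<..<T}. (\<lambda>x. g (x, t)) \<in> L2 \<Omega>"
  proof -
    let ?I = "\<lambda>t. (\<integral>\<^sup>+x. ennreal ((g (x, t))\<^sup>2) * indicator \<Omega> x \<partial>lborel) * indicator {0<..<T} t"
    have g2: "(\<lambda>z. ennreal ((g z)\<^sup>2)) \<in> borel_measurable borel" using g(1) by measurable
    have "(\<integral>\<^sup>+t. ?I t \<partial>lborel) = (\<integral>\<^sup>+z. ennreal ((g z)\<^sup>2) * indicator (Q T) z \<partial>lborel)"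
      by (rule nn_integral_Q[OF g2, symmetric])
    also have "\<dots> < \<infinity>" using L2_nn_integral(1)[OF g(1) Q_borel] g(2) by simp
    finally have lt: "(\<integral>\<^sup>+t. ?I t \<partial>lborel) \<noteq> \<infinity>" by simp
    have "(\<lambda>z. ennreal ((g z)\<^sup>2) * indicator \<Omega> (fst z)) \<in> borel_measurable (lborel \<Otimes>\<^sub>M lborel)"
    proof (rule borel_measurable_times_ennreal)
      show "(\<lambda>z. ennreal ((g z)\<^sup>2)) \<in> borel_measurable (lborel \<Otimes>\<^sub>M lborel)"
        using g2 by (simp only: lborel_prod measurable_lborel2)
    qed measurable
    from borel_measurable_nn_integral_section[OF this]
    have "?I \<in> borel_measurable lborel" by (intro borel_measurable_times_ennreal) simp_all
    from nn_integral_noteq_infinite[OF this lt] have "AE t in lborel. ?I t \<noteq> \<infinity>" .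
    then show ?thesis
      unfolding AE_lebesgue_on_iff[OF borel_open[OF open_greaterThanLessThan]]
      by eventually_elim (use L2_nn_integral(1)[OF gt] in \<open>auto simp: less_top\<close>)
  qed
  have "AE t in lebesgue_on {0<..<T}. \<forall>k. a k t = 0" using key by (simp add: AE_all_countable)
  with fin have "AE t in lebesgue_on {0<..<T}. AE x in lebesgue_on \<Omega>. g (x, t) = 0"
    by eventually_elim (rule sine_complete, simp_all add: a_def)
  then have "AE z in lebesgue_on (Q T). g z = 0"
    by (subst AE_Q_iff) (use measurable_sets[OF g(1), of "{0}"] in \<open>simp_all add: vimage_def\<close>)
  with g(3) show ?thesis by eventually_elim simp
qed

text \<open>Two solutions share the right-hand side of the transposition identity, so their
  difference is orthogonal to every source whose backward problem has a classical solution. The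
  products sin (k \<pi> x) c(t) are such sources and already separate points of L2.\<close>

lemma transposition_solution_unique:
  assumes T: "T \<ge> 0" and 1: "transposition_solution T p \<phi>" and 2: "transposition_solution T p \<phi>'"
  shows "AE z in lebesgue_on (Q T). (case z of (x,t) \<Rightarrow> \<phi> x t) = (case z of (x,t) \<Rightarrow> \<phi>' x t)"
proof -
  obtain p0 p1 where p: "p = (p0, p1)" by (cases p)
  have L: "(\<lambda>(x,t). \<phi> x t) \<in> L2 (Q T)" "(\<lambda>(x,t). \<phi>' x t) \<in> L2 (Q T)"
    using 1 2 wave_path_L2[OF _ T] by (auto simp: transposition_solution_def p)
  define w where "w z = (case z of (x,t) \<Rightarrow> \<phi> x t) - (case z of (x,t) \<Rightarrow> \<phi>' x t)" for z
  have "AE z in lebesgue_on (Q T). w z = 0"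
  proof (rule separated_orthogonality)
    show "w \<in> L2 (Q T)" unfolding w_def[abs_def] by (rule L2_diff[OF L])
    fix k :: int and c assume c: "c \<in> Cc1 0 T"
    show "(\<integral>z. w z * (sin (of_int k * pi * fst z) * c (snd z)) \<partial>lebesgue_on (Q T)) = 0"
    \<comment> \<open>For \<open>k = 0\<close> the sine is zero and the integral vanishes at once;
      otherwise Duhamel's formula may divide by the frequency.\<close>
    proof (cases "k = 0")
      case False
      let ?a = "of_int k * pi :: real"
      have "sin ?a = 0" by (simp add: mult.commute sin_zero_iff_int2)
      moreover have "?a \<noteq> 0" using False by simp
      ultimately obtain z zt where sol: "backward_solution T (\<lambda>x t. sin (?a * x) * c t) z zt"
        using separated_backward_solution[OF _ _ Cc1_D(3)[OF c] T] by blast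
      have cs: "(\<lambda>z. sin (?a * fst z) * c (snd z)) \<in> L2 (Q T)"
      proof (rule continuous_on_Q(1))
        have "continuous_on ({0..1} \<times> {0..T}) (\<lambda>z. c (snd z))"
          by (rule continuous_on_compose2[OF Cc1_D(3)[OF c]]) (auto intro!: continuous_intros)
        then show "continuous_on ({0..1} \<times> {0..T}) (\<lambda>z. sin (?a * fst z) * c (snd z))"
          by (intro continuous_intros)
      qed
      have eq: "(\<integral>z. (case z of (x,t) \<Rightarrow> \<phi> x t) * (sin (?a * fst z) * c (snd z)) \<partial>lebesgue_on (Q T))
        = p1 (\<lambda>x. z x 0) - (\<integral>x. p0 x * zt x 0 \<partial>lebesgue_on \<Omega>)"
        if "transposition_solution T p \<phi>" for \<phi>
      proof -
        have "(\<integral>(x,t). \<phi> x t * (sin (?a * x) * c t) \<partial>lebesgue_on (Q T)) = p1 (\<lambda>x. z x 0) - (\<integral>x. p0 x * zt x 0 \<partial>lebesgue_on \<Omega>)"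
          using that sol unfolding transposition_solution_def p by blast
        then show ?thesis by (simp add: case_prod_unfold)
      qed
      show ?thesis
        unfolding w_def left_diff_distrib
        using Bochner_Integration.integral_diff[OF L2_mult_integrable[OF L(1) cs] L2_mult_integrable[OF L(2) cs]]
        by (simp only: eq[OF 1] eq[OF 2] diff_self)
    qed simp
  qed
  then show ?thesis by (rule lebesgue_on_mono) (auto simp: w_def)
qed

text \<open>Existence of the d'Alembert solution makes the chosen function a solution, and
  uniqueness then makes the two equal almost everywhere.\<close>

lemma wave_sol_dAlembert:
  assumes "F \<in> periodic_L2" "p \<in> W" "generates F p" "T \<ge> 0"
  shows "transposition_solution T p (wave_sol T p)"
    "AE z in lebesgue_on (Q T). (case z of (x,t) \<Rightarrow> wave_sol T p x t) = (case z of (x,t) \<Rightarrow> dAlembert F x t)"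
proof -
  note d = dAlembert_transposition_solution[OF assms]
  show s: "transposition_solution T p (wave_sol T p)"
    unfolding wave_sol_def by (rule someI[of "transposition_solution T p", OF d])
  show "AE z in lebesgue_on (Q T). (case z of (x,t) \<Rightarrow> wave_sol T p x t) = (case z of (x,t) \<Rightarrow> dAlembert F x t)"
    by (rule transposition_solution_unique[OF assms(4) s d])
qed

section \<open>Observability\<close>

text \<open>In the characteristic variables \<open>\<xi> = t + x\<close>, \<open>\<eta> = t - x\<close> a d'Alembert solution is
  \<open>F \<xi> - F \<eta>\<close>. Over a product of two intervals its energy controls the oscillation of \<open>F\<close> on
  each of them, overlapping intervals can be merged, and for \<open>T \<ge> 2\<close> one of the two
  characteristic projections of the tube covers more than a period.\<close>

lemma nn_integral_characteristic:
  assumes h: "h \<in> borel_measurable borel"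
  shows "(\<integral>\<^sup>+z. h (snd z + fst z, snd z - fst z) \<partial>lborel) * 2
    = (\<integral>\<^sup>+\<xi>. (\<integral>\<^sup>+\<eta>. h (\<xi> :: real, \<eta> :: real) \<partial>lborel) \<partial>lborel)"
proof -
  have m: "(\<lambda>z::real \<times> real. h (snd z + fst z, snd z - fst z)) \<in> borel_measurable (lborel \<Otimes>\<^sub>M lborel)"
  proof (rule measurable_compose[OF _ h])
    have "(\<lambda>z::real \<times> real. (snd z + fst z, snd z - fst z)) \<in> (borel \<Otimes>\<^sub>M borel) \<rightarrow>\<^sub>M (borel \<Otimes>\<^sub>M borel)" by measurable
    then show "(\<lambda>z::real \<times> real. (snd z + fst z, snd z - fst z)) \<in> lborel \<Otimes>\<^sub>M lborel \<rightarrow>\<^sub>M borel"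
      by (simp add: borel_prod lborel_prod)
  qed
  have m2: "(\<lambda>(\<xi>, t). h (\<xi>, 2 * t - \<xi>)) \<in> borel_measurable (lborel \<Otimes>\<^sub>M lborel)"
  proof -
    have "(\<lambda>z::real \<times> real. (fst z, 2 * snd z - fst z)) \<in> (borel \<Otimes>\<^sub>M borel) \<rightarrow>\<^sub>M (borel \<Otimes>\<^sub>M borel)" by measurable
    then have "(\<lambda>z::real \<times> real. (fst z, 2 * snd z - fst z)) \<in> lborel \<Otimes>\<^sub>M lborel \<rightarrow>\<^sub>M borel"
      by (simp add: borel_prod lborel_prod)
    from measurable_compose[OF this h] show ?thesis by (simp add: case_prod_unfold)
  qed
  have pair: "(\<lambda>\<xi>. (\<xi>, 2 * t - \<xi>)) \<in> borel \<rightarrow>\<^sub>M borel" "(\<lambda>\<eta>. (t, \<eta>)) \<in> borel \<rightarrow>\<^sub>M borel" for t :: real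
    by (rule borel_measurable_continuous_onI, intro continuous_intros continuous_on_Pair)+
  have "(\<integral>\<^sup>+z. h (snd z + fst z, snd z - fst z) \<partial>lborel) = (\<integral>\<^sup>+t. (\<integral>\<^sup>+x. h (t + x, t - x) \<partial>lborel) \<partial>lborel)"
    using lborel_pair.nn_integral_snd[OF m] by (simp add: lborel_prod)
  also have "\<dots> = (\<integral>\<^sup>+t. (\<integral>\<^sup>+\<xi>. h (\<xi>, 2 * t - \<xi>) \<partial>lborel) \<partial>lborel)"
  proof (rule nn_integral_cong)
    fix t :: real
    have "(\<lambda>\<xi>. h (\<xi>, 2 * t - \<xi>)) \<in> borel_measurable borel" by (rule measurable_compose[OF pair(1) h])
    from nn_integral_real_affine[OF this, of 1 t]
    show "(\<integral>\<^sup>+x. h (t + x, t - x) \<partial>lborel) = (\<integral>\<^sup>+\<xi>. h (\<xi>, 2 * t - \<xi>) \<partial>lborel)"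
      by (simp add: algebra_simps)
  qed
  also have "\<dots> = (\<integral>\<^sup>+\<xi>. (\<integral>\<^sup>+t. h (\<xi>, 2 * t - \<xi>) \<partial>lborel) \<partial>lborel)"
    using lborel_pair.Fubini[OF m2] by simp
  \<comment> \<open>With \<xi> fixed, \<eta> = 2 t - \<xi> replaces t; this substitution carries the
    whole Jacobian factor 2 of the characteristic variables, the earlier one being a
    translation.\<close>
  also have "\<dots> * 2 = (\<integral>\<^sup>+\<xi>. (\<integral>\<^sup>+t. h (\<xi>, 2 * t - \<xi>) \<partial>lborel) * 2 \<partial>lborel)"
    using lborel.borel_measurable_nn_integral[OF m2] by (subst nn_integral_multc) simp_all
  also have "\<dots> = (\<integral>\<^sup>+\<xi>. (\<integral>\<^sup>+\<eta>. h (\<xi>, \<eta>) \<partial>lborel) \<partial>lborel)"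
  proof (rule nn_integral_cong)
    fix \<xi> :: real
    have "(\<lambda>\<eta>. h (\<xi>, \<eta>)) \<in> borel_measurable borel" by (rule measurable_compose[OF pair(2) h])
    from nn_integral_real_affine[OF this, of 2 "- \<xi>"]
    show "(\<integral>\<^sup>+t. h (\<xi>, 2 * t - \<xi>) \<partial>lborel) * 2 = (\<integral>\<^sup>+\<eta>. h (\<xi>, \<eta>) \<partial>lborel)"
      by (simp add: mult.commute)
  qed
  finally show ?thesis .
qed

text \<open>\<open>E\<close> stands for an energy that sees \<open>F\<close> only up to constants,
  hence the oscillation about some \<open>m\<close>, which may depend on \<open>F\<close> while
  \<open>C\<close> may not.\<close>

definition controlled :: "((real \<Rightarrow> real) \<Rightarrow> real) \<Rightarrow> real \<Rightarrow> real \<Rightarrow> bool" where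
  "controlled E a b \<longleftrightarrow> (\<exists>C\<ge>0. \<forall>F\<in>periodic_L2. \<exists>m.
     (\<integral>\<^sup>+x. ennreal ((F x - m)\<^sup>2) * indicator {a<..<b} x \<partial>lborel) \<le> ennreal (C * E F))"

lemma controlled_mono:
  assumes "controlled E a b" "a \<le> a'" "b' \<le> b" shows "controlled E a' b'"
proof -
  have "(\<integral>\<^sup>+x. ennreal ((F x - m)\<^sup>2) * indicator {a'<..<b'} x \<partial>lborel)
     \<le> (\<integral>\<^sup>+x. ennreal ((F x - m)\<^sup>2) * indicator {a<..<b} x \<partial>lborel)" for F and m :: real
    using assms(2,3) by (intro nn_integral_mono mult_left_mono) (auto simp: indicator_def)
  then show ?thesis using assms(1) unfolding controlled_def by (meson order_trans)
qed

text \<open>On the overlap (c, b) both constants approximate the same \<open>F\<close>, so their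
  distance is bounded by the energy, and the constant of the second interval can be replaced by that
  of the first.\<close>

lemma controlled_merge:
  assumes E: "\<And>F. F \<in> periodic_L2 \<Longrightarrow> 0 \<le> E F"
    and 1: "controlled E a b" and 2: "controlled E c d" and ord: "a \<le> c" "c < b" "b \<le> d"
  shows "controlled E a d"
proof -
  obtain C1 where C1: "C1 \<ge> 0" "\<And>F. F \<in> periodic_L2 \<Longrightarrow> \<exists>m. (\<integral>\<^sup>+x. ennreal ((F x - m)\<^sup>2) * indicator {a<..<b} x \<partial>lborel) \<le> ennreal (C1 * E F)"
    using 1 unfolding controlled_def by blast
  obtain C2 where C2: "C2 \<ge> 0" "\<And>F. F \<in> periodic_L2 \<Longrightarrow> \<exists>m. (\<integral>\<^sup>+x. ennreal ((F x - m)\<^sup>2) * indicator {c<..<d} x \<partial>lborel) \<le> ennreal (C2 * E F)"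
    using 2 unfolding controlled_def by blast
  \<comment> \<open>Bound for (m - n)^2 relative to the energy, from averaging 2 (F - m)^2 + 2 (F -
    n)^2 over the overlap of length \<open>b - c\<close>.\<close>
  define D where "D = 2 * C1 / (b - c) + 2 * C2 / (b - c)"
  have D0: "D \<ge> 0" using C1(1) C2(1) ord by (simp add: D_def)
  \<comment> \<open>\<open>C1\<close> accounts for (a, b); the remaining terms come from (F - m)^2
    <= 2 (F - n)^2 + 2 (m - n)^2 on (c, d).\<close>
  define C where "C = C1 + (2 * C2 + 2 * (d - c) * D)"
  have C0: "C \<ge> 0" using C1(1) C2(1) D0 ord by (simp add: C_def)
  have "\<exists>m. (\<integral>\<^sup>+x. ennreal ((F x - m)\<^sup>2) * indicator {a<..<d} x \<partial>lborel) \<le> ennreal (C * E F)"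
    if F: "F \<in> periodic_L2" for F
  proof -
    note [measurable] = periodic_L2_D(1)[OF F]
    obtain m where m: "(\<integral>\<^sup>+x. ennreal ((F x - m)\<^sup>2) * indicator {a<..<b} x \<partial>lborel) \<le> ennreal (C1 * E F)"
      using C1(2)[OF F] by blast
    obtain n where n: "(\<integral>\<^sup>+x. ennreal ((F x - n)\<^sup>2) * indicator {c<..<d} x \<partial>lborel) \<le> ennreal (C2 * E F)"
      using C2(2)[OF F] by blast
    note E0 = E[OF F]
    have young: "(u - v)\<^sup>2 \<le> 2 * (w - u)\<^sup>2 + 2 * (w - v)\<^sup>2" for u v w :: real
    proof -
      have "0 \<le> ((w - u) + (w - v))\<^sup>2" by simp
      then show ?thesis by (simp add: power2_eq_square algebra_simps)
    qed
    have "ennreal ((m - n)\<^sup>2 * (b - c)) = (\<integral>\<^sup>+x. ennreal ((m - n)\<^sup>2) * indicator {c<..<b} x \<partial>lborel)"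
      using ord by (simp add: nn_integral_cmult_indicator ennreal_mult)
    also have "\<dots> \<le> (\<integral>\<^sup>+x. (2 * (ennreal ((F x - m)\<^sup>2) * indicator {a<..<b} x) + 2 * (ennreal ((F x - n)\<^sup>2) * indicator {c<..<d} x)) \<partial>lborel)"
    proof (rule nn_integral_mono)
      fix x :: real
      have "ennreal ((m - n)\<^sup>2) \<le> ennreal (2 * (F x - m)\<^sup>2 + 2 * (F x - n)\<^sup>2)" using young by (rule ennreal_leI)
      also have "\<dots> = 2 * ennreal ((F x - m)\<^sup>2) + 2 * ennreal ((F x - n)\<^sup>2)" by (simp add: ennreal_mult)
      finally show "ennreal ((m - n)\<^sup>2) * indicator {c<..<b} x \<le> 2 * (ennreal ((F x - m)\<^sup>2) * indicator {a<..<b} x) + 2 * (ennreal ((F x - n)\<^sup>2) * indicator {c<..<d} x)"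
        using ord by (auto simp: indicator_def)
    qed
    also have "\<dots> = 2 * (\<integral>\<^sup>+x. ennreal ((F x - m)\<^sup>2) * indicator {a<..<b} x \<partial>lborel) + 2 * (\<integral>\<^sup>+x. ennreal ((F x - n)\<^sup>2) * indicator {c<..<d} x \<partial>lborel)"
      by (simp add: nn_integral_add nn_integral_cmult)
    also have "\<dots> \<le> 2 * ennreal (C1 * E F) + 2 * ennreal (C2 * E F)"
      by (intro add_mono mult_left_mono m n) simp_all
    also have "\<dots> = ennreal (D * (b - c) * E F)"
    proof -
      have "D * (b - c) = 2 * C1 + 2 * C2" using ord by (simp add: D_def distrib_right)
      then have "D * (b - c) * E F = 2 * (C1 * E F) + 2 * (C2 * E F)" by (simp add: distrib_right)
      then show ?thesis using C1(1) C2(1) E0 by (simp add: ennreal_mult)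
    qed
    finally have "(m - n)\<^sup>2 * (b - c) \<le> D * (b - c) * E F"
      using D0 E0 ord by (simp add: ennreal_le_iff)
    then have mn: "(m - n)\<^sup>2 \<le> D * E F" using ord by (simp add: mult.commute mult.left_commute)
    have "(\<integral>\<^sup>+x. ennreal ((F x - m)\<^sup>2) * indicator {a<..<d} x \<partial>lborel)
      \<le> (\<integral>\<^sup>+x. (ennreal ((F x - m)\<^sup>2) * indicator {a<..<b} x + (2 * (ennreal ((F x - n)\<^sup>2) * indicator {c<..<d} x) + ennreal (2 * (D * E F)) * indicator {c<..<d} x)) \<partial>lborel)"
    proof (rule nn_integral_mono)
      fix x :: real
      have "(F x - m)\<^sup>2 \<le> 2 * (n - F x)\<^sup>2 + 2 * (n - m)\<^sup>2" by (rule young)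
      also have "\<dots> \<le> 2 * (F x - n)\<^sup>2 + 2 * (D * E F)" using mn by (simp add: power2_commute)
      finally have "ennreal ((F x - m)\<^sup>2) \<le> ennreal (2 * (F x - n)\<^sup>2 + 2 * (D * E F))" by (rule ennreal_leI)
      also have "\<dots> = 2 * ennreal ((F x - n)\<^sup>2) + ennreal (2 * (D * E F))" using D0 E0 by (simp add: ennreal_mult)
      finally show "ennreal ((F x - m)\<^sup>2) * indicator {a<..<d} x
         \<le> ennreal ((F x - m)\<^sup>2) * indicator {a<..<b} x + (2 * (ennreal ((F x - n)\<^sup>2) * indicator {c<..<d} x) + ennreal (2 * (D * E F)) * indicator {c<..<d} x)"
        using ord by (auto simp: indicator_def intro: add_increasing2)
    qed
    also have "\<dots> = (\<integral>\<^sup>+x. ennreal ((F x - m)\<^sup>2) * indicator {a<..<b} x \<partial>lborel)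
       + (2 * (\<integral>\<^sup>+x. ennreal ((F x - n)\<^sup>2) * indicator {c<..<d} x \<partial>lborel) + ennreal (2 * (D * E F)) * ennreal (d - c))"
      using ord by (simp add: nn_integral_add nn_integral_cmult nn_integral_cmult_indicator)
    also have "\<dots> \<le> ennreal (C1 * E F) + (2 * ennreal (C2 * E F) + ennreal (2 * (D * E F)) * ennreal (d - c))"
      by (intro add_mono mult_left_mono m n order_refl) simp_all
    also have "\<dots> = ennreal (C * E F)"
    proof -
      have "C * E F = C1 * E F + (2 * (C2 * E F) + 2 * (D * E F) * (d - c))" by (simp add: C_def algebra_simps)
      moreover have "ennreal (C1 * E F + (2 * (C2 * E F) + 2 * (D * E F) * (d - c)))
         = ennreal (C1 * E F) + (ennreal (2 * (C2 * E F)) + ennreal (2 * (D * E F) * (d - c)))"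
        using C1(1) C2(1) E0 D0 ord by (simp add: ennreal_plus)
      moreover have "ennreal (2 * (C2 * E F)) = 2 * ennreal (C2 * E F)" using C2(1) E0 by (simp add: ennreal_mult)
      moreover have "ennreal (2 * (D * E F) * (d - c)) = ennreal (2 * (D * E F)) * ennreal (d - c)"
        using D0 E0 ord by (intro ennreal_mult) auto
      ultimately show ?thesis by simp
    qed
    finally show ?thesis by blast
  qed
  then show ?thesis using C0 unfolding controlled_def by blast
qed

text \<open>A compactness argument. The induction carries a margin \<open>e\<close> on both sides,
  because intervals sharing only an end point have no overlap of positive length and could not be
  merged.\<close>

lemma controlled_interval:
  assumes E: "\<And>F. F \<in> periodic_L2 \<Longrightarrow> 0 \<le> E F" and ab: "a \<le> b"
    and local: "\<And>x. a \<le> x \<Longrightarrow> x \<le> b \<Longrightarrow> \<exists>k>0. controlled E (x - k) (x + k)"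
  shows "controlled E a b"
proof -
  have "\<exists>e>0. controlled E (a - e) (b + e)"
    using ab
  proof (induction rule: Bolzano)
    case (trans a b c)
    then obtain e e' where e: "e > 0" "e' > 0" "controlled E (a - e) (b + e)" "controlled E (b - e') (c + e')" by blast
    define m where "m = min e e'"
    have m: "m > 0" "m \<le> e" "m \<le> e'" using e by (auto simp: m_def)
    have "controlled E (a - m) (b + m)" "controlled E (b - m) (c + m)"
      using controlled_mono[OF e(3), of "a - m" "b + m"] controlled_mono[OF e(4), of "b - m" "c + m"] m by simp_all
    then have "controlled E (a - m) (c + m)"
      using controlled_merge[OF E, where a="a - m" and b="b + m" and c="b - m" and d="c + m"] trans m by simp
    then show ?case using m(1) by blast
  next
    case (local x)
    obtain k where k: "k > 0" "controlled E (x - k) (x + k)" using assms(3)[OF local] by blast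
    show ?case
    proof (rule exI[of _ "k / 2"], intro conjI allI impI)
      show "k / 2 > 0" using k by simp
      fix a b assume ab: "a \<le> x \<and> x \<le> b \<and> b - a < k / 2"
      have "controlled E (a - k / 2) (b + k / 2)"
        by (rule controlled_mono[OF k(2)]) (use ab k(1) in linarith)+
      then show "\<exists>e>0. controlled E (a - e) (b + e)" using k(1) by (intro exI[of _ "k / 2"]) simp
    qed
  qed
  then show ?thesis using controlled_mono by fastforce
qed

text \<open>The average over an interval of length \<open>2 * k\<close> is at most half of
  \<open>e / k\<close>. Exceeding \<open>e / k\<close> throughout forces \<open>e = 0\<close>, and
  then a positive function would have integral zero.\<close>

lemma exists_below_average:
  fixes f :: "real \<Rightarrow> ennreal"
  assumes f: "f \<in> borel_measurable borel" and k: "k > 0" and e: "e \<ge> 0"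
    and le: "(\<integral>\<^sup>+y. f y * indicator {c - k<..<c + k} y \<partial>lborel) \<le> ennreal e"
  shows "\<exists>y\<in>{c - k<..<c + k}. f y \<le> ennreal (e / k)"
proof (rule ccontr)
  let ?K = "{c - k<..<c + k}"
  assume "\<not> ?thesis"
  then have gt: "\<And>y. y \<in> ?K \<Longrightarrow> ennreal (e / k) < f y" by (auto simp: not_le)
  have "ennreal (2 * e) = (\<integral>\<^sup>+y. ennreal (e / k) * indicator ?K y \<partial>lborel)"
    using k e by (simp add: nn_integral_cmult_indicator ennreal_mult[symmetric])
  also have "\<dots> \<le> (\<integral>\<^sup>+y. f y * indicator ?K y \<partial>lborel)"
    using gt by (intro nn_integral_mono) (auto simp: indicator_def less_imp_le)
  also note le
  finally have "e = 0" using e by (simp add: ennreal_le_iff)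
  then have "(\<integral>\<^sup>+y. f y * indicator ?K y \<partial>lborel) = 0" using le by simp
  then have "AE y in lborel. f y * indicator ?K y = 0"
    using f by (subst (asm) nn_integral_0_iff_AE) auto
  then have "AE y in lborel. y \<notin> ?K"
    by eventually_elim (use gt in \<open>force simp: indicator_def split: if_splits\<close>)
  then have "emeasure lborel ?K = 0"
    by (subst (asm) AE_iff_measurable[where N="?K"]) auto
  then show False using k by simp
qed

text \<open>Choosing \<xi> where the inner integral is at most \<open>2 * E F / k\<close> and taking
  \<open>m = F \<xi>\<close> turns a double integral over a square into an oscillation bound on one
  of its sides.\<close>

lemma controlled_square:
  assumes k: "k > 0"
    and square: "\<And>F. F \<in> periodic_L2 \<Longrightarrow> (\<integral>\<^sup>+\<xi>. (\<integral>\<^sup>+\<eta>. ennreal ((F \<xi> - F \<eta>)\<^sup>2) * indicator {y - k<..<y + k} \<eta> \<partial>lborel) * indicator {x - k<..<x + k} \<xi> \<partial>lborel) \<le> ennreal (2 * E F)"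
    and E: "\<And>F. F \<in> periodic_L2 \<Longrightarrow> 0 \<le> E F"
  shows "controlled E (y - k) (y + k)"
  unfolding controlled_def
proof (rule exI[of _ "2 / k"], intro conjI ballI)
  show "0 \<le> 2 / k" using k by simp
  fix F assume F: "F \<in> periodic_L2"
  note [measurable] = periodic_L2_D(1)[OF F]
  have "(\<lambda>\<xi>. \<integral>\<^sup>+\<eta>. ennreal ((F \<xi> - F \<eta>)\<^sup>2) * indicator {y - k<..<y + k} \<eta> \<partial>lborel) \<in> borel_measurable borel"
    by measurable
  from exists_below_average[OF this k _ square[OF F]] E[OF F]
  obtain \<xi> where "(\<integral>\<^sup>+\<eta>. ennreal ((F \<xi> - F \<eta>)\<^sup>2) * indicator {y - k<..<y + k} \<eta> \<partial>lborel) \<le> ennreal (2 * E F / k)"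
    by auto
  then show "\<exists>m. (\<integral>\<^sup>+x. ennreal ((F x - m)\<^sup>2) * indicator {y - k<..<y + k} x \<partial>lborel) \<le> ennreal (2 / k * E F)"
    by (intro exI[of _ "F \<xi>"]) (simp add: power2_commute)
qed

section \<open>The energy form\<close>

text \<open>The polar form of the weighted energy, integrated over all of \<open>Q T\<close> instead
  of the tube: the cut-off vanishes off the tube, and a domain independent of the curve makes the
  forms of two curves directly comparable.\<close>

definition energy_form :: "real \<Rightarrow> (real \<Rightarrow> real) \<Rightarrow> (real \<Rightarrow> real) \<Rightarrow> (real \<Rightarrow> real) \<Rightarrow> (real \<Rightarrow> real) \<Rightarrow> real" where
  "energy_form T chi g F G
    = (\<integral>z. (chi (fst z - g (snd z)) * (case z of (x,t) \<Rightarrow> dAlembert F x t)) * (case z of (x,t) \<Rightarrow> dAlembert G x t) \<partial>lebesgue_on (Q T))"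

text \<open>The curve is meant to be a continuous representative, defined at all times. Plateau and
  support of the cut-off enter through hypotheses of individual lemmas.\<close>

locale energy =
  fixes T :: real and chi g :: "real \<Rightarrow> real"
  assumes T: "T \<ge> 0" and chi: "continuous_on UNIV chi" "\<And>x. 0 \<le> chi x" "\<And>x. chi x \<le> 1" and g: "continuous_on UNIV g"
begin

lemma weight_measurable: "(\<lambda>z. chi (fst z - g (snd z))) \<in> borel_measurable borel"
  by (intro borel_measurable_continuous_onI continuous_on_compose2[OF chi(1)] continuous_intros continuous_on_compose2[OF g]) auto

lemma weighted_L2:
  assumes "F \<in> periodic_L2"
  shows "(\<lambda>z. chi (fst z - g (snd z)) * (case z of (x,t) \<Rightarrow> dAlembert F x t)) \<in> L2 (Q T)"
proof (rule L2_mult_bounded(1)[OF dAlembert_Q(1)[OF assms T] borel_measurable_lebesgue_on[OF weight_measurable] AE_I2])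
  show "\<bar>chi (fst z - g (snd z))\<bar> \<le> 1" for z using chi(2,3) by simp
qed

lemma energy_integrable:
  assumes "F \<in> periodic_L2" "G \<in> periodic_L2"
  shows "integrable (lebesgue_on (Q T)) (\<lambda>z. (chi (fst z - g (snd z)) * (case z of (x,t) \<Rightarrow> dAlembert F x t)) * (case z of (x,t) \<Rightarrow> dAlembert G x t))"
  by (rule L2_mult_integrable[OF weighted_L2[OF assms(1)] dAlembert_Q(1)[OF assms(2) T]])

lemma energy_form_sym: "energy_form T chi g F G = energy_form T chi g G F"
  unfolding energy_form_def by (rule Bochner_Integration.integral_cong) auto

lemma energy_form_nonneg: "0 \<le> energy_form T chi g F F"
  unfolding energy_form_def using chi(2) by (intro integral_nonneg_AE AE_I2) (auto simp: mult.assoc)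

lemma energy_form_lin:
  assumes "F \<in> periodic_L2" "G \<in> periodic_L2" "H \<in> periodic_L2"
  shows "energy_form T chi g (\<lambda>x. a * F x + b * G x) H = a * energy_form T chi g F H + b * energy_form T chi g G H"
proof -
  have "energy_form T chi g (\<lambda>x. a * F x + b * G x) H
    = (\<integral>z. a * ((chi (fst z - g (snd z)) * (case z of (x,t) \<Rightarrow> dAlembert F x t)) * (case z of (x,t) \<Rightarrow> dAlembert H x t))
        + b * ((chi (fst z - g (snd z)) * (case z of (x,t) \<Rightarrow> dAlembert G x t)) * (case z of (x,t) \<Rightarrow> dAlembert H x t)) \<partial>lebesgue_on (Q T))"
    unfolding energy_form_def dAlembert_lin by (rule Bochner_Integration.integral_cong) (auto simp: algebra_simps)
  also have "\<dots> = a * energy_form T chi g F H + b * energy_form T chi g G H"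
    unfolding energy_form_def using energy_integrable[OF assms(1,3)] energy_integrable[OF assms(2,3)] by simp
  finally show ?thesis .
qed

lemma energy_form_const: "energy_form T chi g F (\<lambda>x. c) = 0"
  by (simp add: energy_form_def dAlembert_def case_prod_unfold)

lemma energy_form_bound:
  assumes F: "F \<in> periodic_L2" and G: "G \<in> periodic_L2"
  shows "\<bar>energy_form T chi g F G\<bar> \<le> 4 * T * circle_norm F * circle_norm G"
proof -
  have "\<bar>energy_form T chi g F G\<bar>
    \<le> L2_norm (Q T) (\<lambda>z. chi (fst z - g (snd z)) * (case z of (x,t) \<Rightarrow> dAlembert F x t)) * L2_norm (Q T) (\<lambda>(x,t). dAlembert G x t)"
    unfolding energy_form_def by (rule L2_Cauchy_Schwarz[OF weighted_L2[OF F] dAlembert_Q(1)[OF G T]])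
  also have "L2_norm (Q T) (\<lambda>z. chi (fst z - g (snd z)) * (case z of (x,t) \<Rightarrow> dAlembert F x t)) \<le> \<bar>1\<bar> * L2_norm (Q T) (\<lambda>(x,t). dAlembert F x t)"
    by (rule L2_mult_bounded(2)[OF dAlembert_Q(1)[OF F T] borel_measurable_lebesgue_on[OF weight_measurable] AE_I2])
      (use chi(2,3) in simp)
  also have "\<bar>1\<bar> * L2_norm (Q T) (\<lambda>(x,t). dAlembert F x t) \<le> 2 * sqrt T * circle_norm F" using dAlembert_Q(2)[OF F T] by simp
  also have "L2_norm (Q T) (\<lambda>(x,t). dAlembert G x t) \<le> 2 * sqrt T * circle_norm G" by (rule dAlembert_Q(2)[OF G T])
  finally have "\<bar>energy_form T chi g F G\<bar> \<le> 2 * sqrt T * circle_norm F * (2 * sqrt T * circle_norm G)"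
    using T by (simp add: mult_left_mono mult_right_mono)
  also have "\<dots> = 4 * T * circle_norm F * circle_norm G" using T by (simp add: algebra_simps)
  finally show ?thesis .
qed

lemma energy_form_nn:
  assumes F: "F \<in> periodic_L2"
  shows "ennreal (energy_form T chi g F F)
    = (\<integral>\<^sup>+z. ennreal (chi (fst z - g (snd z)) * (F (snd z + fst z) - F (snd z - fst z))\<^sup>2) * indicator (Q T) z \<partial>lborel)"
proof -
  have eq: "(chi (fst z - g (snd z)) * (case z of (x,t) \<Rightarrow> dAlembert F x t)) * (case z of (x,t) \<Rightarrow> dAlembert F x t)
     = chi (fst z - g (snd z)) * (F (snd z + fst z) - F (snd z - fst z))\<^sup>2" for z
    by (simp add: case_prod_unfold dAlembert_def power2_eq_square)
  have m: "(\<lambda>z. chi (fst z - g (snd z)) * (F (snd z + fst z) - F (snd z - fst z))\<^sup>2) \<in> borel_measurable borel"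
    using dAlembert_measurable[OF periodic_L2_D(1)[OF F]] weight_measurable by (simp add: case_prod_unfold dAlembert_def)
  have "(\<integral>\<^sup>+z. ennreal (chi (fst z - g (snd z)) * (F (snd z + fst z) - F (snd z - fst z))\<^sup>2) \<partial>lebesgue_on (Q T)) = ennreal (energy_form T chi g F F)"
    unfolding energy_form_def eq
    by (rule nn_integral_eq_integral[OF energy_integrable[OF F F, unfolded eq] AE_I2]) (use chi(2) in simp)
  moreover have "(\<lambda>z. ennreal (chi (fst z - g (snd z)) * (F (snd z + fst z) - F (snd z - fst z))\<^sup>2)) \<in> borel_measurable borel"
    by (rule measurable_compose[OF m]) measurable
  ultimately show ?thesis by (simp add: nn_integral_lebesgue_on)
qed

text \<open>Around a point closer than \<open>r\<close> to the curve, a small square in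
  characteristic coordinates stays where the cut-off is 1. There the energy is, up to the Jacobian,
  the integral of (F \<xi> - F \<eta>)^2, so \<open>F\<close> is controlled near both characteristic
  coordinates of the point.\<close>

lemma controlled_near:
  assumes chi1: "\<And>x. \<bar>x\<bar> \<le> r \<Longrightarrow> chi x = 1" and z0: "0 < t0" "t0 < T" "\<bar>x0 - g t0\<bar> < r"
    and tube: "\<And>x t. 0 < t \<Longrightarrow> t < T \<Longrightarrow> \<bar>x - g t\<bar> < r \<Longrightarrow> 0 < x \<and> x < 1"
  shows "\<exists>k>0. controlled (\<lambda>F. energy_form T chi g F F) (t0 + x0 - k) (t0 + x0 + k) \<and>
     controlled (\<lambda>F. energy_form T chi g F F) (t0 - x0 - k) (t0 - x0 + k)"
proof -
  define \<rho> where "\<rho> = r - \<bar>x0 - g t0\<bar>"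
  have \<rho>: "\<rho> > 0" using z0 by (simp add: \<rho>_def)
  have "isCont g t0" using g by (simp add: continuous_on_eq_continuous_at)
  then obtain d where d: "d > 0" "\<And>t. \<bar>t - t0\<bar> < d \<Longrightarrow> \<bar>g t - g t0\<bar> < \<rho> / 2"
    using \<rho> unfolding continuous_at_eps_delta dist_real_def by (metis half_gt_zero)
  \<comment> \<open>Half of the slack \<rho> is granted to the motion of the curve and half to the
    displacement of \<open>x\<close>; the last two entries keep the times inside (0, T).\<close>
  define k where "k = min (min d (\<rho> / 2)) (min t0 (T - t0))"
  have k: "k > 0" "k \<le> d" "k \<le> \<rho> / 2" "k \<le> t0" "k \<le> T - t0" using d(1) \<rho> z0(1,2) unfolding k_def by linarith+
  define \<xi>0 where "\<xi>0 = t0 + x0"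
  define \<eta>0 where "\<eta>0 = t0 - x0"
  define I where "I = {\<xi>0 - k<..<\<xi>0 + k}"
  define K where "K = {\<eta>0 - k<..<\<eta>0 + k}"
  have inside: "(x, t) \<in> Q T \<and> chi (x - g t) = 1" if "t + x \<in> I" "t - x \<in> K" for x t
  proof -
    \<comment> \<open>\<open>t\<close> and \<open>x\<close> are half the sum and half the difference
      of the characteristic coordinates, so their displacements again stay below
      \<open>k\<close>.\<close>
    have tx: "\<bar>t - t0\<bar> < k" "\<bar>x - x0\<bar> < k" using that by (auto simp: I_def K_def \<xi>0_def \<eta>0_def)
    have t: "0 < t" "t < T" using tx(1) k(4,5) by auto
    have "\<bar>g t - g t0\<bar> < \<rho> / 2" using d(2)[of t] tx(1) k(2) by simp
    moreover have "\<bar>x - g t\<bar> \<le> \<bar>x - x0\<bar> + \<bar>x0 - g t0\<bar> + \<bar>g t - g t0\<bar>" by arith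
    moreover have "r = \<rho> + \<bar>x0 - g t0\<bar>" by (simp add: \<rho>_def)
    moreover have "a < s" if "a \<le> b + c + d" "b < k" "d < \<rho> / 2" "s = \<rho> + c" for a b c d s
      using that k(3) by linarith
    ultimately have lt: "\<bar>x - g t\<bar> < r" using tx(2) by blast
    then show ?thesis using tube[OF t lt] t chi1[of "x - g t"] by simp
  qed
  have sq: "(\<integral>\<^sup>+\<xi>. (\<integral>\<^sup>+\<eta>. ennreal ((F \<xi> - F \<eta>)\<^sup>2) * indicator K \<eta> \<partial>lborel) * indicator I \<xi> \<partial>lborel)
      \<le> ennreal (2 * energy_form T chi g F F)" if F: "F \<in> periodic_L2" for F
  proof -
    note [measurable] = periodic_L2_D(1)[OF F]
    define h where "h z = ennreal ((F (fst z) - F (snd z))\<^sup>2) * (indicator I (fst z) * indicator K (snd z))" for z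
    have [measurable]: "I \<in> sets borel" "K \<in> sets borel" by (simp_all add: I_def K_def)
    have hm: "h \<in> borel_measurable borel"
      unfolding h_def[abs_def] borel_prod[symmetric] by measurable
    have "(\<integral>\<^sup>+\<xi>. (\<integral>\<^sup>+\<eta>. ennreal ((F \<xi> - F \<eta>)\<^sup>2) * indicator K \<eta> \<partial>lborel) * indicator I \<xi> \<partial>lborel)
      = (\<integral>\<^sup>+\<xi>. (\<integral>\<^sup>+\<eta>. h (\<xi>, \<eta>) \<partial>lborel) \<partial>lborel)"
    proof (rule nn_integral_cong)
      fix \<xi> :: real
      have "(\<integral>\<^sup>+\<eta>. ennreal ((F \<xi> - F \<eta>)\<^sup>2) * indicator K \<eta> \<partial>lborel) * indicator I \<xi>
        = (\<integral>\<^sup>+\<eta>. (ennreal ((F \<xi> - F \<eta>)\<^sup>2) * indicator K \<eta>) * indicator I \<xi> \<partial>lborel)"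
        by (rule nn_integral_multc[symmetric]) measurable
      then show "(\<integral>\<^sup>+\<eta>. ennreal ((F \<xi> - F \<eta>)\<^sup>2) * indicator K \<eta> \<partial>lborel) * indicator I \<xi> = (\<integral>\<^sup>+\<eta>. h (\<xi>, \<eta>) \<partial>lborel)"
        by (simp add: h_def mult.assoc mult.commute mult.left_commute)
    qed
    also have "\<dots> = (\<integral>\<^sup>+z. h (snd z + fst z, snd z - fst z) \<partial>lborel) * 2"
      by (rule nn_integral_characteristic[OF hm, symmetric])
    also have "\<dots> \<le> ennreal (energy_form T chi g F F) * 2"
      unfolding energy_form_nn[OF F]
    proof (rule mult_right_mono, rule nn_integral_mono)
      fix z :: "real \<times> real"
      obtain x t where z: "z = (x, t)" by (cases z)
      show "h (snd z + fst z, snd z - fst z)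
        \<le> ennreal (chi (fst z - g (snd z)) * (F (snd z + fst z) - F (snd z - fst z))\<^sup>2) * indicator (Q T) z"
        using inside[of t x] by (auto simp: h_def z indicator_def)
    qed simp
    also have "\<dots> = ennreal (2 * energy_form T chi g F F)"
      using energy_form_nonneg by (simp add: ennreal_mult mult.commute)
    finally show ?thesis .
  qed
  have "controlled (\<lambda>F. energy_form T chi g F F) (\<eta>0 - k) (\<eta>0 + k)"
    by (rule controlled_square[OF k(1), where x=\<xi>0]) (use sq energy_form_nonneg in \<open>simp_all add: I_def K_def\<close>)
  moreover have "controlled (\<lambda>F. energy_form T chi g F F) (\<xi>0 - k) (\<xi>0 + k)"
  proof (rule controlled_square[OF k(1), where x=\<eta>0])
    fix F assume F: "F \<in> periodic_L2"
    note [measurable] = periodic_L2_D(1)[OF F]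
    have [measurable]: "I \<in> sets borel" "K \<in> sets borel" by (simp_all add: I_def K_def)
    have m: "(\<lambda>(\<xi>,\<eta>). ennreal ((F \<xi> - F \<eta>)\<^sup>2) * (indicator K \<eta> * indicator I \<xi>)) \<in> borel_measurable (lborel \<Otimes>\<^sub>M lborel)"
      unfolding case_prod_unfold by measurable
    have "(\<integral>\<^sup>+\<eta>. (\<integral>\<^sup>+\<xi>. ennreal ((F \<eta> - F \<xi>)\<^sup>2) * indicator I \<xi> \<partial>lborel) * indicator K \<eta> \<partial>lborel)
      = (\<integral>\<^sup>+\<eta>. (\<integral>\<^sup>+\<xi>. ennreal ((F \<xi> - F \<eta>)\<^sup>2) * (indicator K \<eta> * indicator I \<xi>) \<partial>lborel) \<partial>lborel)"
    proof (rule nn_integral_cong)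
      fix \<eta> :: real
      have "(\<integral>\<^sup>+\<xi>. ennreal ((F \<eta> - F \<xi>)\<^sup>2) * indicator I \<xi> \<partial>lborel) * indicator K \<eta>
        = (\<integral>\<^sup>+\<xi>. (ennreal ((F \<eta> - F \<xi>)\<^sup>2) * indicator I \<xi>) * indicator K \<eta> \<partial>lborel)"
        by (rule nn_integral_multc[symmetric]) measurable
      then show "(\<integral>\<^sup>+\<xi>. ennreal ((F \<eta> - F \<xi>)\<^sup>2) * indicator I \<xi> \<partial>lborel) * indicator K \<eta>
        = (\<integral>\<^sup>+\<xi>. ennreal ((F \<xi> - F \<eta>)\<^sup>2) * (indicator K \<eta> * indicator I \<xi>) \<partial>lborel)"
        by (simp add: power2_commute[of "F \<eta>"] mult.assoc mult.commute mult.left_commute)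
    qed
    also have "\<dots> = (\<integral>\<^sup>+\<xi>. (\<integral>\<^sup>+\<eta>. ennreal ((F \<xi> - F \<eta>)\<^sup>2) * (indicator K \<eta> * indicator I \<xi>) \<partial>lborel) \<partial>lborel)"
      using lborel_pair.Fubini[OF m] by simp
    also have "\<dots> = (\<integral>\<^sup>+\<xi>. (\<integral>\<^sup>+\<eta>. ennreal ((F \<xi> - F \<eta>)\<^sup>2) * indicator K \<eta> \<partial>lborel) * indicator I \<xi> \<partial>lborel)"
    proof (rule nn_integral_cong)
      fix \<xi> :: real
      have "(\<integral>\<^sup>+\<eta>. ennreal ((F \<xi> - F \<eta>)\<^sup>2) * indicator K \<eta> \<partial>lborel) * indicator I \<xi>
        = (\<integral>\<^sup>+\<eta>. (ennreal ((F \<xi> - F \<eta>)\<^sup>2) * indicator K \<eta>) * indicator I \<xi> \<partial>lborel)"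
        by (rule nn_integral_multc[symmetric]) measurable
      then show "(\<integral>\<^sup>+\<eta>. ennreal ((F \<xi> - F \<eta>)\<^sup>2) * (indicator K \<eta> * indicator I \<xi>) \<partial>lborel)
        = (\<integral>\<^sup>+\<eta>. ennreal ((F \<xi> - F \<eta>)\<^sup>2) * indicator K \<eta> \<partial>lborel) * indicator I \<xi>"
        by (simp add: mult.assoc)
    qed
    finally show "(\<integral>\<^sup>+\<xi>. (\<integral>\<^sup>+\<eta>. ennreal ((F \<xi> - F \<eta>)\<^sup>2) * indicator {\<xi>0 - k<..<\<xi>0 + k} \<eta> \<partial>lborel) * indicator {\<eta>0 - k<..<\<eta>0 + k} \<xi> \<partial>lborel)
      \<le> ennreal (2 * energy_form T chi g F F)"
      using sq[OF F] by (simp add: I_def K_def)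
  qed (rule energy_form_nonneg)
  ultimately show ?thesis using k(1) unfolding \<xi>0_def \<eta>0_def by blast
qed

text \<open>The path x = g(t) + r (t/T - 1/2) stays closer than \<open>r\<close> to the curve. Along
  it t + x grows by T + r + g(T) - g(0), and along its mirror image in the curve t - x grows by T +
  r - (g(T) - g(0)). One of these is at least T + r, so a closed interval of length 2 fits strictly
  inside its range; merging the local control along it covers a full period.\<close>

lemma observability:
  assumes T2: "T \<ge> 2" and r: "r > 0" and chi1: "\<And>x. \<bar>x\<bar> \<le> r \<Longrightarrow> chi x = 1"
    and tube: "\<And>x t. 0 < t \<Longrightarrow> t < T \<Longrightarrow> \<bar>x - g t\<bar> < r \<Longrightarrow> 0 < x \<and> x < 1"
  obtains C where "C \<ge> 0" "\<And>F. F \<in> periodic_L2 \<Longrightarrow> \<exists>m. (circle_norm (\<lambda>x. F x - m))\<^sup>2 \<le> C * energy_form T chi g F F"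
proof -
  let ?E = "\<lambda>F. energy_form T chi g F F"
  have shift: "\<bar>r * (t / T - 1 / 2)\<bar> < r" if "0 \<le> t" "t \<le> T" for t
  proof -
    have "0 \<le> t / T" "t / T \<le> 1" using that T2 by simp_all
    then have "\<bar>t / T - 1 / 2\<bar> \<le> 1 / 2" by linarith
    then have "r * \<bar>t / T - 1 / 2\<bar> \<le> r * (1 / 2)" using r by (intro mult_left_mono) auto
    then show ?thesis using r by (simp add: abs_mult)
  qed
  have gc: "continuous_on S g" for S using g continuous_on_subset by blast
  have "\<exists>\<alpha>. controlled ?E \<alpha> (\<alpha> + 2)"
  proof (cases "g 0 \<le> g T")
    case True
    \<comment> \<open>The coordinate t + x along the drifting path.\<close>
    define h where "h t = t + g t + r * (t / T - 1 / 2)" for t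
    have hc: "continuous_on {0..T} h" unfolding h_def using T2 by (intro continuous_intros gc) auto
    have h0: "h 0 = g 0 - r / 2" "h T = T + g T + r / 2" using T2 by (simp_all add: h_def)
    have "controlled ?E (h 0 + r / 2) (h 0 + r / 2 + 2)"
    proof (rule controlled_interval)
      fix \<xi> assume \<xi>: "h 0 + r / 2 \<le> \<xi>" "\<xi> \<le> h 0 + r / 2 + 2"
      \<comment> \<open>\<open>h T - h 0\<close> is at least \<open>T + r\<close>; starting
        \<open>r / 2\<close> above \<open>h 0\<close> keeps the interval strictly between the end
        values, so that the intermediate time is neither 0 nor \<open>T\<close>.\<close>
      have lt: "h 0 < \<xi>" "\<xi> < h T" using \<xi> r T2 True unfolding h0 by linarith+
      obtain t where t: "0 \<le> t" "t \<le> T" "h t = \<xi>" using IVT'[of h 0 \<xi> T] lt T2 hc by auto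
      have t': "0 < t" "t < T" using t lt by (metis less_le)+
      have near: "\<bar>(\<xi> - t) - g t\<bar> < r" using shift[OF t(1,2)] t(3) by (simp add: h_def)
      have "\<exists>k>0. controlled ?E (t + (\<xi> - t) - k) (t + (\<xi> - t) + k) \<and> controlled ?E (t - (\<xi> - t) - k) (t - (\<xi> - t) + k)"
        by (rule controlled_near[OF chi1 t' near tube])
      then show "\<exists>k>0. controlled ?E (\<xi> - k) (\<xi> + k)" by auto
    qed (use energy_form_nonneg in simp_all)
    then show ?thesis by blast
  next
    case False
    \<comment> \<open>The coordinate t - x along the mirrored path x = g(t) - r (t/T - 1/2).\<close>
    define h where "h t = t - g t + r * (t / T - 1 / 2)" for t
    have hc: "continuous_on {0..T} h" unfolding h_def using T2 by (intro continuous_intros gc) auto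
    have h0: "h 0 = - g 0 - r / 2" "h T = T - g T + r / 2" using T2 by (simp_all add: h_def)
    have "controlled ?E (h 0 + r / 2) (h 0 + r / 2 + 2)"
    proof (rule controlled_interval)
      fix \<xi> assume \<xi>: "h 0 + r / 2 \<le> \<xi>" "\<xi> \<le> h 0 + r / 2 + 2"
      have lt: "h 0 < \<xi>" "\<xi> < h T" using \<xi> r T2 False unfolding h0 by linarith+
      obtain t where t: "0 \<le> t" "t \<le> T" "h t = \<xi>" using IVT'[of h 0 \<xi> T] lt T2 hc by auto
      have t': "0 < t" "t < T" using t lt by (metis less_le)+
      have near: "\<bar>(t - \<xi>) - g t\<bar> < r" using shift[OF t(1,2)] t(3) by (simp add: h_def)
      have "\<exists>k>0. controlled ?E (t + (t - \<xi>) - k) (t + (t - \<xi>) + k) \<and> controlled ?E (t - (t - \<xi>) - k) (t - (t - \<xi>) + k)"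
        by (rule controlled_near[OF chi1 t' near tube])
      then show "\<exists>k>0. controlled ?E (\<xi> - k) (\<xi> + k)" by auto
    qed (use energy_form_nonneg in simp_all)
    then show ?thesis by blast
  qed
  then obtain \<alpha> C where C: "C \<ge> 0" "\<And>F. F \<in> periodic_L2 \<Longrightarrow>
      \<exists>m. (\<integral>\<^sup>+x. ennreal ((F x - m)\<^sup>2) * indicator {\<alpha><..<\<alpha> + 2} x \<partial>lborel) \<le> ennreal (C * ?E F)"
    unfolding controlled_def by blast
  have "\<exists>m. (circle_norm (\<lambda>x. F x - m))\<^sup>2 \<le> C * ?E F" if F: "F \<in> periodic_L2" for F
  proof -
    obtain m where m: "(\<integral>\<^sup>+x. ennreal ((F x - m)\<^sup>2) * indicator {\<alpha><..<\<alpha> + 2} x \<partial>lborel) \<le> ennreal (C * ?E F)"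
      using C(2)[OF F] by blast
    note Fm = periodic_L2_diff[OF F periodic_L2_const[of m]]
    have mm: "(\<lambda>x. ennreal ((F x - m)\<^sup>2)) \<in> borel_measurable borel" using periodic_L2_D(1)[OF F] by measurable
    have "ennreal ((circle_norm (\<lambda>x. F x - m))\<^sup>2) \<le> ennreal (C * ?E F)"
      using m periodic_nn_integral[OF Fm, of \<alpha>] nn_integral_interval_open(1)[OF mm, of \<alpha> "\<alpha> + 2"] by simp
    then show ?thesis using C(1) energy_form_nonneg by (auto simp: ennreal_le_iff)
  qed
  then show ?thesis using that C(1) by blast
qed

end

section \<open>The cost functional\<close>

text \<open>Completeness of Lebesgue measure. The integrand of the cost contains the given curve and
  the chosen solution, which are compared with Borel functions only almost everywhere.\<close>

lemma borel_measurable_lebesgue_AE: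
  fixes f g :: "'a::euclidean_space \<Rightarrow> real"
  assumes g: "g \<in> borel_measurable lebesgue" and ae: "AE x in lebesgue. f x = g x"
  shows "f \<in> borel_measurable lebesgue"
proof (rule measurableI)
  fix A :: "real set" assume "A \<in> sets borel"
  then have gA: "g -` A \<inter> space lebesgue \<in> sets lebesgue" using g by (rule measurable_sets[rotated])
  show "f -` A \<inter> space lebesgue \<in> sets lebesgue"
  proof (rule completion.in_sets_AE[OF _ gA])
    show "AE x in lebesgue. x \<in> g -` A \<inter> space lebesgue \<longleftrightarrow> x \<in> f -` A \<inter> space lebesgue"
      using ae by eventually_elim auto
  qed simp
qed simp

text \<open>A null set of times sweeps out a null set of the cylinder. \<open>R\<close> may fail to
  be measurable, so a Borel null set \<open>N\<close> covering its failures is lifted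
  instead.\<close>

lemma AE_snd_Q:
  assumes "AE t in lebesgue_on {0<..<T}. R t" shows "AE z in lebesgue_on (Q T). R (snd z)"
proof -
  have "AE t in lborel. t \<in> {0<..<T} \<longrightarrow> R t" using assms by (simp add: AE_lebesgue_on_iff)
  then obtain N where N: "N \<in> null_sets lborel" "{t. \<not> (t \<in> {0<..<T} \<longrightarrow> R t)} \<subseteq> N"
    by (auto simp: eventually_ae_filter)
  have Nb: "N \<in> sets borel" using N(1) by (simp add: null_sets_def)
  have "snd -` N \<inter> space ((borel :: real measure) \<Otimes>\<^sub>M borel) \<in> sets ((borel :: real measure) \<Otimes>\<^sub>M (borel :: real measure))"
    by (rule measurable_sets[OF measurable_snd Nb])
  then have "snd -` N \<in> sets (borel :: (real \<times> real) measure)" unfolding borel_prod by simp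
  then have "- (snd -` N) \<in> sets (borel :: (real \<times> real) measure)" by (intro borel_comp) simp
  moreover have "- (snd -` N) = {z :: real \<times> real. snd z \<notin> N}" by auto
  ultimately have m: "{z :: real \<times> real. snd z \<notin> N} \<in> sets borel" by simp
  have "AE t in lebesgue_on {0<..<T}. t \<notin> N"
    unfolding AE_lebesgue_on_iff[OF borel_open[OF open_greaterThanLessThan]]
    using AE_not_in[OF N(1)] by eventually_elim simp
  then have "AE z in lebesgue_on (Q T). snd z \<notin> N"
    by (subst AE_Q_iff[OF m]) (auto elim: eventually_mono)
  then show ?thesis by (rule lebesgue_on_mono) (use N(2) in auto)
qed

lemma not_AE_False_interval:
  assumes "a < b" shows "\<not> (AE t in lebesgue_on {a<..<b::real}. False)"
proof
  assume "AE t in lebesgue_on {a<..<b}. False"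
  then have "AE t in lborel. t \<notin> {a<..<b}" by (simp add: AE_lebesgue_on_iff)
  then have "emeasure lborel {a<..<b} = 0"
    by (subst (asm) AE_iff_measurable[where N="{a<..<b}"]) auto
  then show False using assms by simp
qed

text \<open>The continuous representative on [0, T] is continued by its end values and clamped to
  the admissible range. The clamp changes nothing almost everywhere and makes the bounds hold at
  every time.\<close>

lemma Gad_representative:
  assumes \<gamma>: "\<gamma> \<in> Gad T \<delta>0 M" and T: "T > 0"
  obtains g where "continuous_on UNIV g" "AE t in lebesgue_on {0<..<T}. \<gamma> t = g t" "\<And>t. \<delta>0 \<le> g t" "\<And>t. g t \<le> 1 - \<delta>0"
proof -
  obtain v where v: "continuous_on {0..T} v" "AE t in lebesgue_on {0<..<T}. \<gamma> t = v t"
    using W1inf_continuous_representative[of \<gamma> 0 T] \<gamma> by (auto simp: Gad_def)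
  have b: "AE t in lebesgue_on {0<..<T}. \<delta>0 \<le> \<gamma> t \<and> \<gamma> t \<le> 1 - \<delta>0" using \<gamma> by (simp add: Gad_def)
  \<comment> \<open>The clamp respects both bounds only if they are consistent; on an interval of
    positive length a curve can satisfy them almost everywhere only in that case.\<close>
  have le: "\<delta>0 \<le> 1 - \<delta>0"
  proof (rule ccontr)
    assume "\<not> ?thesis"
    then have "AE t in lebesgue_on {0<..<T}. False" using b by (auto elim: eventually_mono)
    then show False using not_AE_False_interval[OF T] by blast
  qed
  define g where "g t = max \<delta>0 (min (1 - \<delta>0) (v (max 0 (min T t))))" for t
  show ?thesis
  proof
    have "continuous_on UNIV (\<lambda>t. v (max 0 (min T t)))"
      by (rule continuous_on_compose2[OF v(1)]) (use T in \<open>auto intro!: continuous_intros\<close>)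
    then show "continuous_on UNIV g" unfolding g_def by (intro continuous_intros)
    have "AE t in lebesgue_on {0<..<T}. t \<in> {0<..<T}" by (rule AE_I2) simp
    with v(2) b show "AE t in lebesgue_on {0<..<T}. \<gamma> t = g t"
      by eventually_elim (auto simp: g_def)
  qed (use le in \<open>auto simp: g_def\<close>)
qed

text \<open>Tube and integrand formed with the given curve agree almost everywhere with those formed
  with \<open>g\<close> and \<open>F\<close>. Outside the tube the cut-off vanishes, so that
  enlarging the domain to \<open>Q T\<close> adds nothing.\<close>

lemma weighted_energy_eq:
  assumes en: "energy T chi g" and out: "\<And>x. \<delta>0 \<le> \<bar>x\<bar> \<Longrightarrow> chi x = 0"
    and \<gamma>: "AE t in lebesgue_on {0<..<T}. \<gamma> t = g t" and F: "F \<in> periodic_L2"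
    and \<phi>: "AE z in lebesgue_on (Q T). (case z of (x,t) \<Rightarrow> \<phi> x t) = (case z of (x,t) \<Rightarrow> dAlembert F x t)"
  shows "weighted_energy T \<delta>0 chi \<gamma> \<phi> = energy_form T chi g F F"
proof -
  interpret energy T chi g by (rule en)
  let ?B = "{z. z \<in> Q T \<and> \<bar>fst z - g (snd z)\<bar> < \<delta>0}"
  have "AE z in lebesgue. z \<in> Q T \<longrightarrow> \<gamma> (snd z) = g (snd z)"
    using AE_snd_Q[OF \<gamma>] by (simp add: AE_lebesgue_on_iff AE_completion_iff)
  moreover have "AE z in lebesgue. z \<in> Q T \<longrightarrow> (case z of (x,t) \<Rightarrow> \<phi> x t) = (case z of (x,t) \<Rightarrow> dAlembert F x t)"
    using \<phi> by (simp add: AE_lebesgue_on_iff AE_completion_iff)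
  ultimately have ae: "AE z in lebesgue. z \<in> Q T \<longrightarrow> \<gamma> (snd z) = g (snd z) \<and> \<phi> (fst z) (snd z) = dAlembert F (fst z) (snd z)"
    by eventually_elim (auto simp: case_prod_unfold)
  have Bm: "?B \<in> sets lebesgue"
  proof -
    have "open {z. \<bar>fst z - g (snd z)\<bar> < \<delta>0}"
      by (intro open_Collect_less continuous_intros continuous_on_compose2[OF g]) auto
    then have "Q T \<inter> {z. \<bar>fst z - g (snd z)\<bar> < \<delta>0} \<in> sets borel" by (intro sets.Int borel_open Q_borel)
    then have "?B \<in> sets borel" by (simp add: Collect_conj_eq)
    then show ?thesis by simp
  qed
  have tm: "tube T \<delta>0 \<gamma> \<in> sets lebesgue"
  proof (rule completion.in_sets_AE[OF _ Bm])
    show "AE z in lebesgue. z \<in> ?B \<longleftrightarrow> z \<in> tube T \<delta>0 \<gamma>"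
      using ae by eventually_elim (auto simp: tube_def)
  qed simp
  let ?e = "\<lambda>z. (chi (fst z - g (snd z)) * (case z of (x,t) \<Rightarrow> dAlembert F x t)) * (case z of (x,t) \<Rightarrow> dAlembert F x t)"
  have eq: "AE z in lebesgue. indicat_real (tube T \<delta>0 \<gamma>) z *\<^sub>R (case z of (x,t) \<Rightarrow> (\<phi> x t)\<^sup>2 * chi (x - \<gamma> t)) = indicat_real (Q T) z *\<^sub>R ?e z"
    using ae
  proof eventually_elim
    case (elim z)
    show ?case
    proof (cases "z \<in> Q T")
      case True
      then have e: "\<gamma> (snd z) = g (snd z)" "\<phi> (fst z) (snd z) = dAlembert F (fst z) (snd z)" using elim by auto
      have "chi (fst z - g (snd z)) = 0" if "z \<notin> tube T \<delta>0 \<gamma>"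
        using that True e(1) out[of "fst z - g (snd z)"] by (auto simp: tube_def case_prod_unfold)
      then show ?thesis using True e by (auto simp: indicator_def case_prod_unfold power2_eq_square)
    next
      case False
      then have "z \<notin> tube T \<delta>0 \<gamma>" by (auto simp: tube_def)
      then show ?thesis using False by simp
    qed
  qed
  have "integrable lebesgue (\<lambda>z. indicat_real (Q T) z *\<^sub>R ?e z)"
    using energy_integrable[OF F F] integrable_restrict_space[of "Q T" lebesgue ?e] by (simp add: fmeasurableD)
  then have m2: "(\<lambda>z. indicat_real (Q T) z *\<^sub>R ?e z) \<in> borel_measurable lebesgue" by (rule borel_measurable_integrable)
  have "weighted_energy T \<delta>0 chi \<gamma> \<phi> = (\<integral>z. indicat_real (tube T \<delta>0 \<gamma>) z *\<^sub>R (case z of (x,t) \<Rightarrow> (\<phi> x t)\<^sup>2 * chi (x - \<gamma> t)) \<partial>lebesgue)"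
    unfolding weighted_energy_def using tm by (intro integral_restrict_space) simp
  also have "\<dots> = (\<integral>z. indicat_real (Q T) z *\<^sub>R ?e z \<partial>lebesgue)"
    by (rule integral_cong_AE[OF borel_measurable_lebesgue_AE[OF m2 eq] m2 eq])
  also have "\<dots> = energy_form T chi g F F"
    unfolding energy_form_def by (rule integral_restrict_space[symmetric]) (simp add: fmeasurableD)
  finally show ?thesis .
qed

text \<open>The linear part of the functional with its sign reversed, in terms of the profile. With
  this sign the Euler-Lagrange equation reads a(F, G) = load(G).\<close>

definition load :: "(real \<Rightarrow> real) \<Rightarrow> (real \<Rightarrow> real) \<Rightarrow> (real \<Rightarrow> real) \<Rightarrow> real" where
  "load y0 y1 F = velocity F 0 y0 - (\<integral>x. dAlembert F x 0 * y1 x \<partial>lebesgue_on \<Omega>)"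

lemma load_lin:
  assumes "y0 \<in> H10" "y1 \<in> L2 \<Omega>" "F \<in> periodic_L2" "G \<in> periodic_L2"
  shows "load y0 y1 (\<lambda>x. a * F x + b * G x) = a * load y0 y1 F + b * load y0 y1 G"
proof -
  have "(\<integral>x. dAlembert (\<lambda>x. a * F x + b * G x) x 0 * y1 x \<partial>lebesgue_on \<Omega>)
    = a * (\<integral>x. dAlembert F x 0 * y1 x \<partial>lebesgue_on \<Omega>) + b * (\<integral>x. dAlembert G x 0 * y1 x \<partial>lebesgue_on \<Omega>)"
    using L2_mult_integrable[OF dAlembert_L2(1)[OF assms(3)] assms(2)] L2_mult_integrable[OF dAlembert_L2(1)[OF assms(4)] assms(2)]
    by (simp add: dAlembert_lin distrib_right mult.assoc)
  then show ?thesis unfolding load_def velocity_lin[OF assms(3,4,1)] by (simp add: algebra_simps)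
qed

text \<open>For a constant profile the velocity pairing is a multiple of the mean of the weak
  derivative of \<open>y0\<close>, which is zero, and the displacement vanishes.\<close>

lemma load_const:
  assumes "y0 \<in> H10" shows "load y0 y1 (\<lambda>x. c) = 0"
proof -
  have "velocity (\<lambda>x. c) 0 y0 = - (2 * c) * (\<integral>x. weak_deriv 0 1 y0 x \<partial>lebesgue_on \<Omega>)"
    unfolding velocity_def by (simp flip: integral_mult_right_zero)
  then show ?thesis using H10_mean_weak_deriv[OF assms] by (simp add: load_def dAlembert_def)
qed

lemma load_diff_const:
  assumes "y0 \<in> H10" "y1 \<in> L2 \<Omega>" "F \<in> periodic_L2"
  shows "load y0 y1 (\<lambda>x. F x - c) = load y0 y1 F"
  using load_lin[OF assms periodic_L2_const[of c], of 1 "-1"] load_const[OF assms(1), of y1 c] by simp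

lemma load_bound:
  assumes "y0 \<in> H10" "y1 \<in> L2 \<Omega>" "F \<in> periodic_L2"
  shows "\<bar>load y0 y1 F\<bar> \<le> 2 * (L2_norm \<Omega> (weak_deriv 0 1 y0) + L2_norm \<Omega> y1) * circle_norm F"
proof -
  have "\<bar>\<integral>x. dAlembert F x 0 * y1 x \<partial>lebesgue_on \<Omega>\<bar> \<le> L2_norm \<Omega> (\<lambda>x. dAlembert F x 0) * L2_norm \<Omega> y1"
    by (rule L2_Cauchy_Schwarz[OF dAlembert_L2(1)[OF assms(3)] assms(2)])
  also have "\<dots> \<le> 2 * circle_norm F * L2_norm \<Omega> y1"
    by (rule mult_right_mono[OF dAlembert_L2(2)[OF assms(3)]]) simp
  finally show ?thesis using velocity_bound[OF assms(3,1), of 0] by (simp add: load_def algebra_simps)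
qed

text \<open>The L2 limit on (0, 2) is replaced by a Borel representative and repeated periodically,
  so that it meets the pointwise requirements of \<open>periodic_L2\<close>.\<close>

lemma periodic_L2_complete:
  assumes f: "\<And>n. f n \<in> periodic_L2"
    and Cauchy: "\<And>e. e > 0 \<Longrightarrow> \<exists>N. \<forall>m\<ge>N. \<forall>n\<ge>N. circle_norm (\<lambda>x. f m x - f n x) < e"
  obtains F where "F \<in> periodic_L2" "(\<lambda>n. circle_norm (\<lambda>x. f n x - F x)) \<longlonglongrightarrow> 0"
proof -
  obtain h where h: "h \<in> L2 {0<..<2}" "(\<lambda>n. circle_norm (\<lambda>x. f n x - h x)) \<longlonglongrightarrow> 0"
    using L2_complete[of "{0<..<2}" f] Cauchy periodic_L2_D(3)[OF f] by auto
  obtain h' where h': "h' \<in> borel_measurable borel" "h' \<in> L2 {0<..<2}" "AE x in lebesgue_on {0<..<2}. h x = h' x"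
    using L2_borel_representative[OF h(1)] by auto
  define F where "F y = h' (y - 2 * of_int \<lfloor>y / 2\<rfloor>)" for y
  have Fm: "F \<in> borel_measurable borel" unfolding F_def using h'(1) by measurable
  have per: "F (x + 2) = F x" for x
  proof -
    have "(x + 2) / 2 = x / 2 + of_int 1" by (simp add: field_simps)
    then have "\<lfloor>(x + 2) / 2\<rfloor> = \<lfloor>x / 2\<rfloor> + 1" by (simp only: floor_add_int)
    then show ?thesis by (simp add: F_def)
  qed
  have Fh: "F x = h' x" if "x \<in> {0<..<2}" for x
  proof -
    have "\<lfloor>x / 2\<rfloor> = 0" using that by (simp add: floor_eq_iff)
    then show ?thesis by (simp add: F_def)
  qed
  have ae: "AE x in lebesgue_on {0<..<2}. h x = F x" by (rule lebesgue_on_mono[OF h'(3)]) (simp add: Fh)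
  have FL: "F \<in> L2 {0<..<2}" by (rule L2_cong_AE[OF h(1) borel_measurable_lebesgue_on[OF Fm] ae])
  have "F \<in> periodic_L2" using Fm per FL by (simp add: periodic_L2_def)
  moreover have "circle_norm (\<lambda>x. f n x - F x) = circle_norm (\<lambda>x. f n x - h x)" for n
    by (rule L2_norm_cong_AE[OF L2_D(1)[OF L2_diff[OF periodic_L2_D(3)[OF f] FL]] L2_D(1)[OF L2_diff[OF periodic_L2_D(3)[OF f] h(1)]]])
      (use ae in \<open>auto elim: eventually_mono\<close>)
  ultimately show ?thesis using that h(2) by simp
qed

text \<open>Any profile generating the pair may be used: solutions agree almost everywhere, and the
  pairings see the data only as elements of L2 and \<open>Hm1\<close>. The functional on
  \<open>W\<close> thus becomes quadratic in the profile.\<close>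

lemma Jstar_eq:
  assumes en: "energy T chi g" and out: "\<And>x. \<delta>0 \<le> \<bar>x\<bar> \<Longrightarrow> chi x = 0"
    and \<gamma>: "AE t in lebesgue_on {0<..<T}. \<gamma> t = g t" and F: "F \<in> periodic_L2"
    and p: "p \<in> W" "generates F p" and y: "y0 \<in> H10" "y1 \<in> L2 \<Omega>"
  shows "weighted_energy T \<delta>0 chi \<gamma> (wave_sol T p) = energy_form T chi g F F"
    "Jstar T \<delta>0 chi y0 y1 \<gamma> p = 1/2 * energy_form T chi g F F - load y0 y1 F"
proof -
  have T: "T \<ge> 0" using en by (simp add: energy_def)
  show we: "weighted_energy T \<delta>0 chi \<gamma> (wave_sol T p) = energy_form T chi g F F"
    by (rule weighted_energy_eq[OF en out \<gamma> F wave_sol_dAlembert(2)[OF F p T]])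
  obtain p0 p1 where pp: "p = (p0, p1)" by (cases p)
  have "(\<integral>x. p0 x * y1 x \<partial>lebesgue_on \<Omega>) = (\<integral>x. dAlembert F x 0 * y1 x \<partial>lebesgue_on \<Omega>)"
  proof (rule integral_cong_AE)
    have "p0 \<in> L2 \<Omega>" using p(1) by (simp add: pp W_def)
    then show "(\<lambda>x. p0 x * y1 x) \<in> borel_measurable (lebesgue_on \<Omega>)"
      by (rule borel_measurable_integrable[OF L2_mult_integrable[OF _ y(2)]])
    show "(\<lambda>x. dAlembert F x 0 * y1 x) \<in> borel_measurable (lebesgue_on \<Omega>)"
      by (rule borel_measurable_integrable[OF L2_mult_integrable[OF dAlembert_L2(1)[OF F] y(2)]])
    show "AE x in lebesgue_on \<Omega>. p0 x * y1 x = dAlembert F x 0 * y1 x"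
      using p(2) by (auto simp: generates_def pp elim: eventually_mono)
  qed
  then show "Jstar T \<delta>0 chi y0 y1 \<gamma> p = 1/2 * energy_form T chi g F F - load y0 y1 F"
    using we p(2) y(1) by (simp add: Jstar_def pp load_def generates_def)
qed

text \<open>The constant functions, which generate the zero solution, are removed by subtracting means.\<close>

lemma energy_minimizer:
  assumes en: "energy T chi g" and y: "y0 \<in> H10" "y1 \<in> L2 \<Omega>" and C: "C \<ge> 0"
    and obs: "\<And>F. F \<in> periodic_L2 \<Longrightarrow> \<exists>m. (circle_norm (\<lambda>x. F x - m))\<^sup>2 \<le> C * energy_form T chi g F F"
  obtains F where "F \<in> periodic_L2" "\<And>G. G \<in> periodic_L2 \<Longrightarrow> energy_form T chi g F G = load y0 y1 G"
proof -
  interpret energy T chi g by (rule en)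
  let ?a = "energy_form T chi g" and ?l = "load y0 y1"
  define K where "K = 2 * (L2_norm \<Omega> (weak_deriv 0 1 y0) + L2_norm \<Omega> y1)"
  obtain v where v: "\<And>n::nat. v n \<in> periodic_L2"
    "\<And>e. e > 0 \<Longrightarrow> \<exists>N. \<forall>m\<ge>N. \<forall>n\<ge>N. ?a (\<lambda>x. v m x - v n x) (\<lambda>x. v m x - v n x) < e"
    "\<And>w. w \<in> periodic_L2 \<Longrightarrow> (\<lambda>n. ?a (v n) w) \<longlonglongrightarrow> ?l w"
  proof (rule quadratic_minimizing_sequence[of periodic_L2 ?a ?l "K\<^sup>2 * C"])
    show "periodic_L2 \<noteq> {}" using periodic_L2_const by blast
    show "(?l F)\<^sup>2 \<le> K\<^sup>2 * C * ?a F F" if F: "F \<in> periodic_L2" for F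
    proof -
      \<comment> \<open>The linear form ignores constants, so it may be estimated on F - m, whose
        norm is bounded by the energy.\<close>
      obtain m where m: "(circle_norm (\<lambda>x. F x - m))\<^sup>2 \<le> C * ?a F F" using obs[OF F] by blast
      have "\<bar>?l F\<bar> \<le> K * circle_norm (\<lambda>x. F x - m)"
        using load_bound[OF y periodic_L2_diff[OF F periodic_L2_const[of m]]] load_diff_const[OF y F, of m]
        by (simp add: K_def)
      then have "(?l F)\<^sup>2 \<le> (K * circle_norm (\<lambda>x. F x - m))\<^sup>2" by (intro power2_le_iff_abs_le[THEN iffD2]) (auto simp: K_def)
      also have "\<dots> \<le> K\<^sup>2 * (C * ?a F F)" unfolding power_mult_distrib by (intro mult_left_mono m) simp
      finally show ?thesis by (simp add: mult.assoc)
    qed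
  qed (use periodic_L2_lin energy_form_lin energy_form_sym energy_form_nonneg load_lin[OF y] in blast)+
  define mean where "mean F = (\<integral>x. F x \<partial>lebesgue_on {0<..<2::real}) / 2" for F :: "real \<Rightarrow> real"
  have int: "integrable (lebesgue_on {0<..<2}) F" if "F \<in> periodic_L2" for F
    using L2_imp_integrable[OF _ periodic_L2_D(3)[OF that]] by simp
  have mean_diff: "mean (\<lambda>x. F x - G x) = mean F - mean G" if "F \<in> periodic_L2" "G \<in> periodic_L2" for F G
    using int[OF that(1)] int[OF that(2)] by (simp add: mean_def diff_divide_distrib)
  have mean_const: "mean (\<lambda>x. c) = c" for c
    by (simp add: mean_def measure_restrict_space)
  have cn: "circle_norm (\<lambda>x. c) = \<bar>c\<bar> * sqrt 2" for c using L2_norm_const[of "{0<..<2::real}" c] by simp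
  \<comment> \<open>Observability supplies an unspecified constant; the mean depends linearly on the
    function, so centring commutes with differences. Using it at most doubles the norm, since the
    mean of a function, as a constant function, has norm at most that of the function.\<close>
  have center: "circle_norm (\<lambda>x. F x - mean F) \<le> 2 * circle_norm (\<lambda>x. F x - m)" if F: "F \<in> periodic_L2" for F m
  proof -
    define H where "H x = F x - m" for x
    have H: "H \<in> periodic_L2" unfolding H_def[abs_def] by (rule periodic_L2_diff[OF F periodic_L2_const])
    have mH: "mean H = mean F - m" using mean_diff[OF F periodic_L2_const[of m]] mean_const by (simp add: H_def[abs_def])
    have "\<bar>mean H\<bar> \<le> circle_norm H * sqrt 2 / 2"
      using L2_integral_bound[OF _ periodic_L2_D(3)[OF H]] by (simp add: mean_def)
    then have "\<bar>mean H\<bar> * sqrt 2 \<le> circle_norm H * sqrt 2 / 2 * sqrt 2" by (rule mult_right_mono) simp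
    moreover have "c * sqrt 2 / 2 * sqrt 2 = c" for c
    proof -
      have "c * sqrt 2 / 2 * sqrt 2 = c * (sqrt 2 * sqrt 2) / 2" by (simp only: times_divide_eq_left mult.assoc)
      then show ?thesis by simp
    qed
    ultimately have le: "circle_norm (\<lambda>x. mean H) \<le> circle_norm H" by (simp only: cn)
    have "(\<lambda>x. F x - mean F) = (\<lambda>x. H x - mean H)" by (auto simp: mH H_def)
    then have "circle_norm (\<lambda>x. F x - mean F) \<le> circle_norm H + circle_norm (\<lambda>x. mean H)"
      using L2_norm_triangle_diff[OF periodic_L2_D(3)[OF H] periodic_L2_D(3)[OF periodic_L2_const[of "mean H"]]] by simp
    then show ?thesis using le by (simp add: H_def[abs_def])
  qed
  define u where "u n x = v n x - mean (v n)" for n x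
  have u: "u n \<in> periodic_L2" for n unfolding u_def[abs_def] by (rule periodic_L2_diff[OF v(1) periodic_L2_const])
  have ua: "?a (u n) w = ?a (v n) w" if "w \<in> periodic_L2" for n w
    using energy_form_lin[OF v(1)[of n] periodic_L2_const[of "mean (v n)"] that, of 1 "-1"]
      energy_form_sym[of "\<lambda>x. mean (v n)" w] energy_form_const[of w "mean (v n)"] by (simp add: u_def[abs_def])
  have udiff: "(circle_norm (\<lambda>x. u i x - u j x))\<^sup>2 \<le> 4 * C * ?a (\<lambda>x. v i x - v j x) (\<lambda>x. v i x - v j x)" for i j
  proof -
    note d = periodic_L2_diff[OF v(1)[of i] v(1)[of j]]
    obtain m where m: "(circle_norm (\<lambda>x. v i x - v j x - m))\<^sup>2 \<le> C * ?a (\<lambda>x. v i x - v j x) (\<lambda>x. v i x - v j x)"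
      using obs[OF d] by blast
    have "(\<lambda>x. u i x - u j x) = (\<lambda>x. (v i x - v j x) - mean (\<lambda>x. v i x - v j x))"
      by (auto simp: u_def mean_diff[OF v(1) v(1)])
    then have "(circle_norm (\<lambda>x. u i x - u j x))\<^sup>2 \<le> (2 * circle_norm (\<lambda>x. v i x - v j x - m))\<^sup>2"
      using center[OF d, of m] by (intro power_mono) auto
    also have "\<dots> \<le> 4 * (C * ?a (\<lambda>x. v i x - v j x) (\<lambda>x. v i x - v j x))" using m by (simp add: power_mult_distrib)
    finally show ?thesis by simp
  qed
  obtain F where F: "F \<in> periodic_L2" "(\<lambda>n. circle_norm (\<lambda>x. u n x - F x)) \<longlonglongrightarrow> 0"
  proof (rule periodic_L2_complete[OF u])
    fix e :: real assume e: "e > 0"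
    have "e\<^sup>2 / (4 * C + 1) > 0" using e C by simp
    \<comment> \<open>The factor 4 is the square of the doubling caused by centring; the summand 1
      guards against \<open>C = 0\<close>.\<close>
    then obtain N where N: "\<And>i j. i \<ge> N \<Longrightarrow> j \<ge> N \<Longrightarrow> ?a (\<lambda>x. v i x - v j x) (\<lambda>x. v i x - v j x) < e\<^sup>2 / (4 * C + 1)"
      using v(2) by meson
    have "circle_norm (\<lambda>x. u i x - u j x) < e" if "i \<ge> N" "j \<ge> N" for i j
    proof -
      let ?A = "?a (\<lambda>x. v i x - v j x) (\<lambda>x. v i x - v j x)"
      have "4 * C * ?A \<le> (4 * C + 1) * ?A" using energy_form_nonneg by (intro mult_right_mono) auto
      also have "\<dots> < e\<^sup>2" using N[OF that] C by (simp add: pos_less_divide_eq mult.commute)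
      finally have "(circle_norm (\<lambda>x. u i x - u j x))\<^sup>2 < e\<^sup>2" using udiff[of i j] by linarith
      then show ?thesis using e by (simp add: power2_less_imp_less)
    qed
    then show "\<exists>N. \<forall>i\<ge>N. \<forall>j\<ge>N. circle_norm (\<lambda>x. u i x - u j x) < e" by blast
  qed blast
  have "?a F G = ?l G" if G: "G \<in> periodic_L2" for G
  proof -
    have "(\<lambda>n. ?a (u n) G - ?a F G) \<longlonglongrightarrow> 0"
    proof (rule Lim_null_comparison)
      show "(\<lambda>n. 4 * T * circle_norm (\<lambda>x. u n x - F x) * circle_norm G) \<longlonglongrightarrow> 0"
        using tendsto_mult_right[OF tendsto_mult_left[OF F(2), of "4 * T"], of "circle_norm G"] by simp
      show "\<forall>\<^sub>F n in sequentially. norm (?a (u n) G - ?a F G) \<le> 4 * T * circle_norm (\<lambda>x. u n x - F x) * circle_norm G"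
      proof (intro always_eventually allI)
        fix n
        have "?a (u n) G - ?a F G = ?a (\<lambda>x. u n x - F x) G"
          using energy_form_lin[OF u[of n] F(1) G, of 1 "-1"] by simp
        then show "norm (?a (u n) G - ?a F G) \<le> 4 * T * circle_norm (\<lambda>x. u n x - F x) * circle_norm G"
          using energy_form_bound[OF periodic_L2_diff[OF u[of n] F(1)] G] by simp
      qed
    qed
    then have "(\<lambda>n. ?a (u n) G) \<longlonglongrightarrow> ?a F G" by (simp add: LIM_zero_iff)
    then show ?thesis using v(3)[OF G] ua[OF G] LIMSEQ_unique by simp
  qed
  then show ?thesis using that F(1) by blast
qed

section \<open>Lipschitz bound for the cut-off and stability of the energy form\<close>

lemma cutoff_D:
  assumes "cutoff \<delta>0 \<delta> chi"
  shows "continuous_on UNIV chi" "0 \<le> chi x" "chi x \<le> 1" "\<bar>x\<bar> \<le> \<delta>0 - \<delta> \<Longrightarrow> chi x = 1" "\<delta>0 \<le> \<bar>x\<bar> \<Longrightarrow> chi x = 0"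
proof -
  have r: "range chi \<subseteq> {0..1}" using assms by (simp add: cutoff_def)
  then show "0 \<le> chi x" "chi x \<le> 1" by (auto simp: image_subset_iff)
  show "continuous_on UNIV chi"
    using assms by (auto simp: cutoff_def dest!: C1_diff_imp_diff intro: differentiable_imp_continuous_on)
  have 1: "\<forall>x\<in>{- \<delta>0 + \<delta>..\<delta>0 - \<delta>}. chi x = 1" and 0: "\<forall>x. x \<notin> {- \<delta>0<..<\<delta>0} \<longrightarrow> chi x = 0"
    using assms by (simp_all add: cutoff_def)
  show "chi x = 1" if "\<bar>x\<bar> \<le> \<delta>0 - \<delta>" using 1 that by (auto simp: abs_le_iff)
  show "chi x = 0" if "\<delta>0 \<le> \<bar>x\<bar>" using 0 that by (auto simp: abs_if split: if_splits)
qed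

text \<open>The differences x - g(t) of two points of [0, 1] stay in [-1, 1], where the continuous
  derivative is bounded.\<close>

lemma cutoff_Lipschitz:
  assumes "cutoff \<delta>0 \<delta> chi"
  obtains L where "L \<ge> 0" "\<And>x y. x \<in> {-1..1} \<Longrightarrow> y \<in> {-1..1} \<Longrightarrow> \<bar>chi x - chi y\<bar> \<le> L * \<bar>x - y\<bar>"
proof -
  obtain D where D: "\<And>x. (chi has_real_derivative D x) (at x)" "continuous_on UNIV D"
    using assms by (auto simp: cutoff_def C1_differentiable_on_def has_real_derivative_iff_has_vector_derivative)
  obtain L where L: "\<And>x. x \<in> {-1..1} \<Longrightarrow> \<bar>D x\<bar> \<le> L"
    using continuous_Icc_bounded[OF continuous_on_subset[OF D(2)], of "-1" 1] by auto
  have "\<bar>chi x - chi y\<bar> \<le> L * \<bar>x - y\<bar>" if "x \<in> {-1..1}" "y \<in> {-1..1}" for x y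
    using field_differentiable_bound[of "{-1..1}" chi D L x y] D(1) L that
    by (auto simp: has_field_derivative_at_within)
  moreover have "L \<ge> 0" using L[of 0] by simp
  ultimately show ?thesis using that by blast
qed

text \<open>The weights differ by at most \<open>L * e\<close> almost everywhere on the cylinder;
  Cauchy-Schwarz and the two cylinder norms, each with its factor 2 sqrt T, give the rest.\<close>

lemma energy_form_perturbation:
  assumes g: "energy T chi g" and h: "energy T chi h"
    and range: "\<And>t. g t \<in> {0..1}" "\<And>t. h t \<in> {0..1}"
    and L: "L \<ge> 0" "\<And>x y. x \<in> {-1..1} \<Longrightarrow> y \<in> {-1..1} \<Longrightarrow> \<bar>chi x - chi y\<bar> \<le> L * \<bar>x - y\<bar>"
    and e: "e \<ge> 0" "AE t in lebesgue_on {0<..<T}. \<bar>g t - h t\<bar> \<le> e"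
    and F: "F \<in> periodic_L2" and G: "G \<in> periodic_L2"
  shows "\<bar>energy_form T chi g F G - energy_form T chi h F G\<bar> \<le> L * e * (4 * T) * circle_norm F * circle_norm G"
proof -
  interpret g: energy T chi g by (rule g)
  interpret h: energy T chi h by (rule h)
  let ?F = "\<lambda>(x,t). dAlembert F x t" and ?G = "\<lambda>(x,t). dAlembert G x t"
  let ?w = "\<lambda>z. chi (fst z - g (snd z)) - chi (fst z - h (snd z))"
  have m: "?w \<in> borel_measurable (lebesgue_on (Q T))"
    by (intro borel_measurable_lebesgue_on borel_measurable_diff g.weight_measurable h.weight_measurable)
  have "AE z in lebesgue_on (Q T). z \<in> Q T" by (rule AE_I2) simp
  with AE_snd_Q[OF e(2)] have w: "AE z in lebesgue_on (Q T). \<bar>?w z\<bar> \<le> L * e"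
  proof eventually_elim
    case (elim z)
    have x: "0 < fst z" "fst z < 1" using elim(2) by auto
    have "fst z - g (snd z) \<in> {-1..1}" "fst z - h (snd z) \<in> {-1..1}"
      using x range(1)[of "snd z"] range(2)[of "snd z"] by auto
    then have "\<bar>?w z\<bar> \<le> L * \<bar>(fst z - g (snd z)) - (fst z - h (snd z))\<bar>" by (rule L(2))
    also have "\<dots> = L * \<bar>g (snd z) - h (snd z)\<bar>" by (simp add: abs_minus_commute)
    also have "\<dots> \<le> L * e" using elim(1) L(1) by (rule mult_left_mono)
    finally show ?case .
  qed
  note wF = L2_mult_bounded[OF dAlembert_Q(1)[OF F g.T] m w]
  have eq: "energy_form T chi g F G - energy_form T chi h F G = (\<integral>z. (?w z * ?F z) * ?G z \<partial>lebesgue_on (Q T))"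
    unfolding energy_form_def left_diff_distrib
    by (rule Bochner_Integration.integral_diff[OF g.energy_integrable[OF F G] h.energy_integrable[OF F G], symmetric])
  have "\<bar>energy_form T chi g F G - energy_form T chi h F G\<bar> \<le> L2_norm (Q T) (\<lambda>z. ?w z * ?F z) * L2_norm (Q T) ?G"
    unfolding eq by (rule L2_Cauchy_Schwarz[OF wF(1) dAlembert_Q(1)[OF G g.T]])
  also have "\<dots> \<le> (L * e * (2 * sqrt T * circle_norm F)) * (2 * sqrt T * circle_norm G)"
  proof (rule mult_mono)
    have "L2_norm (Q T) (\<lambda>z. ?w z * ?F z) \<le> L * e * L2_norm (Q T) ?F" using wF(2) L(1) e(1) by simp
    also have "\<dots> \<le> L * e * (2 * sqrt T * circle_norm F)"
      by (rule mult_left_mono[OF dAlembert_Q(2)[OF F g.T]]) (use L(1) e(1) in simp)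
    finally show "L2_norm (Q T) (\<lambda>z. ?w z * ?F z) \<le> L * e * (2 * sqrt T * circle_norm F)" .
    show "L2_norm (Q T) ?G \<le> 2 * sqrt T * circle_norm G" by (rule dAlembert_Q(2)[OF G g.T])
  qed (use L(1) e(1) g.T in simp_all)
  also have "\<dots> = L * e * (4 * T) * circle_norm F * circle_norm G"
  proof -
    have eq: "(L * e * (2 * s * n)) * (2 * s * k) = L * e * (4 * (s * s)) * n * k" for s n k :: real by simp
    have "sqrt T * sqrt T = T" using g.T by simp
    then show ?thesis unfolding eq by (simp only:)
  qed
  finally show ?thesis .
qed

lemma linear_bounded_by_quadratic_eq_0:
  fixes d b :: real
  assumes "\<And>s. 0 \<le> s * d + s\<^sup>2 * b" shows "d = 0"
proof (rule ccontr)
  assume d: "d \<noteq> 0"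
  \<comment> \<open>Scaled so that \<open>s * (\<bar>b\<bar> + 1) = - d\<close>; the summand 1 makes
    the denominator positive and the comparison below strict.\<close>
  define s where "s = - d / (\<bar>b\<bar> + 1)"
  have "s * d + s\<^sup>2 * b \<le> s * d + s\<^sup>2 * \<bar>b\<bar>" by (intro add_left_mono mult_left_mono) auto
  also have "s \<noteq> 0" using d by (simp add: s_def)
  then have "s * d + s\<^sup>2 * \<bar>b\<bar> < s * d + s\<^sup>2 * (\<bar>b\<bar> + 1)" by (simp add: distrib_left)
  also have "\<dots> = 0"
  proof -
    have "s * (\<bar>b\<bar> + 1) = - d" by (simp add: s_def)
    then show ?thesis unfolding power2_eq_square mult.assoc by simp
  qed
  finally show False using assms[of s] by simp
qed

text \<open>\<open>arg_min_on\<close> can be used only once a minimiser is known, so one is built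
  from the solution \<open>F0\<close> of the variational equation. That equation is then derived
  anew for the pair actually chosen, and testing it with its own profile identifies the cost with
  the linear form.\<close>

lemma J_eq_load:
  assumes T2: "T \<ge> 2" and \<delta>: "\<delta> \<in> {0<..<\<delta>0}" and cut: "cutoff \<delta>0 \<delta> chi"
    and y: "y0 \<in> H10" "y1 \<in> L2 \<Omega>"
    and rep: "continuous_on UNIV g" "AE t in lebesgue_on {0<..<T}. \<gamma> t = g t" "\<And>t. \<delta>0 \<le> g t" "\<And>t. g t \<le> 1 - \<delta>0"
  obtains F C where "F \<in> periodic_L2" "\<And>G. G \<in> periodic_L2 \<Longrightarrow> energy_form T chi g F G = load y0 y1 G"
    "J T \<delta>0 chi y0 y1 \<gamma> = load y0 y1 F"
    "C \<ge> 0" "\<And>F. F \<in> periodic_L2 \<Longrightarrow> \<exists>m. (circle_norm (\<lambda>x. F x - m))\<^sup>2 \<le> C * energy_form T chi g F F"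
proof -
  note c = cutoff_D[OF cut]
  have en: "energy T chi g" using T2 c(1-3) rep(1) by unfold_locales auto
  interpret energy T chi g by (rule en)
  let ?a = "energy_form T chi g" and ?l = "load y0 y1" and ?J = "Jstar T \<delta>0 chi y0 y1 \<gamma>"
  have tube: "0 < x \<and> x < 1" if "\<bar>x - g t\<bar> < \<delta>0 - \<delta>" for x t
    using that rep(3)[of t] rep(4)[of t] \<delta> by (auto simp: abs_less_iff)
  obtain C where C: "C \<ge> 0" "\<And>F. F \<in> periodic_L2 \<Longrightarrow> \<exists>m. (circle_norm (\<lambda>x. F x - m))\<^sup>2 \<le> C * ?a F F"
    using observability[OF T2, of "\<delta>0 - \<delta>"] \<delta> c(4) tube by auto
  obtain F0 where F0: "F0 \<in> periodic_L2" "\<And>G. G \<in> periodic_L2 \<Longrightarrow> ?a F0 G = ?l G"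
    using energy_minimizer[OF en y C] by blast
  have Jeq: "?J p = 1/2 * ?a F F - ?l F" "weighted_energy T \<delta>0 chi \<gamma> (wave_sol T p) = ?a F F"
    if "F \<in> periodic_L2" "p \<in> W" "generates F p" for F p
    using Jstar_eq[OF en c(5) rep(2) that y] by auto
  have expand: "?a (\<lambda>x. 1 * F x + s * G x) (\<lambda>x. 1 * F x + s * G x) = ?a F F + 2 * s * ?a F G + s\<^sup>2 * ?a G G"
    if F: "F \<in> periodic_L2" and G: "G \<in> periodic_L2" for F G s
  proof -
    note l = periodic_L2_lin[OF F G, of 1 s]
    have "?a (\<lambda>x. 1 * F x + s * G x) (\<lambda>x. 1 * F x + s * G x) = 1 * ?a (\<lambda>x. 1 * F x + s * G x) F + s * ?a (\<lambda>x. 1 * F x + s * G x) G"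
      using energy_form_lin[OF F G l, of 1 s] energy_form_sym by simp
    then show ?thesis
      using energy_form_lin[OF F G F, of 1 s] energy_form_lin[OF F G G, of 1 s] energy_form_sym[of G F]
      by (simp add: power2_eq_square algebra_simps)
  qed
  let ?p0 = "((\<lambda>x. dAlembert F0 x 0), velocity F0 0)"
  \<comment> \<open>As \<open>F0\<close> solves the equation, the functional at \<open>p\<close>
    exceeds its value at \<open>?p0\<close> by half the energy of F - F0.\<close>
  have min0: "is_arg_min ?J (\<lambda>p. p \<in> W) ?p0"
    unfolding is_arg_min_linorder
  proof (intro conjI allI impI)
    show "?p0 \<in> W" by (rule generates_W(1)[OF F0(1)])
    fix p assume p: "p \<in> W"
    obtain F where F: "F \<in> periodic_L2" "generates F p" using W_generated[OF p] by blast
    have d: "?a (\<lambda>x. 1 * F x + (-1) * F0 x) (\<lambda>x. 1 * F x + (-1) * F0 x) \<ge> 0" by (rule energy_form_nonneg)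
    have "?a F F0 = ?l F" using F0(2)[OF F(1)] energy_form_sym[of F F0] by simp
    moreover have "?a F0 F0 = ?l F0" by (rule F0(2)[OF F0(1)])
    ultimately show "?J ?p0 \<le> ?J p"
      using d expand[OF F(1) F0(1), of "-1"] Jeq(1)[OF F(1) p F(2)] Jeq(1)[OF F0(1) generates_W[OF F0(1)]] by simp
  qed
  define p where "p = arg_min_on ?J W"
  have "is_arg_min ?J (\<lambda>p. p \<in> W) p"
    unfolding p_def arg_min_on_def arg_min_def by (rule someI[of "is_arg_min ?J (\<lambda>p. p \<in> W)", OF min0])
  then have p: "p \<in> W" "\<And>q. q \<in> W \<Longrightarrow> ?J p \<le> ?J q" by (auto simp: is_arg_min_linorder)
  obtain F where F: "F \<in> periodic_L2" "generates F p" using W_generated[OF p(1)] by blast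
  \<comment> \<open>Every variation F + s G generates a pair in \<open>W\<close> and competes with
    \<open>p\<close>; a linear term in \<open>s\<close> that is dominated by a quadratic one must
    vanish.\<close>
  have EL: "?a F G = ?l G" if G: "G \<in> periodic_L2" for G
  proof -
    have "0 \<le> s * (?a F G - ?l G) + s\<^sup>2 * (?a G G / 2)" for s
    proof -
      note l = periodic_L2_lin[OF F(1) G, of 1 s]
      have "?J p \<le> ?J ((\<lambda>x. dAlembert (\<lambda>x. 1 * F x + s * G x) x 0), velocity (\<lambda>x. 1 * F x + s * G x) 0)"
        by (rule p(2)[OF generates_W(1)[OF l]])
      then have "1/2 * ?a F F - ?l F \<le> 1/2 * (?a F F + 2 * s * ?a F G + s\<^sup>2 * ?a G G) - (1 * ?l F + s * ?l G)"
        unfolding Jeq(1)[OF F(1) p(1) F(2)] Jeq(1)[OF l generates_W[OF l]] expand[OF F(1) G] load_lin[OF y F(1) G] .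
      then show ?thesis by (simp add: algebra_simps)
    qed
    from linear_bounded_by_quadratic_eq_0[OF this] show ?thesis by simp
  qed
  have "J T \<delta>0 chi y0 y1 \<gamma> = ?l F"
    using Jeq(2)[OF F(1) p(1) F(2)] EL[OF F(1)] by (simp add: J_def p_def)
  then show ?thesis using that[OF F(1) EL _ C] by blast
qed

theorem proposition1:
  fixes T \<delta>0 \<delta> M :: real
    and chi y0 y1 \<gamma> :: "real \<Rightarrow> real"
    and \<gamma>s :: "nat \<Rightarrow> real \<Rightarrow> real"
  assumes "T \<ge> 2" and "\<delta>0 > 0" and "\<delta> \<in> {0<..<\<delta>0}" and "M > 0"
    and "cutoff \<delta>0 \<delta> chi"
    and "y0 \<in> H10" and "y1 \<in> L2 \<Omega>"
    and "\<And>n. \<gamma>s n \<in> Gad T \<delta>0 M" and "\<gamma> \<in> Gad T \<delta>0 M"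
    and "(\<lambda>n. Linf_norm {0<..<T} (\<lambda>t. \<gamma>s n t - \<gamma> t)) \<longlonglongrightarrow> 0"
  shows "(\<lambda>n. J T \<delta>0 chi y0 y1 (\<gamma>s n)) \<longlonglongrightarrow> J T \<delta>0 chi y0 y1 \<gamma>"
proof -
  note cut = assms(5) and y = assms(6,7)
  have T0: "T > 0" using assms(1) by simp
  obtain g where g: "continuous_on UNIV g" "AE t in lebesgue_on {0<..<T}. \<gamma> t = g t" "\<And>t. \<delta>0 \<le> g t" "\<And>t. g t \<le> 1 - \<delta>0"
    using Gad_representative[OF assms(9) T0] by blast
  have "\<exists>h. continuous_on UNIV h \<and> (AE t in lebesgue_on {0<..<T}. \<gamma>s n t = h t) \<and> (\<forall>t. \<delta>0 \<le> h t \<and> h t \<le> 1 - \<delta>0)" for n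
  proof -
    obtain k where "continuous_on UNIV k" "AE t in lebesgue_on {0<..<T}. \<gamma>s n t = k t" "\<And>t. \<delta>0 \<le> k t" "\<And>t. k t \<le> 1 - \<delta>0"
      using Gad_representative[OF assms(8) T0] by blast
    then show ?thesis by blast
  qed
  then obtain h where h: "\<And>n. continuous_on UNIV (h n)" "\<And>n. AE t in lebesgue_on {0<..<T}. \<gamma>s n t = h n t"
    "\<And>n t. \<delta>0 \<le> h n t" "\<And>n t. h n t \<le> 1 - \<delta>0" by metis
  obtain L where L: "L \<ge> 0" "\<And>x y. x \<in> {-1..1} \<Longrightarrow> y \<in> {-1..1} \<Longrightarrow> \<bar>chi x - chi y\<bar> \<le> L * \<bar>x - y\<bar>"
    using cutoff_Lipschitz[OF cut] by blast
  have en: "energy T chi f" if "continuous_on UNIV f" for f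
    using T0 cutoff_D(1-3)[OF cut] that by unfold_locales auto
  interpret g: energy T chi g by (rule en[OF g(1)])
  let ?l = "load y0 y1" and ?a = "energy_form T chi g" and ?b = "\<lambda>n. energy_form T chi (h n)"
  \<comment> \<open>Among all the observability constants, this one for the limit curve is the one
    kept.\<close>
  obtain F C where F: "F \<in> periodic_L2" "\<And>G. G \<in> periodic_L2 \<Longrightarrow> ?a F G = ?l G" "J T \<delta>0 chi y0 y1 \<gamma> = ?l F"
    and C: "C \<ge> 0" "\<And>F. F \<in> periodic_L2 \<Longrightarrow> \<exists>m. (circle_norm (\<lambda>x. F x - m))\<^sup>2 \<le> C * ?a F F"
    by (rule J_eq_load[OF assms(1,3) cut y g]) (rule that; blast)
  define K where "K = 2 * (L2_norm \<Omega> (weak_deriv 0 1 y0) + L2_norm \<Omega> y1)"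
  have K: "K \<ge> 0" by (simp add: K_def)
  define A where "A = L * (4 * T)"
  have A: "A \<ge> 0" using L(1) T0 by (simp add: A_def)
  \<comment> \<open>\<open>e\<close> bounds the distance of the two curves and is small against the
    observability constant of the limit; the sequence enters only through \<open>n\<close>.\<close>
  have main: "\<bar>J T \<delta>0 chi y0 y1 (\<gamma>s n) - J T \<delta>0 chi y0 y1 \<gamma>\<bar> \<le> e * (A * circle_norm F * (2 * C * K))"
    if e: "e > 0" "C * (A * e) \<le> 1/2" and ae: "AE t in lebesgue_on {0<..<T}. \<bar>g t - h n t\<bar> \<le> e" for n e
  proof -
    interpret h: energy T chi "h n" by (rule en[OF h(1)])
    obtain E where E: "E \<in> periodic_L2" "\<And>G. G \<in> periodic_L2 \<Longrightarrow> ?b n E G = ?l G" "J T \<delta>0 chi y0 y1 (\<gamma>s n) = ?l E"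
      by (rule J_eq_load[OF assms(1,3) cut y h(1)[of n] h(2)[of n] h(3) h(4)]) (rule that; blast)
    obtain m where m: "(circle_norm (\<lambda>x. E x - m))\<^sup>2 \<le> C * ?a E E" using C(2)[OF E(1)] by blast
    \<comment> \<open>Subtracting \<open>m\<close> makes the norm of the profile controllable; the
      linear form and both energy forms do not notice it.\<close>
    define G where "G x = E x - m" for x
    have G: "G \<in> periodic_L2" unfolding G_def[abs_def] by (rule periodic_L2_diff[OF E(1) periodic_L2_const])
    have pert: "\<bar>?a U V - ?b n U V\<bar> \<le> A * e * circle_norm U * circle_norm V"
      if "U \<in> periodic_L2" "V \<in> periodic_L2" for U V
    proof -
      have "\<bar>?a U V - ?b n U V\<bar> \<le> L * e * (4 * T) * circle_norm U * circle_norm V"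
        by (rule energy_form_perturbation[OF en[OF g(1)] en[OF h(1)] _ _ L _ ae that])
          (use g(3,4) h(3,4) assms(2) e(1) in \<open>auto intro: order_trans[OF less_imp_le]  order_trans[of _ "1 - \<delta>0"]\<close>)
      then show ?thesis by (simp add: A_def algebra_simps)
    qed
    have lG: "?l G = ?l E" unfolding G_def[abs_def] by (rule load_diff_const[OF y E(1)])
    have aV: "?a G V = ?a E V" "?b n G V = ?b n E V" if "V \<in> periodic_L2" for V
      using g.energy_form_lin[OF E(1) periodic_L2_const[of m] that, of 1 "-1"] g.energy_form_sym[of "\<lambda>x. m" V] g.energy_form_const[of V m]
        h.energy_form_lin[OF E(1) periodic_L2_const[of m] that, of 1 "-1"] h.energy_form_sym[of "\<lambda>x. m" V] h.energy_form_const[of V m]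
      by (simp_all add: G_def[abs_def])
    have aGG: "?a G G = ?a E E" using aV(1)[OF G] aV(1)[OF E(1)] g.energy_form_sym[of E G] by simp
    let ?N = "circle_norm G"
    have "?N\<^sup>2 \<le> C * ?a G G" using m unfolding aGG by (simp add: G_def[abs_def])
    \<comment> \<open>The nearby minimiser solves the equation of its own form, so its energy in the
      limit form is at most the linear form, of first order in the norm, plus the perturbation
      error, of second order.\<close>
    also have "\<dots> \<le> C * (K * ?N + A * e * ?N\<^sup>2)"
    proof (rule mult_left_mono[OF _ C(1)])
      have "?b n G G = ?l G" using aV(2)[OF G] E(2)[OF G] by simp
      moreover have "\<bar>?l G\<bar> \<le> K * ?N" using load_bound[OF y G] by (simp add: K_def)
      moreover have "\<bar>?a G G - ?b n G G\<bar> \<le> A * e * ?N\<^sup>2" using pert[OF G G] by (simp add: power2_eq_square mult.assoc)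
      ultimately show "?a G G \<le> K * ?N + A * e * ?N\<^sup>2" by linarith
    qed
    also have "\<dots> = C * K * ?N + C * (A * e) * ?N\<^sup>2" by (simp add: algebra_simps)
    \<comment> \<open>Smallness of \<open>e\<close> reduces the second order term to half of the
      squared norm, which is absorbed on the left.\<close>
    also have "\<dots> \<le> C * K * ?N + 1/2 * ?N\<^sup>2" using e(2) by (intro add_left_mono mult_right_mono) simp_all
    finally have "?N * ?N \<le> (2 * C * K) * ?N" by (simp add: power2_eq_square)
    then have N: "?N \<le> 2 * C * K"
    proof (cases "?N = 0")
      case False
      then have "?N > 0" using L2_norm_ge0[of _ G] by (simp add: less_le)
      then show ?thesis using \<open>?N * ?N \<le> (2 * C * K) * ?N\<close> by (simp only: mult_le_cancel_right_pos)
    qed (use C(1) K in simp)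
    \<comment> \<open>Each equation is tested with the other minimiser, so both costs become values
      at the same pair of profiles and only the difference of the forms remains.\<close>
    have "?l E = ?a F G" using F(2)[OF G] lG by simp
    moreover have "?l F = ?b n F G" using E(2)[OF F(1)] aV(2)[OF F(1)] h.energy_form_sym[of F G] by simp
    ultimately have "\<bar>?l E - ?l F\<bar> \<le> A * e * circle_norm F * ?N" using pert[OF F(1) G] by simp
    also have "\<dots> \<le> A * e * circle_norm F * (2 * C * K)"
      using A e(1) by (intro mult_left_mono N) simp
    finally show ?thesis using F(3) E(3) by (simp add: algebra_simps)
  qed
  define B where "B = A * circle_norm F * (2 * C * K)"
  have B: "B \<ge> 0" using A C(1) K by (simp add: B_def)
  show ?thesis
  proof (rule LIMSEQ_I)
    fix r :: real assume r: "r > 0"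
    \<comment> \<open>The left entry yields the absorption condition of \<open>main\<close>, the
      right one the accuracy \<open>r\<close>; the added ones keep denominators positive and make
      the final inequality strict.\<close>
    define e where "e = min (1 / (2 * (C * A + 1))) (r / (B + 1))"
    have CA: "C * A \<ge> 0" using C(1) A by simp
    have e: "e > 0" "e \<le> 1 / (2 * (C * A + 1))" "e \<le> r / (B + 1)" using CA B r by (auto simp: e_def)
    have "e * (2 * (C * A + 1)) \<le> 1" using e(2) CA by (simp add: pos_le_divide_eq)
    then have e1: "C * (A * e) \<le> 1/2" using e(1) by (simp add: algebra_simps)
    have "e * (B + 1) \<le> r" using e(3) B by (simp add: pos_le_divide_eq)
    then have e2: "e * B < r" using e(1) by (simp add: algebra_simps)
    have "\<forall>\<^sub>F n in sequentially. Linf_norm {0<..<T} (\<lambda>t. \<gamma>s n t - \<gamma> t) < ereal e"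
      by (rule order_tendstoD(2)[OF assms(10)]) (use e(1) in simp)
    then obtain n0 where n0: "\<And>n. n \<ge> n0 \<Longrightarrow> Linf_norm {0<..<T} (\<lambda>t. \<gamma>s n t - \<gamma> t) < ereal e"
      by (auto simp: eventually_sequentially)
    have "norm (J T \<delta>0 chi y0 y1 (\<gamma>s n) - J T \<delta>0 chi y0 y1 \<gamma>) < r" if n: "n \<ge> n0" for n
    proof -
      have "AE t in lebesgue_on {0<..<T}. ereal \<bar>\<gamma>s n t - \<gamma> t\<bar> \<le> Linf_norm {0<..<T} (\<lambda>t. \<gamma>s n t - \<gamma> t)"
        unfolding Linf_norm_def by (rule esssup_AE)
      with g(2) h(2)[of n] have "AE t in lebesgue_on {0<..<T}. \<bar>g t - h n t\<bar> \<le> e"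
      proof eventually_elim
        case (elim t)
        have "ereal \<bar>\<gamma>s n t - \<gamma> t\<bar> \<le> ereal e" using elim(3) n0[OF n] by (meson less_imp_le order_trans)
        then show ?case using elim(1,2) by (simp add: abs_minus_commute)
      qed
      from main[OF e(1) e1 this] e2 show ?thesis by (simp add: B_def)
    qed
    then show "\<exists>no. \<forall>n\<ge>no. norm (J T \<delta>0 chi y0 y1 (\<gamma>s n) - J T \<delta>0 chi y0 y1 \<gamma>) < r" by blast
  qed
qed

end
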